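(* Let $W$ be a tournamenton with $\zeta(W)\in[0,1)$ and, for each $n$, let $T_n\sim T(n,W)$ be a $W$-random tournament on $n$ vertices. Let $\theta_W:=t(\vec C_3,W)$. Then the following hold (convergence in distribution as $n\to\infty$). (1) For any such $W$, $$\frac{N_\triangle(T_n)-2\binom n3\theta_W}{n^{5/2}}\xrightarrow{D}N(0,\sigma_W^2),\qquad \sigma_W^2:=\int_0^1 t_W^\triangle(x)^2\,\mathrm dx-\Big(\int_0^1t_W^\triangle(x)\,\mathrm dx\Big)^2 .$$ Moreover this limiting distribution is non-degenerate (that is, $\sigma_W^2>0$) if and only if $W$ is not $\triangle$-regular. (2) If $W$ is $\triangle$-regular, then $$\frac{N_\triangle(T_n)-2\binom n3\theta_W}{n^{2}}\xrightarrow{D}\tau_W\cdot Z+\sum_{\lambda\in\mathrm{Spec}^-(\triangle_W)}\lambda(Z_\lambda^2-1),$$ where $Z,\{Z_\lambda\}_{\lambda\in\mathrm{Spec}^-(\triangle_W)}$ are i.i.d. $N(0,1)$ and $$\tau_W^2:=\frac12\int_{[0,1]^2}W(x,y)W(y,x)\big(p_W(x,y)-p_W(y,x)\big)^2\,\mathrm dx\,\mathrm dy .$$ Moreover, this limiting distribution is non-degenerate if and only if $W(x,y)\neq\frac12$ on a set of positive measure. (3) If $W(x,y)=\frac12$ almost everywhere, then $$\frac{N_\triangle(T_n)-\frac14\binom n3}{n^{3/2}}\xrightarrow{D}N\big(0,\tfrac1{32}\big).$$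
   Context: A tournamenton is a measurable function $W:[0,1]^2\to[0,1]$ with $W(x,y)+W(y,x)=1$ for all $x,y\in[0,1]$. The $W$-random tournament $T_n\sim T(n,W)$ on vertex set $[n]=\{1,\dots,n\}$ has adjacency matrix $(a_{uv})$ obtained as follows: $\eta_1,\dots,\eta_n$ are i.i.d. $\mathrm{Unif}([0,1])$ and, conditionally on them, $a_{uv}\sim\mathrm{Ber}(W(\eta_u,\eta_v))$ independently for $1\le u<v\le n$, with $a_{vu}=1-a_{uv}$ (and $a_{uu}=\frac12$ by convention). The number of circular triads (directed 3-cycles) is $N_\triangle(T_n)=\sum_{1\le u<v<w\le n}(a_{uv}a_{vw}a_{wu}+a_{uw}a_{wv}a_{vu})$. $t(\vec C_3,W)=\int_{[0,1]^3}W(x,y)W(y,z)W(z,x)\,\mathrm dx\,\mathrm dy\,\mathrm dz$ and $\zeta(W)=1-8\,t(\vec C_3,W)$ (which always lies in $[0,1]$). $t_W^\triangle(x)=\int_{[0,1]^2}W(x,y)W(y,z)W(z,x)\,\mathrm dy\,\mathrm dz$. $W$ is $\triangle$-regular if $t_W^\triangle$ is constant almost everywhere on $[0,1]$ (the constant is then $t(\vec C_3,W)$). $p_W(x,y)=\int_0^1W(y,z)W(z,x)\,\mathrm dz$ and $\triangle_W(x,y)=\frac12\big(W(x,y)p_W(x,y)+W(y,x)p_W(y,x)\big)$, a symmetric function $[0,1]^2\to[0,1]$. $\mathrm{Spec}(\triangle_W)$ is the multiset (with multiplicities) of non-zero eigenvalues of the symmetric Hilbert–Schmidt operator $(T_{\triangle_W}f)(x)=\int_0^1\triangle_W(x,y)f(y)\,\mathrm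 dy$ on $L^2[0,1]$. If $W$ is $\triangle$-regular, then $t(\vec C_3,W)$ (positive since $\zeta(W)<1$) is an eigenvalue with constant eigenfunction, and $\mathrm{Spec}^-(\triangle_W)$ is obtained from $\mathrm{Spec}(\triangle_W)$ by decreasing the multiplicity of $t(\vec C_3,W)$ by $1$. The (possibly infinite) sum over the multiset in (2) converges in $L^2$ and almost surely; a variable $Z_\lambda$ is used for each element counted with multiplicity. $\tau_W\ge0$. *)

theory Defs
  imports "HOL-Probability.Probability"
begin

definition unit_leb :: "real measure" where
  "unit_leb = restrict_space lborel {0..1}"

text \<open>
  A tournamenton is represented by a total function on pairs of reals; only its values on the
  unit square are constrained, and no definition below looks at the others.
\<close>

definition tournamenton :: "(real \<Rightarrow> real \<Rightarrow> real) \<Rightarrow> bool" where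
  "tournamenton W \<longleftrightarrow>
     (\<lambda>(x, y). W x y) \<in> borel_measurable (unit_leb \<Otimes>\<^sub>M unit_leb) \<and>
     (\<forall>x\<in>{0..1}. \<forall>y\<in>{0..1}. W x y \<in> {0..1} \<and> W x y + W y x = 1)"

subsection \<open>Random tournaments and circular triads\<close>

definition adj_matrix :: "(nat \<times> nat \<Rightarrow> bool) \<Rightarrow> nat \<Rightarrow> nat \<Rightarrow> real" where
  "adj_matrix e u v =
     (if u < v then of_bool (e (u, v)) else if v < u then 1 - of_bool (e (v, u)) else 1/2)"

text \<open>
  The law of the adjacency matrix of the W-random tournament on the vertices 1, ..., n: first
  sample the types \<open>\<eta>\<close>, then, given the types, independent Bernoulli orientations of
  the pairs \<open>u < v\<close>.
\<close>

definition random_tournament ::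
    "nat \<Rightarrow> (real \<Rightarrow> real \<Rightarrow> real) \<Rightarrow> (nat \<Rightarrow> nat \<Rightarrow> real) measure" where
  "random_tournament n W =
     (\<Pi>\<^sub>M u\<in>{1..n}. unit_leb) \<bind>
       (\<lambda>\<eta>. measure_pmf (map_pmf adj_matrix
          (Pi_pmf {(u, v). 1 \<le> u \<and> u < v \<and> v \<le> n} False
             (\<lambda>(u, v). bernoulli_pmf (W (\<eta> u) (\<eta> v))))))"

definition num_triads :: "nat \<Rightarrow> (nat \<Rightarrow> nat \<Rightarrow> real) \<Rightarrow> real" where
  "num_triads n a =
     (\<Sum>u\<in>{1..n}. \<Sum>v\<in>{u<..n}. \<Sum>w\<in>{v<..n}.
        a u v * a v w * a w u + a u w * a w v * a v u)"

subsection \<open>Functionals of a tournamenton\<close>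

definition t_C3 :: "(real \<Rightarrow> real \<Rightarrow> real) \<Rightarrow> real" where
  "t_C3 W = (\<integral>(x, y, z). W x y * W y z * W z x \<partial>(unit_leb \<Otimes>\<^sub>M unit_leb \<Otimes>\<^sub>M unit_leb))"

definition zeta :: "(real \<Rightarrow> real \<Rightarrow> real) \<Rightarrow> real" where
  "zeta W = 1 - 8 * t_C3 W"

definition t_tri :: "(real \<Rightarrow> real \<Rightarrow> real) \<Rightarrow> real \<Rightarrow> real" where
  "t_tri W x = (\<integral>(y, z). W x y * W y z * W z x \<partial>(unit_leb \<Otimes>\<^sub>M unit_leb))"

definition tri_regular :: "(real \<Rightarrow> real \<Rightarrow> real) \<Rightarrow> bool" where
  "tri_regular W \<longleftrightarrow> (\<exists>c. AE x in unit_leb. t_tri W x = c)"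

definition sigma_sq :: "(real \<Rightarrow> real \<Rightarrow> real) \<Rightarrow> real" where
  "sigma_sq W = (\<integral>x. (t_tri W x)\<^sup>2 \<partial>unit_leb) - (\<integral>x. t_tri W x \<partial>unit_leb)\<^sup>2"

definition p_fun :: "(real \<Rightarrow> real \<Rightarrow> real) \<Rightarrow> real \<Rightarrow> real \<Rightarrow> real" where
  "p_fun W x y = (\<integral>z. W y z * W z x \<partial>unit_leb)"

definition tri_kernel :: "(real \<Rightarrow> real \<Rightarrow> real) \<Rightarrow> real \<Rightarrow> real \<Rightarrow> real" where
  "tri_kernel W x y = 1/2 * (W x y * p_fun W x y + W y x * p_fun W y x)"

definition tau :: "(real \<Rightarrow> real \<Rightarrow> real) \<Rightarrow> real" where
  "tau W = sqrt (1/2 * (\<integral>(x, y). W x y * W y x * (p_fun W x y - p_fun W y x)\<^sup>2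
                           \<partial>(unit_leb \<Otimes>\<^sub>M unit_leb)))"

subsection \<open>Spectrum of an integral operator on square-integrable functions\<close>

definition eigenspace_L2 :: "(real \<Rightarrow> real \<Rightarrow> real) \<Rightarrow> real \<Rightarrow> (real \<Rightarrow> real) set" where
  "eigenspace_L2 K l =
     {f. f \<in> borel_measurable unit_leb \<and> integrable unit_leb (\<lambda>x. (f x)\<^sup>2) \<and>
         (AE x in unit_leb. (\<integral>y. K x y * f y \<partial>unit_leb) = l * f x)}"

definition indep_L2 :: "nat \<Rightarrow> (nat \<Rightarrow> real \<Rightarrow> real) \<Rightarrow> bool" where
  "indep_L2 k f \<longleftrightarrow>
     (\<forall>c. (AE x in unit_leb. (\<Sum>i<k. c i * f i x) = 0) \<longrightarrow> (\<forall>i<k. c i = 0))"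

text \<open>
  Multiplicity of an eigenvalue: the dimension of its eigenspace, functions that agree almost
  everywhere being identified. It is 0 exactly when \<open>l\<close> is not an eigenvalue.
\<close>

definition eigen_mult :: "(real \<Rightarrow> real \<Rightarrow> real) \<Rightarrow> real \<Rightarrow> enat" where
  "eigen_mult K l =
     (SUP k\<in>{k. \<exists>f. (\<forall>i<k. f i \<in> eigenspace_L2 K l) \<and> indep_L2 k f}. enat k)"

text \<open>
  The possibly infinite multiset of non-zero eigenvalues is given by its multiplicity function.
\<close>

definition Spec :: "(real \<Rightarrow> real \<Rightarrow> real) \<Rightarrow> real \<Rightarrow> enat" where
  "Spec K l = (if l = 0 then 0 else eigen_mult K l)"

definition Spec_minus :: "(real \<Rightarrow> real \<Rightarrow> real) \<Rightarrow> real \<Rightarrow> enat" where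
  "Spec_minus W = (Spec (tri_kernel W))(t_C3 W := Spec (tri_kernel W) (t_C3 W) - 1)"

text \<open>The elements of a multiset, counted with multiplicity.\<close>

definition mset_index :: "(real \<Rightarrow> enat) \<Rightarrow> (real \<times> nat) set" where
  "mset_index m = {(l, i). enat i < m l}"

subsection \<open>Limit laws\<close>

text \<open>
  Defined as an image of the standard normal law so that variance 0 gives the point mass, which
  the density would not.
\<close>

definition normal_law :: "real \<Rightarrow> real \<Rightarrow> real measure" where
  "normal_law \<mu> v = distr std_normal_distribution borel (\<lambda>x. \<mu> + sqrt v * x)"

definition nondegenerate :: "real measure \<Rightarrow> bool" where
  "nondegenerate N \<longleftrightarrow> (\<nexists>c. N = return borel c)"

text \<open>
  Canonical space of i.i.d. standard normal variables: coordinate \<open>None\<close> is \<open>Z\<close>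
  and coordinate \<open>Some j\<close> is the variable attached to the element \<open>j\<close> of the
  multiset.
\<close>

definition gauss_space :: "(real \<Rightarrow> enat) \<Rightarrow> ((real \<times> nat) option \<Rightarrow> real) measure" where
  "gauss_space m = (\<Pi>\<^sub>M j\<in>insert None (Some ` mset_index m). std_normal_distribution)"

text \<open>
  The sum of random variables over an index set as the mean-square limit of its finite partial
  sums. It does not depend on an enumeration and is unique up to almost sure equality. A pointwise
  unconditional sum would not do: the eigenvalues are in general only square-summable, so the
  series need not converge absolutely.
\<close>

definition has_L2_sum ::
    "'a measure \<Rightarrow> ('i \<Rightarrow> 'a \<Rightarrow> real) \<Rightarrow> 'i set \<Rightarrow> ('a \<Rightarrow> real) \<Rightarrow> bool" where
  "has_L2_sum M X J S \<longleftrightarrow>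
     S \<in> borel_measurable M \<and>
     ((\<lambda>F. \<integral>\<^sup>+\<omega>. ennreal ((S \<omega> - (\<Sum>j\<in>F. X j \<omega>))\<^sup>2) \<partial>M) \<longlongrightarrow> 0) (finite_subsets_at_top J)"

end

theory Submission
  imports Defs "HOL-Real_Asymp.Real_Asymp"
begin

text \<open>  The number of circular triads is a statistic of independent vertex types and, given the types,
  independent edge orientations. Both are realized on one space \<open>Om\<close> of independent uniform coordinates
  (\<open>random_tournament_eq\<close>), on which conditioning means integrating out coordinates.

  Hoeffding's decomposition (\<open>hoeffding_decomposition\<close>) writes the centred count as the sum of \<open>h3\<close> over
  triples, \<open>n - 2\<close> times the sum of \<open>h2\<close> over pairs, and \<open>(n - 1) (n - 2)\<close> times the sum of \<open>t_tri W - t_C3 W\<close>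
  over the types. The functions \<open>h2\<close> and \<open>h3\<close> have mean 0 as soon as one of their vertices is integrated out,
  so distinct summands are orthogonal, and the three parts have order \<open>n^(3/2)\<close>, \<open>n^2\<close> and \<open>n^(5/2)\<close>. Each
  claim is about the largest part that does not vanish.

  At scale \<open>n^(5/2)\<close> the last part is a sum of independent bounded variables with variance \<open>sigma_sq W\<close>
  (\<open>gaussian_limit\<close>); it vanishes if and only if \<open>W\<close> is regular.

  At scale \<open>n^2\<close>, for regular \<open>W\<close>, the sum of \<open>h2\<close> remains. It is the quadratic form of the kernel
  \<open>tri_kernel W - t_C3 W\<close> in the types plus a noise of the edges. Given the types, the noise is a sum of
  independent centred variables whose conditional variance concentrates at \<open>(tau W)^2\<close>, so it
  contributes an independent Gaussian factor (\<open>edge_noise_limit\<close>). The quadratic form is truncated to finitely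
  many eigenfunctions (\<open>spectral_decomposition_minus\<close>); the error is bounded, uniformly in \<open>n\<close>, by the
  Hilbert--Schmidt norm of the remaining kernel (\<open>kernel_quad_bound\<close>). For finitely many eigenfunctions the
  limit depends only on their second moments: Lindeberg's exchange, one vertex at a time, replaces
  them by independent random signs (\<open>qform_universal\<close>), and for signs the form is a combination of squares of
  normalized sums (\<open>qform_limit\<close>). The limit is constant only if \<open>tau W = 0\<close> and no eigenvalue is left. Then
  the triangle kernel is constant, and an algebraic argument gives \<open>W = 1/2\<close> (\<open>degenerate_balanced\<close>).

  At scale \<open>n^(3/2)\<close>, for \<open>W = 1/2\<close>, the signs of the edges are independent and the count is an affine function
  of the sum of the squared scores. When a vertex is added to a tournament on \<open>m\<close> vertices, the centred sum of
  squares \<open>s\<close> changes by an increment with mean 0 and variance \<open>4 s + 6 m (m - 1)\<close> given the past. This turns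
  into a recursion for the characteristic functions (\<open>scores_step\<close>), which the Gaussian law solves up to
  vanishing errors.

  The spectral theorem is obtained for bounded kernels. A top eigenfunction is a column of the limit of the
  normalized even powers of a kernel (\<open>top_eigenvector\<close>). Hence a kernel from which all eigenvalues of modulus at
  least \<open>1/k\<close> are split off has operator norm at most \<open>1/k\<close>, and \<open>hs_tendsto_0\<close> upgrades this to the
  Hilbert--Schmidt norm (\<open>spectral_decomposition\<close>).\<close>

section \<open>Bounded measurable functions\<close>

text \<open>These names also belong to rules for the gauge integral; here they always mean the Lebesgue integral.\<close>
lemmas lint_cong = Bochner_Integration.integral_cong and lint_sum = Bochner_Integration.integral_sum
  and lint_add = Bochner_Integration.integral_add and lint_diff = Bochner_Integration.integral_diff

text \<open>  Closed under arithmetic, substitution and partial integration, and integrable for every probability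
  measure: all side conditions on measurability and integrability below reduce to this predicate.\<close>
definition bmeas :: "'a measure \<Rightarrow> ('a \<Rightarrow> 'b::{real_normed_field,banach,second_countable_topology}) \<Rightarrow> bool" where
  "bmeas M f \<longleftrightarrow> f \<in> borel_measurable M \<and> (\<exists>C. \<forall>x\<in>space M. norm (f x) \<le> C)"

lemma bmeasI: "f \<in> borel_measurable M \<Longrightarrow> (\<And>x. x \<in> space M \<Longrightarrow> norm (f x) \<le> C) \<Longrightarrow> bmeas M f"
  unfolding bmeas_def by auto

lemma bmeas_measurable: "bmeas M f \<Longrightarrow> f \<in> borel_measurable M"
  unfolding bmeas_def by auto

lemma bmeas_bound:
  assumes "bmeas M f" obtains C where "C \<ge> 0" "\<And>x. x \<in> space M \<Longrightarrow> norm (f x) \<le> C"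
proof -
  from assms obtain C where "\<forall>x\<in>space M. norm (f x) \<le> C" by (auto simp: bmeas_def)
  hence "\<And>x. x \<in> space M \<Longrightarrow> norm (f x) \<le> max 0 C" by (meson max.coboundedI2)
  thus ?thesis by (intro that[of "max 0 C"]) auto
qed

lemma bmeas_const [intro!, simp]: "bmeas M (\<lambda>_. c)"
  by (rule bmeasI[where C="norm c"]) auto

lemma bmeas_add [intro!]:
  assumes "bmeas M f" "bmeas M g" shows "bmeas M (\<lambda>x. f x + g x)"
proof -
  obtain C where "\<And>x. x \<in> space M \<Longrightarrow> norm (f x) \<le> C" using assms(1) bmeas_bound by blast
  moreover obtain D where "\<And>x. x \<in> space M \<Longrightarrow> norm (g x) \<le> D" using assms(2) bmeas_bound by blast
  ultimately show ?thesis
    by (intro bmeasI[where C="C+D"] borel_measurable_add assms[THEN bmeas_measurable])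
       (meson norm_triangle_mono)
qed

lemma bmeas_mult [intro!]:
  assumes "bmeas M f" "bmeas M g" shows "bmeas M (\<lambda>x. f x * g x)"
proof -
  obtain C where C: "C \<ge> 0" "\<And>x. x \<in> space M \<Longrightarrow> norm (f x) \<le> C" using assms(1) bmeas_bound by blast
  obtain D where D: "D \<ge> 0" "\<And>x. x \<in> space M \<Longrightarrow> norm (g x) \<le> D" using assms(2) bmeas_bound by blast
  show ?thesis
    by (intro bmeasI[where C="C*D"] borel_measurable_times assms[THEN bmeas_measurable])
       (auto simp: norm_mult intro!: mult_mono C D)
qed

lemma bmeas_uminus [intro!]: "bmeas M f \<Longrightarrow> bmeas M (\<lambda>x. - f x)"
  using bmeas_mult[of M "\<lambda>_. -1" f] by simp

lemma bmeas_diff [intro!]: "bmeas M f \<Longrightarrow> bmeas M g \<Longrightarrow> bmeas M (\<lambda>x. f x - g x)"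
  using bmeas_add[of M f "\<lambda>x. - g x"] by auto

lemma bmeas_divide [intro!]: "bmeas M f \<Longrightarrow> bmeas M (\<lambda>x. f x / c)"
  using bmeas_mult[of M f "\<lambda>_. inverse c"] by (simp add: field_simps)

lemma bmeas_power [intro!]: "bmeas M f \<Longrightarrow> bmeas M (\<lambda>x. f x ^ n)"
  by (induction n) auto

lemma bmeas_sum [intro!]: "(\<And>i. i \<in> I \<Longrightarrow> bmeas M (f i)) \<Longrightarrow> bmeas M (\<lambda>x. \<Sum>i\<in>I. f i x)"
  by (induction I rule: infinite_finite_induct) auto

lemma bmeas_prod [intro!]: "(\<And>i. i \<in> I \<Longrightarrow> bmeas M (f i)) \<Longrightarrow> bmeas M (\<lambda>x. \<Prod>i\<in>I. f i x)"
  by (induction I rule: infinite_finite_induct) auto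

lemma bmeas_abs [intro!]: "bmeas M f \<Longrightarrow> bmeas M (\<lambda>x. \<bar>f x :: real\<bar>)"
  unfolding bmeas_def by auto

lemma bmeas_norm [intro!]: "bmeas M f \<Longrightarrow> bmeas M (\<lambda>x. norm (f x))"
  unfolding bmeas_def by (auto intro: borel_measurable_norm)

lemma bmeas_of_real [intro!]: "bmeas M f \<Longrightarrow> bmeas M (\<lambda>x. complex_of_real (f x))"
  unfolding bmeas_def by auto

lemma bmeas_iexp [intro!]: "bmeas M f \<Longrightarrow> bmeas M (\<lambda>x. iexp (f x))"
  by (rule bmeasI[where C=1]) (auto dest: bmeas_measurable)

lemma bmeas_exp [intro!]: "bmeas M f \<Longrightarrow> bmeas M (\<lambda>x. exp (f x :: real))"
proof -
  assume *: "bmeas M f"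
  then obtain C where C: "\<And>x. x \<in> space M \<Longrightarrow> norm (f x) \<le> C" using bmeas_bound by blast
  show ?thesis
  proof (rule bmeasI[where C="exp C"])
    show "(\<lambda>x. exp (f x)) \<in> borel_measurable M" using * by (auto dest: bmeas_measurable)
  qed (use C in \<open>auto simp: abs_le_iff\<close>)
qed

lemma bmeas_comp: "bmeas N f \<Longrightarrow> g \<in> measurable M N \<Longrightarrow> bmeas M (\<lambda>x. f (g x))"
  unfolding bmeas_def by (auto intro: measurable_compose dest: measurable_space)

lemma bmeas_comp2:
  "bmeas (N1 \<Otimes>\<^sub>M N2) (\<lambda>(x, y). f x y) \<Longrightarrow> g \<in> measurable M N1 \<Longrightarrow> h \<in> measurable M N2 \<Longrightarrow>
   bmeas M (\<lambda>x. f (g x) (h x))"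
  using bmeas_comp[of "N1 \<Otimes>\<^sub>M N2" "\<lambda>(x, y). f x y" "\<lambda>x. (g x, h x)" M] by simp

lemma bmeas_of_bool: "Measurable.pred M P \<Longrightarrow> bmeas M (\<lambda>x. of_bool (P x))"
  by (rule bmeasI[where C=1]) auto

lemma bmeas_indicator [intro!]: "A \<in> sets M \<Longrightarrow> bmeas M (indicator A)"
  by (rule bmeasI[where C=1]) (auto simp: indicator_def)

lemma bmeas_cong: "(\<And>x. x \<in> space M \<Longrightarrow> f x = g x) \<Longrightarrow> bmeas M f \<longleftrightarrow> bmeas M g"
  unfolding bmeas_def using measurable_cong[of M f g borel] by auto

lemma (in finite_measure) bmeas_integrable: "bmeas M f \<Longrightarrow> integrable M f"
  unfolding bmeas_def by (auto intro: integrable_const_bound)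

lemma (in finite_measure) bmeas_integral:
  assumes "bmeas (N \<Otimes>\<^sub>M M) (\<lambda>(x, y). f x y)"
  shows "bmeas N (\<lambda>x. \<integral>y. f x y \<partial>M)"
proof -
  obtain C where C: "\<And>x. x \<in> space (N \<Otimes>\<^sub>M M) \<Longrightarrow> norm (case x of (x, y) \<Rightarrow> f x y) \<le> C"
    using assms bmeas_bound by blast
  have b: "norm (f x y) \<le> C" if "x \<in> space N" "y \<in> space M" for x y
    using C[of "(x, y)"] that by (simp add: space_pair_measure)
  have m: "(\<lambda>(x, y). f x y) \<in> borel_measurable (N \<Otimes>\<^sub>M M)" using assms by (rule bmeas_measurable)
  show ?thesis
  proof (rule bmeasI[where C="C * measure M (space M)"])
    show "(\<lambda>x. \<integral>y. f x y \<partial>M) \<in> borel_measurable N"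
      by (rule borel_measurable_lebesgue_integral[OF m])
    fix x assume x: "x \<in> space N"
    have mx: "f x \<in> borel_measurable M" using measurable_compose[OF measurable_Pair1'[OF x, of M] m] by simp
    have "norm (\<integral>y. f x y \<partial>M) \<le> (\<integral>y. norm (f x y) \<partial>M)" by (rule integral_norm_bound)
    also have "\<dots> \<le> (\<integral>y. C \<partial>M)"
      by (rule integral_mono) (use b[OF x] mx in \<open>auto intro!: integrable_const_bound[where B=C]\<close>)
    finally show "norm (\<integral>y. f x y \<partial>M) \<le> C * measure M (space M)" by (simp add: mult.commute)
  qed
qed

lemma (in prob_space) bmeas_integral_mono:
  assumes "bmeas M f" "bmeas M g" "\<And>x. x \<in> space M \<Longrightarrow> f x \<le> (g x :: real)"
  shows "(\<integral>x. f x \<partial>M) \<le> (\<integral>x. g x \<partial>M)"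
  using assms by (intro integral_mono bmeas_integrable)

lemma sq_diff_le: "(a - b)^2 \<le> 2 * a^2 + 2 * (b :: real)^2"
  using zero_le_power2[of "a + b"] by (simp add: power2_eq_square algebra_simps)

text \<open>The integral of \<open>(s * f + t * g)^2\<close> is a nonnegative quadratic form in \<open>(s, t)\<close>; choosing \<open>s\<close> and \<open>t\<close> gives the bound.\<close>
lemma (in prob_space) cauchy_schwarz:
  assumes "f \<in> borel_measurable M" "g \<in> borel_measurable M"
    "integrable M (\<lambda>x. (f x)^2 :: real)" "integrable M (\<lambda>x. (g x)^2 :: real)"
  shows "integrable M (\<lambda>x. f x * g x)"
    "(\<integral>x. f x * g x \<partial>M)^2 \<le> (\<integral>x. (f x)^2 \<partial>M) * (\<integral>x. (g x)^2 \<partial>M)"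
proof -
  show fg: "integrable M (\<lambda>x. f x * g x)"
  proof (rule Bochner_Integration.integrable_bound)
    show "integrable M (\<lambda>x. (f x)^2 + (g x)^2)" using assms by auto
    show "AE x in M. norm (f x * g x) \<le> norm ((f x)^2 + (g x)^2)"
    proof (rule AE_I2)
      fix x
      have "0 \<le> (\<bar>f x\<bar> - \<bar>g x\<bar>)^2" by simp
      hence "2 * (\<bar>f x\<bar> * \<bar>g x\<bar>) \<le> (f x)^2 + (g x)^2" by (simp add: power2_diff)
      moreover have "0 \<le> \<bar>f x\<bar> * \<bar>g x\<bar>" by simp
      ultimately have "\<bar>f x\<bar> * \<bar>g x\<bar> \<le> (f x)^2 + (g x)^2" by linarith
      thus "norm (f x * g x) \<le> norm ((f x)^2 + (g x)^2)" by (simp add: abs_mult)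
    qed
  qed (use assms in auto)
  let ?a = "\<integral>x. (f x)^2 \<partial>M" and ?b = "\<integral>x. f x * g x \<partial>M" and ?c = "\<integral>x. (g x)^2 \<partial>M"
  have q: "0 \<le> s^2 * ?a + 2 * s * t * ?b + t^2 * ?c" for s t
  proof -
    have "0 \<le> (\<integral>x. (s * f x + t * g x)^2 \<partial>M)" by simp
    also have "\<dots> = (\<integral>x. s^2 * (f x)^2 + 2 * s * t * (f x * g x) + t^2 * (g x)^2 \<partial>M)"
      by (intro lint_cong) (auto simp: power2_eq_square algebra_simps)
    also have "\<dots> = s^2 * ?a + 2 * s * t * ?b + t^2 * ?c" using fg assms by simp
    finally show ?thesis .
  qed
  have a0: "?a \<ge> 0" "?c \<ge> 0" by auto
  show "?b\<^sup>2 \<le> ?a * ?c"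
  proof (cases "?c = 0")
    case False
    have "0 \<le> ?c * (?a * ?c - ?b\<^sup>2)" using q[of ?c "- ?b"] by (simp add: power2_eq_square algebra_simps)
    thus ?thesis using False a0 by (simp add: zero_le_mult_iff)
  next
    case c: True
    have "?b = 0"
    proof (rule ccontr)
      assume b: "?b \<noteq> 0"
      have "0 \<le> ?a + 2 * (- (?a + 1) / (2 * ?b)) * ?b"
        using q[of 1 "- (?a + 1) / (2 * ?b)"] c by simp
      also have "\<dots> = -1" using b by (simp add: field_simps)
      finally show False by simp
    qed
    thus ?thesis using c by simp
  qed
qed

lemma (in prob_space) cauchy_schwarz_bmeas:
  assumes "bmeas M f" "bmeas M g"
  shows "(\<integral>x. f x * g x \<partial>M)^2 \<le> (\<integral>x. (f x)^2 \<partial>M) * (\<integral>x. (g x :: real)^2 \<partial>M)"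
  by (rule cauchy_schwarz) (use assms in \<open>auto intro!: bmeas_measurable bmeas_integrable\<close>)

lemma (in prob_space) L1_le_L2:
  assumes "f \<in> borel_measurable M" "integrable M (\<lambda>x. (f x)^2 :: real)"
  shows "(\<integral>x. \<bar>f x\<bar> \<partial>M) \<le> sqrt (\<integral>x. (f x)^2 \<partial>M)"
  using cauchy_schwarz(2)[of "\<lambda>_. 1" "\<lambda>x. \<bar>f x\<bar>"] assms
  by (intro real_le_rsqrt) (simp add: prob_space)

section \<open>Independent uniform coordinates\<close>

lemma indep_vars_PiM_coords:
  assumes M: "\<And>i. i \<in> K \<Longrightarrow> prob_space (M i)" and "K \<noteq> {}"
  shows "prob_space.indep_vars (PiM K M) M (\<lambda>i w. w i) K"
proof -
  interpret prob_space "PiM K M" by (rule prob_space_PiM) (rule M)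
  have "distr (PiM K M) (PiM K M) (\<lambda>w. \<lambda>i\<in>K. w i) = distr (PiM K M) (PiM K M) (\<lambda>w. w)"
    by (rule distr_cong) (auto simp: space_PiM PiE_def extensional_restrict)
  also have "\<dots> = PiM K (\<lambda>i. distr (PiM K M) (M i) (\<lambda>w. w i))"
    by (simp add: distr_id2 distr_PiM_component M cong: PiM_cong)
  finally show ?thesis
    using assms by (subst indep_vars_iff_distr_eq_PiM') auto
qed

lemma prob_space_unit: "prob_space unit_leb"
  unfolding unit_leb_def by (rule prob_space_restrict_space) auto

lemma space_unit [simp]: "space unit_leb = {0..1}"
  by (simp add: unit_leb_def space_restrict_space)

abbreviation UU :: "(real \<times> real) measure" where "UU \<equiv> unit_leb \<Otimes>\<^sub>M unit_leb"

type_synonym kernel = "real \<Rightarrow> real \<Rightarrow> real"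
type_synonym outcome = "nat \<times> nat \<Rightarrow> real"

text \<open>One coordinate for each pair of numbers, so that the tournaments of all sizes live on the same space.\<close>
definition Om :: "outcome measure" where
  "Om = (\<Pi>\<^sub>M i\<in>UNIV. unit_leb)"

abbreviation ex_Om :: "(outcome \<Rightarrow> 'b::{banach, second_countable_topology}) \<Rightarrow> 'b" (binder "\<E>" 10) where
  "ex_Om f \<equiv> integral\<^sup>L Om f"

abbreviation ex_unit :: "(real \<Rightarrow> 'b::{banach, second_countable_topology}) \<Rightarrow> 'b" (binder "\<I>" 10) where
  "ex_unit f \<equiv> integral\<^sup>L unit_leb f"

interpretation U: prob_space unit_leb by (rule prob_space_unit)
interpretation Om: prob_space Om unfolding Om_def by (rule prob_space_PiM) (rule prob_space_unit)
interpretation UU: pair_prob_space unit_leb unit_leb ..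
interpretation OU: pair_prob_space Om unit_leb ..

lemma prob_unit [simp]: "measure unit_leb {0..1} = 1"
  using U.prob_space by simp

lemma coord_measurable [measurable]: "(\<lambda>w. w i) \<in> measurable Om unit_leb"
  unfolding Om_def by measurable

lemma coord_in: "w \<in> space Om \<Longrightarrow> w i \<in> {0..1}"
  using measurable_space[OF coord_measurable] by simp

lemma upd_measurable [measurable]: "(\<lambda>(w, y). w(i := y)) \<in> measurable (Om \<Otimes>\<^sub>M unit_leb) Om"
  unfolding Om_def split_beta by (rule measurable_PiM_single') (auto simp: space_PiM space_pair_measure fun_upd_def)

lemma bmeas_upd: "bmeas Om f \<Longrightarrow> bmeas (Om \<Otimes>\<^sub>M unit_leb) (\<lambda>(w, y). f (w(i := y)))"
  using bmeas_comp[OF _ upd_measurable, of f i] by (simp add: case_prod_unfold)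

text \<open>A coordinate is independent of the others and may be drawn again. Every conditioning step below
  is an instance.\<close>
lemma resample:
  assumes "bmeas Om f"
  shows "(\<E> w. f w) = (\<E> w. (\<I> y. f (w(i := y))))"
proof -
  let ?I = "UNIV - {i}"
  let ?P = "PiM ?I (\<lambda>_. unit_leb)"
  interpret P: prob_space ?P by (rule prob_space_PiM) (rule prob_space_unit)
  interpret UP: pair_prob_space unit_leb ?P ..
  have m: "(\<lambda>(x, X). X(i := x)) \<in> measurable (unit_leb \<Otimes>\<^sub>M ?P) Om"
    unfolding Om_def split_beta
  proof (rule measurable_PiM_single', goal_cases)
    case (1 j)
    show ?case
    proof (cases "j = i")
      case True thus ?thesis by simp
    next
      case False
      hence "j \<in> ?I" by simp
      hence "(\<lambda>x. (snd x) j) \<in> measurable (unit_leb \<Otimes>\<^sub>M ?P) unit_leb"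
        by (rule measurable_compose[OF measurable_snd measurable_component_singleton])
      thus ?thesis using False by simp
    qed
  next
    case 2 show ?case by (auto simp: space_PiM space_pair_measure PiE_def)
  qed
  have d: "distr (unit_leb \<Otimes>\<^sub>M ?P) Om (\<lambda>(x, X). X(i := x)) = Om"
    using distr_pair_PiM_eq_PiM[of ?I "\<lambda>_. unit_leb" i] prob_space_unit
    by (simp add: Om_def insert_absorb)
  have step: "(\<E> w. g w) = (\<integral>X. (\<I> x. g (X(i := x))) \<partial>?P)" if g: "bmeas Om g"
    for g :: "outcome \<Rightarrow> 'a"
  proof -
    have "(\<E> w. g w) = (\<integral>z. g ((\<lambda>(x, X). X(i := x)) z) \<partial>(unit_leb \<Otimes>\<^sub>M ?P))"
      by (subst d[symmetric]) (rule integral_distr[OF m bmeas_measurable[OF g]])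
    also have "\<dots> = (\<integral>X. (\<I> x. g (X(i := x))) \<partial>?P)"
      using UP.integral_snd[of "\<lambda>x X. g (X(i := x))"] UP.P.bmeas_integrable[OF bmeas_comp[OF g m]]
      by (simp add: case_prod_unfold)
    finally show ?thesis .
  qed
  have "bmeas Om (\<lambda>w. (\<I> y. f (w(i := y))))"
    by (rule U.bmeas_integral[OF bmeas_upd[OF assms]])
  from step[OF this] have "(\<E> w. (\<I> y. f (w(i := y))))
      = (\<integral>X. (\<I> y. f (X(i := y))) \<partial>?P)"
    by simp
  with step[OF assms] show ?thesis by simp
qed

text \<open>  Measurability with respect to a block of coordinates, without sigma-algebras. It refers to all points, also
  those outside the space of the measure.\<close>
definition depends_on :: "'i set \<Rightarrow> (('i \<Rightarrow> 'a) \<Rightarrow> 'b) \<Rightarrow> bool" where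
  "depends_on A f \<longleftrightarrow> (\<forall>w w'. (\<forall>i\<in>A. w i = w' i) \<longrightarrow> f w = f w')"

lemma depends_onI: "(\<And>w w'. (\<And>i. i \<in> A \<Longrightarrow> w i = w' i) \<Longrightarrow> f w = f w') \<Longrightarrow> depends_on A f"
  unfolding depends_on_def by blast

lemma depends_onD: "depends_on A f \<Longrightarrow> (\<And>i. i \<in> A \<Longrightarrow> w i = w' i) \<Longrightarrow> f w = f w'"
  unfolding depends_on_def by blast

lemma depends_on_upd: "depends_on A f \<Longrightarrow> i \<notin> A \<Longrightarrow> f (w(i := y)) = f w"
  by (erule depends_onD) auto

lemma depends_on_mono: "depends_on A f \<Longrightarrow> A \<subseteq> B \<Longrightarrow> depends_on B f"
  unfolding depends_on_def by blast

lemma depends_on_const [intro!, simp]: "depends_on A (\<lambda>_. c)"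
  unfolding depends_on_def by blast

lemma depends_on_coord [intro]: "i \<in> A \<Longrightarrow> depends_on A (\<lambda>w. w i)"
  unfolding depends_on_def by blast

lemma depends_on_comp: "depends_on A f \<Longrightarrow> depends_on A (\<lambda>w. h (f w))"
  unfolding depends_on_def by metis

lemma depends_on_comp2: "depends_on A f \<Longrightarrow> depends_on A g \<Longrightarrow> depends_on A (\<lambda>w. h (f w) (g w))"
  unfolding depends_on_def by metis

lemma depends_on_sum [intro!]: "(\<And>j. j \<in> J \<Longrightarrow> depends_on A (f j)) \<Longrightarrow> depends_on A (\<lambda>w. \<Sum>j\<in>J. f j w)"
  unfolding depends_on_def by (metis (no_types, lifting) sum.cong)

lemma depends_on_prod [intro!]: "(\<And>j. j \<in> J \<Longrightarrow> depends_on A (f j)) \<Longrightarrow> depends_on A (\<lambda>w. \<Prod>j\<in>J. f j w)"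
  unfolding depends_on_def by (metis (no_types, lifting) prod.cong)

lemmas depends_on_arith [intro!] =
  depends_on_comp2[where h="(+)"] depends_on_comp2[where h="(-)"] depends_on_comp2[where h="(*)"]
  depends_on_comp2[where h="(/)"]
  depends_on_comp[where h="uminus"] depends_on_comp[where h="\<lambda>x. x ^ n" for n]
  depends_on_comp[where h=of_real] depends_on_comp[where h=iexp] depends_on_comp[where h=norm] depends_on_comp[where h=abs]
  depends_on_comp[where h=exp]

text \<open>Conditioning on all coordinates but one: \<open>G\<close> is known, and \<open>g\<close> is averaged.\<close>
lemma integrate_coordinate:
  fixes g :: "real \<Rightarrow> outcome \<Rightarrow> 'b::{real_normed_field,banach,second_countable_topology}"
  assumes "bmeas Om G" "bmeas Om (\<lambda>w. g (w i) w)" "depends_on (- {i}) G" "\<And>y. depends_on (- {i}) (g y)"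
  shows "(\<E> w. G w * g (w i) w) = (\<E> w. G w * (\<I> y. g y w))"
proof -
  have "(\<E> w. G w * g (w i) w)
      = (\<E> w. (\<I> y. G (w(i := y)) * g ((w(i := y)) i) (w(i := y))))"
    using assms by (intro resample) auto
  also have "\<dots> = (\<E> w. (\<I> y. G w * g y w))"
    using depends_on_upd[OF assms(3), of i] depends_on_upd[OF assms(4), of i] by simp
  finally show ?thesis by simp
qed

text \<open>Disjoint blocks of coordinates are independent under a product measure.\<close>
lemma expectation_disjoint_mult:
  fixes f g :: "outcome \<Rightarrow> 'b::{real_normed_field,banach,second_countable_topology}"
  assumes f: "bmeas Om f" "depends_on A f" and g: "bmeas Om g" "depends_on B g" and AB: "A \<inter> B = {}"
  shows "(\<E> w. f w * g w) = (\<E> w. f w) * (\<E> w. g w)"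
proof -
  \<comment> \<open>Both functions are defined on full points, so a restriction to a block is continued by 0.\<close>
  define ext where "ext A x i = (if i \<in> A then x i else 0)" for A :: "(nat \<times> nat) set" and x :: outcome and i
  have ext_m: "ext A \<in> measurable (PiM A (\<lambda>_. unit_leb)) Om" for A
    unfolding Om_def
  proof (rule measurable_PiM_single', goal_cases)
    case (1 j)
    show ?case by (cases "j \<in> A") (auto simp: ext_def)
  next
    case 2
    show ?case by (auto simp: space_PiM PiE_def ext_def Pi_def)
  qed
  have iv: "Om.indep_vars (\<lambda>_. unit_leb) (\<lambda>i w. w i) UNIV"
    unfolding Om_def by (rule indep_vars_PiM_coords) (auto intro: prob_space_unit)
  have "Om.indep_var (PiM A (\<lambda>_. unit_leb)) (\<lambda>w. restrict (\<lambda>i. w i) A) (PiM B (\<lambda>_. unit_leb)) (\<lambda>w. restrict (\<lambda>i. w i) B)"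
    by (rule Om.indep_var_restrict[OF iv AB]) auto
  hence "Om.indep_var borel ((\<lambda>x. f (ext A x)) \<circ> (\<lambda>w. restrict (\<lambda>i. w i) A))
     borel ((\<lambda>x. g (ext B x)) \<circ> (\<lambda>w. restrict (\<lambda>i. w i) B))"
    using measurable_compose[OF ext_m bmeas_measurable[OF f(1)]] measurable_compose[OF ext_m bmeas_measurable[OF g(1)]]
    by (rule Om.indep_var_compose)
  moreover have "f (ext A (restrict (\<lambda>i. w i) A)) = f w" for w
    by (rule depends_onD[OF f(2)]) (auto simp: ext_def)
  moreover have "g (ext B (restrict (\<lambda>i. w i) B)) = g w" for w
    by (rule depends_onD[OF g(2)]) (auto simp: ext_def)
  ultimately have "Om.indep_var borel f borel g" by (simp add: comp_def)
  thus ?thesis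
    by (rule Om.indep_var_lebesgue_integral) (use f g Om.bmeas_integrable in auto)
qed

lemma expectation_disjoint_prod:
  fixes f :: "'k \<Rightarrow> outcome \<Rightarrow> 'b::{real_normed_field,banach,second_countable_topology}"
  assumes "finite J" "\<And>j. j \<in> J \<Longrightarrow> bmeas Om (f j)" "\<And>j. j \<in> J \<Longrightarrow> depends_on (A j) (f j)" "disjoint_family_on A J"
  shows "(\<E> w. (\<Prod>j\<in>J. f j w)) = (\<Prod>j\<in>J. \<E> w. f j w)"
  using assms
proof (induction J rule: finite_induct)
  case empty thus ?case by (simp add: Om.prob_space)
next
  case (insert j J)
  have dis: "A j \<inter> (\<Union>k\<in>J. A k) = {}" using insert.prems(3) insert.hyps by (auto simp: disjoint_family_on_def)
  have dis': "disjoint_family_on A J" using insert.prems(3) by (auto simp: disjoint_family_on_def)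
  have "(\<E> w. (\<Prod>k\<in>insert j J. f k w)) = (\<E> w. f j w * (\<Prod>k\<in>J. f k w))"
    using insert.hyps by simp
  also have "\<dots> = (\<E> w. f j w) * (\<E> w. (\<Prod>k\<in>J. f k w))"
  proof (rule expectation_disjoint_mult[OF _ _ _ _ dis])
    show "depends_on (\<Union> (A ` J)) (\<lambda>w. \<Prod>k\<in>J. f k w)"
      using insert.prems(2) by (intro depends_on_prod) (blast intro: depends_on_mono)
  qed (use insert.prems in auto)
  finally show ?case using insert dis' by simp
qed


section \<open>The random tournament on independent uniform coordinates\<close>

text \<open>
  Coordinate \<open>(u, 0)\<close> carries the type of vertex \<open>u\<close>, and coordinate \<open>(u, v)\<close> with \<open>1 \<le> u < v\<close>
  the uniform variable that decides the orientation of that pair.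
\<close>

lemma integral_unit_threshold:
  assumes "p \<in> {0..1}"
  shows "(\<I> y. of_bool (y \<le> p)) = p"
proof -
  have "(\<I> y. of_bool (y \<le> p)) = (\<I> y. indicator {0..p} y)"
    by (intro lint_cong) (auto simp: indicator_def)
  also have "\<dots> = measure unit_leb {0..p}" using assms
    by (simp add: unit_leb_def sets_restrict_space Int_absorb2)
  also have "\<dots> = p"
    unfolding unit_leb_def using assms by (subst measure_restrict_space) auto
  finally show ?thesis .
qed

text \<open>Given the types the edges are independent, so a product over edges can be averaged factor by factor.\<close>
lemma integrate_edges:
  fixes g :: "nat \<times> nat \<Rightarrow> real \<Rightarrow> outcome \<Rightarrow> 'b::{real_normed_field,banach,second_countable_topology}"
  assumes "finite E" "\<And>e. e \<in> E \<Longrightarrow> snd e \<noteq> 0" "bmeas Om G" "depends_on {i. snd i = 0} G"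
    "\<And>e. e \<in> E \<Longrightarrow> bmeas (Om \<Otimes>\<^sub>M unit_leb) (\<lambda>(w, y). g e y w)"
    "\<And>e y. e \<in> E \<Longrightarrow> depends_on {i. snd i = 0} (g e y)"
  shows "(\<E> w. G w * (\<Prod>e\<in>E. g e (w e) w)) = (\<E> w. G w * (\<Prod>e\<in>E. \<I> y. g e y w))"
  using assms
proof (induction E arbitrary: G rule: finite_induct)
  case empty thus ?case by simp
next
  case (insert e E)
  have bg: "bmeas Om (\<lambda>w. g e' (w e') w)" if "e' \<in> insert e E" for e'
    by (rule bmeas_comp2[where f="\<lambda>w y. g e' y w", OF insert.prems(4)[OF that]]) simp_all
  have bi: "bmeas Om (\<lambda>w. \<I> y. g e' y w)" if "e' \<in> insert e E" for e'
    by (rule U.bmeas_integral[where f="\<lambda>w y. g e' y w", OF insert.prems(4)[OF that]])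
  have di: "depends_on {i. snd i = 0} (\<lambda>w. \<I> y. g e' y w)" if "e' \<in> insert e E" for e'
  proof (rule depends_onI)
    fix w w' :: outcome assume *: "\<And>i. i \<in> {i. snd i = 0} \<Longrightarrow> w i = w' i"
    have "g e' y w = g e' y w'" for y by (rule depends_onD[OF insert.prems(5)[OF that] *])
    thus "(\<I> y. g e' y w) = (\<I> y. g e' y w')" by simp
  qed
  have sub: "{i. snd i = 0} \<subseteq> - {e}" using insert.prems(1)[of e] by auto
  have dprod: "depends_on (- {e}) (\<lambda>w. G w * (\<Prod>e\<in>E. g e (w e) w))"
  proof (intro depends_on_arith depends_on_prod)
    show "depends_on (- {e}) G" using insert.prems(3) sub by (rule depends_on_mono)
    fix e' assume e': "e' \<in> E"
    show "depends_on (- {e}) (\<lambda>w. g e' (w e') w)"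
    proof (rule depends_onI)
      fix w w' :: outcome assume *: "\<And>i. i \<in> - {e} \<Longrightarrow> w i = w' i"
      have "w e' = w' e'" by (rule *) (use e' insert.hyps in auto)
      moreover have "g e' y w = g e' y w'" for y
      proof (rule depends_onD[OF insert.prems(5)])
        show "e' \<in> insert e E" using e' by simp
        show "w i = w' i" if "i \<in> {i. snd i = 0}" for i using * sub that by blast
      qed
      ultimately show "g e' (w e') w = g e' (w' e') w'" by simp
    qed
  qed
  have "(\<E> w. G w * (\<Prod>e\<in>insert e E. g e (w e) w))
      = (\<E> w. (G w * (\<Prod>e\<in>E. g e (w e) w)) * g e (w e) w)"
    using insert.hyps by (simp add: mult_ac)
  also have "\<dots> = (\<E> w. (G w * (\<Prod>e\<in>E. g e (w e) w)) * (\<I> y. g e y w))"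
  proof (rule integrate_coordinate[OF _ _ dprod])
    show "depends_on (- {e}) (g e y)" for y by (rule depends_on_mono[OF insert.prems(5) sub]) simp
    show "bmeas Om (\<lambda>w. G w * (\<Prod>e\<in>E. g e (w e) w))" using bg insert.prems by auto
    show "bmeas Om (\<lambda>w. g e (w e) w)" by (rule bg) simp
  qed
  also have "\<dots> = (\<E> w. (G w * (\<I> y. g e y w)) * (\<Prod>e\<in>E. g e (w e) w))"
    by (simp add: mult_ac)
  also have "\<dots> = (\<E> w. (G w * (\<I> y. g e y w)) * (\<Prod>e\<in>E. \<I> y. g e y w))"
  proof (rule insert.IH)
    show "bmeas Om (\<lambda>w. G w * (\<I> y. g e y w))" by (intro bmeas_mult insert.prems(2) bi) simp
    show "depends_on {i. snd i = 0} (\<lambda>w. G w * (\<I> y. g e y w))"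
      by (intro depends_on_arith(3) insert.prems(3) di) simp
  qed (use insert.prems in blast)+
  finally show ?case using insert.hyps by (simp add: mult_ac)
qed

locale tourn =
  fixes W :: kernel
  assumes tour: "tournamenton W"
begin

lemma bmeas_W: "bmeas UU (\<lambda>(x, y). W x y)"
  using tour unfolding tournamenton_def
  by (intro bmeasI[where C=1]) (auto simp: space_pair_measure)

lemma W_in: "x \<in> {0..1} \<Longrightarrow> y \<in> {0..1} \<Longrightarrow> W x y \<in> {0..1}"
  and W_swap: "x \<in> {0..1} \<Longrightarrow> y \<in> {0..1} \<Longrightarrow> W y x = 1 - W x y"
  using tour unfolding tournamenton_def by (auto simp: eq_diff_eq)

lemma bmeas_W_comp [intro!]:
  "g \<in> measurable M unit_leb \<Longrightarrow> h \<in> measurable M unit_leb \<Longrightarrow> bmeas M (\<lambda>x. W (g x) (h x))"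
  by (rule bmeas_comp2[OF bmeas_W])

lemma W_measurable [measurable (raw)]:
  "g \<in> measurable M unit_leb \<Longrightarrow> h \<in> measurable M unit_leb \<Longrightarrow> (\<lambda>x. W (g x) (h x)) \<in> borel_measurable M"
  by (rule bmeas_measurable) (rule bmeas_W_comp)

definition ori :: "outcome \<Rightarrow> nat \<times> nat \<Rightarrow> bool" where
  "ori w = (\<lambda>(u, v). w (u, v) \<le> W (w (u, 0)) (w (v, 0)))"

definition adj :: "outcome \<Rightarrow> nat \<Rightarrow> nat \<Rightarrow> real" where
  "adj w = adj_matrix (ori w)"

lemma unit_coord_real [measurable]: "(\<lambda>w. w i) \<in> borel_measurable Om"
proof -
  have "(\<lambda>x::real. x) \<in> measurable unit_leb borel" unfolding unit_leb_def by (rule measurable_restrict_space1) auto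
  from measurable_compose[OF coord_measurable this] show ?thesis .
qed

lemma ori_measurable [measurable]: "Measurable.pred Om (\<lambda>w. ori w e)"
proof (cases e)
  case (Pair u v)
  have "(\<lambda>w. W (w (u, 0)) (w (v, 0))) \<in> borel_measurable Om" by (intro W_measurable coord_measurable)
  from borel_measurable_le[OF unit_coord_real[of "(u, v)"] this] show ?thesis
    unfolding ori_def Pair split pred_def .
qed

lemma ident_unit_measurable [measurable]: "(\<lambda>x::real. x) \<in> borel_measurable unit_leb"
  unfolding unit_leb_def by (rule measurable_restrict_space1) auto

abbreviation edges :: "nat \<Rightarrow> (nat \<times> nat) set" where
  "edges n \<equiv> {(u, v). 1 \<le> u \<and> u < v \<and> v \<le> n}"

lemma finite_edges: "finite (edges n)"
  by (rule finite_subset[of _ "{..n} \<times> {..n}"]) auto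

text \<open>  The matrix takes finitely many values on the edges, and an edge configuration \<open>e\<close> has the same probability on
  both sides: the average over the types of the product \<open>wt e\<close> of its edge probabilities.\<close>
lemma
  shows random_matrix_measurable:
      "(\<lambda>w. adj_matrix (\<lambda>e. e \<in> edges n \<and> ori w e)) \<in> measurable Om (count_space UNIV)"
    and random_tournament_eq: "random_tournament n W =
      distr Om (count_space UNIV) (\<lambda>w. adj_matrix (\<lambda>e. e \<in> edges n \<and> ori w e))"
proof -
  define E where "E = edges n"
  have Efin: "finite E" unfolding E_def by (rule finite_edges)
  have Emem: "1 \<le> fst x" "fst x \<le> n" "1 \<le> snd x" "snd x \<le> n" if "x \<in> E" for x
    using that by (auto simp: E_def)
  let ?N = "PiM {1..n} (\<lambda>_. unit_leb)"
  interpret N: prob_space ?N by (rule prob_space_PiM) (rule prob_space_unit)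
  define p where "p \<eta> = Pi_pmf E False (\<lambda>x. bernoulli_pmf (W (\<eta> (fst x)) (\<eta> (snd x))))" for \<eta>
  define K where "K \<eta> = measure_pmf (map_pmf adj_matrix (p \<eta>))" for \<eta>
  define S where "S A = {e. (\<forall>x. x \<notin> E \<longrightarrow> e x = False) \<and> adj_matrix e \<in> A}" for A
  define wt where "wt e \<eta> = (\<Prod>x\<in>E. if e x then W (\<eta> (fst x)) (\<eta> (snd x)) else 1 - W (\<eta> (fst x)) (\<eta> (snd x)))"
    for e :: "nat \<times> nat \<Rightarrow> bool" and \<eta> :: "nat \<Rightarrow> real"
  have finS: "finite (S A)" for A
  proof (rule finite_subset)
    show "S A \<subseteq> PiE_dflt E False (\<lambda>_. UNIV)" by (auto simp: S_def PiE_dflt_def)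
    show "finite (PiE_dflt E False (\<lambda>_. UNIV :: bool set))" by (rule finite_PiE_dflt[OF Efin]) auto
  qed
  have eta_in: "\<eta> u \<in> {0..1}" if "\<eta> \<in> space ?N" "u \<in> {1..n}" for \<eta> u
    using that by (simp add: space_PiM PiE_iff)
  have pmfp: "pmf (p \<eta>) e = wt e \<eta>" if "\<eta> \<in> space ?N" "e \<in> S A" for \<eta> e A
  proof -
    have "pmf (p \<eta>) e = (\<Prod>x\<in>E. pmf (bernoulli_pmf (W (\<eta> (fst x)) (\<eta> (snd x)))) (e x))"
      using that(2) unfolding p_def S_def by (simp add: pmf_Pi[OF Efin])
    also have "\<dots> = wt e \<eta>" unfolding wt_def
    proof (rule prod.cong[OF refl])
      fix x assume "x \<in> E"
      hence "W (\<eta> (fst x)) (\<eta> (snd x)) \<in> {0..1}" using Emem[of x] that(1) by (intro W_in eta_in) simp_all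
      thus "pmf (bernoulli_pmf (W (\<eta> (fst x)) (\<eta> (snd x)))) (e x)
          = (if e x then W (\<eta> (fst x)) (\<eta> (snd x)) else 1 - W (\<eta> (fst x)) (\<eta> (snd x)))"
        by (cases "e x") simp_all
    qed
    finally show ?thesis .
  qed
  have emK: "emeasure (K \<eta>) A = ennreal (\<Sum>e\<in>S A. wt e \<eta>)" if "\<eta> \<in> space ?N" for \<eta> A
  proof -
    have "emeasure (K \<eta>) A = emeasure (measure_pmf (p \<eta>)) (adj_matrix -` A)" by (simp add: K_def)
    also have "\<dots> = emeasure (measure_pmf (p \<eta>)) (S A)"
    proof (rule emeasure_eq_AE)
      show "AE e in measure_pmf (p \<eta>). (e \<in> adj_matrix -` A) = (e \<in> S A)"
      proof (rule AE_pmfI)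
        fix e assume "e \<in> set_pmf (p \<eta>)"
        hence "\<forall>x. x \<notin> E \<longrightarrow> e x = False"
          using subsetD[OF set_Pi_pmf_subset[OF Efin]] unfolding p_def by fastforce
        thus "(e \<in> adj_matrix -` A) = (e \<in> S A)" unfolding S_def by blast
      qed
    qed auto
    also have "\<dots> = ennreal (\<Sum>e\<in>S A. pmf (p \<eta>) e)"
      by (subst emeasure_measure_pmf_finite[OF finS]) auto
    also have "\<dots> = ennreal (\<Sum>e\<in>S A. wt e \<eta>)" using pmfp[OF that] by (metis (no_types, lifting) sum.cong)
    finally show ?thesis .
  qed
  have bwt: "bmeas ?N (wt e)" for e
    unfolding wt_def
  proof (rule bmeas_prod)
    fix x assume x: "x \<in> E"
    have "bmeas ?N (\<lambda>\<eta>. W (\<eta> (fst x)) (\<eta> (snd x)))"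
      using Emem[OF x] by (intro bmeas_W_comp measurable_component_singleton) simp_all
    thus "bmeas ?N (\<lambda>\<eta>. if e x then W (\<eta> (fst x)) (\<eta> (snd x)) else 1 - W (\<eta> (fst x)) (\<eta> (snd x)))"
      by (cases "e x") auto
  qed
  have Kmeas: "K \<in> measurable ?N (subprob_algebra (count_space UNIV))"
  proof (rule measurable_subprob_algebra)
    show "\<And>a. subprob_space (K a)" unfolding K_def by (rule measure_pmf.subprob_space_axioms)
    show "\<And>a. sets (K a) = sets (count_space UNIV)" by (simp add: K_def)
    fix A
    have "(\<lambda>a. ennreal (\<Sum>e\<in>S A. wt e a)) \<in> borel_measurable ?N"
      using bmeas_measurable[OF bwt] by measurable
    thus "(\<lambda>a. emeasure (K a) A) \<in> borel_measurable ?N" by (subst measurable_cong[OF emK]) auto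
  qed
  have rt: "random_tournament n W = ?N \<bind> K" unfolding random_tournament_def K_def p_def E_def split_beta ..
  define T where "T w = (\<lambda>u\<in>{1..n}. w (u, 0::nat))" for w :: outcome
  have dT: "distr Om ?N T = ?N" unfolding Om_def T_def
    using distr_PiM_reindex[of UNIV "\<lambda>_. unit_leb" "\<lambda>u. (u, 0)" "{1..n}"] by (simp add: prob_space_unit inj_on_def)
  have mT: "T \<in> measurable Om ?N" unfolding T_def by (rule measurable_restrict) simp
  define X where "X w = adj_matrix (\<lambda>e. e \<in> E \<and> ori w e)" for w
  have Xeq: "of_bool (X w \<in> A) = (\<Sum>e\<in>S A. \<Prod>x\<in>E. of_bool (ori w x = e x) :: real)" for w A
  proof -
    define e0 where "e0 = (\<lambda>e. e \<in> E \<and> ori w e)"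
    have *: "(\<Prod>x\<in>E. of_bool (ori w x = e x) :: real) = of_bool (e = e0)" if "e \<in> S A" for e
    proof -
      have "(\<Prod>x\<in>E. of_bool (ori w x = e x) :: real) = of_bool (\<forall>x\<in>E. ori w x = e x)"
        using Efin by (induction rule: finite_induct) auto
      also have "(\<forall>x\<in>E. ori w x = e x) \<longleftrightarrow> e = e0"
        using that unfolding e0_def S_def by fastforce
      finally show ?thesis .
    qed
    have "(\<Sum>e\<in>S A. \<Prod>x\<in>E. of_bool (ori w x = e x) :: real) = (\<Sum>e\<in>S A. of_bool (e = e0))"
      by (intro sum.cong) (auto simp: *)
    also have "\<dots> = of_bool (e0 \<in> S A)" using finS by (simp add: of_bool_def sum.delta)
    also have "e0 \<in> S A \<longleftrightarrow> X w \<in> A" by (auto simp: S_def X_def e0_def)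
    finally show ?thesis by simp
  qed
  have Xpred: "Measurable.pred Om (\<lambda>w. X w \<in> A)" for A
  proof -
    have "Measurable.pred Om (\<lambda>w. (\<Sum>e\<in>S A. \<Prod>x\<in>E. of_bool (ori w x = e x) :: real) = 1)"
      by measurable
    thus ?thesis unfolding Xeq[symmetric] by simp
  qed
  have Xmeas: "X \<in> measurable Om (count_space UNIV)"
  proof (rule measurableI)
    fix A
    have "X -` A \<inter> space Om = {w \<in> space Om. X w \<in> A}" by auto
    thus "X -` A \<inter> space Om \<in> sets Om" using Xpred[of A] unfolding pred_def by simp
  qed auto
  thus "(\<lambda>w. adj_matrix (\<lambda>e. e \<in> edges n \<and> ori w e)) \<in> measurable Om (count_space UNIV)"
    unfolding X_def E_def .
  show "random_tournament n W =
      distr Om (count_space UNIV) (\<lambda>w. adj_matrix (\<lambda>e. e \<in> edges n \<and> ori w e))"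
  proof (rule measure_eqI)
    show "sets (random_tournament n W) = sets (distr Om (count_space UNIV) (\<lambda>w. adj_matrix (\<lambda>e. e \<in> edges n \<and> ori w e)))"
      unfolding rt by (subst sets_bind[where N="count_space UNIV"]) (simp_all add: K_def N.not_empty)
    fix A
    have "emeasure (random_tournament n W) A = (\<integral>\<^sup>+\<eta>. emeasure (K \<eta>) A \<partial>?N)"
      unfolding rt by (rule emeasure_bind[OF N.not_empty Kmeas]) auto
    also have "\<dots> = (\<integral>\<^sup>+\<eta>. ennreal (\<Sum>e\<in>S A. wt e \<eta>) \<partial>?N)" by (intro nn_integral_cong emK)
    also have "\<dots> = ennreal (\<integral>\<eta>. (\<Sum>e\<in>S A. wt e \<eta>) \<partial>?N)"
    proof (rule nn_integral_eq_integral)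
      show "integrable ?N (\<lambda>\<eta>. \<Sum>e\<in>S A. wt e \<eta>)" by (intro N.bmeas_integrable bmeas_sum bwt)
      have "0 \<le> wt e \<eta>" if "\<eta> \<in> space ?N" for \<eta> e
        unfolding wt_def using W_in[OF eta_in[OF that] eta_in[OF that]] Emem by (intro prod_nonneg) simp
      thus "AE \<eta> in ?N. 0 \<le> (\<Sum>e\<in>S A. wt e \<eta>)" by (auto intro!: AE_I2 sum_nonneg)
    qed
    also have "(\<integral>\<eta>. (\<Sum>e\<in>S A. wt e \<eta>) \<partial>?N) = (\<E> w. (\<Sum>e\<in>S A. wt e (T w)))"
      by (subst dT[symmetric], rule integral_distr[OF mT bmeas_measurable[OF bmeas_sum[OF bwt]]])
    also have "\<dots> = (\<Sum>e\<in>S A. \<E> w. wt e (T w))"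
      by (intro lint_sum Om.bmeas_integrable bmeas_comp[OF bwt mT])
    also have "\<dots> = (\<Sum>e\<in>S A. \<E> w. (\<Prod>x\<in>E. of_bool (ori w x = e x)))"
    proof (rule sum.cong[OF refl])
      fix e
      define g where "g x y w = (of_bool ((y \<le> W (w (fst x, 0)) (w (snd x, 0))) = e x) :: real)"
        for x :: "nat \<times> nat" and y and w :: outcome
      have gint: "(\<I> y. g x y w) = (if e x then W (w (fst x, 0)) (w (snd x, 0)) else 1 - W (w (fst x, 0)) (w (snd x, 0)))"
        if "w \<in> space Om" for x w
      proof -
        let ?q = "W (w (fst x, 0)) (w (snd x, 0))"
        have q: "?q \<in> {0..1}" by (intro W_in coord_in that)
        show ?thesis
        proof (cases "e x")
          case True thus ?thesis using integral_unit_threshold[OF q] by (simp add: g_def)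
        next
          case False
          have "(\<I> y. g x y w) = (\<I> y. 1 - of_bool (y \<le> ?q))"
            using False by (intro lint_cong) (auto simp: g_def)
          also have "\<dots> = 1 - ?q"
            by (subst lint_diff)
               (auto simp: integral_unit_threshold[OF q]
                  intro!: U.bmeas_integrable bmeas_of_bool)
          finally show ?thesis using False by simp
        qed
      qed
      have "(\<E> w. (\<Prod>x\<in>E. of_bool (ori w x = e x))) = (\<E> w. 1 * (\<Prod>x\<in>E. g x (w x) w))"
        by (simp add: g_def ori_def split_beta)
      also have "\<dots> = (\<E> w. 1 * (\<Prod>x\<in>E. \<I> y. g x y w))"
      proof (rule integrate_edges[OF Efin])
        show "\<And>e. e \<in> E \<Longrightarrow> snd e \<noteq> 0" using Emem by fastforce
        fix x
        show "bmeas (Om \<Otimes>\<^sub>M unit_leb) (\<lambda>(w, y). g x y w)"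
          unfolding g_def case_prod_unfold by (rule bmeas_of_bool) measurable
        show "depends_on {i. snd i = 0} (g x y)" for y
          unfolding g_def depends_on_def by auto
      qed auto
      also have "\<dots> = (\<E> w. wt e (T w))"
        by (intro lint_cong refl)
           (use Emem in \<open>auto simp: wt_def T_def gint intro!: prod.cong\<close>)
      finally show "(\<E> w. wt e (T w)) = (\<E> w. (\<Prod>x\<in>E. of_bool (ori w x = e x)))" ..
    qed
    also have "\<dots> = (\<E> w. of_bool (X w \<in> A))"
      unfolding Xeq by (intro lint_sum[symmetric] Om.bmeas_integrable bmeas_prod bmeas_of_bool) measurable
    also have "\<dots> = measure Om {w \<in> space Om. X w \<in> A}"
    proof -
      have "{w \<in> space Om. X w \<in> A} \<in> sets Om" using Xpred by simp
      hence "measure Om {w \<in> space Om. X w \<in> A} = (\<E> w. indicator {w \<in> space Om. X w \<in> A} w)" by simp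
      also have "\<dots> = (\<E> w. of_bool (X w \<in> A))"
        by (intro lint_cong) (auto simp: indicator_def)
      finally show ?thesis ..
    qed
    also have "ennreal \<dots> = emeasure (distr Om (count_space UNIV) X) A"
      by (subst emeasure_distr[OF Xmeas]) (auto simp: Om.emeasure_eq_measure intro!: arg_cong[where f="measure Om"])
    finally show "emeasure (random_tournament n W) A
        = emeasure (distr Om (count_space UNIV) (\<lambda>w. adj_matrix (\<lambda>e. e \<in> edges n \<and> ori w e))) A"
      unfolding X_def E_def .
  qed
qed

end


section \<open>Weak convergence through characteristic functions\<close>

lemma iexp_diff_le: "cmod (iexp x - iexp y) \<le> \<bar>x - y\<bar>"
proof -
  have "iexp x - iexp y = iexp y * (iexp (x - y) - 1)"
    by (simp add: algebra_simps exp_add[symmetric])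
  hence "cmod (iexp x - iexp y) = cmod (iexp (x - y) - 1)" by (simp add: norm_mult)
  also have "\<dots> \<le> \<bar>x - y\<bar>" using iexp_approx1[of "x - y" 0] by simp
  finally show ?thesis .
qed

lemma (in prob_space) integrable_iexp_rv [intro]:
  "X \<in> borel_measurable M \<Longrightarrow> integrable M (\<lambda>x. iexp (X x))"
  by (rule integrable_const_bound[where B=1]) auto

lemma (in prob_space) iexp_expectation_diff_le:
  assumes X: "X \<in> borel_measurable M" and Y: "Y \<in> borel_measurable M"
    and I: "integrable M (\<lambda>x. (X x - Y x)^2)"
  shows "cmod ((\<integral>x. iexp (t * X x) \<partial>M) - (\<integral>x. iexp (t * Y x) \<partial>M)) \<le> \<bar>t\<bar> * sqrt (\<integral>x. (X x - Y x)^2 \<partial>M)"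
proof -
  have int: "integrable M (\<lambda>x. \<bar>X x - Y x\<bar>)"
    using cauchy_schwarz(1)[of "\<lambda>_. 1" "\<lambda>x. \<bar>X x - Y x\<bar>"] X Y I by simp
  have "(\<integral>x. iexp (t * X x) \<partial>M) - (\<integral>x. iexp (t * Y x) \<partial>M) = (\<integral>x. iexp (t * X x) - iexp (t * Y x) \<partial>M)"
    using X Y by (intro lint_diff[symmetric] integrable_iexp_rv) simp_all
  also have "cmod \<dots> \<le> (\<integral>x. cmod (iexp (t * X x) - iexp (t * Y x)) \<partial>M)" by (rule integral_norm_bound)
  also have "\<dots> \<le> (\<integral>x. \<bar>t\<bar> * \<bar>X x - Y x\<bar> \<partial>M)"
  proof (rule integral_mono)
    show "integrable M (\<lambda>x. cmod (iexp (t * X x) - iexp (t * Y x)))"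
      using X Y by (intro integrable_norm Bochner_Integration.integrable_diff integrable_iexp_rv) simp_all
    show "integrable M (\<lambda>x. \<bar>t\<bar> * \<bar>X x - Y x\<bar>)" using int by simp
    fix x show "cmod (iexp (t * X x) - iexp (t * Y x)) \<le> \<bar>t\<bar> * \<bar>X x - Y x\<bar>"
      using iexp_diff_le[of "t * X x" "t * Y x"] by (simp add: abs_mult right_diff_distrib[symmetric])
  qed
  also have "\<dots> = \<bar>t\<bar> * (\<integral>x. \<bar>X x - Y x\<bar> \<partial>M)" by simp
  also have "\<dots> \<le> \<bar>t\<bar> * sqrt (\<integral>x. (X x - Y x)^2 \<partial>M)"
    using L1_le_L2[of "\<lambda>x. X x - Y x"] X Y I by (intro mult_left_mono) auto
  finally show ?thesis .
qed

lemma (in prob_space) char_distr_eq: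
  "X \<in> borel_measurable M \<Longrightarrow> char (distr M borel X) t = (\<integral>x. iexp (t * X x) \<partial>M)"
  unfolding char_def by (subst integral_distr) auto

lemma weak_conv_by_char:
  assumes "prob_space M" "prob_space N" "\<And>n. X n \<in> borel_measurable M" "Y \<in> borel_measurable N"
    and "\<And>t. (\<lambda>n. \<integral>x. iexp (t * X n x) \<partial>M) \<longlonglongrightarrow> (\<integral>x. iexp (t * Y x) \<partial>N)"
  shows "weak_conv_m (\<lambda>n. distr M borel (X n)) (distr N borel Y)"
proof -
  interpret M: prob_space M by fact
  interpret N: prob_space N by fact
  show ?thesis
    using assms by (intro levy_continuity)
      (auto simp: M.char_distr_eq N.char_distr_eq real_distribution_def real_distribution_axioms_def
        intro!: M.prob_space_distr N.prob_space_distr)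
qed

lemma char_tendsto_of_weak_conv:
  assumes "prob_space M" "prob_space N" "\<And>n. X n \<in> borel_measurable M" "Y \<in> borel_measurable N"
    and "weak_conv_m (\<lambda>n. distr M borel (X n)) (distr N borel Y)"
  shows "(\<lambda>n. \<integral>x. iexp (t * X n x) \<partial>M) \<longlonglongrightarrow> (\<integral>x. iexp (t * Y x) \<partial>N)"
proof -
  interpret M: prob_space M by fact
  interpret N: prob_space N by fact
  have "(\<lambda>n. char (distr M borel (X n)) t) \<longlonglongrightarrow> char (distr N borel Y) t"
    using assms by (intro levy_continuity1)
      (auto simp: real_distribution_def real_distribution_axioms_def
        intro!: M.prob_space_distr N.prob_space_distr)
  thus ?thesis using assms by (simp add: M.char_distr_eq N.char_distr_eq)
qed

text \<open>Slutsky's lemma: a perturbation that vanishes in mean square does not change the limit.\<close>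
lemma (in prob_space) char_limit_perturb:
  assumes "\<And>n. X n \<in> borel_measurable M" "\<And>n. Y n \<in> borel_measurable M"
    "\<And>n. integrable M (\<lambda>x. (X n x - Y n x)^2)"
    "(\<lambda>n. \<integral>x. (X n x - Y n x)^2 \<partial>M) \<longlonglongrightarrow> 0"
    "(\<lambda>n. \<integral>x. iexp (t * Y n x) \<partial>M) \<longlonglongrightarrow> c"
  shows "(\<lambda>n. \<integral>x. iexp (t * X n x) \<partial>M) \<longlonglongrightarrow> c"
proof -
  have "(\<lambda>n. (\<integral>x. iexp (t * X n x) \<partial>M) - (\<integral>x. iexp (t * Y n x) \<partial>M)) \<longlonglongrightarrow> 0"
  proof (rule Lim_null_comparison)
    show "\<forall>\<^sub>F n in sequentially. cmod ((\<integral>x. iexp (t * X n x) \<partial>M) - (\<integral>x. iexp (t * Y n x) \<partial>M))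
       \<le> \<bar>t\<bar> * sqrt (\<integral>x. (X n x - Y n x)^2 \<partial>M)"
      using iexp_expectation_diff_le assms by (intro always_eventually) blast
    show "(\<lambda>n. \<bar>t\<bar> * sqrt (\<integral>x. (X n x - Y n x)^2 \<partial>M)) \<longlonglongrightarrow> 0"
      using tendsto_mult_right_zero[OF tendsto_real_sqrt[OF assms(4), simplified]] .
  qed
  from tendsto_add[OF this assms(5)] show ?thesis by simp
qed

abbreviation NN :: "real measure" where "NN \<equiv> std_normal_distribution"

lemma space_std_normal [simp]: "space NN = UNIV"
  and sets_std_normal [simp, measurable_cong]: "sets NN = sets borel"
  by simp_all

lemma prob_space_std_normal: "prob_space NN"
  by (rule prob_space_normal_density) simp

lemma iexp_std_normal: "(\<integral>x. iexp (t * x) \<partial>NN) = exp (- (t^2) / 2)"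
  using char_std_normal_distribution[of ] by (auto simp: char_def fun_eq_iff)

lemma weak_conv_normal_law:
  assumes "prob_space M" "\<And>n. X n \<in> borel_measurable M" "v \<ge> 0"
    and "\<And>t. (\<lambda>n. \<integral>x. iexp (t * X n x) \<partial>M) \<longlonglongrightarrow> exp (- (t^2 * v) / 2)"
  shows "weak_conv_m (\<lambda>n. distr M borel (X n)) (normal_law 0 v)"
  unfolding normal_law_def
proof (rule weak_conv_by_char[OF assms(1) prob_space_std_normal assms(2)])
  fix t
  have "(\<integral>x. iexp (t * (0 + sqrt v * x)) \<partial>NN) = exp (- (t^2 * v) / 2)"
    using iexp_std_normal[of "t * sqrt v"] assms(3) by (simp add: mult.assoc power_mult_distrib)
  thus "(\<lambda>n. \<integral>x. iexp (t * X n x) \<partial>M) \<longlonglongrightarrow> (\<integral>x. iexp (t * (0 + sqrt v * x)) \<partial>NN)"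
    using assms(4)[of t] by simp
qed simp


section \<open>Orthogonal sums\<close>

lemma (in prob_space) orthogonal_sum_bound:
  fixes Y :: "'i \<Rightarrow> 'a \<Rightarrow> real"
  assumes "finite I" and b: "\<And>i. i \<in> I \<Longrightarrow> bmeas M (Y i)"
    and C: "\<And>i x. i \<in> I \<Longrightarrow> x \<in> space M \<Longrightarrow> \<bar>Y i x\<bar> \<le> C"
    and orth: "\<And>i j. i \<in> I \<Longrightarrow> j \<in> I \<Longrightarrow> i \<noteq> j \<Longrightarrow> (\<integral>x. Y i x * Y j x \<partial>M) = 0"
  shows "(\<integral>x. (\<Sum>i\<in>I. Y i x)^2 \<partial>M) = (\<Sum>i\<in>I. \<integral>x. (Y i x)^2 \<partial>M)"
    and "(\<integral>x. (\<Sum>i\<in>I. Y i x)^2 \<partial>M) \<le> C^2 * card I"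
proof -
  have "(\<integral>x. (\<Sum>i\<in>I. Y i x)^2 \<partial>M) = (\<integral>x. (\<Sum>i\<in>I. \<Sum>j\<in>I. Y i x * Y j x) \<partial>M)"
    by (simp add: power2_eq_square sum_product)
  also have "\<dots> = (\<Sum>i\<in>I. \<Sum>j\<in>I. \<integral>x. Y i x * Y j x \<partial>M)"
    using b by (simp add: lint_sum bmeas_integrable bmeas_mult bmeas_sum)
  also have "\<dots> = (\<Sum>i\<in>I. \<Sum>j\<in>I. if j = i then \<integral>x. (Y i x)^2 \<partial>M else 0)"
    by (intro sum.cong refl) (auto simp: power2_eq_square orth)
  also have "\<dots> = (\<Sum>i\<in>I. \<integral>x. (Y i x)^2 \<partial>M)" using assms(1) by (simp add: sum.delta')
  finally show eq: "(\<integral>x. (\<Sum>i\<in>I. Y i x)^2 \<partial>M) = (\<Sum>i\<in>I. \<integral>x. (Y i x)^2 \<partial>M)" .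
  have "(\<Sum>i\<in>I. \<integral>x. (Y i x)^2 \<partial>M) \<le> (\<Sum>i\<in>I. C^2)"
  proof (rule sum_mono)
    fix i assume i: "i \<in> I"
    have "(\<integral>x. (Y i x)^2 \<partial>M) \<le> (\<integral>x. C^2 \<partial>M)"
    proof (intro bmeas_integral_mono)
      show "bmeas M (\<lambda>x. (Y i x)^2)" using b[OF i] by auto
      fix x assume "x \<in> space M"
      from power_mono[OF C[OF i this] abs_ge_zero, of 2] show "(Y i x)^2 \<le> C^2" by simp
    qed auto
    thus "(\<integral>x. (Y i x)^2 \<partial>M) \<le> C^2" by (simp add: prob_space)
  qed
  thus "(\<integral>x. (\<Sum>i\<in>I. Y i x)^2 \<partial>M) \<le> C^2 * card I" using eq by (simp add: mult.commute)
qed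

section \<open>Sums over pairs and triples of vertices\<close>

definition pairs :: "nat \<Rightarrow> (nat \<times> nat) set" where
  "pairs n = {(u, v). 1 \<le> u \<and> u < v \<and> v \<le> n}"

definition triples :: "nat \<Rightarrow> (nat \<times> nat \<times> nat) set" where
  "triples n = {(u, v, x). 1 \<le> u \<and> u < v \<and> v < x \<and> x \<le> n}"

lemma finite_pairs: "finite (pairs n)"
  by (rule finite_subset[of _ "{..n} \<times> {..n}"]) (auto simp: pairs_def)

lemma finite_triples: "finite (triples n)"
  by (rule finite_subset[of _ "{..n} \<times> {..n} \<times> {..n}"]) (auto simp: triples_def)

lemma card_pairs_le: "card (pairs n) \<le> n ^ 2"
proof -
  have "card (pairs n) \<le> card ({1..n} \<times> {1..n})" by (rule card_mono) (auto simp: pairs_def)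
  thus ?thesis by (simp add: power2_eq_square)
qed

lemma card_triples_le: "card (triples n) \<le> n ^ 3"
proof -
  have "card (triples n) \<le> card ({1..n} \<times> {1..n} \<times> {1..n})" by (rule card_mono) (auto simp: triples_def)
  thus ?thesis by (simp add: power3_eq_cube)
qed

text \<open>Vertices are added one at a time; the counting identities below are inductions along these two steps.\<close>
lemma sum_pairs_Suc:
  fixes F :: "nat \<times> nat \<Rightarrow> 'b::comm_monoid_add"
  shows "(\<Sum>e\<in>pairs (Suc n). F e) = (\<Sum>e\<in>pairs n. F e) + (\<Sum>u\<in>{1..n}. F (u, Suc n))"
proof -
  have eq: "pairs (Suc n) = pairs n \<union> (\<lambda>u. (u, Suc n)) ` {1..n}" by (auto simp: image_iff pairs_def)
  have "(\<Sum>e\<in>pairs (Suc n). F e) = (\<Sum>e\<in>pairs n. F e) + (\<Sum>e\<in>(\<lambda>u. (u, Suc n)) ` {1..n}. F e)"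
    unfolding eq by (rule sum.union_disjoint[OF finite_pairs]) (auto simp: pairs_def)
  thus ?thesis by (subst (asm) sum.reindex) (auto simp: inj_on_def)
qed

lemma sum_triples_Suc:
  fixes F :: "nat \<times> nat \<times> nat \<Rightarrow> 'b::comm_monoid_add"
  shows "(\<Sum>e\<in>triples (Suc n). F e) = (\<Sum>e\<in>triples n. F e) + (\<Sum>(u, v)\<in>pairs n. F (u, v, Suc n))"
proof -
  have eq: "triples (Suc n) = triples n \<union> (\<lambda>(u, v). (u, v, Suc n)) ` pairs n"
    by (auto simp: image_iff triples_def pairs_def)
  have "(\<Sum>e\<in>triples (Suc n). F e) = (\<Sum>e\<in>triples n. F e) + (\<Sum>e\<in>(\<lambda>(u, v). (u, v, Suc n)) ` pairs n. F e)"
    unfolding eq by (rule sum.union_disjoint[OF finite_triples]) (auto intro: finite_pairs simp: triples_def)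
  thus ?thesis by (subst (asm) sum.reindex) (auto simp: inj_on_def case_prod_unfold)
qed

lemma pairs_0: "pairs 0 = {}" and triples_0: "triples 0 = {}"
  by (auto simp: triples_def pairs_def)

lemma sum_pairs_vertex:
  fixes G :: "nat \<Rightarrow> real"
  shows "(\<Sum>(u, v)\<in>pairs n. G u + G v) = (real n - 1) * (\<Sum>u\<in>{1..n}. G u)"
proof (induction n)
  case 0 thus ?case by (simp add: pairs_0)
next
  case (Suc n)
  show ?case unfolding sum_pairs_Suc Suc by (simp add: sum.distrib algebra_simps)
qed

lemma card_pairs: "real (card (pairs n)) = real n * (real n - 1) / 2"
  using sum_pairs_vertex[of "\<lambda>_. 1" n] by (simp add: algebra_simps case_prod_unfold)

lemma sum_triples_pair:
  fixes F :: "nat \<Rightarrow> nat \<Rightarrow> real"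
  shows "(\<Sum>(u, v, x)\<in>triples n. F u v + F v x + F u x) = (real n - 2) * (\<Sum>(u, v)\<in>pairs n. F u v)"
proof (induction n)
  case 0 thus ?case by (simp add: pairs_0 triples_0)
next
  case (Suc n)
  have "(\<Sum>(u, v)\<in>pairs n. F u v + F v (Suc n) + F u (Suc n))
      = (\<Sum>(u, v)\<in>pairs n. F u v) + (\<Sum>(u, v)\<in>pairs n. F u (Suc n) + F v (Suc n))"
    unfolding sum.distrib[symmetric] by (intro sum.cong) auto
  also have "\<dots> = (\<Sum>(u, v)\<in>pairs n. F u v) + (real n - 1) * (\<Sum>u\<in>{1..n}. F u (Suc n))"
    by (simp only: sum_pairs_vertex)
  finally show ?case unfolding sum_triples_Suc sum_pairs_Suc prod.case Suc by (simp add: algebra_simps)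
qed

lemma sum_triples_vertex:
  fixes G :: "nat \<Rightarrow> real"
  shows "(\<Sum>(u, v, x)\<in>triples n. G u + G v + G x) = (real n - 1) * (real n - 2) / 2 * (\<Sum>u\<in>{1..n}. G u)"
proof (induction n)
  case 0 thus ?case by (simp add: triples_0)
next
  case (Suc n)
  have "(\<Sum>(u, v)\<in>pairs n. G u + G v + G (Suc n))
      = (\<Sum>(u, v)\<in>pairs n. G u + G v) + real (card (pairs n)) * G (Suc n)"
    by (simp add: sum.distrib case_prod_unfold)
  also have "\<dots> = (real n - 1) * (\<Sum>u\<in>{1..n}. G u) + real n * (real n - 1) / 2 * G (Suc n)"
    by (simp only: sum_pairs_vertex card_pairs)
  finally show ?case unfolding sum_triples_Suc prod.case Suc by (simp add: field_simps)
qed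

lemma card_triples: "real (card (triples n)) = real n * (real n - 1) * (real n - 2) / 6"
proof -
  have "3 * real (card (triples n)) = (real n - 1) * (real n - 2) / 2 * real n"
    using sum_triples_vertex[of "\<lambda>_. 1" n] by (simp add: case_prod_unfold)
  thus ?thesis by (simp add: field_simps)
qed

lemma card_triples_binomial: "real (n choose 3) = real (card (triples n))"
  unfolding card_triples by (simp add: binomial_gbinomial gbinomial_prod_rev numeral_3_eq_3 field_simps)

lemma num_triads_triples:
  "num_triads n a = (\<Sum>(u, v, x)\<in>triples n. a u v * a v x * a x u + a u x * a x v * a v u)"
proof -
  have "triples n = Sigma {1..n} (\<lambda>u. Sigma {u<..n} (\<lambda>v. {v<..n}))"
    by (auto simp: triples_def)
  thus ?thesis unfolding num_triads_def by (simp add: sum.Sigma)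
qed

section \<open>The Hoeffding decomposition of the number of circular triads\<close>

text \<open>  The coordinates attached to a vertex (its type and its edges), and the coordinates that determine the
  tournament on a set of vertices.\<close>
definition touch :: "nat \<Rightarrow> (nat \<times> nat) set" where
  "touch x = {i. fst i = x \<or> snd i = x}"

definition coords :: "nat set \<Rightarrow> (nat \<times> nat) set" where
  "coords S = {i. fst i \<in> S \<and> (snd i = 0 \<or> snd i \<in> S)}"

lemma coords_mono: "S \<subseteq> T \<Longrightarrow> coords S \<subseteq> coords T"
  by (auto simp: coords_def)

lemma coords_touch: "x \<notin> S \<Longrightarrow> x \<noteq> 0 \<Longrightarrow> coords S \<subseteq> - touch x"
  by (auto simp: coords_def touch_def)

interpretation UUU: pair_prob_space unit_leb "UU" ..

context tourn
begin

lemma bmeas_p: "bmeas UU (\<lambda>(x, y). p_fun W x y)"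
proof -
  have "bmeas (UU \<Otimes>\<^sub>M unit_leb) (\<lambda>(q, z). W (snd q) z * W z (fst q))"
    unfolding case_prod_unfold by (intro bmeas_mult bmeas_W_comp) measurable
  from U.bmeas_integral[OF this] show ?thesis by (simp add: p_fun_def case_prod_unfold)
qed

lemma bmeas_p_comp [intro!]:
  "g \<in> measurable M unit_leb \<Longrightarrow> h \<in> measurable M unit_leb \<Longrightarrow> bmeas M (\<lambda>x. p_fun W (g x) (h x))"
  by (rule bmeas_comp2[OF bmeas_p])

lemma p_in: 
  assumes "x \<in> {0..1}" "y \<in> {0..1}" shows "p_fun W x y \<in> {0..1}"
proof -
  have b: "bmeas unit_leb (\<lambda>z. W y z * W z x)"
    using assms by (intro bmeas_mult bmeas_W_comp) auto
  have 1: "0 \<le> W y z * W z x" "W y z * W z x \<le> 1" if "z \<in> {0..1}" for z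
    using W_in[OF assms(2) that] W_in[OF that assms(1)] by (auto intro: mult_le_one)
  have "p_fun W x y \<le> (\<I> z. 1)" unfolding p_fun_def
    by (rule U.bmeas_integral_mono[OF b]) (auto simp: 1)
  moreover have "0 \<le> p_fun W x y" unfolding p_fun_def by (rule integral_nonneg_AE) (auto intro!: AE_I2 simp: 1)
  ultimately show ?thesis by simp
qed

lemma t_tri_eq1:
  assumes x: "x \<in> {0..1}" shows "t_tri W x = (\<I> y. W x y * p_fun W x y)"
proof -
  have b: "bmeas UU (\<lambda>(y, z). W x y * W y z * W z x)"
    using x unfolding case_prod_unfold by (intro bmeas_mult bmeas_W_comp) measurable
  have "(\<I> y. W x y * p_fun W x y) = (\<I> y. (\<I> z. W x y * W y z * W z x))"
    by (simp add: p_fun_def mult.assoc)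
  also have "\<dots> = (\<integral>(y, z). W x y * W y z * W z x \<partial>UU)"
    by (rule UU.integral_fst[OF UU.P.bmeas_integrable[OF b]])
  finally show ?thesis by (simp add: t_tri_def)
qed

lemma t_tri_eq2:
  assumes x: "x \<in> {0..1}" shows "t_tri W x = (\<I> y. W y x * p_fun W y x)"
proof -
  have b: "bmeas UU (\<lambda>(y, z). W x y * W y z * W z x)"
    using x unfolding case_prod_unfold by (intro bmeas_mult bmeas_W_comp) measurable
  have "(\<I> z. W z x * p_fun W z x) = (\<I> z. (\<I> y. W x y * W y z * W z x))"
    by (simp add: p_fun_def mult.commute)
  also have "\<dots> = (\<integral>(y, z). W x y * W y z * W z x \<partial>UU)"
    by (rule UU.integral_snd[OF UU.P.bmeas_integrable[OF b]])
  finally show ?thesis by (simp add: t_tri_def)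
qed

lemma bmeas_t: "bmeas unit_leb (t_tri W)"
proof -
  have "bmeas unit_leb (\<lambda>x. \<I> y. W x y * p_fun W x y)"
    by (rule U.bmeas_integral) (unfold case_prod_unfold, intro bmeas_mult bmeas_W_comp bmeas_p_comp, measurable)
  thus ?thesis by (subst bmeas_cong[OF t_tri_eq1]) auto
qed

lemma bmeas_t_comp [intro!]: "g \<in> measurable M unit_leb \<Longrightarrow> bmeas M (\<lambda>x. t_tri W (g x))"
  by (rule bmeas_comp[OF bmeas_t])

lemma t_C3_eq: "t_C3 W = (\<I> x. t_tri W x)"
proof -
  have b: "bmeas (unit_leb \<Otimes>\<^sub>M UU) (\<lambda>(x, q). (\<lambda>(y, z). W x y * W y z * W z x) q)"
    unfolding case_prod_unfold by (intro bmeas_mult bmeas_W_comp) measurable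
  show ?thesis unfolding t_C3_def t_tri_def
    using UUU.integral_fst'[OF UUU.P.bmeas_integrable[OF b]] by (simp add: case_prod_unfold)
qed

lemma t_in: 
  assumes "x \<in> {0..1}" shows "t_tri W x \<in> {0..1}"
proof -
  have b: "bmeas unit_leb (\<lambda>y. W x y * p_fun W x y)"
    using assms by (intro bmeas_mult bmeas_W_comp bmeas_p_comp) auto
  have 1: "0 \<le> W x y * p_fun W x y" "W x y * p_fun W x y \<le> 1" if "y \<in> {0..1}" for y
    using W_in[OF assms that] p_in[OF assms that] by (auto intro: mult_le_one)
  have "t_tri W x \<le> (\<I> z. 1)" unfolding t_tri_eq1[OF assms]
    by (rule U.bmeas_integral_mono[OF b]) (auto simp: 1)
  moreover have "0 \<le> t_tri W x" unfolding t_tri_eq1[OF assms] by (rule integral_nonneg_AE) (auto intro!: AE_I2 simp: 1)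
  ultimately show ?thesis by simp
qed

lemma t_C3_in: "t_C3 W \<in> {0..1}"
proof -
  have "t_C3 W \<le> (\<I> z. 1)" unfolding t_C3_eq
    by (rule U.bmeas_integral_mono[OF bmeas_t]) (use t_in in auto)
  moreover have "0 \<le> t_C3 W" unfolding t_C3_eq by (rule integral_nonneg_AE) (use t_in in \<open>auto intro!: AE_I2\<close>)
  ultimately show ?thesis by simp
qed

definition edge :: "nat \<Rightarrow> nat \<Rightarrow> nat \<times> nat" where
  "edge u v = (min u v, max u v)"

lemma adj_alt: "adj w u v = (if u < v then of_bool (ori w (u, v)) else if v < u then 1 - of_bool (ori w (v, u)) else 1/2)"
  unfolding adj_def adj_matrix_def by simp

lemma bmeas_adj [intro!]: "bmeas Om (\<lambda>w. adj w u v)"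
  unfolding adj_alt by (cases u v rule: linorder_cases) (auto intro!: bmeas_of_bool)

lemma adj_swap: "u \<noteq> v \<Longrightarrow> adj w v u = 1 - adj w u v"
  unfolding adj_alt by auto

lemma adj_in: "adj w u v \<in> {0..1}"
  unfolding adj_alt by auto

lemma depends_ori: "(u, v) \<in> A \<Longrightarrow> (u, 0) \<in> A \<Longrightarrow> (v, 0) \<in> A \<Longrightarrow> depends_on A (\<lambda>w. ori w (u, v))"
  unfolding depends_on_def ori_def by auto

lemma depends_adj: "edge u v \<in> A \<Longrightarrow> (u, 0) \<in> A \<Longrightarrow> (v, 0) \<in> A \<Longrightarrow> depends_on A (\<lambda>w. adj w u v)"
  unfolding adj_alt edge_def
  by (cases u v rule: linorder_cases)
     (auto intro!: depends_on_comp[where h=of_bool] depends_on_arith(2) depends_ori)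

lemma depends_type:
  "(u, 0) \<in> A \<Longrightarrow> (v, 0) \<in> A \<Longrightarrow> depends_on A (\<lambda>w. W (w (u, 0)) (w (v, 0)))"
  "(u, 0) \<in> A \<Longrightarrow> (v, 0) \<in> A \<Longrightarrow> depends_on A (\<lambda>w. p_fun W (w (u, 0)) (w (v, 0)))"
  "(u, 0) \<in> A \<Longrightarrow> depends_on A (\<lambda>w. t_tri W (w (u, 0)))"
  unfolding depends_on_def by auto

text \<open>  Only the pair in increasing order is a coordinate; the reverse orientation follows from
  \<open>W y x = 1 - W x y\<close>.\<close>
lemma edge_mean:
  assumes G: "bmeas Om G" "depends_on (- {edge u x}) G" and ux: "u \<noteq> x" "u \<noteq> 0" "x \<noteq> 0"
  shows "(\<E> w. G w * adj w u x) = (\<E> w. G w * W (w (u, 0)) (w (x, 0)))"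
proof -
  have less: "(\<E> w. G w * of_bool (ori w (u, x))) = (\<E> w. G w * W (w (u, 0)) (w (x, 0)))"
    if "u < x" "x \<noteq> 0" "depends_on (- {(u, x)}) G" for u x
  proof -
    have "(\<E> w. G w * of_bool (ori w (u, x)))
        = (\<E> w. G w * (\<lambda>y w. of_bool (y \<le> W (w (u, 0)) (w (x, 0)))) (w (u, x)) w)"
      by (simp add: ori_def)
    also have "\<dots> = (\<E> w. G w * (\<I> y. of_bool (y \<le> W (w (u, 0)) (w (x, 0)))))"
      using that G(1) ori_measurable[of "(u, x)"]
      by (intro integrate_coordinate bmeas_of_bool) (auto simp: depends_on_def ori_def)
    also have "\<dots> = (\<E> w. G w * W (w (u, 0)) (w (x, 0)))"
      by (intro lint_cong refl) (simp add: integral_unit_threshold[OF W_in[OF coord_in coord_in]])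
    finally show ?thesis .
  qed
  show ?thesis
  proof (cases "u < x")
    case True
    thus ?thesis using less[of u x] assms by (simp add: adj_alt edge_def min_def max_def)
  next
    case False
    hence xu: "x < u" using ux by simp
    have sw: "W (w (u, 0)) (w (x, 0)) = 1 - W (w (x, 0)) (w (u, 0))" if "w \<in> space Om" for w
      by (rule W_swap[OF coord_in[OF that] coord_in[OF that]])
    have "(\<E> w. G w * adj w u x) = (\<E> w. G w - G w * of_bool (ori w (x, u)))"
      using xu by (intro lint_cong refl) (simp add: adj_alt algebra_simps)
    also have "\<dots> = (\<E> w. G w) - (\<E> w. G w * of_bool (ori w (x, u)))"
      using G by (intro lint_diff Om.bmeas_integrable bmeas_mult bmeas_of_bool) auto
    also have "(\<E> w. G w * of_bool (ori w (x, u))) = (\<E> w. G w * W (w (x, 0)) (w (u, 0)))"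
      using less[of x u] assms xu by (simp add: edge_def min_def max_def)
    also have "(\<E> w. G w) - \<dots> = (\<E> w. G w - G w * W (w (x, 0)) (w (u, 0)))"
      using G by (intro lint_diff[symmetric] Om.bmeas_integrable) auto
    also have "\<dots> = (\<E> w. G w * W (w (u, 0)) (w (x, 0)))"
      by (intro lint_cong refl)
         (simp add: sw algebra_simps)
    finally show ?thesis .
  qed
qed

text \<open>  The conditional mean of a triad is \<open>pair_proj\<close> given the tournament on two of its vertices and twice
  \<open>t_tri W\<close> given one type. Inclusion and exclusion of these projections yields \<open>h2\<close> and \<open>h3\<close>, which are centred
  in every vertex.\<close>
definition triad :: "outcome \<Rightarrow> nat \<Rightarrow> nat \<Rightarrow> nat \<Rightarrow> real" where
  "triad w u v x = adj w u v * adj w v x * adj w x u + adj w u x * adj w x v * adj w v u"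

definition pair_proj :: "outcome \<Rightarrow> nat \<Rightarrow> nat \<Rightarrow> real" where
  "pair_proj w u v = adj w u v * p_fun W (w (u, 0)) (w (v, 0)) + adj w v u * p_fun W (w (v, 0)) (w (u, 0))"

definition h2 :: "outcome \<Rightarrow> nat \<Rightarrow> nat \<Rightarrow> real" where
  "h2 w u v = pair_proj w u v - 2 * t_tri W (w (u, 0)) - 2 * t_tri W (w (v, 0)) + 2 * t_C3 W"

definition h3 :: "outcome \<Rightarrow> nat \<Rightarrow> nat \<Rightarrow> nat \<Rightarrow> real" where
  "h3 w u v x = triad w u v x - (pair_proj w u v + pair_proj w v x + pair_proj w u x)
     + 2 * (t_tri W (w (u, 0)) + t_tri W (w (v, 0)) + t_tri W (w (x, 0))) - 2 * t_C3 W"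

lemma pair_proj_sym: "pair_proj w u v = pair_proj w v u"
  by (simp add: pair_proj_def)

lemma h2_sym: "h2 w u v = h2 w v u"
  using pair_proj_sym[of w u v] by (simp add: h2_def)

lemma h3_rotate: "h3 w u v x = h3 w v x u" and h3_swap: "h3 w u v x = h3 w v u x"
  using pair_proj_sym[of w u v] pair_proj_sym[of w u x] pair_proj_sym[of w v x]
  by (simp_all add: h3_def triad_def algebra_simps)

lemma bmeas_pair_proj [intro!]: "bmeas Om (\<lambda>w. pair_proj w u v)"
  unfolding pair_proj_def by auto

lemma bmeas_triad [intro!]: "bmeas Om (\<lambda>w. triad w u v x)"
  unfolding triad_def by auto

lemma bmeas_h2 [intro!]: "bmeas Om (\<lambda>w. h2 w u v)"
  unfolding h2_def by auto

lemma bmeas_h3 [intro!]: "bmeas Om (\<lambda>w. h3 w u v x)"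
  unfolding h3_def by auto

lemma depends_pair_proj: "depends_on (coords {u, v}) (\<lambda>w. pair_proj w u v)"
  unfolding pair_proj_def
  by (intro depends_on_arith depends_adj depends_type) (auto simp: coords_def edge_def min_def max_def)

lemma depends_h2: "depends_on (coords {u, v}) (\<lambda>w. h2 w u v)"
  unfolding h2_def by (intro depends_on_arith depends_pair_proj depends_type depends_on_const) (auto simp: coords_def)

lemma depends_h3: "depends_on (coords {u, v, x}) (\<lambda>w. h3 w u v x)"
  unfolding h3_def triad_def
  by (intro depends_on_arith depends_on_mono[OF depends_pair_proj coords_mono] depends_type depends_on_const depends_adj)
     (auto simp: coords_def edge_def min_def max_def)

lemma mult_in_unit: "a \<in> {0..1} \<Longrightarrow> b \<in> {0..1} \<Longrightarrow> a * b \<in> {0..1::real}"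
  by (auto intro: mult_le_one)

lemma pair_proj_bound: "w \<in> space Om \<Longrightarrow> pair_proj w u v \<in> {0..2}"
proof -
  assume w: "w \<in> space Om"
  have "adj w u v * p_fun W (w (u, 0)) (w (v, 0)) \<in> {0..1}" "adj w v u * p_fun W (w (v, 0)) (w (u, 0)) \<in> {0..1}"
    by (intro mult_in_unit adj_in p_in coord_in w)+
  thus ?thesis unfolding pair_proj_def by auto
qed

lemma h2_bound: "w \<in> space Om \<Longrightarrow> \<bar>h2 w u v\<bar> \<le> 8"
  using pair_proj_bound[of w u v] t_in[OF coord_in, of w "(u, 0)"] t_in[OF coord_in, of w "(v, 0)"] t_C3_in
  unfolding h2_def by auto

lemma h3_bound: "w \<in> space Om \<Longrightarrow> \<bar>h3 w u v x\<bar> \<le> 20"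
proof -
  assume w: "w \<in> space Om"
  have "adj w u v * adj w v x * adj w x u \<in> {0..1}" "adj w u x * adj w x v * adj w v u \<in> {0..1}"
    by (intro mult_in_unit adj_in)+
  thus ?thesis using pair_proj_bound[OF w, of u v] pair_proj_bound[OF w, of v x] pair_proj_bound[OF w, of u x]
    t_in[OF coord_in[OF w], of "(u, 0)"] t_in[OF coord_in[OF w], of "(v, 0)"] t_in[OF coord_in[OF w], of "(x, 0)"] t_C3_in
    unfolding h3_def triad_def by auto
qed

text \<open>
  Integrating out everything attached to a vertex \<open>x\<close> (its type and its edges) reduces a triad
  to the pair projection and a pair projection to twice the local density.
\<close>

context
  fixes f :: "outcome \<Rightarrow> real" and x :: nat
  assumes f: "bmeas Om f" "depends_on (- touch x) f" and x0: "x \<noteq> 0"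
begin

lemma f_dep: "- touch x \<subseteq> A \<Longrightarrow> depends_on A f"
  by (rule depends_on_mono[OF f(2)])

lemma vertex_mean:
  assumes "bmeas (Om \<Otimes>\<^sub>M unit_leb) (\<lambda>(w, y). g y w)" "\<And>y. depends_on (- {(x, 0)}) (g y)"
    "bmeas Om G" "depends_on (- {(x, 0)}) G"
  shows "(\<E> w. G w * g (w (x, 0)) w) = (\<E> w. G w * (\<I> y. g y w))"
  by (rule integrate_coordinate[OF assms(3) _ assms(4,2)])
     (rule bmeas_comp2[where f="\<lambda>w y. g y w", OF assms(1)], simp_all)

lemma mean_path:
  assumes "u \<noteq> v" "u \<noteq> x" "v \<noteq> x" "u \<noteq> 0" "v \<noteq> 0"
  shows "(\<E> w. f w * (adj w u v * adj w v x * adj w x u))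
       = (\<E> w. f w * (adj w u v * p_fun W (w (u, 0)) (w (v, 0))))"
proof -
  have "(\<E> w. f w * (adj w u v * adj w v x * adj w x u))
      = (\<E> w. (f w * adj w u v * adj w v x) * adj w x u)" by (simp add: mult_ac)
  also have "\<dots> = (\<E> w. (f w * adj w u v * adj w v x) * W (w (x, 0)) (w (u, 0)))"
    using assms x0 f
    by (intro edge_mean depends_on_arith(3) f_dep depends_adj)
       (auto simp: touch_def edge_def min_def max_def)
  also have "\<dots> = (\<E> w. (f w * adj w u v * W (w (x, 0)) (w (u, 0))) * adj w v x)" by (simp add: mult_ac)
  also have "\<dots> = (\<E> w. (f w * adj w u v * W (w (x, 0)) (w (u, 0))) * W (w (v, 0)) (w (x, 0)))"
    using assms x0 f
    by (intro edge_mean depends_on_arith(3) f_dep depends_adj depends_type)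
       (auto simp: touch_def edge_def min_def max_def)
  also have "\<dots> = (\<E> w. (f w * adj w u v) * (\<lambda>y w. W (w (v, 0)) y * W y (w (u, 0))) (w (x, 0)) w)"
    by (simp add: mult_ac)
  also have "\<dots> = (\<E> w. (f w * adj w u v) * (\<I> y. W (w (v, 0)) y * W y (w (u, 0))))"
  proof (rule vertex_mean)
    show "bmeas (Om \<Otimes>\<^sub>M unit_leb) (\<lambda>(w, y). W (w (v, 0)) y * W y (w (u, 0)))"
      unfolding case_prod_unfold by (intro bmeas_mult bmeas_W_comp) measurable
    show "depends_on (- {(x, 0)}) (\<lambda>w. f w * adj w u v)"
      using assms by (intro depends_on_arith(3) f_dep depends_adj) (auto simp: touch_def edge_def min_def max_def)
  qed (use f assms in \<open>auto simp: depends_on_def\<close>)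
  finally show ?thesis by (simp add: p_fun_def mult_ac)
qed

lemma mean_triad:
  assumes "u \<noteq> v" "u \<noteq> x" "v \<noteq> x" "u \<noteq> 0" "v \<noteq> 0"
  shows "(\<E> w. f w * triad w u v x) = (\<E> w. f w * pair_proj w u v)"
proof -
  have "(\<E> w. f w * triad w u v x)
      = (\<E> w. f w * (adj w u v * adj w v x * adj w x u) + f w * (adj w v u * adj w u x * adj w x v))"
    by (simp add: triad_def algebra_simps)
  also have "\<dots> = (\<E> w. f w * (adj w u v * adj w v x * adj w x u)) + (\<E> w. f w * (adj w v u * adj w u x * adj w x v))"
    using f by (intro lint_add Om.bmeas_integrable) auto
  also have "\<dots> = (\<E> w. f w * (adj w u v * p_fun W (w (u, 0)) (w (v, 0))))
      + (\<E> w. f w * (adj w v u * p_fun W (w (v, 0)) (w (u, 0))))"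
    using assms by (simp add: mean_path)
  also have "\<dots> = (\<E> w. f w * (adj w u v * p_fun W (w (u, 0)) (w (v, 0)))
      + f w * (adj w v u * p_fun W (w (v, 0)) (w (u, 0))))"
    using f by (intro lint_add[symmetric] Om.bmeas_integrable) auto
  finally show ?thesis by (simp add: pair_proj_def algebra_simps)
qed

lemma mean_half_pair:
  assumes "u \<noteq> x" "u \<noteq> 0"
  shows "(\<E> w. f w * (adj w u x * p_fun W (w (u, 0)) (w (x, 0)))) = (\<E> w. f w * t_tri W (w (u, 0)))"
    and "(\<E> w. f w * (adj w x u * p_fun W (w (x, 0)) (w (u, 0)))) = (\<E> w. f w * t_tri W (w (u, 0)))"
proof -
  have fd: "depends_on (- {(x, 0)}) f" by (rule f_dep) (auto simp: touch_def)
  have "(\<E> w. f w * (adj w u x * p_fun W (w (u, 0)) (w (x, 0))))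
      = (\<E> w. (f w * p_fun W (w (u, 0)) (w (x, 0))) * adj w u x)" by (simp add: mult_ac)
  also have "\<dots> = (\<E> w. (f w * p_fun W (w (u, 0)) (w (x, 0))) * W (w (u, 0)) (w (x, 0)))"
    using assms x0 f by (intro edge_mean depends_on_arith(3) f_dep depends_type)
       (auto simp: touch_def edge_def min_def max_def)
  also have "\<dots> = (\<E> w. f w * (\<lambda>y w. W (w (u, 0)) y * p_fun W (w (u, 0)) y) (w (x, 0)) w)" by (simp add: mult_ac)
  also have "\<dots> = (\<E> w. f w * (\<I> y. W (w (u, 0)) y * p_fun W (w (u, 0)) y))"
  proof (rule vertex_mean)
    show "bmeas (Om \<Otimes>\<^sub>M unit_leb) (\<lambda>(w, y). W (w (u, 0)) y * p_fun W (w (u, 0)) y)"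
      unfolding case_prod_unfold by (intro bmeas_mult bmeas_W_comp bmeas_p_comp) measurable
  qed (use f fd assms in \<open>auto simp: depends_on_def\<close>)
  also have "\<dots> = (\<E> w. f w * t_tri W (w (u, 0)))"
    by (intro lint_cong refl) (simp add: t_tri_eq1[OF coord_in])
  finally show "(\<E> w. f w * (adj w u x * p_fun W (w (u, 0)) (w (x, 0)))) = \<dots>" .
  have "(\<E> w. f w * (adj w x u * p_fun W (w (x, 0)) (w (u, 0))))
      = (\<E> w. (f w * p_fun W (w (x, 0)) (w (u, 0))) * adj w x u)" by (simp add: mult_ac)
  also have "\<dots> = (\<E> w. (f w * p_fun W (w (x, 0)) (w (u, 0))) * W (w (x, 0)) (w (u, 0)))"
    using assms x0 f by (intro edge_mean depends_on_arith(3) f_dep depends_type)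
       (auto simp: touch_def edge_def min_def max_def)
  also have "\<dots> = (\<E> w. f w * (\<lambda>y w. W y (w (u, 0)) * p_fun W y (w (u, 0))) (w (x, 0)) w)" by (simp add: mult_ac)
  also have "\<dots> = (\<E> w. f w * (\<I> y. W y (w (u, 0)) * p_fun W y (w (u, 0))))"
  proof (rule vertex_mean)
    show "bmeas (Om \<Otimes>\<^sub>M unit_leb) (\<lambda>(w, y). W y (w (u, 0)) * p_fun W y (w (u, 0)))"
      unfolding case_prod_unfold by (intro bmeas_mult bmeas_W_comp bmeas_p_comp) measurable
  qed (use f fd assms in \<open>auto simp: depends_on_def\<close>)
  also have "\<dots> = (\<E> w. f w * t_tri W (w (u, 0)))"
    by (intro lint_cong refl) (simp add: t_tri_eq2[OF coord_in])
  finally show "(\<E> w. f w * (adj w x u * p_fun W (w (x, 0)) (w (u, 0)))) = \<dots>" .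
qed

lemma mean_pair:
  assumes "u \<noteq> x" "u \<noteq> 0"
  shows "(\<E> w. f w * pair_proj w u x) = 2 * (\<E> w. f w * t_tri W (w (u, 0)))"
proof -
  have "(\<E> w. f w * pair_proj w u x) = (\<E> w. f w * (adj w u x * p_fun W (w (u, 0)) (w (x, 0)))
      + f w * (adj w x u * p_fun W (w (x, 0)) (w (u, 0))))" by (simp add: pair_proj_def algebra_simps)
  also have "\<dots> = (\<E> w. f w * (adj w u x * p_fun W (w (u, 0)) (w (x, 0))))
      + (\<E> w. f w * (adj w x u * p_fun W (w (x, 0)) (w (u, 0))))"
    using f by (intro lint_add Om.bmeas_integrable) auto
  finally show ?thesis using mean_half_pair[OF assms] by simp
qed

lemma mean_vertex: "(\<E> w. f w * t_tri W (w (x, 0))) = t_C3 W * (\<E> w. f w)"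
proof -
  have "(\<E> w. f w * (\<lambda>y w. t_tri W y) (w (x, 0)) w) = (\<E> w. f w * (\<I> y. t_tri W y))"
  proof (rule vertex_mean)
    show "depends_on (- {(x, 0)}) f" by (rule f_dep) (auto simp: touch_def)
    show "bmeas (Om \<Otimes>\<^sub>M unit_leb) (\<lambda>(w, y). t_tri W y)"
      unfolding case_prod_unfold by (intro bmeas_t_comp) measurable
  qed (use f in auto)
  thus ?thesis by (simp add: t_C3_eq mult.commute)
qed

lemma h2_degenerate:
  assumes "u \<noteq> x" "u \<noteq> 0"
  shows "(\<E> w. f w * h2 w u x) = 0"
proof -
  have i: "integrable Om (\<lambda>w. f w * pair_proj w u x)" "integrable Om (\<lambda>w. f w * t_tri W (w (u, 0)))"
    "integrable Om (\<lambda>w. f w * t_tri W (w (x, 0)))" "integrable Om f"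
    using f by (auto intro!: Om.bmeas_integrable)
  have "(\<E> w. f w * h2 w u x) = (\<E> w. f w * pair_proj w u x - 2 * (f w * t_tri W (w (u, 0)))
      - 2 * (f w * t_tri W (w (x, 0))) + 2 * t_C3 W * f w)"
    by (simp add: h2_def algebra_simps)
  also have "\<dots> = (\<E> w. f w * pair_proj w u x) - 2 * (\<E> w. f w * t_tri W (w (u, 0)))
      - 2 * (\<E> w. f w * t_tri W (w (x, 0))) + 2 * t_C3 W * (\<E> w. f w)"
    using i by simp
  finally show ?thesis using mean_pair[OF assms] mean_vertex by simp
qed

lemma h3_degenerate:
  assumes "u \<noteq> v" "u \<noteq> x" "v \<noteq> x" "u \<noteq> 0" "v \<noteq> 0"
  shows "(\<E> w. f w * h3 w u v x) = 0"
proof -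
  have i: "integrable Om (\<lambda>w. f w * pair_proj w u' v')" "integrable Om (\<lambda>w. f w * t_tri W (w (u', 0)))"
    "integrable Om (\<lambda>w. f w * triad w u v x)" "integrable Om f" for u' v'
    using f by (auto intro!: Om.bmeas_integrable)
  have "(\<E> w. f w * h3 w u v x) = (\<E> w. f w * triad w u v x - (f w * pair_proj w u v + f w * pair_proj w v x + f w * pair_proj w u x)
      + 2 * (f w * t_tri W (w (u, 0)) + f w * t_tri W (w (v, 0)) + f w * t_tri W (w (x, 0))) - 2 * t_C3 W * f w)"
    by (simp add: h3_def algebra_simps)
  also have "\<dots> = (\<E> w. f w * triad w u v x) - ((\<E> w. f w * pair_proj w u v)
      + (\<E> w. f w * pair_proj w v x) + (\<E> w. f w * pair_proj w u x))
      + 2 * ((\<E> w. f w * t_tri W (w (u, 0))) + (\<E> w. f w * t_tri W (w (v, 0))) + (\<E> w. f w * t_tri W (w (x, 0))))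
      - 2 * t_C3 W * (\<E> w. f w)"
    using i by simp
  finally show ?thesis
    using mean_triad[OF assms] mean_pair[of u] mean_pair[of v] mean_vertex assms by simp
qed

end

text \<open>One of two distinct pairs has a vertex outside the other, and degeneracy in this vertex makes their terms
  orthogonal. The same holds for triples.\<close>

lemma pair_orthogonal:
  fixes Y :: "outcome \<Rightarrow> nat \<Rightarrow> nat \<Rightarrow> real"
  assumes b: "\<And>u v. bmeas Om (\<lambda>w. Y w u v)" and sym: "\<And>w u v. Y w u v = Y w v u"
    and dep: "\<And>u v. depends_on (coords {u, v}) (\<lambda>w. Y w u v)"
    and deg: "\<And>f u x. bmeas Om f \<Longrightarrow> depends_on (- touch x) f \<Longrightarrow> u \<noteq> x \<Longrightarrow> u \<noteq> 0 \<Longrightarrow> x \<noteq> 0 \<Longrightarrow>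
               (\<E> w. f w * Y w u x) = 0"
    and ij: "i \<in> pairs n" "j \<in> pairs n" "i \<noteq> j"
  shows "(\<E> w. Y w (fst i) (snd i) * Y w (fst j) (snd j)) = 0"
proof -
  obtain u v u' v' where uv: "i = (u, v)" "j = (u', v')" by (cases i, cases j)
  have nz: "u \<noteq> 0" "v \<noteq> 0" "u < v" "u' \<noteq> 0" "v' \<noteq> 0" "u' < v'" using ij uv by (auto simp: pairs_def)
  have dp: "depends_on (- touch x) (\<lambda>w. Y w u v)" if "x \<notin> {u, v}" "x \<noteq> 0" for x
    by (rule depends_on_mono[OF dep coords_touch[OF that]])
  have "v' \<notin> {u, v} \<or> u' \<notin> {u, v}" using ij(3) uv nz by auto
  thus ?thesis
  proof
    assume "v' \<notin> {u, v}"
    thus ?thesis using deg[OF b dp, of v' u'] nz uv by simp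
  next
    assume "u' \<notin> {u, v}"
    thus ?thesis using deg[OF b dp, of u' v'] nz uv sym[of _ v' u'] by simp
  qed
qed

lemma h3_orthogonal:
  assumes ij: "i \<in> triples n" "j \<in> triples n" "i \<noteq> j"
  shows "(\<E> w. (\<lambda>(u, v, x). h3 w u v x) i * (\<lambda>(u, v, x). h3 w u v x) j) = 0"
proof -
  obtain u v x u' v' x' where uv: "i = (u, v, x)" "j = (u', v', x')" by (cases i, cases j)
  have nz: "u \<noteq> 0" "v \<noteq> 0" "x \<noteq> 0" "u < v" "v < x" "u' \<noteq> 0" "v' \<noteq> 0" "x' \<noteq> 0" "u' < v'" "v' < x'"
    using ij uv by (auto simp: triples_def)
  have dp: "depends_on (- touch y) (\<lambda>w. h3 w u v x)" if "y \<notin> {u, v, x}" "y \<noteq> 0" for y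
    by (rule depends_on_mono[OF depends_h3 coords_touch[OF that]])
  have "v' \<notin> {u, v, x} \<or> u' \<notin> {u, v, x} \<or> x' \<notin> {u, v, x}" using ij(3) uv nz by auto
  then consider "v' \<notin> {u, v, x}" | "u' \<notin> {u, v, x}" | "x' \<notin> {u, v, x}" by blast
  thus ?thesis
  proof cases
    case 1
    have "(\<E> w. h3 w u v x * h3 w x' u' v') = 0" by (rule h3_degenerate[OF bmeas_h3 dp]) (use 1 nz in auto)
    thus ?thesis using uv h3_rotate[of _ x' u' v'] by simp
  next
    case 2
    have "(\<E> w. h3 w u v x * h3 w v' x' u') = 0" by (rule h3_degenerate[OF bmeas_h3 dp]) (use 2 nz in auto)
    thus ?thesis using uv h3_rotate[of _ u' v' x'] by simp
  next
    case 3
    have "(\<E> w. h3 w u v x * h3 w u' v' x') = 0" by (rule h3_degenerate[OF bmeas_h3 dp]) (use 3 nz in auto)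
    thus ?thesis using uv by simp
  qed
qed

lemma h2_sum_bound: "(\<E> w. (\<Sum>(u, v)\<in>pairs n. h2 w u v)^2) \<le> 64 * real n ^ 2"
proof -
  have "(\<E> w. (\<Sum>i\<in>pairs n. (\<lambda>i w. h2 w (fst i) (snd i)) i w)^2) \<le> 8^2 * real (card (pairs n))"
    by (rule Om.orthogonal_sum_bound(2)[OF finite_pairs])
       (auto simp: h2_bound intro!: pair_orthogonal[OF bmeas_h2 h2_sym depends_h2 h2_degenerate])
  also have "\<dots> \<le> 64 * real n ^ 2" using card_pairs_le[of n] by (simp add: of_nat_le_iff[symmetric] del: of_nat_le_iff)
  finally show ?thesis by (simp add: case_prod_unfold)
qed

lemma h3_sum_bound: "(\<E> w. (\<Sum>(u, v, x)\<in>triples n. h3 w u v x)^2) \<le> 400 * real n ^ 3"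
proof -
  have "(\<E> w. (\<Sum>i\<in>triples n. (\<lambda>i w. (\<lambda>(u, v, x). h3 w u v x) i) i w)^2) \<le> 20^2 * real (card (triples n))"
  proof (rule Om.orthogonal_sum_bound(2)[OF finite_triples])
    fix i j assume "i \<in> triples n" "j \<in> triples n" "i \<noteq> j"
    thus "(\<E> w. (\<lambda>(u, v, x). h3 w u v x) i * (\<lambda>(u, v, x). h3 w u v x) j) = 0" by (rule h3_orthogonal)
  qed (auto simp: case_prod_unfold h3_bound)
  also have "\<dots> \<le> 400 * real n ^ 3" using card_triples_le[of n] by (simp add: of_nat_le_iff[symmetric] del: of_nat_le_iff)
  finally show ?thesis by simp
qed

abbreviation centred_count :: "nat \<Rightarrow> outcome \<Rightarrow> real" where
  "centred_count n w \<equiv> num_triads n (adj w) - 2 * real (n choose 3) * t_C3 W"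

text \<open>  A pair lies in \<open>n - 2\<close> triples and a vertex in \<open>(n - 1) (n - 2) / 2\<close>, and with these weights the projections
  subtracted in \<open>h3\<close> and \<open>h2\<close> cancel.\<close>
lemma hoeffding_decomposition:
  "centred_count n w
     = (\<Sum>(u, v, x)\<in>triples n. h3 w u v x) + (real n - 2) * (\<Sum>(u, v)\<in>pairs n. h2 w u v)
       + (real n - 1) * (real n - 2) * (\<Sum>u\<in>{1..n}. t_tri W (w (u, 0)) - t_C3 W)"
proof -
  define t where "t u = t_tri W (w (u, 0))" for u
  define T where "T = (\<Sum>u\<in>{1..n}. t u)"
  define Q where "Q = (\<Sum>(u, v)\<in>pairs n. pair_proj w u v)"
  define N where "N = num_triads n (adj w)"
  define \<theta> where "\<theta> = t_C3 W"
  have c3: "real (n choose 3) = real n * (real n - 1) * (real n - 2) / 6"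
    unfolding card_triples_binomial card_triples ..
  have "(\<Sum>(u, v, x)\<in>triples n. h3 w u v x) = (\<Sum>(u, v, x)\<in>triples n. triad w u v x)
      - (\<Sum>(u, v, x)\<in>triples n. pair_proj w u v + pair_proj w v x + pair_proj w u x)
      + 2 * (\<Sum>(u, v, x)\<in>triples n. t u + t v + t x) - 2 * \<theta> * card (triples n)"
    by (simp add: h3_def t_def \<theta>_def case_prod_unfold sum.distrib sum_subtractf sum_distrib_left)
  also have "(\<Sum>(u, v, x)\<in>triples n. triad w u v x) = N"
    unfolding N_def num_triads_triples triad_def ..
  finally have h3: "(\<Sum>(u, v, x)\<in>triples n. h3 w u v x)
      = N - (real n - 2) * Q + (real n - 1) * (real n - 2) * T - \<theta> * (real n * (real n - 1) * (real n - 2) / 3)"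
    unfolding sum_triples_pair sum_triples_vertex card_triples Q_def T_def by (simp add: field_simps)
  have "(\<Sum>(u, v)\<in>pairs n. h2 w u v) = (\<Sum>(u, v)\<in>pairs n. pair_proj w u v)
      - 2 * (\<Sum>(u, v)\<in>pairs n. t u + t v) + 2 * \<theta> * card (pairs n)"
    by (simp add: h2_def t_def \<theta>_def case_prod_unfold sum.distrib sum_subtractf sum_distrib_left algebra_simps)
  hence h2: "(\<Sum>(u, v)\<in>pairs n. h2 w u v) = Q - 2 * (real n - 1) * T + \<theta> * (real n * (real n - 1))"
    unfolding sum_pairs_vertex card_pairs Q_def T_def by (simp add: field_simps)
  have h1: "(\<Sum>u\<in>{1..n}. t u - \<theta>) = T - n * \<theta>" by (simp add: T_def sum_subtractf)
  show ?thesis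
    unfolding h3 h2 N_def[symmetric] \<theta>_def[symmetric] t_def[symmetric] h1 c3
    by (simp add: field_simps)
qed

lemma num_triads_restrict: "num_triads n (adj_matrix (\<lambda>e. e \<in> edges n \<and> ori w e)) = num_triads n (adj w)"
  unfolding num_triads_triples
  by (intro sum.cong refl) (auto simp: triples_def adj_def adj_matrix_def)

lemma bmeas_num_triads: "bmeas Om (\<lambda>w. num_triads n (adj w))"
  unfolding num_triads_triples case_prod_unfold by auto

text \<open>The triads only see the edges inside \<open>{1..n}\<close>, so the restriction in \<open>random_tournament_eq\<close> disappears.\<close>
lemma distr_num_triads:
  "distr (random_tournament n W) borel (\<lambda>a. (num_triads n a - c) / d)
     = distr Om borel (\<lambda>w. (num_triads n (adj w) - c) / d)"
proof -
  let ?X = "\<lambda>w. adj_matrix (\<lambda>e. e \<in> edges n \<and> ori w e)"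
  have "distr (random_tournament n W) borel (\<lambda>a. (num_triads n a - c) / d)
      = distr Om borel ((\<lambda>a. (num_triads n a - c) / d) \<circ> ?X)"
    unfolding random_tournament_eq by (rule distr_distr[OF _ random_matrix_measurable]) simp
  thus ?thesis unfolding comp_def num_triads_restrict .
qed

end


section \<open>The Gaussian regime\<close>

lemma distr_coord: "distr Om unit_leb (\<lambda>w. w i) = unit_leb"
  unfolding Om_def by (rule distr_PiM_component) (auto intro: prob_space_unit)

lemma expectation_coord:
  fixes f :: "real \<Rightarrow> 'b::{real_normed_field,banach,second_countable_topology}"
  assumes "bmeas unit_leb f" shows "(\<E> w. f (w i)) = (\<I> x. f x)"
  using integral_distr[OF coord_measurable bmeas_measurable[OF assms], of i] by (simp add: distr_coord)

text \<open>  For positive variance this is the classical central limit theorem; if the variance is 0, the sum vanishes in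
  mean square.\<close>
lemma clt_coords:
  assumes g: "bmeas unit_leb (g :: real \<Rightarrow> real)" and mean: "(\<I> x. g x) = 0"
    and c: "inj (c :: nat \<Rightarrow> nat \<times> nat)"
  shows "(\<lambda>n. \<E> w. iexp (t * ((\<Sum>i<n. g (w (c i))) / sqrt n)))
     \<longlonglongrightarrow> exp (- (t^2 * (\<I> x. (g x)^2)) / 2)"
proof -
  define v where "v = (\<I> x. (g x)^2)"
  have v0: "v \<ge> 0" by (simp add: v_def)
  have bg: "bmeas Om (\<lambda>w. g (w (c i)))" for i by (rule bmeas_comp[OF g]) simp
  have orth: "(\<E> w. g (w (c i)) * g (w (c j))) = 0" if "i \<noteq> j" for i j
  proof -
    have "(\<E> w. g (w (c i)) * g (w (c j))) = (\<E> w. g (w (c i))) * (\<E> w. g (w (c j)))"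
      by (rule expectation_disjoint_mult[where A="{c i}" and B="{c j}"])
         (use that c bg in \<open>auto simp: depends_on_def inj_def\<close>)
    thus ?thesis using mean expectation_coord[OF g] by simp
  qed
  show ?thesis
  proof (cases "v = 0")
    case True
    have m: "(\<lambda>w. (\<Sum>i<n. g (w (c i))) / sqrt n) \<in> borel_measurable Om" for n
      by (rule bmeas_measurable) (use bg in auto)
    have z: "(\<E> w. ((\<Sum>i<n. g (w (c i))) / sqrt n - 0)^2) = 0" for n
    proof -
      obtain C where C: "\<And>x. x \<in> space unit_leb \<Longrightarrow> norm (g x) \<le> C" using bmeas_bound[OF g] by blast
      have "(\<E> w. (\<Sum>i<n. g (w (c i)))^2) = (\<Sum>i<n. \<E> w. (g (w (c i)))^2)"
        by (rule Om.orthogonal_sum_bound(1)[where C=C]) (use bg orth C coord_in in auto)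
      also have "\<dots> = 0" using expectation_coord[OF bmeas_power[OF g, of 2]] True by (simp add: v_def)
      finally show ?thesis by (simp add: power_divide)
    qed
    have "(\<lambda>n. \<E> w. iexp (t * ((\<Sum>i<n. g (w (c i))) / sqrt n))) \<longlonglongrightarrow> 1"
    proof (rule Om.char_limit_perturb[where Y="\<lambda>_ _. 0"])
      show "integrable Om (\<lambda>x. ((\<Sum>i<n. g (x (c i))) / sqrt (real n) - 0)^2)" for n
        by (rule Om.bmeas_integrable) (use bg in auto)
    qed (use m z in \<open>simp_all add: Om.prob_space\<close>)
    thus ?thesis using True by (simp add: v_def)
  next
    case False
    hence vp: "v > 0" using v0 by simp
    have iv: "Om.indep_vars (\<lambda>_. unit_leb) (\<lambda>i w. w i) UNIV"
      unfolding Om_def by (rule indep_vars_PiM_coords) (auto intro: prob_space_unit)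
    have iv2: "Om.indep_vars (\<lambda>i. PiM {c i} (\<lambda>_. unit_leb)) (\<lambda>i w. restrict w {c i}) UNIV"
      by (rule Om.indep_vars_restrict[OF iv]) (use c in \<open>auto simp: disjoint_family_on_def inj_def\<close>)
    have ind: "Om.indep_vars (\<lambda>_. borel) (\<lambda>i w. g (w (c i))) UNIV"
    proof -
      have "(\<lambda>x. g (x (c i))) \<in> borel_measurable (PiM {c i} (\<lambda>_. unit_leb))" for i
        by (rule measurable_compose[where f="\<lambda>x. x (c i)" and N=unit_leb]) (simp, rule bmeas_measurable[OF g])
      from Om.indep_vars_compose2[OF iv2 this] show ?thesis by simp
    qed
    have e: "(\<E> w. g (w (c i))) = 0" for i using expectation_coord[OF g] mean by simp
    have "weak_conv_m (\<lambda>n. distr Om borel (\<lambda>w. (\<Sum>i<n. g (w (c i))) / sqrt (real n * (sqrt v)^2))) NN"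
    proof (rule Om.central_limit_theorem_zero_mean[OF ind e])
      show "sqrt v > 0" using vp by simp
      show "integrable Om (\<lambda>w. (g (w (c i)))^2)" for i by (rule Om.bmeas_integrable) (use bg in auto)
      show "(\<E> w. (g (w (c i)) - (\<E> w. g (w (c i))))^2) = (sqrt v)^2" for i
        using e expectation_coord[OF bmeas_power[OF g, of 2]] v0 by (simp add: v_def)
      show "distr Om borel (\<lambda>w. g (w (c i))) = distr unit_leb borel g" for i
        using distr_distr[of g unit_leb borel "\<lambda>w. w (c i)" Om] distr_coord[of "c i"] g
        by (simp add: comp_def bmeas_measurable)
    qed
    moreover have "distr NN borel (\<lambda>x. x) = NN"
      by (rule distr_id2) simp
    ultimately have wc: "weak_conv_m (\<lambda>n. distr Om borel (\<lambda>w. (\<Sum>i<n. g (w (c i))) / sqrt (real n * v)))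
      (distr NN borel (\<lambda>x. x))" using v0 by simp
    have "(\<lambda>n. \<E> w. iexp (sqrt v * t * ((\<Sum>i<n. g (w (c i))) / sqrt (real n * v))))
       \<longlonglongrightarrow> (\<integral>x. iexp (sqrt v * t * x) \<partial>NN)"
    proof (rule char_tendsto_of_weak_conv[where X="\<lambda>n w. (\<Sum>i<n. g (w (c i))) / sqrt (real n * v)" and Y="\<lambda>x. x"])
      show "(\<lambda>w. (\<Sum>i<n. g (w (c i))) / sqrt (real n * v)) \<in> borel_measurable Om" for n
        by (intro bmeas_measurable bmeas_divide bmeas_sum bg)
    qed (use wc Om.prob_space_axioms prob_space_std_normal in simp_all)
    hence lim: "(\<lambda>n. \<E> w. iexp (sqrt v * t * ((\<Sum>i<n. g (w (c i))) / sqrt (real n * v))))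
       \<longlonglongrightarrow> exp (- ((sqrt v * t)^2) / 2)" unfolding iexp_std_normal .
    have sc: "sqrt v * t * (s / sqrt (real n * v)) = t * (s / sqrt n)" for s n
      using vp by (simp add: real_sqrt_mult)
    have "(sqrt v * t)^2 = t^2 * v" using v0 by (simp add: power_mult_distrib)
    with lim show ?thesis unfolding sc v_def[symmetric] by simp
  qed
qed

context tourn
begin

lemma sigma_sq_eq: "sigma_sq W = (\<I> x. (t_tri W x - t_C3 W)^2)"
proof -
  have "(\<I> x. (t_tri W x - t_C3 W)^2)
      = (\<I> x. (t_tri W x)^2 - 2 * t_C3 W * t_tri W x + (t_C3 W)^2)"
    by (simp add: power2_diff algebra_simps)
  also have "\<dots> = (\<I> x. (t_tri W x)^2) - 2 * t_C3 W * t_C3 W + (t_C3 W)^2"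
    using U.bmeas_integrable[OF bmeas_t] U.bmeas_integrable[OF bmeas_power[OF bmeas_t, of 2]]
    by (simp add: t_C3_eq[symmetric])
  finally show ?thesis by (simp add: sigma_sq_def t_C3_eq power2_eq_square)
qed

lemma tri_regular_iff: "tri_regular W \<longleftrightarrow> (AE x in unit_leb. t_tri W x = t_C3 W)"
proof
  assume "tri_regular W"
  then obtain c where c: "AE x in unit_leb. t_tri W x = c" by (auto simp: tri_regular_def)
  hence "t_C3 W = (\<I> x. c)"
    unfolding t_C3_eq by (intro integral_cong_AE) (auto intro: bmeas_measurable bmeas_t)
  thus "AE x in unit_leb. t_tri W x = t_C3 W" using c by simp
qed (auto simp: tri_regular_def)

lemma sigma_sq_pos_iff: "sigma_sq W > 0 \<longleftrightarrow> \<not> tri_regular W"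
proof -
  have "sigma_sq W = 0 \<longleftrightarrow> (AE x in unit_leb. (t_tri W x - t_C3 W)^2 = 0)"
    unfolding sigma_sq_eq by (intro integral_nonneg_eq_0_iff_AE U.bmeas_integrable bmeas_power bmeas_diff bmeas_t) auto
  moreover have "sigma_sq W \<ge> 0" unfolding sigma_sq_eq by simp
  ultimately show ?thesis unfolding tri_regular_iff by auto
qed

lemma nondegenerate_normal_law:
  assumes "v \<ge> 0" shows "nondegenerate (normal_law 0 v) \<longleftrightarrow> v > 0"
proof
  assume nd: "nondegenerate (normal_law 0 v)"
  show "v > 0"
  proof (rule ccontr)
    assume "\<not> v > 0"
    hence "v = 0" using assms by simp
    hence "normal_law 0 v = return borel 0"
      unfolding normal_law_def using prob_space.not_empty[OF prob_space_std_normal]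
      by (simp add: prob_space.distr_const[OF prob_space_std_normal])
    thus False using nd by (auto simp: nondegenerate_def)
  qed
next
  assume v: "v > 0"
  show "nondegenerate (normal_law 0 v)"
    unfolding nondegenerate_def
  proof
    assume "\<exists>c. normal_law 0 v = return borel c"
    then obtain c where c: "normal_law 0 v = return borel c" ..
    have "char (normal_law 0 v) 1 = exp (- v / 2)"
      unfolding normal_law_def using iexp_std_normal[of "sqrt v"] v
      by (subst prob_space.char_distr_eq[OF prob_space_std_normal]) simp_all
    moreover have "char (return borel c) 1 = iexp c"
      unfolding char_def by (subst integral_return) auto
    ultimately have "cmod (exp (- v / 2)) = cmod (iexp c)" using c by (metis of_real_exp of_real_divide of_real_minus of_real_numeral)
    hence "exp (- v / 2) = (1::real)" by (simp add: norm_exp_eq_Re)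
    thus False using v by simp
  qed
qed

text \<open>After division by \<open>n^(5/2)\<close> the two degenerate parts have mean square of order \<open>1/n\<close>.\<close>
theorem gaussian_limit:
  "weak_conv_m
     (\<lambda>n. distr (random_tournament n W) borel
        (\<lambda>a. (num_triads n a - 2 * real (n choose 3) * t_C3 W) / real n powr (5/2)))
     (normal_law 0 (sigma_sq W))"
  unfolding distr_num_triads
proof (rule weak_conv_normal_law[OF Om.prob_space_axioms])
  define g where "g x = t_tri W x - t_C3 W" for x
  have bg: "bmeas unit_leb g" unfolding g_def by (intro bmeas_diff bmeas_t bmeas_const)
  have mean: "(\<I> x. g x) = 0"
    using U.bmeas_integrable[OF bmeas_t] by (simp add: g_def t_C3_eq[symmetric])
  define X where "X n w = centred_count n w / real n powr (5/2)" for n w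
  define Y where "Y n w = (\<Sum>i<n. g (w (Suc i, 0))) / sqrt n" for n and w :: outcome
  have bX: "bmeas Om (X n)" for n unfolding X_def by (intro bmeas_divide bmeas_diff bmeas_num_triads bmeas_const)
  thus "\<And>n. (\<lambda>w. centred_count n w / real n powr (5/2)) \<in> borel_measurable Om"
    unfolding X_def by (rule bmeas_measurable)
  show "sigma_sq W \<ge> 0" unfolding sigma_sq_eq by simp
  fix t
  have bgc: "bmeas Om (\<lambda>w. g (w i))" for i by (rule bmeas_comp[OF bg]) simp
  have bY: "bmeas Om (Y n)" for n unfolding Y_def using bgc by auto
  have Yvar: "(\<E> w. (Y n w)^2) \<le> 1" for n
  proof -
    have g1: "\<bar>g x\<bar> \<le> 1" if "x \<in> {0..1}" for x using t_in[OF that] t_C3_in by (auto simp: g_def)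
    have "(\<E> w. (\<Sum>i<n. g (w (Suc i, 0)))^2) \<le> 1^2 * real (card {..<n})"
    proof (rule Om.orthogonal_sum_bound(2))
      fix i j :: nat assume "i \<noteq> j"
      have "(\<E> w. g (w (Suc i, 0)) * g (w (Suc j, 0))) = (\<E> w. g (w (Suc i, 0))) * (\<E> w. g (w (Suc j, 0)))"
        by (rule expectation_disjoint_mult[where A="{(Suc i, 0)}" and B="{(Suc j, 0)}"])
           (use \<open>i \<noteq> j\<close> bgc in \<open>auto simp: depends_on_def\<close>)
      thus "(\<E> w. g (w (Suc i, 0)) * g (w (Suc j, 0))) = 0" using mean expectation_coord[OF bg] by simp
    qed (use bgc g1 coord_in in auto)
    thus ?thesis by (cases "n = 0") (auto simp: Y_def power_divide divide_le_eq)
  qed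
  have "(\<lambda>n. \<E> w. iexp (t * X n w)) \<longlonglongrightarrow> exp (- (t^2 * sigma_sq W) / 2)"
  proof (rule Om.char_limit_perturb[where Y=Y])
    show "X n \<in> borel_measurable Om" "Y n \<in> borel_measurable Om" "integrable Om (\<lambda>w. (X n w - Y n w)^2)" for n
      using bX bY by (auto intro!: bmeas_measurable Om.bmeas_integrable)
    show "(\<lambda>n. \<E> w. iexp (t * Y n w)) \<longlonglongrightarrow> exp (- (t^2 * sigma_sq W) / 2)"
      unfolding Y_def sigma_sq_eq g_def[symmetric] by (rule clt_coords[OF bg mean]) (auto simp: inj_def)
    show "(\<lambda>n. \<E> w. (X n w - Y n w)^2) \<longlonglongrightarrow> 0"
    proof (rule Lim_null_comparison)
      show "(\<lambda>n. 1500 / real n) \<longlonglongrightarrow> 0" by real_asymp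
      show "\<forall>\<^sub>F n in sequentially. norm (\<E> w. (X n w - Y n w)^2) \<le> 1500 / real n"
      proof (rule eventually_mono[OF eventually_gt_at_top[of 0]])
        fix n :: nat assume n0: "n > 0"
        define r where "r = real n"
        have r1: "r \<ge> 1" using n0 by (simp add: r_def)
        \<comment> \<open>All exponents become natural numbers when written in terms of \<open>s\<close>.\<close>
        define s where "s = sqrt r"
        have s: "s > 0" "s ^ 2 = r" "s \<ge> 1" using r1 by (auto simp: s_def)
        have pw: "r powr (5/2) = s ^ 5"
          using r1 by (simp add: s_def powr_half_sqrt[symmetric] powr_power)
        define A where "A w = (\<Sum>(u, v, x)\<in>triples n. h3 w u v x)" for w
        define B where "B w = (\<Sum>(u, v)\<in>pairs n. h2 w u v)" for w
        have bA: "bmeas Om A" and bB: "bmeas Om B" unfolding A_def B_def case_prod_unfold by auto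
        have Xe: "X n w - Y n w = A w / s ^ 5 + (r - 2) * B w / s ^ 5 + (((r - 1) * (r - 2)) / r^2 - 1) * Y n w" for w
        proof -
          have "(\<Sum>u\<in>{1..n}. t_tri W (w (u, 0)) - t_C3 W) = s * Y n w"
            using s n0 by (simp add: Y_def g_def sum.atLeast1_atMost_eq s_def r_def)
          hence "X n w = (A w + (r - 2) * B w + (r - 1) * (r - 2) * (s * Y n w)) / s ^ 5"
            unfolding X_def hoeffding_decomposition A_def B_def r_def[symmetric] pw by simp
          also have "\<dots> = A w / s ^ 5 + (r - 2) * B w / s ^ 5 + (r - 1) * (r - 2) / r^2 * Y n w"
            unfolding s(2)[symmetric] using s(1) by (simp add: field_simps eval_nat_numeral)
          finally show ?thesis by (simp add: algebra_simps)
        qed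
        have sq3: "(a + b + c)^2 \<le> 3 * (a^2 + b^2 + c^2)" for a b c :: real
        proof -
          have "0 \<le> (a - b)^2 + (b - c)^2 + (a - c)^2" by simp
          thus ?thesis by (simp add: power2_eq_square algebra_simps)
        qed
        have s10: "(s ^ 5)^2 = r ^ 5" by (simp add: s(2)[symmetric] power_mult[symmetric])
        have cY: "(((r - 1) * (r - 2)) / r^2 - 1)^2 \<le> 9 / r^2"
        proof -
          have "((r - 1) * (r - 2)) / r^2 - 1 = - ((3 * r - 2) / r^2)" using r1 by (simp add: field_simps power2_eq_square)
          hence "(((r - 1) * (r - 2)) / r^2 - 1)^2 = (3 * r - 2)^2 / (r^2)^2" by (simp add: power_divide)
          also have "\<dots> \<le> (3 * r)^2 / (r^2)^2" using r1 by (intro divide_right_mono power_mono) auto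
          also have "\<dots> = 9 / r^2" using r1 by (simp add: field_simps power2_eq_square)
          finally show ?thesis .
        qed
        have "(\<E> w. (X n w - Y n w)^2)
            \<le> (\<E> w. 3 * ((A w)^2 / r ^ 5 + (r - 2)^2 * (B w)^2 / r ^ 5 + (((r - 1) * (r - 2)) / r^2 - 1)^2 * (Y n w)^2))"
        proof (rule Om.bmeas_integral_mono)
          fix w
          show "(X n w - Y n w)^2 \<le> 3 * ((A w)^2 / r ^ 5 + (r - 2)^2 * (B w)^2 / r ^ 5 + (((r - 1) * (r - 2)) / r^2 - 1)^2 * (Y n w)^2)"
            unfolding Xe using sq3[of "A w / s ^ 5" "(r - 2) * B w / s ^ 5" "(((r - 1) * (r - 2)) / r^2 - 1) * Y n w"]
            by (simp only: power_divide power_mult_distrib s10)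
        qed (use bA bB bX bY in auto)
        also have "\<dots> = 3 * ((\<E> w. (A w)^2) / r ^ 5 + (r - 2)^2 * (\<E> w. (B w)^2) / r ^ 5
            + (((r - 1) * (r - 2)) / r^2 - 1)^2 * (\<E> w. (Y n w)^2))"
          using Om.bmeas_integrable[OF bmeas_power[OF bA, of 2]] Om.bmeas_integrable[OF bmeas_power[OF bB, of 2]]
            Om.bmeas_integrable[OF bmeas_power[OF bY[of n], of 2]] by simp
        also have "\<dots> \<le> 3 * (400 * r ^ 3 / r ^ 5 + r^2 * (64 * r^2) / r ^ 5 + 9 / r^2 * 1)"
        proof -
          have rr: "(r - 2)^2 \<le> r^2"
          proof -
            have "(r - 2)^2 = r^2 - 4 * (r - 1)" by (simp add: power2_eq_square algebra_simps)
            thus ?thesis using r1 by simp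
          qed
          show ?thesis
            using h3_sum_bound[of n] h2_sum_bound[of n] r1 Yvar[of n] cY rr
            by (intro mult_left_mono add_mono divide_right_mono mult_mono) (auto simp: A_def B_def r_def)
        qed
        also have "\<dots> = 1227 / r^2 + 192 / r" using r1 by (simp add: field_simps eval_nat_numeral)
        also have "\<dots> \<le> 1227 / r + 192 / r"
          using r1 by (intro add_mono divide_left_mono) (auto simp: power2_eq_square)
        also have "\<dots> \<le> 1500 / r" using r1 by (simp add: field_simps)
        finally show "norm (\<E> w. (X n w - Y n w)^2) \<le> 1500 / real n"
          by (simp add: r_def abs_of_nonneg)
      qed
    qed
  qed
  thus "(\<lambda>n. \<E> w. iexp (t * (centred_count n w / real n powr (5/2))))
     \<longlonglongrightarrow> exp (- (t^2 * sigma_sq W) / 2)" unfolding X_def by simp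
qed

end


section \<open>The Lindeberg step\<close>

text \<open>  The basic estimate behind all exchanges of laws: in front of a bounded factor a conditionally centred variable
  enters through its second moment, up to its third absolute moment.\<close>
lemma (in prob_space) iexp_taylor2:
  fixes G :: "'a \<Rightarrow> complex" and X :: "'a \<Rightarrow> real"
  assumes G: "bmeas M G" "\<And>x. x \<in> space M \<Longrightarrow> cmod (G x) \<le> 1" and X: "bmeas M X"
    and X1: "(\<integral>x. G x * X x \<partial>M) = 0"
  shows "cmod ((\<integral>x. G x * iexp (X x) \<partial>M) - ((\<integral>x. G x \<partial>M) - (\<integral>x. G x * (X x)^2 \<partial>M) / 2))
    \<le> (\<integral>x. \<bar>X x\<bar> ^ 3 \<partial>M)"
proof -
  have b: "bmeas M (\<lambda>x. G x * X x)" "bmeas M (\<lambda>x. G x * (X x)^2)" "bmeas M (\<lambda>x. G x * iexp (X x))"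
    using G(1) X by (auto intro!: bmeas_mult[OF G(1)] bmeas_of_real bmeas_power simp: of_real_power[symmetric] simp del: of_real_power)
  have "(\<integral>x. G x * iexp (X x) \<partial>M) - ((\<integral>x. G x \<partial>M) - (\<integral>x. G x * (X x)^2 \<partial>M) / 2)
      = (\<integral>x. G x * iexp (X x) \<partial>M) - ((\<integral>x. G x \<partial>M) + \<i> * (\<integral>x. G x * X x \<partial>M) - (\<integral>x. G x * (X x)^2 \<partial>M) / 2)"
    using X1 by simp
  also have "\<dots> = (\<integral>x. G x * iexp (X x) - (G x + \<i> * (G x * X x) - (G x * (X x)^2) / 2) \<partial>M)"
    using bmeas_integrable[OF b(1)] bmeas_integrable[OF b(2)] bmeas_integrable[OF b(3)] bmeas_integrable[OF G(1)]
    by simp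
  also have "\<dots> = (\<integral>x. G x * (iexp (X x) - (\<Sum>k\<le>2. (\<i> * X x) ^ k / fact k)) \<partial>M)"
    by (intro lint_cong refl)
       (simp add: atMost_nat_numeral fact_numeral power2_eq_square algebra_simps eval_nat_numeral)
  also have "cmod \<dots> \<le> (\<integral>x. cmod (G x * (iexp (X x) - (\<Sum>k\<le>2. (\<i> * X x) ^ k / fact k))) \<partial>M)"
    by (rule integral_norm_bound)
  also have "\<dots> \<le> (\<integral>x. \<bar>X x\<bar> ^ 3 \<partial>M)"
  proof (rule bmeas_integral_mono)
    fix x assume x: "x \<in> space M"
    have "cmod (G x * (iexp (X x) - (\<Sum>k\<le>2. (\<i> * X x) ^ k / fact k))) \<le> 1 * (\<bar>X x\<bar> ^ Suc 2 / fact (Suc 2))"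
      unfolding norm_mult by (intro mult_mono G(2) x iexp_approx1) auto
    also have "\<dots> \<le> \<bar>X x\<bar> ^ 3" by (simp add: fact_numeral numeral_3_eq_3[symmetric])
    finally show "cmod (G x * (iexp (X x) - (\<Sum>k\<le>2. (\<i> * X x) ^ k / fact k))) \<le> \<bar>X x\<bar> ^ 3" .
  next
    show "bmeas M (\<lambda>x. cmod (G x * (iexp (X x) - (\<Sum>k\<le>2. (\<i> * X x) ^ k / fact k))))"
      using G(1) X by (intro bmeas_norm bmeas_mult bmeas_diff bmeas_iexp bmeas_sum bmeas_divide bmeas_power bmeas_const bmeas_of_real)
  qed (use X in auto)
  finally show ?thesis .
qed

lemma abs_cube_le: "a > 0 \<Longrightarrow> \<bar>y\<bar> ^ 3 \<le> a ^ 3 + y ^ 4 / (a :: real)"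
proof (cases "\<bar>y\<bar> \<le> a")
  case True
  assume "a > 0"
  have "\<bar>y\<bar> ^ 3 \<le> a ^ 3" by (intro power_mono True) auto
  thus ?thesis using \<open>a > 0\<close> by (smt (verit) zero_le_power_eq_numeral even_numeral divide_nonneg_pos zero_le_even_power)
next
  case False
  assume a: "a > 0"
  have "a * \<bar>y\<bar> ^ 3 \<le> \<bar>y\<bar> * \<bar>y\<bar> ^ 3" using False by (intro mult_right_mono) auto
  also have "\<dots> = y ^ 4" by (simp add: eval_nat_numeral)
  finally have "\<bar>y\<bar> ^ 3 \<le> y ^ 4 / a" using a by (simp add: field_simps)
  thus ?thesis using a by (smt (verit) zero_less_power)
qed

text \<open>  Odd absolute moments are not accessible by orthogonality; at scale \<open>a\<close> they are controlled by the fourth moment.\<close>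
lemma (in prob_space) third_moment_le:
  assumes X: "bmeas M X" and a: "a > 0" and B: "(\<integral>x. (X x) ^ 4 \<partial>M) \<le> B * a ^ 4"
  shows "(\<integral>x. \<bar>X x :: real\<bar> ^ 3 \<partial>M) \<le> (1 + B) * a ^ 3"
proof -
  have "(\<integral>x. \<bar>X x\<bar> ^ 3 \<partial>M) \<le> (\<integral>x. a ^ 3 + (X x) ^ 4 / a \<partial>M)"
    by (rule bmeas_integral_mono) (use X abs_cube_le[OF a] in auto)
  also have "\<dots> = a ^ 3 + (\<integral>x. (X x) ^ 4 \<partial>M) / a"
    using bmeas_integrable[OF bmeas_power[OF X, of 4]] by (simp add: prob_space)
  also have "\<dots> \<le> a ^ 3 + B * a ^ 4 / a" using a B by (intro add_left_mono divide_right_mono) auto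
  also have "\<dots> = (1 + B) * a ^ 3" using a by (simp add: field_simps eval_nat_numeral)
  finally show ?thesis .
qed

text \<open>
  Fourth moments of sums of bounded variables grow quadratically as soon as each new summand is
  uncorrelated with the first and third power of the sum of the others.
\<close>
lemma (in prob_space) fourth_moment_sum:
  fixes Y :: "'i \<Rightarrow> 'a \<Rightarrow> real"
  assumes "finite I" and b: "\<And>i. i \<in> I \<Longrightarrow> bmeas M (Y i)"
    and C: "\<And>i x. i \<in> I \<Longrightarrow> x \<in> space M \<Longrightarrow> \<bar>Y i x\<bar> \<le> C"
    and orth: "\<And>i J k. J \<subseteq> I \<Longrightarrow> i \<in> I - J \<Longrightarrow> k \<in> {1, 3} \<Longrightarrow> (\<integral>x. (\<Sum>j\<in>J. Y j x) ^ k * Y i x \<partial>M) = 0"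
  shows "(\<integral>x. (\<Sum>i\<in>I. Y i x) ^ 4 \<partial>M) \<le> 11 * C ^ 4 * (real (card I))^2"
    and "(\<integral>x. (\<Sum>i\<in>I. Y i x)^2 \<partial>M) \<le> C^2 * card I"
proof -
  have "(\<integral>x. (\<Sum>i\<in>J. Y i x) ^ 4 \<partial>M) \<le> 11 * C ^ 4 * (real (card J))^2 \<and> (\<integral>x. (\<Sum>i\<in>J. Y i x)^2 \<partial>M) \<le> C^2 * card J"
    if "J \<subseteq> I" for J
    using finite_subset[OF that assms(1)] that
  proof (induction J rule: finite_induct)
    case empty thus ?case by simp
  next
    case (insert i J)
    define S where "S x = (\<Sum>j\<in>J. Y j x)" for x
    define y where "y = Y i"
    have bS: "bmeas M S" and by': "bmeas M y" using b insert.prems unfolding S_def y_def by auto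
    have yC: "(y x)^2 \<le> C^2" if "x \<in> space M" for x
      using power_mono[OF C[OF _ that, of i] abs_ge_zero, of 2] insert.prems unfolding y_def by auto
    have IH: "(\<integral>x. S x ^ 4 \<partial>M) \<le> 11 * C ^ 4 * (real (card J))^2" "(\<integral>x. (S x)^2 \<partial>M) \<le> C^2 * card J"
      using insert.IH insert.prems unfolding S_def by auto
    have o: "(\<integral>x. S x * y x \<partial>M) = 0" "(\<integral>x. S x ^ 3 * y x \<partial>M) = 0"
      using orth[of J i 1] orth[of J i 3] insert.prems insert.hyps unfolding S_def y_def by auto
    have i: "integrable M (\<lambda>x. S x ^ k)" "integrable M (\<lambda>x. S x ^ k * y x)" "integrable M (\<lambda>x. S x * y x)" "integrable M (\<lambda>x. y x ^ k)" for k
      using bS by' by (auto intro!: bmeas_integrable)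
    have "(\<integral>x. (S x + y x) ^ 4 \<partial>M) \<le> (\<integral>x. S x ^ 4 + 4 * (S x ^ 3 * y x) + 8 * C^2 * S x ^ 2 + 3 * C ^ 4 \<partial>M)"
    proof (rule bmeas_integral_mono)
      fix x assume x: "x \<in> space M"
      have y4: "y x ^ 4 \<le> C ^ 4" using power_mono[OF yC[OF x], of 2] by simp
      have "0 \<le> 2 * (S x * y x - (y x)^2)^2" by simp
      hence "4 * (S x * y x ^ 3) \<le> 2 * ((S x)^2 * (y x)^2) + 2 * y x ^ 4"
        by (simp add: power2_eq_square power4_eq_xxxx power3_eq_cube algebra_simps)
      moreover have "(S x)^2 * (y x)^2 \<le> C^2 * (S x)^2" using mult_left_mono[OF yC[OF x], of "(S x)^2"] by (simp add: mult.commute)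
      moreover have "(S x + y x) ^ 4 = S x ^ 4 + 4 * (S x ^ 3 * y x) + 6 * ((S x)^2 * (y x)^2) + 4 * (S x * y x ^ 3) + y x ^ 4"
        by (simp add: power2_eq_square power4_eq_xxxx power3_eq_cube algebra_simps)
      ultimately show "(S x + y x) ^ 4 \<le> S x ^ 4 + 4 * (S x ^ 3 * y x) + 8 * C^2 * S x ^ 2 + 3 * C ^ 4"
        using y4 by linarith
    qed (use bS by' in auto)
    also have "\<dots> = (\<integral>x. S x ^ 4 \<partial>M) + 8 * C^2 * (\<integral>x. S x ^ 2 \<partial>M) + 3 * C ^ 4"
      using i o by (simp add: prob_space)
    also have "\<dots> \<le> 11 * C ^ 4 * (real (card J))^2 + 8 * C^2 * (C^2 * card J) + 3 * C ^ 4"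
      using IH by (intro add_mono mult_left_mono) auto
    also have "\<dots> = C ^ 4 * (11 * (real (card J))^2 + 8 * card J + 3)"
      by (simp add: power2_eq_square power4_eq_xxxx algebra_simps)
    also have "\<dots> \<le> C ^ 4 * (11 * (real (card J + 1))^2)"
    proof (rule mult_left_mono)
      show "11 * (real (card J))^2 + 8 * card J + 3 \<le> 11 * (real (card J + 1))^2"
        by (simp add: power2_eq_square algebra_simps)
    qed auto
    finally have 4: "(\<integral>x. (S x + y x) ^ 4 \<partial>M) \<le> 11 * C ^ 4 * (real (card J + 1))^2" by simp
    have "(\<integral>x. (S x + y x)^2 \<partial>M) = (\<integral>x. (S x)^2 + 2 * (S x * y x) + (y x)^2 \<partial>M)"
      by (simp add: power2_eq_square algebra_simps)
    also have "\<dots> = (\<integral>x. (S x)^2 \<partial>M) + (\<integral>x. (y x)^2 \<partial>M)" using i o by simp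
    also have "(\<integral>x. (y x)^2 \<partial>M) \<le> (\<integral>x. C^2 \<partial>M)"
      by (rule bmeas_integral_mono) (use by' yC in auto)
    finally have 2: "(\<integral>x. (S x + y x)^2 \<partial>M) \<le> C^2 * (card J + 1)" using IH(2) by (simp add: prob_space algebra_simps)
    show ?case using 4 2 insert.hyps by (simp add: S_def y_def add.commute)
  qed
  from this[of I] show "(\<integral>x. (\<Sum>i\<in>I. Y i x) ^ 4 \<partial>M) \<le> 11 * C ^ 4 * (real (card I))^2"
     "(\<integral>x. (\<Sum>i\<in>I. Y i x)^2 \<partial>M) \<le> C^2 * card I" by auto
qed

section \<open>Random signs\<close>

definition rad :: "real \<Rightarrow> real" where "rad y = (if y \<le> 1/2 then 1 else -1)"

lemma rad_sq [simp]: "rad y * rad y = 1" "(rad y)^2 = 1" and rad_abs [simp]: "\<bar>rad y\<bar> = 1"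
  by (auto simp: rad_def)

lemma bmeas_rad: "bmeas unit_leb rad"
  by (rule bmeasI[where C=1]) (auto simp: rad_def[abs_def] unit_leb_def intro!: measurable_restrict_space1)

lemma bmeas_rad_comp [intro!]: "g \<in> measurable M unit_leb \<Longrightarrow> bmeas M (\<lambda>x. rad (g x))"
  by (rule bmeas_comp[OF bmeas_rad])

lemma rad_mean0: "(\<I> y. rad y) = 0"
proof -
  have "(\<I> y. rad y) = (\<I> y. 2 * of_bool (y \<le> 1/2) - 1)"
    by (intro lint_cong refl) (simp add: rad_def)
  also have "\<dots> = 2 * (\<I> y. of_bool (y \<le> 1/2)) - 1"
  proof -
    have "integrable unit_leb (\<lambda>y. of_bool (y \<le> 1/2) :: real)"
      by (intro U.bmeas_integrable bmeas_of_bool) (simp add: unit_leb_def measurable_restrict_space1)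
    thus ?thesis by (subst lint_diff) (auto simp del: of_bool_eq_iff)
  qed
  also have "\<dots> = 0" using integral_unit_threshold[of "1/2"] by simp
  finally show ?thesis .
qed

lemma rad_orthogonal:
  fixes G :: "outcome \<Rightarrow> 'b::{real_normed_field,banach,second_countable_topology}"
  assumes "bmeas Om G" "depends_on (- {i}) G"
  shows "(\<E> w. G w * of_real (rad (w i))) = 0"
proof -
  have b: "bmeas unit_leb (\<lambda>y. of_real (rad y) :: 'b)"
    by (rule bmeasI[where C=1]) (use bmeas_measurable[OF bmeas_rad] in auto)
  have "(\<E> w. G w * (\<lambda>y w. of_real (rad y)) (w i) w) = (\<E> w. G w * (\<I> y. of_real (rad y)))"
  proof (rule integrate_coordinate[OF assms(1) _ assms(2)])
    show "bmeas Om (\<lambda>w. of_real (rad (w i)) :: 'b)" by (rule bmeas_comp[OF b]) simp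
  qed simp
  moreover have "(\<I> y. of_real (rad y)) = (of_real (\<I> y. rad y) :: 'b)"
    by (rule integral_bounded_linear[OF bounded_linear_of_real U.bmeas_integrable[OF bmeas_rad]])
  ultimately show ?thesis using rad_mean0 by simp
qed

text \<open>The signs of all edges as a skew-symmetric matrix.\<close>
definition sg :: "outcome \<Rightarrow> nat \<Rightarrow> nat \<Rightarrow> real" where
  "sg w u v = (if u < v then rad (w (u, v)) else if v < u then - rad (w (v, u)) else 0)"

lemma sg_swap: "sg w v u = - sg w u v" and sg_self [simp]: "sg w u u = 0"
  and sg_abs: "\<bar>sg w u v\<bar> \<le> 1"
  by (auto simp: sg_def)

lemma sg_sq: "u \<noteq> v \<Longrightarrow> (sg w u v)\<^sup>2 = 1" "u \<noteq> v \<Longrightarrow> sg w u v * sg w u v = 1"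
  by (auto simp: sg_def)

lemma bmeas_sg [intro!]: "bmeas Om (\<lambda>w. sg w u v)"
  unfolding sg_def by (cases u v rule: linorder_cases) auto

lemma depends_sg: "(min u v, max u v) \<in> A \<Longrightarrow> depends_on A (\<lambda>w. sg w u v)"
  unfolding sg_def depends_on_def by (cases u v rule: linorder_cases) auto

lemma sg_orthogonal:
  fixes G :: "outcome \<Rightarrow> 'b::{real_normed_field,banach,second_countable_topology}"
  assumes "bmeas Om G" "depends_on (- {(min u v, max u v)}) G"
  shows "(\<E> w. G w * of_real (sg w u v)) = 0"
  using rad_orthogonal[OF assms(1), of "(u, v)"] rad_orthogonal[OF assms(1), of "(v, u)"] assms(2)
  unfolding sg_def by (cases u v rule: linorder_cases) (auto simp: min_def max_def split: if_splits)

text \<open>  \<open>deg m v\<close> is the score of \<open>v\<close> (wins minus losses) among the vertices up to \<open>m\<close>, and \<open>scores m\<close> the centred sum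
  of the squared scores. The edges of the new vertex \<open>Suc m\<close> are revealed one after the other: \<open>fresh m j\<close> is the
  sum of the first \<open>j\<close> of them, and \<open>incr m m\<close> is the increment of \<open>scores\<close>, written such that each new sign
  is multiplied by a function of the signs revealed earlier.\<close>
definition deg :: "nat \<Rightarrow> nat \<Rightarrow> outcome \<Rightarrow> real" where
  "deg m v w = (\<Sum>u\<in>{1..m}. sg w v u)"

definition fresh :: "nat \<Rightarrow> nat \<Rightarrow> outcome \<Rightarrow> real" where
  "fresh m j w = (\<Sum>v\<in>{1..j}. sg w v (Suc m))"

definition scores :: "nat \<Rightarrow> outcome \<Rightarrow> real" where
  "scores m w = (\<Sum>v\<in>{1..m}. (deg m v w)^2) - real m * (real m - 1)"

definition incr :: "nat \<Rightarrow> nat \<Rightarrow> outcome \<Rightarrow> real" where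
  "incr m j w = (\<Sum>v\<in>{1..j}. sg w v (Suc m) * (2 * deg m v w + 2 * fresh m (v - 1) w))"

lemma bmeas_deg [intro!]: "bmeas Om (deg m v)" and bmeas_fresh [intro!]: "bmeas Om (fresh m j)"
  unfolding deg_def[abs_def] fresh_def[abs_def] by auto

lemma bmeas_scores [intro!]: "bmeas Om (scores m)" and bmeas_incr [intro!]: "bmeas Om (incr m j)"
  unfolding scores_def[abs_def] incr_def[abs_def] by auto

lemma incr_Suc: "incr m (Suc j) w = incr m j w + (2 * deg m (Suc j) w + 2 * fresh m j w) * sg w (Suc j) (Suc m)"
  by (simp add: incr_def)

lemma fresh_Suc: "fresh m (Suc j) w = fresh m j w + sg w (Suc j) (Suc m)"
  by (simp add: fresh_def)

text \<open>Expanding the square in the order of revelation leaves the diagonal and a martingale.\<close>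
lemma fresh_sq: "j \<le> m \<Longrightarrow> (fresh m j w)\<^sup>2 = real j + (\<Sum>v\<in>{1..j}. sg w v (Suc m) * (2 * fresh m (v - 1) w))"
proof (induction j)
  case 0 thus ?case by (simp add: fresh_def)
next
  case (Suc j)
  have s: "(sg w (Suc j) (Suc m))^2 = 1" using Suc.prems by (intro sg_sq) simp
  show ?case using Suc s unfolding fresh_Suc by (simp add: power2_sum fresh_Suc[unfolded fresh_def, symmetric]) 
qed

lemma scores_Suc: "scores (Suc m) w = scores m w + incr m m w"
proof -
  have d: "deg (Suc m) v w = deg m v w + sg w v (Suc m)" for v by (simp add: deg_def)
  have dn: "deg (Suc m) (Suc m) w = - fresh m m w"
    unfolding deg_def fresh_def by (simp add: sum_negf[symmetric]) (intro sum.cong refl sg_swap)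
  have "(\<Sum>v\<in>{1..Suc m}. (deg (Suc m) v w)^2) = (\<Sum>v\<in>{1..m}. (deg m v w + sg w v (Suc m))^2) + (fresh m m w)^2"
    using dn by (simp add: d)
  also have "(\<Sum>v\<in>{1..m}. (deg m v w + sg w v (Suc m))^2)
     = (\<Sum>v\<in>{1..m}. (deg m v w)^2 + sg w v (Suc m) * (2 * deg m v w) + 1)"
    by (intro sum.cong refl) (simp add: power2_sum sg_sq)
  also have "(fresh m m w)^2 = real m + (\<Sum>v\<in>{1..m}. sg w v (Suc m) * (2 * fresh m (v - 1) w))"
    by (rule fresh_sq) simp
  finally show ?thesis
    by (simp add: scores_def incr_def sum.distrib distrib_left algebra_simps)
qed

lemma depends_deg: "v \<le> m \<Longrightarrow> depends_on {i. snd i \<le> m} (deg m v)"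
  unfolding deg_def[abs_def] by (intro depends_on_sum depends_sg) auto

lemma depends_fresh: "j \<le> m \<Longrightarrow> {(u, v). u \<in> {1..j} \<and> v = Suc m} \<subseteq> A \<Longrightarrow> depends_on A (fresh m j)"
  unfolding fresh_def[abs_def] by (intro depends_on_sum depends_sg) auto

lemma depends_scores: "depends_on {i. snd i \<le> m} (scores m)"
  unfolding scores_def[abs_def]
  by (intro depends_on_arith depends_on_sum depends_deg depends_on_const) auto

lemma depends_incr:
  assumes "j \<le> m" "{i. snd i \<le> m} \<subseteq> A" "{(u, v). u \<in> {1..j} \<and> v = Suc m} \<subseteq> A"
  shows "depends_on A (incr m j)"
  unfolding incr_def[abs_def]
proof (intro depends_on_sum depends_on_arith depends_on_const depends_sg)
  fix v assume v: "v \<in> {1..j}"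
  show "(min v (Suc m), max v (Suc m)) \<in> A" using v assms by (auto simp: min_def max_def)
  show "depends_on A (deg m v)" by (rule depends_on_mono[OF depends_deg assms(2)]) (use v assms in auto)
  show "depends_on A (fresh m (v - 1))" by (rule depends_fresh) (use v assms in auto)
qed

lemma deg_fourth: "(\<E> w. (deg m v w) ^ 4) \<le> 11 * (real m)^2"
proof -
  have "(\<E> w. (\<Sum>u\<in>{1..m}. sg w v u) ^ 4) \<le> 11 * 1 ^ 4 * (real (card {1..m}))^2"
  proof (rule Om.fourth_moment_sum(1))
    fix i J and k :: nat assume *: "J \<subseteq> {1..m}" "i \<in> {1..m} - J"
    have "(\<E> w. (\<Sum>j\<in>J. sg w v j) ^ k * of_real (sg w v i)) = 0"
      by (rule sg_orthogonal)
         (use * in \<open>auto intro!: depends_sg simp: min_def max_def split: if_splits\<close>)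
    thus "(\<E> w. (\<Sum>j\<in>J. sg w v j) ^ k * sg w v i) = 0" by simp
  qed (auto simp: sg_abs)
  thus ?thesis by (simp add: deg_def)
qed

text \<open>The coordinates revealed before the edge between \<open>Suc j\<close> and \<open>Suc m\<close>.\<close>
abbreviation seen :: "nat \<Rightarrow> nat \<Rightarrow> (nat \<times> nat) set" where
  "seen m j \<equiv> {i. snd i \<le> m} \<union> {(u, v). u \<in> {1..j} \<and> v = Suc m}"

lemma fresh_deg: "fresh m j w = - deg j (Suc m) w"
  unfolding deg_def fresh_def by (simp add: sum_negf[symmetric]) (intro sum.cong refl sg_swap)

lemma fresh_fourth: "j \<le> m \<Longrightarrow> (\<E> w. (fresh m j w) ^ 4) \<le> 11 * (real m)^2"
  using order_trans[OF deg_fourth[of j "Suc m"], of "11 * (real m)^2"] by (simp add: fresh_deg power_mono)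

context
  fixes G :: "outcome \<Rightarrow> complex" and m :: nat
  assumes G: "bmeas Om G" "depends_on {i. snd i \<le> m} G"
begin

lemma fresh_orthogonal:
  fixes H :: "outcome \<Rightarrow> complex"
  assumes "bmeas Om H" "depends_on A H" "(v, Suc m) \<notin> A" "v \<le> m"
  shows "(\<E> w. H w * sg w v (Suc m)) = 0"
  by (rule sg_orthogonal[OF assms(1) depends_on_mono[OF assms(2)]])
     (use assms(3,4) in \<open>auto simp: min_def max_def\<close>)

lemma incr_mean: "j \<le> m \<Longrightarrow> (\<E> w. G w * incr m j w) = 0"
proof (induction j)
  case 0 thus ?case by (simp add: incr_def)
next
  case (Suc j)
  let ?L = "\<lambda>w. 2 * deg m (Suc j) w + 2 * fresh m j w"
  have b: "bmeas Om (\<lambda>w. G w * of_real (?L w))" "bmeas Om (\<lambda>w. complex_of_real (sg w (Suc j) (Suc m)))" using G by auto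
  have z: "(\<E> w. (G w * of_real (?L w)) * sg w (Suc j) (Suc m)) = 0"
  proof (rule fresh_orthogonal[OF b(1)])
    show "depends_on (seen m j) (\<lambda>w. G w * of_real (?L w))"
      using Suc.prems
      by (intro depends_on_arith depends_on_mono[OF G(2)] depends_on_const depends_on_mono[OF depends_deg] depends_fresh) auto
  qed (use Suc.prems in auto)
  have "(\<E> w. G w * incr m (Suc j) w)
      = (\<E> w. G w * incr m j w + (G w * of_real (?L w)) * sg w (Suc j) (Suc m))"
    unfolding incr_Suc by (intro lint_cong refl) (simp add: algebra_simps)
  also have "\<dots> = (\<E> w. G w * incr m j w) + (\<E> w. (G w * of_real (?L w)) * sg w (Suc j) (Suc m))"
    by (intro lint_add Om.bmeas_integrable bmeas_mult b) (use G in auto)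
  finally show ?case using Suc z by simp
qed

lemma fresh_mean: "j \<le> m \<Longrightarrow> (\<E> w. G w * fresh m j w) = 0"
proof (induction j)
  case 0 thus ?case by (simp add: fresh_def)
next
  case (Suc j)
  have z: "(\<E> w. G w * sg w (Suc j) (Suc m)) = 0"
    by (rule fresh_orthogonal[OF G]) (use Suc.prems in auto)
  have "(\<E> w. G w * fresh m (Suc j) w) = (\<E> w. G w * fresh m j w + G w * sg w (Suc j) (Suc m))"
    unfolding fresh_Suc by (simp add: algebra_simps)
  also have "\<dots> = (\<E> w. G w * fresh m j w) + (\<E> w. G w * sg w (Suc j) (Suc m))"
    by (intro lint_add Om.bmeas_integrable) (use G in auto)
  finally show ?case using Suc z by simp
qed

lemma fresh_second: "j \<le> m \<Longrightarrow> (\<E> w. G w * of_real ((fresh m j w)^2)) = real j * (\<E> w. G w)"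
proof (induction j)
  case 0 thus ?case by (simp add: fresh_def)
next
  case (Suc j)
  have b: "bmeas Om (\<lambda>w. G w * of_real (2 * fresh m j w))" using G by auto
  have z: "(\<E> w. (G w * of_real (2 * fresh m j w)) * sg w (Suc j) (Suc m)) = 0"
  proof (rule fresh_orthogonal[OF b])
    show "depends_on (seen m j) (\<lambda>w. G w * of_real (2 * fresh m j w))"
      using Suc.prems by (intro depends_on_arith depends_on_mono[OF G(2)] depends_on_const depends_fresh) auto
  qed (use Suc.prems in auto)
  have s: "sg w (Suc j) (Suc m) ^ 2 = 1" for w using Suc.prems by (intro sg_sq) simp
  have "(\<E> w. G w * of_real ((fresh m (Suc j) w)^2))
      = (\<E> w. G w * of_real ((fresh m j w)^2) + (G w * of_real (2 * fresh m j w)) * sg w (Suc j) (Suc m) + G w)"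
    unfolding fresh_Suc power2_sum s by (simp add: algebra_simps)
  also have "\<dots> = (\<E> w. G w * of_real ((fresh m j w)^2))
      + (\<E> w. (G w * of_real (2 * fresh m j w)) * sg w (Suc j) (Suc m)) + (\<E> w. G w)"
  proof -
    have "integrable Om (\<lambda>w. G w * of_real ((fresh m j w)^2))" "integrable Om G"
      "integrable Om (\<lambda>w. (G w * of_real (2 * fresh m j w)) * sg w (Suc j) (Suc m))"
      using G b by (auto intro!: Om.bmeas_integrable simp del: of_real_power of_real_mult)
    thus ?thesis by (simp del: of_real_power of_real_mult)
  qed
  finally show ?case using Suc z by (simp add: algebra_simps)
qed

end

lemma incr_second:
  fixes G :: "outcome \<Rightarrow> complex"
  assumes G: "bmeas Om G" "depends_on {i. snd i \<le> m} G" and "j \<le> m"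
  shows "(\<E> w. G w * of_real ((incr m j w)^2))
     = (\<Sum>v\<in>{1..j}. 4 * (\<E> w. G w * of_real ((deg m v w)^2)) + 4 * (real v - 1) * (\<E> w. G w))"
  using assms(3)
proof (induction j)
  case 0 thus ?case by (simp add: incr_def)
next
  case (Suc j)
  define L where "L w = 2 * deg m (Suc j) w + 2 * fresh m j w" for w
  have bL: "bmeas Om L" unfolding L_def[abs_def] by auto
  have b: "bmeas Om (\<lambda>w. G w * of_real (2 * incr m j w * L w))" using G bL by auto
  have z: "(\<E> w. (G w * of_real (2 * incr m j w * L w)) * sg w (Suc j) (Suc m)) = 0"
  proof (rule fresh_orthogonal[OF G b])
    show "depends_on (seen m j) (\<lambda>w. G w * of_real (2 * incr m j w * L w))"
      unfolding L_def using Suc.prems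
      by (intro depends_on_arith depends_on_mono[OF G(2)] depends_on_const depends_on_mono[OF depends_deg] depends_fresh depends_incr) auto
  qed (use Suc.prems in auto)
  have s: "sg w (Suc j) (Suc m) ^ 2 = 1" for w using Suc.prems by (intro sg_sq) simp
  have i: "integrable Om (\<lambda>w. G w * of_real ((incr m j w)^2))"
      "integrable Om (\<lambda>w. (G w * of_real (2 * incr m j w * L w)) * sg w (Suc j) (Suc m))"
      "integrable Om (\<lambda>w. G w * of_real ((L w)^2))"
      "integrable Om (\<lambda>w. G w * of_real ((deg m (Suc j) w)^2))"
      "integrable Om (\<lambda>w. (G w * deg m (Suc j) w) * fresh m j w)"
      "integrable Om (\<lambda>w. G w * of_real ((fresh m j w)^2))"
    using G b bL by (auto intro!: Om.bmeas_integrable simp del: of_real_power of_real_mult)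
  have "(\<E> w. G w * of_real ((incr m (Suc j) w)^2))
      = (\<E> w. G w * of_real ((incr m j w)^2) + (G w * of_real (2 * incr m j w * L w)) * sg w (Suc j) (Suc m)
           + G w * of_real ((L w)^2))"
    unfolding incr_Suc power2_sum L_def[symmetric] power_mult_distrib s by (simp add: algebra_simps)
  also have "\<dots> = (\<E> w. G w * of_real ((incr m j w)^2))
      + (\<E> w. (G w * of_real (2 * incr m j w * L w)) * sg w (Suc j) (Suc m))
      + (\<E> w. G w * of_real ((L w)^2))"
    using i by (simp del: of_real_power of_real_mult)
  also have "(\<E> w. G w * of_real ((L w)^2))
      = (\<E> w. 4 * (G w * of_real ((deg m (Suc j) w)^2)) + 8 * ((G w * deg m (Suc j) w) * fresh m j w)
            + 4 * (G w * of_real ((fresh m j w)^2)))"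
    unfolding L_def by (intro lint_cong refl) (simp add: power2_eq_square algebra_simps)
  also have "\<dots> = 4 * (\<E> w. G w * of_real ((deg m (Suc j) w)^2))
      + 8 * (\<E> w. (G w * deg m (Suc j) w) * fresh m j w) + 4 * (\<E> w. G w * of_real ((fresh m j w)^2))"
    using i by (simp del: of_real_power of_real_mult)
  also have "(\<E> w. (G w * deg m (Suc j) w) * fresh m j w) = 0"
    using Suc.prems G by (intro fresh_mean depends_on_arith depends_deg) auto
  also have "(\<E> w. G w * of_real ((fresh m j w)^2)) = real j * (\<E> w. G w)"
    using Suc.prems by (intro fresh_second G) auto
  finally show ?case using Suc z by (simp add: algebra_simps)
qed

text \<open>  The squared scores add up to the state \<open>scores m\<close> and its mean, so the conditional variance of
  the increment is an affine function of the state. This is what closes the recursion below.\<close>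
lemma incr_conditional_variance:
  fixes G :: "outcome \<Rightarrow> complex"
  assumes G: "bmeas Om G" "depends_on {i. snd i \<le> m} G"
  shows "(\<E> w. G w * of_real ((incr m m w)^2))
     = 4 * (\<E> w. G w * scores m w) + 6 * real m * (real m - 1) * (\<E> w. G w)"
proof -
  have g: "(\<Sum>v\<in>{1..m}. 4 * (real v - 1)) = 2 * real m * (real m - 1)"
    by (induction m) (auto simp: algebra_simps)
  have "(\<E> w. G w * of_real ((incr m m w)^2))
     = 4 * (\<Sum>v\<in>{1..m}. \<E> w. G w * of_real ((deg m v w)^2)) + complex_of_real (\<Sum>v\<in>{1..m}. 4 * (real v - 1)) * (\<E> w. G w)"
    unfolding incr_second[OF G order_refl] by (simp add: sum.distrib sum_distrib_left sum_distrib_right)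
  also have "(\<Sum>v\<in>{1..m}. \<E> w. G w * of_real ((deg m v w)^2))
      = (\<E> w. (\<Sum>v\<in>{1..m}. G w * of_real ((deg m v w)^2)))"
    using G by (intro lint_sum[symmetric] Om.bmeas_integrable) (auto simp del: of_real_power)
  also have "\<dots> = (\<E> w. G w * scores m w + complex_of_real (real m * (real m - 1)) * G w)"
    by (intro lint_cong refl) (simp add: scores_def sum_distrib_left algebra_simps)
  also have "\<dots> = (\<E> w. G w * scores m w) + complex_of_real (real m * (real m - 1)) * (\<E> w. G w)"
    using G by (subst lint_add) (auto intro!: Om.bmeas_integrable)
  finally show ?thesis unfolding g by (simp add: algebra_simps)
qed

lemma scores_second_moment: "(\<E> w. scores m w) = 0" "(\<E> w. (scores m w)^2) \<le> 2 * real m ^ 3"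
proof (induction m)
  case 0
  { case 1 show ?case by (simp add: scores_def) next case 2 show ?case by (simp add: scores_def) }
next
  case (Suc m)
  have i: "integrable Om (scores m)" "integrable Om (incr m m)" "integrable Om (\<lambda>w. scores m w * incr m m w)"
    "integrable Om (\<lambda>w. (scores m w)^2)" "integrable Om (\<lambda>w. (incr m m w)^2)"
    by (auto intro!: Om.bmeas_integrable)
  have "(\<E> w. incr m m w) = Re (\<E> w. 1 * of_real (incr m m w))" by simp
  also have "\<dots> = 0" by (subst incr_mean) auto
  finally have x0: "(\<E> w. incr m m w) = 0" .
  have "(\<E> w. scores m w * incr m m w) = Re (\<E> w. complex_of_real (scores m w) * of_real (incr m m w))"
    by (simp flip: of_real_mult)
  also have "\<dots> = 0" by (subst incr_mean) (auto intro: depends_scores)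
  finally have x1: "(\<E> w. scores m w * incr m m w) = 0" .
  have "(\<E> w. (incr m m w)^2) = Re (\<E> w. 1 * of_real ((incr m m w)^2))" by (simp del: of_real_power)
  also have "\<dots> = 6 * real m * (real m - 1)"
    by (subst incr_conditional_variance) (auto simp: Suc.IH Om.prob_space)
  finally have x2: "(\<E> w. (incr m m w)^2) = 6 * real m * (real m - 1)" .
  { case 1 show ?case unfolding scores_Suc using i Suc.IH x0 by simp
  next case 2
    have "(\<E> w. (scores (Suc m) w)^2) = (\<E> w. (scores m w)^2 + 2 * (scores m w * incr m m w) + (incr m m w)^2)"
      unfolding scores_Suc by (simp add: power2_sum algebra_simps)
    also have "\<dots> = (\<E> w. (scores m w)^2) + 6 * real m * (real m - 1)" using i x1 x2 by simp
    also have "\<dots> \<le> 2 * real m ^ 3 + 6 * real m * (real m - 1)" using Suc.IH(2) by simp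
    also have "\<dots> \<le> 2 * real (Suc m) ^ 3" by (simp add: power3_eq_cube algebra_simps)
    finally show ?case . }
qed

text \<open>  Odd powers of the new sign vanish, and by Cauchy--Schwarz the mixed term grows only linearly in \<open>j\<close>.
  The constant 2816 is \<open>128 * (11 + 11)\<close>, from the fourth moments of the two parts of the coefficient.\<close>
lemma incr_fourth: "j \<le> m \<Longrightarrow> (\<E> w. (incr m j w) ^ 4) \<le> 9 * 2816 * (real m)^2 * (real j)^2"
proof (induction j)
  case 0 thus ?case by (simp add: incr_def)
next
  case (Suc j)
  define L where "L w = 2 * deg m (Suc j) w + 2 * fresh m j w" for w
  define X where "X = incr m j"
  define K where "K = 2816 * (real m)^2"
  have bL: "bmeas Om L" and bX: "bmeas Om X" unfolding L_def[abs_def] X_def by auto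
  have sum4: "(2 * a + 2 * b) ^ 4 \<le> 128 * (a ^ 4 + b ^ 4)" for a b :: real
  proof -
    have "0 \<le> (a - b)^2 * (7 * a^2 + 10 * a * b + 7 * b^2)"
    proof (rule mult_nonneg_nonneg)
      have "(a + b)^2 = a^2 + 2 * a * b + b^2" by (simp add: power2_sum)
      moreover have "0 \<le> (a + b)^2" "0 \<le> a^2" "0 \<le> b^2" by simp_all
      ultimately show "0 \<le> 7 * a^2 + 10 * a * b + 7 * b^2" by linarith
    qed simp
    thus ?thesis by (simp add: power2_eq_square power4_eq_xxxx algebra_simps)
  qed
  have L4: "(\<E> w. L w ^ 4) \<le> K"
  proof -
    have "(\<E> w. L w ^ 4) \<le> (\<E> w. 128 * (deg m (Suc j) w ^ 4 + fresh m j w ^ 4))"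
      by (rule Om.bmeas_integral_mono) (use bL sum4 in \<open>auto simp: L_def\<close>)
    also have "\<dots> = 128 * ((\<E> w. deg m (Suc j) w ^ 4) + (\<E> w. fresh m j w ^ 4))"
      using Om.bmeas_integrable[OF bmeas_power[OF bmeas_deg[of m "Suc j"], of 4]]
        Om.bmeas_integrable[OF bmeas_power[OF bmeas_fresh[of m j], of 4]] by simp
    also have "\<dots> \<le> 128 * (11 * (real m)^2 + 11 * (real m)^2)"
      using deg_fourth fresh_fourth Suc.prems by (intro mult_left_mono add_mono) auto
    finally show ?thesis by (simp add: K_def)
  qed
  have IH: "(\<E> w. X w ^ 4) \<le> 9 * K * (real j)^2" using Suc by (simp add: X_def K_def algebra_simps)
  have K0: "K \<ge> 0" by (simp add: K_def)
  have cross: "(\<E> w. (X w)^2 * (L w)^2) \<le> 3 * K * real j"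
  proof -
    have c1: "(\<E> w. (X w)^2 * (L w)^2)^2 \<le> (\<E> w. ((X w)^2)^2) * (\<E> w. ((L w)^2)^2)"
      using bL bX by (intro Om.cauchy_schwarz_bmeas) auto
    have c2: "(\<E> w. ((X w)^2)^2) * (\<E> w. ((L w)^2)^2) \<le> (9 * K * (real j)^2) * K"
      using IH L4 K0 by (intro mult_mono) auto
    have c3: "(9 * K * (real j)^2) * K = (3 * K * real j)^2" by (simp add: power2_eq_square)
    show ?thesis
      by (rule power2_le_imp_le[OF order_trans[OF c1 c2[unfolded c3]]]) (use K0 in simp)
  qed
  have odd: "(\<E> w. (X w ^ a * L w ^ b) * sg w (Suc j) (Suc m)) = 0" for a b
  proof -
    have dd: "depends_on (seen m j) (\<lambda>w. X w ^ a * L w ^ b)"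
      unfolding L_def X_def using Suc.prems
      by (intro depends_on_arith depends_on_const depends_on_mono[OF depends_deg] depends_fresh depends_incr) auto
    have "(\<E> w. (X w ^ a * L w ^ b) * of_real (sg w (Suc j) (Suc m))) = 0"
      by (rule sg_orthogonal[OF _ depends_on_mono[OF dd]])
         (use bX bL Suc.prems in \<open>auto simp: min_def max_def\<close>)
    thus ?thesis by simp
  qed
  have exp4: "(X w + L w * sg w (Suc j) (Suc m)) ^ 4
      = X w ^ 4 + 4 * ((X w ^ 3 * L w ^ 1) * sg w (Suc j) (Suc m)) + 6 * ((X w)^2 * (L w)^2)
        + 4 * ((X w ^ 1 * L w ^ 3) * sg w (Suc j) (Suc m)) + L w ^ 4" for w
  proof -
    have s: "sg w (Suc j) (Suc m) * sg w (Suc j) (Suc m) = 1" using Suc.prems by (intro sg_sq) simp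
    have "(x + l * e) ^ 4 = x ^ 4 + 4 * (x ^ 3 * l * e) + 6 * (x^2 * l^2) * (e * e) + 4 * (x * l ^ 3 * e) * (e * e) + l ^ 4 * (e * e) * (e * e)"
      for x l e :: real by (simp add: power2_eq_square power4_eq_xxxx power3_eq_cube algebra_simps)
    from this[of "X w" "L w" "sg w (Suc j) (Suc m)"] show ?thesis unfolding s by simp
  qed
  have i: "integrable Om (\<lambda>w. X w ^ 4)" "integrable Om (\<lambda>w. L w ^ 4)" "integrable Om (\<lambda>w. (X w)^2 * (L w)^2)"
    "integrable Om (\<lambda>w. (X w ^ a * L w ^ b) * sg w (Suc j) (Suc m))" for a b
    using bX bL by (auto intro!: Om.bmeas_integrable)
  have "(\<E> w. (incr m (Suc j) w) ^ 4) = (\<E> w. (X w + L w * sg w (Suc j) (Suc m)) ^ 4)"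
    by (simp add: incr_Suc X_def L_def)
  also have "\<dots> = (\<E> w. X w ^ 4) + 6 * (\<E> w. (X w)^2 * (L w)^2) + (\<E> w. L w ^ 4)"
    unfolding exp4 using i(1-3) i(4)[of 3 1] i(4)[of 1 3] odd[of 3 1] odd[of 1 3] by simp
  also have "\<dots> \<le> 9 * K * (real j)^2 + 6 * (3 * K * real j) + K" using IH cross L4 by (intro add_mono mult_left_mono) auto
  also have "\<dots> \<le> 9 * K * (real (Suc j))^2" using K0 by (simp add: power2_eq_square algebra_simps)
  finally show ?case by (simp add: K_def algebra_simps)
qed


section \<open>The balanced case\<close>

lemma exp_minus_taylor: "x \<ge> 0 \<Longrightarrow> \<bar>1 - x - exp (- x)\<bar> \<le> x^2 / (2 :: real)"
proof -
  assume x: "x \<ge> 0"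
  have "exp (- x) \<le> 1 - x + x^2 / 2"
  proof -
    have d: "((\<lambda>y. 1 - y + y^2 / 2 - exp (- y)) has_real_derivative (y - 1 + exp (- y))) (at y)" for y :: real
      by (auto intro!: derivative_eq_intros)
    have "0 \<le> y - 1 + exp (- y)" for y :: real using exp_ge_add_one_self[of "- y"] by simp
    hence "1 - 0 + 0^2 / 2 - exp (- 0) \<le> 1 - x + x^2 / 2 - exp (- x)"
      using DERIV_nonneg_imp_nondecreasing[OF x, of "\<lambda>y. 1 - y + y^2 / 2 - exp (- y)"] d by blast
    thus ?thesis by simp
  qed
  moreover have "1 - x \<le> exp (- x)" using exp_ge_add_one_self[of "- x"] by simp
  ultimately show ?thesis by simp
qed

text \<open>  One step of the recursion for the characteristic function. The three errors come from the third moment of the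
  increment, from the random part \<open>4 * scores m\<close> of its conditional variance, which is of order \<open>n^(3/2)\<close>, and
  from the exponential in place of its linear approximation.\<close>
lemma scores_step:
  fixes \<kappa> :: real and \<phi> :: "nat \<Rightarrow> complex"
  assumes "m < n"
  defines "\<phi> \<equiv> \<lambda>m. \<integral>w. iexp (\<kappa> * scores m w) \<partial>Om"
  shows "cmod (\<phi> (Suc m) - exp (- (\<kappa>\<^sup>2 * (6 * real m * (real m - 1))) / 2) * \<phi> m)
    \<le> 25345 * \<bar>\<kappa>\<bar> ^ 3 * real n ^ 3 + 4 * \<kappa>\<^sup>2 * sqrt (real n) ^ 3 + 5 * \<kappa> ^ 4 * real n ^ 4"
proof -
  define G where "G w = iexp (\<kappa> * scores m w)" for w
  define X where "X w = \<kappa> * incr m m w" for w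
  define x where "x = \<kappa>\<^sup>2 * (6 * real m * (real m - 1)) / 2"
  have n0: "real n > 0" and mn: "real m \<le> real n" using assms by auto
  have x0: "0 \<le> x" unfolding x_def by (cases "m = 0") auto
  have bG: "bmeas Om G" unfolding G_def[abs_def] by (intro bmeas_iexp bmeas_mult bmeas_const bmeas_scores)
  have bX: "bmeas Om X" unfolding X_def[abs_def] by auto
  have dG: "depends_on {i. snd i \<le> m} G" unfolding G_def[abs_def]
    by (intro depends_on_arith depends_scores depends_on_const)
  have G1: "cmod (G w) \<le> 1" for w by (simp add: G_def)
  have GX: "(\<E> w. G w * X w) = 0"
  proof -
    have "(\<E> w. G w * X w) = (\<E> w. complex_of_real \<kappa> * (G w * incr m m w))"
      by (simp add: X_def mult_ac)
    thus ?thesis using incr_mean[OF bG dG order_refl] by simp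
  qed
  have GX2: "(\<E> w. G w * of_real ((X w)^2)) = 4 * \<kappa>\<^sup>2 * (\<E> w. G w * scores m w) + 2 * x * (\<E> w. G w)"
  proof -
    have "(\<E> w. G w * of_real ((X w)^2)) = (\<E> w. complex_of_real (\<kappa>\<^sup>2) * (G w * of_real ((incr m m w)^2)))"
      by (simp add: X_def mult_ac power_mult_distrib)
    also have "\<dots> = complex_of_real (\<kappa>\<^sup>2) * (\<E> w. G w * of_real ((incr m m w)^2))"
      by (simp del: of_real_power)
    also have "\<dots> = 4 * \<kappa>\<^sup>2 * (\<E> w. G w * scores m w)
        + complex_of_real (\<kappa>\<^sup>2 * (6 * real m * (real m - 1))) * (\<E> w. G w)"
      unfolding incr_conditional_variance[OF bG dG] by (simp add: algebra_simps)
    also have "\<kappa>\<^sup>2 * (6 * real m * (real m - 1)) = 2 * x" by (simp add: x_def)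
    finally show ?thesis by simp
  qed
  have s3: "(\<E> w. \<bar>X w\<bar> ^ 3) \<le> 25345 * \<bar>\<kappa>\<bar> ^ 3 * real n ^ 3"
  proof -
    have "(\<E> w. (incr m m w) ^ 4) \<le> 25344 * (real m ^ 4)"
      using incr_fourth[of m m] by (simp add: power2_eq_square power4_eq_xxxx mult_ac)
    also have "\<dots> \<le> 25344 * real n ^ 4" using mn by (intro mult_left_mono power_mono) auto
    finally have "(\<E> w. \<bar>incr m m w\<bar> ^ 3) \<le> (1 + 25344) * real n ^ 3"
      by (intro Om.third_moment_le bmeas_incr n0)
    hence "\<bar>\<kappa>\<bar> ^ 3 * (\<E> w. \<bar>incr m m w\<bar> ^ 3) \<le> \<bar>\<kappa>\<bar> ^ 3 * (25345 * real n ^ 3)" by (intro mult_left_mono) auto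
    thus ?thesis by (simp add: X_def abs_mult power_mult_distrib mult_ac)
  qed
  have sc: "cmod (\<E> w. G w * scores m w) \<le> 2 * sqrt (real n) ^ 3"
  proof -
    have "cmod (\<E> w. G w * scores m w) \<le> (\<E> w. cmod (G w * scores m w))" by (rule integral_norm_bound)
    also have "\<dots> = (\<E> w. \<bar>scores m w\<bar>)" by (simp add: norm_mult G_def)
    also have "\<dots> \<le> sqrt (\<E> w. (scores m w)^2)"
      by (rule Om.L1_le_L2) (auto intro: bmeas_measurable Om.bmeas_integrable)
    also have "\<dots> \<le> sqrt (4 * real n ^ 3)"
    proof (rule real_sqrt_le_mono)
      have "real m ^ 3 \<le> real n ^ 3" using mn by (intro power_mono) auto
      moreover have "0 \<le> real n ^ 3" by simp
      ultimately show "(\<E> w. (scores m w)^2) \<le> 4 * real n ^ 3"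
        using scores_second_moment(2)[of m] by linarith
    qed
    finally show ?thesis by (simp add: real_sqrt_mult real_sqrt_power)
  qed
  have x2: "\<bar>1 - x - exp (- x)\<bar> \<le> 5 * \<kappa> ^ 4 * real n ^ 4"
  proof -
    have "x \<le> 3 * \<kappa>\<^sup>2 * (real n)^2"
    proof -
      have "real m * (real m - 1) \<le> real n * real n" using mn by (cases "m = 0") (auto intro!: mult_mono)
      hence "3 * \<kappa>\<^sup>2 * (real m * (real m - 1)) \<le> 3 * \<kappa>\<^sup>2 * (real n * real n)" by (intro mult_left_mono) auto
      moreover have "x = 3 * \<kappa>\<^sup>2 * (real m * (real m - 1))" by (simp add: x_def)
      ultimately show ?thesis by (simp only: power2_eq_square[of "real n"])
    qed
    hence "x^2 \<le> (3 * \<kappa>\<^sup>2 * (real n)^2)^2" using x0 by (intro power_mono) auto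
    also have "\<dots> = 9 * (\<kappa> ^ 4 * real n ^ 4)" by (simp add: power_mult_distrib power_mult[symmetric])
    finally have "x^2 \<le> 9 * (\<kappa> ^ 4 * real n ^ 4)" .
    hence "x^2 / 2 \<le> 5 * (\<kappa> ^ 4 * real n ^ 4)"
    proof -
      have "0 \<le> \<kappa> ^ 4 * real n ^ 4" by simp
      with \<open>x\<^sup>2 \<le> 9 * (\<kappa> ^ 4 * real n ^ 4)\<close> show ?thesis by linarith
    qed
    thus ?thesis using exp_minus_taylor[OF x0] by simp
  qed
  have Gm: "cmod (\<E> w. G w) \<le> 1"
  proof -
    have "cmod (\<E> w. G w) \<le> (\<E> w. cmod (G w))" by (rule integral_norm_bound)
    thus ?thesis by (simp add: G_def Om.prob_space)
  qed
  have ph: "\<phi> (Suc m) = (\<E> w. G w * iexp (X w))"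
    unfolding \<phi>_def scores_Suc G_def X_def by (simp add: algebra_simps exp_add)
  have pm: "\<phi> m = (\<E> w. G w)" unfolding \<phi>_def G_def ..
  have split: "\<phi> (Suc m) - exp (- x) * \<phi> m
      = (\<phi> (Suc m) - (\<phi> m - (\<E> w. G w * of_real ((X w)^2)) / 2))
        - 2 * \<kappa>\<^sup>2 * (\<E> w. G w * scores m w) + complex_of_real (1 - x - exp (- x)) * \<phi> m"
    unfolding GX2 pm by (simp add: field_simps)
  have 1: "cmod (\<phi> (Suc m) - (\<phi> m - (\<E> w. G w * of_real ((X w)^2)) / 2)) \<le> (\<E> w. \<bar>X w\<bar> ^ 3)"
    using Om.iexp_taylor2[OF bG G1 bX GX] unfolding ph pm by simp
  have 2: "cmod (2 * \<kappa>\<^sup>2 * (\<E> w. G w * scores m w)) \<le> 4 * \<kappa>\<^sup>2 * sqrt (real n) ^ 3"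
    using mult_left_mono[OF sc, of "2 * \<kappa>\<^sup>2"] by (simp add: norm_mult norm_power)
  have 3: "cmod (complex_of_real (1 - x - exp (- x)) * \<phi> m) \<le> 5 * \<kappa> ^ 4 * real n ^ 4"
  proof -
    have "cmod (complex_of_real (1 - x - exp (- x)) * \<phi> m) = \<bar>1 - x - exp (- x)\<bar> * cmod (\<phi> m)"
      by (simp only: norm_mult norm_of_real)
    also have "\<dots> \<le> (5 * \<kappa> ^ 4 * real n ^ 4) * 1"
      using x2 Gm unfolding pm by (intro mult_mono) simp_all
    finally show ?thesis by simp
  qed
  have tri: "cmod (a - b + c) \<le> A + B + C" if "cmod a \<le> A" "cmod b \<le> B" "cmod c \<le> C" for a b c A B C
    using norm_triangle_ineq[of "a - b" c] norm_triangle_ineq4[of a b] that by linarith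
  have "cmod (\<phi> (Suc m) - exp (- x) * \<phi> m) \<le> 25345 * \<bar>\<kappa>\<bar> ^ 3 * real n ^ 3 + 4 * \<kappa>\<^sup>2 * sqrt (real n) ^ 3 + 5 * \<kappa> ^ 4 * real n ^ 4"
    unfolding split by (rule tri[OF order_trans[OF 1 s3] 2 3])
  thus ?thesis by (simp add: x_def)
qed

text \<open>  The factors of the recursion are at most 1, so the errors only add up; the exponents sum to
  \<open>m (m - 1) (m - 2)\<close>.\<close>
lemma scores_char_bound:
  fixes \<kappa> :: real
  shows "cmod ((\<E> w. iexp (\<kappa> * scores n w)) - exp (- (\<kappa>\<^sup>2 * (real n * (real n - 1) * (real n - 2)))))
    \<le> real n * (25345 * \<bar>\<kappa>\<bar> ^ 3 * real n ^ 3 + 4 * \<kappa>\<^sup>2 * sqrt (real n) ^ 3 + 5 * \<kappa> ^ 4 * real n ^ 4)"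
proof -
  define D where "D = 25345 * \<bar>\<kappa>\<bar> ^ 3 * real n ^ 3 + 4 * \<kappa>\<^sup>2 * sqrt (real n) ^ 3 + 5 * \<kappa> ^ 4 * real n ^ 4"
  define \<phi> where "\<phi> m = (\<E> w. iexp (\<kappa> * scores m w))" for m
  define E where "E m = exp (- (\<kappa>\<^sup>2 * (real m * (real m - 1) * (real m - 2))))" for m :: nat
  have "cmod (\<phi> m - E m) \<le> real m * D" if "m \<le> n" for m
    using that
  proof (induction m)
    case 0
    have "scores 0 w = 0" for w by (simp add: scores_def)
    thus ?case by (simp add: \<phi>_def E_def Om.prob_space)
  next
    case (Suc m)
    define r where "r = exp (- (\<kappa>\<^sup>2 * (6 * real m * (real m - 1))) / 2)"
    have r: "0 \<le> r" "r \<le> 1" unfolding r_def by (auto, cases "m = 0") auto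
    have ES: "E (Suc m) = r * E m"
      unfolding E_def r_def exp_add[symmetric] by (rule arg_cong[where f=exp]) (simp add: field_simps)
    have "\<phi> (Suc m) - E (Suc m) = (\<phi> (Suc m) - r * \<phi> m) + r * (\<phi> m - E m)"
      unfolding ES by (simp add: algebra_simps)
    also have "cmod \<dots> \<le> cmod (\<phi> (Suc m) - r * \<phi> m) + cmod (r * (\<phi> m - E m))" by (rule norm_triangle_ineq)
    also have "cmod (\<phi> (Suc m) - r * \<phi> m) \<le> D"
      using scores_step[of m n \<kappa>] Suc.prems by (simp add: \<phi>_def r_def D_def)
    also have "cmod (r * (\<phi> m - E m)) = r * cmod (\<phi> m - E m)" using r by (simp add: norm_mult)
    also have "r * cmod (\<phi> m - E m) \<le> 1 * (real m * D)" using Suc r by (intro mult_mono) auto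
    finally show ?case by (simp add: algebra_simps)
  qed
  from this[of n] show ?thesis by (simp add: \<phi>_def E_def D_def)
qed

text \<open>For \<open>\<kappa>\<close> of order \<open>n^(-3/2)\<close> the total error is of order \<open>n^(-1/2)\<close>.\<close>
lemma scores_clt:
  "(\<lambda>n. \<E> w. iexp (t * (- scores n w / (8 * real n powr (3/2))))) \<longlonglongrightarrow> exp (- (t^2 * (1/32)) / 2)"
proof -
  define \<kappa> where "\<kappa> n = - t / (8 * sqrt (real n) ^ 3)" for n :: nat
  define \<phi> where "\<phi> n = (\<E> w. iexp (\<kappa> n * scores n w))" for n
  have pw: "real n powr (3/2) = sqrt (real n) ^ 3" for n
    by (cases "n = 0") (simp_all add: powr_half_sqrt[symmetric] powr_power)
  have eq: "(\<E> w. iexp (t * (- scores n w / (8 * real n powr (3/2))))) = \<phi> n" for n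
    unfolding \<phi>_def \<kappa>_def pw by (simp add: field_simps)
  have "(\<lambda>n. \<phi> n - exp (- ((\<kappa> n)^2 * (real n * (real n - 1) * (real n - 2))))) \<longlonglongrightarrow> 0"
  proof (rule Lim_null_comparison)
    show "\<forall>\<^sub>F n in sequentially. norm (\<phi> n - exp (- ((\<kappa> n)^2 * (real n * (real n - 1) * (real n - 2)))))
        \<le> (25345 * \<bar>t\<bar> ^ 3 / 512 + t^2 / 16 + 5 * t ^ 4 / 4096) * (1 / sqrt (real n))"
    proof (rule eventually_mono[OF eventually_gt_at_top[of 0]])
      fix n :: nat assume n0: "n > 0"
      define s where "s = sqrt (real n)"
      have s: "s \<ge> 1" "real n = s^2" using n0 by (auto simp: s_def)
      have k: "\<kappa> n = - t / (8 * s ^ 3)" by (simp add: \<kappa>_def s_def)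
      have "norm (\<phi> n - exp (- ((\<kappa> n)^2 * (real n * (real n - 1) * (real n - 2)))))
          \<le> real n * (25345 * \<bar>\<kappa> n\<bar> ^ 3 * real n ^ 3 + 4 * (\<kappa> n)^2 * sqrt (real n) ^ 3 + 5 * (\<kappa> n) ^ 4 * real n ^ 4)"
        unfolding \<phi>_def by (rule scores_char_bound)
      also have "\<dots> = s^2 * (25345 * (\<bar>t\<bar> / (8 * s ^ 3)) ^ 3 * (s^2) ^ 3 + 4 * (t / (8 * s ^ 3))^2 * s ^ 3 + 5 * (t / (8 * s ^ 3)) ^ 4 * (s^2) ^ 4)"
        unfolding s_def[symmetric] s(2) k using s(1) by (simp add: abs_divide)
      also have "\<dots> = 25345 * \<bar>t\<bar> ^ 3 / 512 * (1 / s) + t^2 / 16 * (1 / s) + 5 * t ^ 4 / 4096 * (1 / s^2)"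
        using s(1) by (simp add: field_simps power_mult_distrib eval_nat_numeral)
      also have "1 / s^2 \<le> 1 / s" using s(1) by (simp add: field_simps power2_eq_square)
      hence "25345 * \<bar>t\<bar> ^ 3 / 512 * (1 / s) + t^2 / 16 * (1 / s) + 5 * t ^ 4 / 4096 * (1 / s^2)
         \<le> 25345 * \<bar>t\<bar> ^ 3 / 512 * (1 / s) + t^2 / 16 * (1 / s) + 5 * t ^ 4 / 4096 * (1 / s)"
        by (intro add_left_mono mult_left_mono) auto
      finally show "norm (\<phi> n - exp (- ((\<kappa> n)^2 * (real n * (real n - 1) * (real n - 2)))))
        \<le> (25345 * \<bar>t\<bar> ^ 3 / 512 + t^2 / 16 + 5 * t ^ 4 / 4096) * (1 / sqrt (real n))"
        by (simp add: s_def algebra_simps add_divide_distrib)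
    qed
    have "(\<lambda>n. 1 / sqrt (real n)) \<longlonglongrightarrow> 0" by real_asymp
    from tendsto_mult_right_zero[OF this]
    show "(\<lambda>n. (25345 * \<bar>t\<bar> ^ 3 / 512 + t^2 / 16 + 5 * t ^ 4 / 4096) * (1 / sqrt (real n))) \<longlonglongrightarrow> 0" .
  qed
  moreover have "(\<lambda>n. exp (- ((\<kappa> n)^2 * (real n * (real n - 1) * (real n - 2))))) \<longlonglongrightarrow> exp (- (t^2 / 64 * 1))"
  proof (rule tendsto_exp[OF tendsto_minus])
    have "(\<lambda>n. t^2 / 64 * ((real n - 1) * (real n - 2) / (real n)^2)) \<longlonglongrightarrow> t\<^sup>2 / 64 * 1"
      by (intro tendsto_mult tendsto_const) real_asymp
    moreover have "\<forall>\<^sub>F n in sequentially. t^2 / 64 * ((real n - 1) * (real n - 2) / (real n)^2)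
        = (\<kappa> n)^2 * (real n * (real n - 1) * (real n - 2))"
    proof (rule eventually_mono[OF eventually_gt_at_top[of 0]])
      fix n :: nat assume n0: "n > 0"
      have "(sqrt (real n) ^ 3)^2 = real n ^ 3" 
      proof -
        have "(sqrt (real n) ^ 3)^2 = (sqrt (real n) ^ 2) ^ 3" by (simp only: power_mult[symmetric] mult.commute)
        thus ?thesis by simp
      qed
      hence k2: "(\<kappa> n)^2 = t^2 / (64 * real n ^ 3)" by (simp add: \<kappa>_def power_divide power_mult_distrib)
      show "t^2 / 64 * ((real n - 1) * (real n - 2) / (real n)^2) = (\<kappa> n)^2 * (real n * (real n - 1) * (real n - 2))"
        unfolding k2 using n0 by (simp add: field_simps eval_nat_numeral)
    qed
    ultimately show "(\<lambda>n. (\<kappa> n)^2 * (real n * (real n - 1) * (real n - 2))) \<longlonglongrightarrow> t\<^sup>2 / 64 * 1"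
      by (rule Lim_transform_eventually)
  qed
  hence "(\<lambda>n. complex_of_real (exp (- ((\<kappa> n)^2 * (real n * (real n - 1) * (real n - 2)))))) \<longlonglongrightarrow> complex_of_real (exp (- (t^2 / 64 * 1)))"
    by (rule tendsto_of_real)
  ultimately have "\<phi> \<longlonglongrightarrow> complex_of_real (exp (- (t^2 / 64 * 1)))" using tendsto_add by fastforce
  thus ?thesis unfolding eq by (simp add: field_simps)
qed

lemma sum_pairs_ordered:
  fixes F :: "nat \<Rightarrow> nat \<Rightarrow> real"
  shows "(\<Sum>(u, v)\<in>pairs n. F u v + F v u) = (\<Sum>u\<in>{1..n}. \<Sum>v\<in>{1..n}. F u v) - (\<Sum>u\<in>{1..n}. F u u)"
proof (induction n)
  case 0 thus ?case by (simp add: pairs_0)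
next
  case (Suc n)
  show ?case unfolding sum_pairs_Suc Suc by (simp add: sum.distrib algebra_simps)
qed

text \<open>  A cherry is a pair of edges at a common vertex. Those at a vertex with score \<open>d\<close> add up to
  \<open>(d^2 - (n - 1)) / 2\<close>; the induction compares the increments of both sides when a vertex is added.\<close>
lemma cherries_scores:
  "(\<Sum>(u, v, x)\<in>triples n. sg w v u * sg w v x + sg w x v * sg w x u + sg w u v * sg w u x) = scores n w / 2"
proof (induction n)
  case 0 thus ?case by (simp add: triples_0 scores_def)
next
  case (Suc n)
  let ?e = "\<lambda>v. sg w v (Suc n)"
  have "(\<Sum>(u, v)\<in>pairs n. sg w v u * ?e v + sg w (Suc n) v * sg w (Suc n) u + sg w u v * ?e u)
      = (\<Sum>(u, v)\<in>pairs n. sg w u v * ?e u + sg w v u * ?e v) + (\<Sum>(u, v)\<in>pairs n. (?e u * ?e v + ?e v * ?e u) / 2)"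
    unfolding sum.distrib[symmetric] by (intro sum.cong refl) (auto simp: sg_swap[of w "Suc n"] algebra_simps)
  also have "\<dots> = (\<Sum>u\<in>{1..n}. \<Sum>v\<in>{1..n}. sg w u v * ?e u)
      + ((\<Sum>u\<in>{1..n}. \<Sum>v\<in>{1..n}. ?e u * ?e v) - (\<Sum>u\<in>{1..n}. ?e u * ?e u)) / 2"
  proof -
    have "(\<Sum>(u, v)\<in>pairs n. (?e u * ?e v + ?e v * ?e u) / 2) = (\<Sum>(u, v)\<in>pairs n. ?e u * ?e v + ?e v * ?e u) / 2"
      by (simp only: case_prod_unfold sum_divide_distrib)
    thus ?thesis
      unfolding sum_pairs_ordered[of "\<lambda>u v. ?e u * ?e v" n] sum_pairs_ordered[of "\<lambda>u v. sg w u v * ?e u" n] by simp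
  qed
  also have "(\<Sum>u\<in>{1..n}. ?e u * ?e u) = real n" by (simp add: sg_sq)
  also have "(\<Sum>u\<in>{1..n}. \<Sum>v\<in>{1..n}. ?e u * ?e v) = (fresh n n w)^2"
    by (simp add: fresh_def power2_eq_square sum_product)
  also have "(\<Sum>u\<in>{1..n}. \<Sum>v\<in>{1..n}. sg w u v * ?e u) = (\<Sum>u\<in>{1..n}. ?e u * deg n u w)"
    by (simp add: deg_def sum_distrib_left mult.commute)
  also have "(\<Sum>u\<in>{1..n}. ?e u * deg n u w) + ((fresh n n w)^2 - real n) / 2 = incr n n w / 2"
    unfolding fresh_sq[OF order_refl] by (simp add: incr_def sum.distrib distrib_left sum_divide_distrib[symmetric] add_divide_distrib sum_distrib_left mult_ac)
  finally show ?case unfolding sum_triples_Suc prod.case Suc scores_Suc by (simp add: add_divide_distrib)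
qed

lemma distr_coord_pair:
  assumes "i \<noteq> j" shows "distr Om UU (\<lambda>w. (w i, w j)) = UU"
proof -
  have iv: "Om.indep_vars (\<lambda>_. unit_leb) (\<lambda>i w. w i) UNIV"
    unfolding Om_def by (rule indep_vars_PiM_coords) (auto intro: prob_space_unit)
  have "Om.indep_var (PiM {i} (\<lambda>_. unit_leb)) (\<lambda>w. restrict (\<lambda>i. w i) {i}) (PiM {j} (\<lambda>_. unit_leb)) (\<lambda>w. restrict (\<lambda>i. w i) {j})"
    by (rule Om.indep_var_restrict[OF iv]) (use assms in auto)
  hence "Om.indep_var unit_leb ((\<lambda>x. x i) \<circ> (\<lambda>w. restrict (\<lambda>i. w i) {i})) unit_leb ((\<lambda>x. x j) \<circ> (\<lambda>w. restrict (\<lambda>i. w i) {j}))"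
    by (rule Om.indep_var_compose) simp_all
  hence "Om.indep_var unit_leb (\<lambda>w. w i) unit_leb (\<lambda>w. w j)" by (simp add: comp_def)
  thus ?thesis unfolding Om.indep_var_distribution_eq by (simp add: distr_coord)
qed

lemma AE_coord_pair:
  "i \<noteq> j \<Longrightarrow> (AE q in UU. P (fst q) (snd q)) \<Longrightarrow> AE w in Om. P (w i) (w j)"
proof -
  assume ij: "i \<noteq> j" and P: "AE q in UU. P (fst q) (snd q)"
  have "(\<lambda>w. (w i, w j)) \<in> measurable Om UU" by measurable
  from AE_distrD[OF this, unfolded distr_coord_pair[OF ij], OF P] show ?thesis by simp
qed


context tourn
begin

text \<open>  In terms of signs a triad is \<open>1/4\<close> minus a quarter of its three cherries, because the products of one and of
  three signs cancel between the two cyclic orientations.\<close>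
theorem balanced_limit:
  assumes half: "AE (x, y) in UU. W x y = 1/2"
  shows "weak_conv_m
         (\<lambda>n. distr (random_tournament n W) borel
            (\<lambda>a. (num_triads n a - 1/4 * real (n choose 3)) / real n powr (3/2)))
         (normal_law 0 (1/32))"
  unfolding distr_num_triads
proof (rule weak_conv_normal_law[OF Om.prob_space_axioms])
  define X where "X n w = (num_triads n (adj w) - 1/4 * real (n choose 3)) / real n powr (3/2)" for n w
  have bX: "bmeas Om (X n)" for n unfolding X_def by (intro bmeas_divide bmeas_diff bmeas_num_triads bmeas_const)
  thus "\<And>n. (\<lambda>w. (num_triads n (adj w) - 1/4 * real (n choose 3)) / real n powr (3/2)) \<in> borel_measurable Om"
    unfolding X_def by (rule bmeas_measurable)
  fix t
  have "AE w in Om. \<forall>u\<in>{1..n}. \<forall>v\<in>{1..n}. u \<noteq> v \<longrightarrow> W (w (u, 0)) (w (v, 0)) = 1/2" for n :: nat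
  proof (rule AE_finite_allI[OF finite_atLeastAtMost], rule AE_finite_allI[OF finite_atLeastAtMost])
    fix u v :: nat
    show "AE w in Om. u \<noteq> v \<longrightarrow> W (w (u, 0)) (w (v, 0)) = 1/2"
    proof (cases "u = v")
      case False
      hence "AE w in Om. W (w (u, 0)) (w (v, 0)) = 1/2"
        using half by (intro AE_coord_pair[where P="\<lambda>x y. W x y = 1/2"]) (simp_all add: case_prod_unfold)
      thus ?thesis by (rule AE_mp) simp
    qed simp
  qed
  note half_types = this
  have Xs: "AE w in Om. X n w = - scores n w / (8 * real n powr (3/2))" for n
  using half_types[of n]
  proof eventually_elim
    case (elim w)
    note W = elim
    have a: "adj w u v = (1 + sg w u v) / 2" if "u \<in> {1..n}" "v \<in> {1..n}" "u \<noteq> v" for u v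
    proof -
      have "W (w (u, 0)) (w (v, 0)) = 1/2" "W (w (v, 0)) (w (u, 0)) = 1/2"
        using bspec[OF bspec[OF W that(1)] that(2)] bspec[OF bspec[OF W that(2)] that(1)] that(3) by simp_all
      thus ?thesis using that(3) by (cases "u < v") (simp_all add: adj_alt sg_def ori_def rad_def)
    qed
    have "num_triads n (adj w) = (\<Sum>(u, v, x)\<in>triples n. 1/4 - (sg w v u * sg w v x + sg w x v * sg w x u + sg w u v * sg w u x) / 4)"
      unfolding num_triads_triples
    proof (intro sum.cong refl, clarify)
      fix u v x assume "(u, v, x) \<in> triples n"
      hence m: "u \<in> {1..n}" "v \<in> {1..n}" "x \<in> {1..n}" "u \<noteq> v" "v \<noteq> x" "u \<noteq> x" by (auto simp: triples_def)
      have s: "sg w v u = - sg w u v" "sg w x v = - sg w v x" "sg w x u = - sg w u x" by (rule sg_swap)+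
      show "adj w u v * adj w v x * adj w x u + adj w u x * adj w x v * adj w v u
          = 1/4 - (sg w v u * sg w v x + sg w x v * sg w x u + sg w u v * sg w u x) / 4"
        using m by (simp add: a s field_simps)
    qed
    also have "\<dots> = 1/4 * real (n choose 3) - scores n w / 8"
      unfolding card_triples_binomial using cherries_scores[of w n]
      by (simp add: case_prod_unfold sum_subtractf sum_divide_distrib[symmetric])
    finally show "X n w = - scores n w / (8 * real n powr (3/2))" by (simp add: X_def)
  qed
  have "(\<E> w. iexp (t * X n w)) = (\<E> w. iexp (t * (- scores n w / (8 * real n powr (3/2)))))" for n
  proof (rule integral_cong_AE)
    show "AE w in Om. iexp (t * X n w) = iexp (t * (- scores n w / (8 * real n powr (3/2))))"
      using Xs[of n] by eventually_elim simp
  qed (intro bmeas_measurable bmeas_iexp bmeas_mult bmeas_const bX bmeas_divide bmeas_uminus bmeas_scores)+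
  with scores_clt[of t] have "(\<lambda>n. \<E> w. iexp (t * X n w)) \<longlonglongrightarrow> exp (- (t^2 * (1/32)) / 2)" by simp
  thus "(\<lambda>n. \<E> w. iexp (t * ((num_triads n (adj w) - 1/4 * real (n choose 3)) / real n powr (3/2))))
     \<longlonglongrightarrow> exp (- (t^2 * (1/32)) / 2)" unfolding X_def .
qed simp

end


section \<open>Integral operators with bounded kernels\<close>

text \<open>  Functions and kernels are bounded and evaluated pointwise. \<open>ip\<close> and \<open>hs\<close> are the inner products of functions and
  of kernels (Hilbert--Schmidt), \<open>opr K\<close> is the integral operator of \<open>K\<close>, and \<open>kcomp\<close> the kernel of a composition.\<close>
abbreviation bm1 :: "(real \<Rightarrow> real) \<Rightarrow> bool" where "bm1 \<equiv> bmeas unit_leb"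
definition bm2 :: "kernel \<Rightarrow> bool" where "bm2 K \<longleftrightarrow> bmeas UU (\<lambda>(x, y). K x y)"
definition sym2 :: "kernel \<Rightarrow> bool" where
  "sym2 K \<longleftrightarrow> (\<forall>x\<in>{0..1}. \<forall>y\<in>{0..1}. K x y = K y x)"

definition ip :: "(real \<Rightarrow> real) \<Rightarrow> (real \<Rightarrow> real) \<Rightarrow> real" where "ip f g = (\<I> x. f x * g x)"
definition opr :: "kernel \<Rightarrow> (real \<Rightarrow> real) \<Rightarrow> real \<Rightarrow> real" where
  "opr K f x = (\<I> y. K x y * f y)"
definition kcomp :: "kernel \<Rightarrow> kernel \<Rightarrow> real \<Rightarrow> real \<Rightarrow> real" where
  "kcomp K L x y = opr K (\<lambda>z. L z y) x"
definition hs :: "kernel \<Rightarrow> kernel \<Rightarrow> real" where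
  "hs K L = (\<I> x. (\<I> y. K x y * L x y))"

text \<open>The squared Hilbert--Schmidt distance.\<close>
abbreviation hs_dist :: "kernel \<Rightarrow> kernel \<Rightarrow> real" where
  "hs_dist K L \<equiv> hs (\<lambda>x y. K x y - L x y) (\<lambda>x y. K x y - L x y)"

lemma bm2_comp: "bm2 K \<Longrightarrow> g \<in> measurable M unit_leb \<Longrightarrow> h \<in> measurable M unit_leb \<Longrightarrow> bmeas M (\<lambda>x. K (g x) (h x))"
  unfolding bm2_def by (rule bmeas_comp2)

lemma bm2_const [intro!]: "bm2 (\<lambda>_ _. c)" and bm2_add [intro!]: "bm2 K \<Longrightarrow> bm2 L \<Longrightarrow> bm2 (\<lambda>x y. K x y + L x y)"
  and bm2_diff [intro!]: "bm2 K \<Longrightarrow> bm2 L \<Longrightarrow> bm2 (\<lambda>x y. K x y - L x y)"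
  and bm2_mult [intro!]: "bm2 K \<Longrightarrow> bm2 L \<Longrightarrow> bm2 (\<lambda>x y. K x y * L x y)"
  and bm2_divide [intro!]: "bm2 K \<Longrightarrow> bm2 (\<lambda>x y. K x y / c)"
  unfolding bm2_def case_prod_unfold by auto

lemma bm2_sum [intro!]: "(\<And>i. i \<in> I \<Longrightarrow> bm2 (K i)) \<Longrightarrow> bm2 (\<lambda>x y. \<Sum>i\<in>I. K i x y)"
  unfolding bm2_def case_prod_unfold by auto

lemma bm2_fst [intro]: "bm1 f \<Longrightarrow> bm2 (\<lambda>x y. f x)" and bm2_snd [intro]: "bm1 f \<Longrightarrow> bm2 (\<lambda>x y. f y)"
  using bmeas_comp[of unit_leb f fst UU] bmeas_comp[of unit_leb f snd UU]
  unfolding bm2_def case_prod_unfold by simp_all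

lemma bm2_row: "bm2 K \<Longrightarrow> x \<in> {0..1} \<Longrightarrow> bm1 (K x)"
  by (rule bm2_comp[where K=K and g="\<lambda>_. x" and h="\<lambda>y. y"]) simp_all

lemma bm2_col: "bm2 K \<Longrightarrow> y \<in> {0..1} \<Longrightarrow> bm1 (\<lambda>x. K x y)"
  by (rule bm2_comp[where K=K and g="\<lambda>x. x" and h="\<lambda>_. y"]) simp_all

lemma bm2_swap: "bm2 K \<Longrightarrow> bm2 (\<lambda>x y. K y x)"
  using bm2_comp[of K snd UU fst] unfolding bm2_def case_prod_unfold by simp

lemma bm2_bound: assumes "bm2 K" obtains C where "C > 0" "\<And>x y. x \<in> {0..1} \<Longrightarrow> y \<in> {0..1} \<Longrightarrow> \<bar>K x y\<bar> \<le> C"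
proof -
  obtain C where C: "C \<ge> 0" "\<And>q. q \<in> space UU \<Longrightarrow> norm ((\<lambda>(x, y). K x y) q) \<le> C"
    using assms bmeas_bound unfolding bm2_def by blast
  show ?thesis
  proof (rule that[of "C + 1"])
    fix x y :: real assume "x \<in> {0..1}" "y \<in> {0..1}"
    thus "\<bar>K x y\<bar> \<le> C + 1" using C(2)[of "(x, y)"] by (simp add: space_pair_measure)
  qed (use C in simp)
qed

lemma bm1_integrable: "bm1 f \<Longrightarrow> integrable unit_leb f" by (rule U.bmeas_integrable)
lemma bm2_integrable: "bm2 K \<Longrightarrow> integrable UU (\<lambda>(x, y). K x y)"
  unfolding bm2_def by (rule UU.P.bmeas_integrable)

lemma bm2_fubini: "bm2 K \<Longrightarrow> (\<I> y. (\<I> x. K x y)) = (\<I> x. (\<I> y. K x y))"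
  by (rule UU.Fubini_integral[OF bm2_integrable])

lemma bm2_pair: "bm2 K \<Longrightarrow> (\<integral>q. K (fst q) (snd q) \<partial>UU) = (\<I> x. (\<I> y. K x y))"
  using UU.integral_fst[OF bm2_integrable, of K] by (simp add: case_prod_unfold)

lemma bm1_integral: "bm2 K \<Longrightarrow> bm1 (\<lambda>x. \<I> y. K x y)"
  unfolding bm2_def by (rule U.bmeas_integral)

lemma bm1_opr [intro!]: "bm2 K \<Longrightarrow> bm1 f \<Longrightarrow> bm1 (opr K f)"
  unfolding opr_def[abs_def] by (rule bm1_integral) auto

lemma bm2_kcomp [intro!]:
  assumes "bm2 K" "bm2 L" shows "bm2 (kcomp K L)"
proof -
  have "bmeas (UU \<Otimes>\<^sub>M unit_leb) (\<lambda>(q, z). K (fst q) z * L z (snd q))"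
    unfolding case_prod_unfold by (intro bmeas_mult bm2_comp[OF assms(1)] bm2_comp[OF assms(2)]) measurable
  from U.bmeas_integral[OF this] show ?thesis
    by (simp add: bm2_def kcomp_def opr_def case_prod_unfold)
qed

lemma opr_kcomp:
  assumes "bm2 K" "bm2 L" "bm1 f" "x \<in> {0..1}"
  shows "opr (kcomp K L) f x = opr K (opr L f) x"
proof -
  have b: "bm2 (\<lambda>z y. K x z * L z y * f y)"
    using assms bm2_row by (intro bm2_mult bm2_fst bm2_snd) auto
  have "opr (kcomp K L) f x = (\<I> y. (\<I> z. K x z * L z y * f y))"
    by (simp add: opr_def kcomp_def)
  also have "\<dots> = (\<I> z. (\<I> y. K x z * L z y * f y))" by (rule bm2_fubini[OF b])
  also have "\<dots> = opr K (opr L f) x" by (simp add: opr_def mult.assoc)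
  finally show ?thesis .
qed

lemma kcomp_assoc:
  assumes "bm2 K" "bm2 L" "bm2 M" "x \<in> {0..1}" "y \<in> {0..1}"
  shows "kcomp (kcomp K L) M x y = kcomp K (kcomp L M) x y"
  using opr_kcomp[OF assms(1,2) bm2_col[OF assms(3,5)] assms(4)] unfolding kcomp_def by (simp add: kcomp_def[abs_def])

lemma opr_cong: "(\<And>y. y \<in> {0..1} \<Longrightarrow> K x y = K' x y) \<Longrightarrow> (\<And>y. y \<in> {0..1} \<Longrightarrow> f y = g y) \<Longrightarrow> opr K f x = opr K' g x"
  unfolding opr_def by (intro lint_cong) auto

lemma opr_cong_AE:
  assumes "bm2 K" "x \<in> {0..1}" "f \<in> borel_measurable unit_leb" "g \<in> borel_measurable unit_leb" "AE y in unit_leb. f y = g y"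
  shows "opr K f x = opr K g x"
proof -
  have "K x \<in> borel_measurable unit_leb" using bm2_row[OF assms(1,2)] by (rule bmeas_measurable)
  thus ?thesis unfolding opr_def using assms(3-5) by (intro integral_cong_AE) (auto elim: eventually_mono)
qed

lemma ip_self: "ip f f = (\<I> x. (f x)^2)" "0 \<le> ip f f"
  by (simp_all add: ip_def power2_eq_square)

lemma ip_sym: "ip f g = ip g f" by (simp add: ip_def mult.commute)

lemma ip_scale: "ip (\<lambda>x. c * f x) h = c * ip f h" by (simp add: ip_def mult.assoc)

lemma ip_sum: "(\<And>i. i \<in> I \<Longrightarrow> bm1 (f i)) \<Longrightarrow> bm1 h \<Longrightarrow> ip (\<lambda>x. \<Sum>i\<in>I. f i x) h = (\<Sum>i\<in>I. ip (f i) h)"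
  by (auto simp: ip_def sum_distrib_right intro!: lint_sum bm1_integrable)

lemma ip_cs: "bm1 f \<Longrightarrow> bm1 g \<Longrightarrow> (ip f g)\<^sup>2 \<le> ip f f * ip g g"
  unfolding ip_self(1) unfolding ip_def by (rule U.cauchy_schwarz_bmeas)

lemma ip_cong: "(\<And>x. x \<in> {0..1} \<Longrightarrow> f x = f' x) \<Longrightarrow> (\<And>x. x \<in> {0..1} \<Longrightarrow> g x = g' x) \<Longrightarrow> ip f g = ip f' g'"
  unfolding ip_def by (intro lint_cong) auto

lemma opr_selfadjoint:
  assumes "bm2 K" "sym2 K" "bm1 f" "bm1 g"
  shows "ip (opr K f) g = ip f (opr K g)"
proof -
  have b: "bm2 (\<lambda>x y. K x y * f y * g x)" using assms by auto
  have "ip (opr K f) g = (\<I> x. (\<I> y. K x y * f y * g x))" by (simp add: ip_def opr_def)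
  also have "\<dots> = (\<I> y. (\<I> x. K x y * f y * g x))" by (rule bm2_fubini[OF b, symmetric])
  also have "\<dots> = (\<I> y. (\<I> x. f y * (K y x * g x)))"
    using assms(2) by (intro lint_cong refl) (auto simp: sym2_def)
  finally show ?thesis by (simp add: ip_def opr_def)
qed

lemma hs_self: "hs K K = (\<I> x. (\<I> y. (K x y)^2))" "0 \<le> hs K K"
  by (simp_all add: hs_def power2_eq_square)

lemma hs_pair: "bm2 K \<Longrightarrow> bm2 L \<Longrightarrow> hs K L = (\<integral>q. K (fst q) (snd q) * L (fst q) (snd q) \<partial>UU)"
  unfolding hs_def by (subst bm2_pair[of "\<lambda>x y. K x y * L x y"]) auto

lemma hs_diff:
  assumes "bm2 K" "bm2 L"
  shows "hs_dist K L = hs K K - 2 * hs K L + hs L L"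
proof -
  have i: "integrable unit_leb (\<lambda>y. A x y * A' x y)" if "bm2 A" "bm2 A'" "x \<in> {0..1}" for A A' x
    using bm2_row[OF that(1,3)] bm2_row[OF that(2,3)] by (intro bm1_integrable bmeas_mult)
  have i2: "integrable unit_leb (\<lambda>x. \<I> y. A x y * A' x y)" if "bm2 A" "bm2 A'" for A A'
    by (intro bm1_integrable bm1_integral bm2_mult that)
  have "hs_dist K L
      = (\<I> x. (\<I> y. K x y * K x y) - 2 * (\<I> y. K x y * L x y) + (\<I> y. L x y * L x y))"
    unfolding hs_def
  proof (intro lint_cong refl)
    fix x assume "x \<in> space unit_leb"
    hence x: "x \<in> {0..1}" by simp
    have "(\<I> y. (K x y - L x y) * (K x y - L x y))
        = (\<I> y. K x y * K x y - 2 * (K x y * L x y) + L x y * L x y)"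
      by (simp add: algebra_simps)
    also have "\<dots> = (\<I> y. K x y * K x y) - 2 * (\<I> y. K x y * L x y) + (\<I> y. L x y * L x y)"
      using i[OF assms(1,1) x] i[OF assms x] i[OF assms(2,2) x] by simp
    finally show "(\<I> y. (K x y - L x y) * (K x y - L x y)) = \<dots>" .
  qed
  also have "\<dots> = hs K K - 2 * hs K L + hs L L"
    unfolding hs_def using i2[OF assms(1,1)] i2[OF assms] i2[OF assms(2,2)] by simp
  finally show ?thesis .
qed

lemma opr_cs:
  assumes "bm2 K" "bm1 f" "x \<in> {0..1}" shows "(opr K f x)^2 \<le> (\<I> y. (K x y)^2) * ip f f"
  unfolding opr_def ip_self(1) by (intro U.cauchy_schwarz_bmeas bm2_row assms)

lemma bm2_power [intro!]: "bm2 K \<Longrightarrow> bm2 (\<lambda>x y. (K x y) ^ n)"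
  unfolding bm2_def case_prod_unfold by auto

lemma opr_norm_le:
  assumes "bm2 K" "bm1 f" shows "ip (opr K f) (opr K f) \<le> hs K K * ip f f"
proof -
  have "(\<I> x. (opr K f x)^2) \<le> (\<I> x. (\<I> y. (K x y)^2) * ip f f)"
    by (rule U.bmeas_integral_mono)
       (use assms opr_cs in \<open>auto intro!: bm1_integral\<close>)
  thus ?thesis by (simp add: ip_self(1)[of "opr K f"] hs_self)
qed

lemma ip_normalize:
  assumes "bm1 \<phi>" "ip \<phi> \<phi> > 0"
  defines "\<psi> \<equiv> \<lambda>x. \<phi> x / sqrt (ip \<phi> \<phi>)"
  shows "bm1 \<psi>" "ip \<psi> \<psi> = 1" "ip (opr K \<psi>) (opr K \<psi>) = ip (opr K \<phi>) (opr K \<phi>) / ip \<phi> \<phi>"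
proof -
  show "bm1 \<psi>" using assms by auto
  have "ip \<psi> \<psi> = (\<I> x. (\<phi> x)^2 / ip \<phi> \<phi>)"
    unfolding ip_self(1)[of \<psi>] using assms(2) by (simp add: \<psi>_def power_divide)
  thus "ip \<psi> \<psi> = 1" using assms(2) by (simp add: ip_self(1)[symmetric])
  have "opr K \<psi> x = opr K \<phi> x / sqrt (ip \<phi> \<phi>)" for x by (simp add: opr_def \<psi>_def)
  hence "ip (opr K \<psi>) (opr K \<psi>) = (\<I> x. (opr K \<phi> x)^2 / ip \<phi> \<phi>)"
    unfolding ip_self(1)[of "opr K \<psi>"] using assms(2) by (simp add: power_divide)
  thus "ip (opr K \<psi>) (opr K \<psi>) = ip (opr K \<phi>) (opr K \<phi>) / ip \<phi> \<phi>" by (simp add: ip_self(1)[of "opr K \<phi>"])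
qed

subsection \<open>Weak convergence of kernels\<close>

text \<open>
  Rectangles generate the product sigma-algebra, so a bounded sequence of kernels whose operators tend to
  0 strongly is orthogonal in the limit to every bounded kernel. The functions that are orthogonal in the
  limit are closed under mean-square approximation; this carries the property from rectangles to all
  measurable sets and then to step functions and their uniform limits.
\<close>
lemma hs_tendsto_0:
  assumes R: "\<And>n. bm2 (R n)" and M: "\<And>n. hs (R n) (R n) \<le> M"
    and z: "\<And>\<phi>. bm1 \<phi> \<Longrightarrow> (\<lambda>n. ip (opr (R n) \<phi>) (opr (R n) \<phi>)) \<longlonglongrightarrow> 0" and K: "bm2 K"
  shows "(\<lambda>n :: nat. hs (R n) K) \<longlonglongrightarrow> 0"
proof -
  define r where "r n q = R n (fst q) (snd q)" for n and q :: "real \<times> real"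
  have br: "bmeas UU (r n)" for n using R[of n] unfolding bm2_def r_def case_prod_unfold .
  define null where "null L \<longleftrightarrow> bmeas UU L \<and> (\<lambda>n. \<integral>q. r n q * L q \<partial>UU) \<longlonglongrightarrow> 0" for L :: "real \<times> real \<Rightarrow> real"
  have M0: "0 \<le> M" using M[of 0] hs_self(2)[of "R 0"] by linarith
  have approx: "null L" if L: "bmeas UU L" and ex: "\<And>\<epsilon>. \<epsilon> > 0 \<Longrightarrow> \<exists>L'. null L' \<and> (\<integral>q. (L q - L' q)^2 \<partial>UU) \<le> \<epsilon>" for L
    unfolding null_def
  proof (intro conjI L LIMSEQ_I)
    fix \<epsilon> :: real assume e: "\<epsilon> > 0"
    define \<delta> where "\<delta> = (\<epsilon> / 2)^2 / (M + 1)"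
    have d: "\<delta> > 0" "M * \<delta> \<le> (\<epsilon> / 2)^2" using e M0 by (simp_all add: \<delta>_def field_simps)
    obtain L' where L': "null L'" "(\<integral>q. (L q - L' q)^2 \<partial>UU) \<le> \<delta>" using ex[OF d(1)] by blast
    have bL': "bmeas UU L'" using L'(1) by (simp add: null_def)
    obtain N where N: "\<And>n. n \<ge> N \<Longrightarrow> \<bar>\<integral>q. r n q * L' q \<partial>UU\<bar> < \<epsilon> / 2"
      using LIMSEQ_D[of _ 0 "\<epsilon> / 2"] L'(1) e unfolding null_def by fastforce
    have near: "\<bar>\<integral>q. r n q * (L q - L' q) \<partial>UU\<bar> \<le> \<epsilon> / 2" for n
    proof (rule power2_le_imp_le)
      have "(\<integral>q. r n q * (L q - L' q) \<partial>UU)^2 \<le> (\<integral>q. (r n q)^2 \<partial>UU) * (\<integral>q. (L q - L' q)^2 \<partial>UU)"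
        by (rule UU.P.cauchy_schwarz_bmeas[OF br bmeas_diff[OF L bL']])
      also have "\<dots> \<le> M * \<delta>"
        using M[of n] L'(2) M0 hs_pair[OF R R, of n n] by (intro mult_mono) (auto simp: r_def power2_eq_square)
      finally show "\<bar>\<integral>q. r n q * (L q - L' q) \<partial>UU\<bar>\<^sup>2 \<le> (\<epsilon> / 2)^2" using d(2) by simp
    qed (use e in simp)
    have split: "(\<integral>q. r n q * L q \<partial>UU) = (\<integral>q. r n q * L' q \<partial>UU) + (\<integral>q. r n q * (L q - L' q) \<partial>UU)" for n
      using UU.P.bmeas_integrable[OF bmeas_mult[OF br[of n] L]] UU.P.bmeas_integrable[OF bmeas_mult[OF br[of n] bL']]
      by (simp add: right_diff_distrib)
    show "\<exists>N. \<forall>n\<ge>N. norm ((\<integral>q. r n q * L q \<partial>UU) - 0) < \<epsilon>"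
    proof (intro exI[of _ N] allI impI)
      fix n assume "n \<ge> N"
      thus "norm ((\<integral>q. r n q * L q \<partial>UU) - 0) < \<epsilon>" using N near[of n] unfolding split by fastforce
    qed
  qed
  have null_sum: "null (\<lambda>q. \<Sum>i\<in>I. c i * L i q)" if "\<And>i. i \<in> I \<Longrightarrow> null (L i)" for I :: "'i set" and c :: "'i \<Rightarrow> real" and L
    unfolding null_def
  proof
    have b: "bmeas UU (L i)" if "i \<in> I" for i using \<open>\<And>i. i \<in> I \<Longrightarrow> null (L i)\<close>[OF that] by (simp add: null_def)
    thus "bmeas UU (\<lambda>q. \<Sum>i\<in>I. c i * L i q)" by auto
    have "(\<integral>q. r n q * (\<Sum>i\<in>I. c i * L i q) \<partial>UU) = (\<Sum>i\<in>I. c i * (\<integral>q. r n q * L i q \<partial>UU))" for n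
      using UU.P.bmeas_integrable[OF bmeas_mult[OF br b]]
      by (simp add: sum_distrib_left mult.left_commute lint_sum)
    moreover have "(\<lambda>n. \<Sum>i\<in>I. c i * (\<integral>q. r n q * L i q \<partial>UU)) \<longlonglongrightarrow> (\<Sum>i\<in>I. c i * 0)"
      using that unfolding null_def by (intro tendsto_sum tendsto_mult tendsto_const) auto
    ultimately show "(\<lambda>n. \<integral>q. r n q * (\<Sum>i\<in>I. c i * L i q) \<partial>UU) \<longlonglongrightarrow> 0" by simp
  qed
  have bi: "bmeas UU (indicator S :: _ \<Rightarrow> real)" if "S \<in> sets UU" for S using that by auto
  have rect: "null (indicator (S \<times> T))" if ST: "S \<in> sets unit_leb" "T \<in> sets unit_leb" for S T
    unfolding null_def
  proof
    show "bmeas UU (indicator (S \<times> T) :: _ \<Rightarrow> real)" using ST by (intro bi) auto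
    have bT: "bm1 (indicator T)" and bS: "bm1 (indicator S)" using ST by auto
    have e: "(\<integral>q. r n q * indicator (S \<times> T) q \<partial>UU) = ip (opr (R n) (indicator T)) (indicator S)" for n
    proof -
      have "(\<integral>q. r n q * indicator (S \<times> T) q \<partial>UU) = (\<integral>q. R n (fst q) (snd q) * (indicator T (snd q) * indicator S (fst q)) \<partial>UU)"
        by (intro lint_cong refl) (auto simp: indicator_def mem_Times_iff r_def)
      also have "\<dots> = (\<I> x. (\<I> y. R n x y * (indicator T y * indicator S x)))"
        using R bT bS by (intro bm2_pair[of "\<lambda>x y. R n x y * (indicator T y * indicator S x)"] bm2_mult bm2_fst bm2_snd)
      also have "\<dots> = ip (opr (R n) (indicator T)) (indicator S)" by (simp add: ip_def opr_def mult.assoc[symmetric])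
      finally show ?thesis .
    qed
    have "(\<lambda>n. (ip (opr (R n) (indicator T)) (indicator S))^2) \<longlonglongrightarrow> 0"
    proof (rule tendsto_sandwich[OF _ _ tendsto_const])
      show "\<forall>\<^sub>F n in sequentially. (ip (opr (R n) (indicator T)) (indicator S))^2
          \<le> ip (opr (R n) (indicator T)) (opr (R n) (indicator T)) * ip (indicator S) (indicator S)"
        by (intro always_eventually allI ip_cs bm1_opr R bT bS)
      show "(\<lambda>n. ip (opr (R n) (indicator T)) (opr (R n) (indicator T)) * ip (indicator S) (indicator S)) \<longlonglongrightarrow> 0"
        using tendsto_mult_left_zero[OF z[OF bT]] .
    qed simp
    thus "(\<lambda>n. \<integral>q. r n q * indicator (S \<times> T) q \<partial>UU) \<longlonglongrightarrow> 0" unfolding e by simp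
  qed
  let ?E = "{A \<times> B | A B. A \<in> sets unit_leb \<and> B \<in> sets unit_leb}" and ?\<Omega> = "space unit_leb \<times> space unit_leb"
  have E: "?E \<subseteq> Pow ?\<Omega>" using sets.space_closed[of unit_leb] by blast
  have setsE: "sets UU = sigma_sets ?\<Omega> ?E" by (simp add: sets_pair_measure)
  have ind: "null (indicator S)" if "S \<in> sigma_sets ?\<Omega> ?E" for S
    using Int_stable_pair_measure_generator[of unit_leb unit_leb] E that
  proof (induction S rule: sigma_sets_induct_disjoint)
    case (basic A)
    thus ?case using rect by auto
  next
    case empty
    show ?case by (simp add: null_def)
  next
    case (compl A)
    have "null (\<lambda>q. \<Sum>i\<in>{True, False}. (if i then 1 else -1) * (if i then indicator ?\<Omega> else indicator A) q)"
      using compl rect[OF sets.top sets.top] by (intro null_sum) (simp split: if_split del: space_unit)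
    moreover have "(\<lambda>q. \<Sum>i\<in>{True, False}. (if i then 1 else -1) * (if i then indicator ?\<Omega> else indicator A) q) = (indicator (?\<Omega> - A) :: _ \<Rightarrow> real)"
      using sets.sets_into_space[of A UU] compl(1) unfolding setsE space_pair_measure by (auto simp: fun_eq_iff indicator_def)
    ultimately show ?case by simp
  next
    case (union A)
    have Am: "A i \<in> sets UU" for i using union(2) unfolding setsE by auto
    have Um: "(\<Union>i. A i) \<in> sets UU" using Am by auto
    show ?case
    proof (rule approx[OF bi[OF Um]])
      fix \<epsilon> :: real assume "\<epsilon> > 0"
      have "(\<lambda>n. measure UU (\<Union>i<n. A i)) \<longlonglongrightarrow> measure UU (\<Union>n. \<Union>i<n. A i)"
      proof (rule UU.P.finite_Lim_measure_incseq)
        show "incseq (\<lambda>n. \<Union>i<n. A i)" unfolding incseq_def by (intro allI impI UN_mono) (simp_all add: lessThan_subset_iff)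
      qed (use Am in auto)
      moreover have "(\<Union>n. \<Union>i<n. A i) = (\<Union>i. A i)" by auto
      ultimately obtain n where n: "\<bar>measure UU (\<Union>i<n. A i) - measure UU (\<Union>i. A i)\<bar> < \<epsilon>"
        using LIMSEQ_D[OF _ \<open>\<epsilon> > 0\<close>] by fastforce
      have e: "indicator (\<Union>i<n. A i) q = (\<Sum>i<n. 1 * indicator (A i) q :: real)" for q
        using indicator_UN_disjoint[of "{..<n}" A q] union(1) by (auto simp: disjoint_family_on_def)
      have "(\<integral>q. (indicator (\<Union>i. A i) q - indicator (\<Union>i<n. A i) q)^2 \<partial>UU) = (\<integral>q. (indicator (\<Union>i. A i) q :: real) - indicator (\<Union>i<n. A i) q \<partial>UU)"
        by (intro lint_cong refl) (auto simp: indicator_def)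
      also have "\<dots> = measure UU (\<Union>i. A i) - measure UU (\<Union>i<n. A i)"
        using UU.P.bmeas_integrable[OF bi[OF Um]] UU.P.bmeas_integrable[OF bi[of "\<Union>i<n. A i"]] Am Um sets.sets_into_space[OF Um] sets.sets_into_space[of "\<Union>i<n. A i" UU]
        by (simp add: Int_absorb2)
      finally have "(\<integral>q. (indicator (\<Union>i. A i) q - indicator (\<Union>i<n. A i) q)^2 \<partial>UU) \<le> \<epsilon>" using n by linarith
      moreover have "null (indicator (\<Union>i<n. A i))" unfolding e[abs_def] using union(3) by (intro null_sum) auto
      ultimately show "\<exists>L'. null L' \<and> (\<integral>q. (indicator (\<Union>i. A i) q - L' q)^2 \<partial>UU) \<le> \<epsilon>" by blast
    qed
  qed
  define L where "L q = K (fst q) (snd q)" for q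
  have bL: "bmeas UU L" using K unfolding bm2_def L_def case_prod_unfold .
  obtain C where C: "\<And>q. q \<in> space UU \<Longrightarrow> norm (L q) \<le> C" using bmeas_bound[OF bL] by blast
  have "null L"
  proof (rule approx[OF bL])
    fix \<epsilon> :: real assume e: "\<epsilon> > 0"
    obtain k :: nat where k: "1 / real (Suc k) < sqrt \<epsilon>" using nat_approx_posE[of "sqrt \<epsilon>"] e by auto
    define I where "I = {- \<lceil>real (Suc k) * C\<rceil> - 1 .. \<lceil>real (Suc k) * C\<rceil>}"
    define lev where "lev i = {q \<in> space UU. \<lfloor>real (Suc k) * L q\<rfloor> = i}" for i
    have lev: "lev i \<in> sets UU" for i
    proof -
      have [measurable]: "L \<in> borel_measurable UU" by (rule bmeas_measurable[OF bL])
      show ?thesis unfolding lev_def by measurable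
    qed
    define T where "T q = (\<Sum>i\<in>I. real_of_int i / real (Suc k) * indicator (lev i) q)" for q
    have T: "T q = real_of_int \<lfloor>real (Suc k) * L q\<rfloor> / real (Suc k)" if q: "q \<in> space UU" for q
    proof -
      have rnd: "\<lfloor>y\<rfloor> \<in> {- \<lceil>D\<rceil> - 1..\<lceil>D\<rceil>}" if "\<bar>y\<bar> \<le> D" for y D :: real
        unfolding atLeastAtMost_iff using that by (intro conjI; linarith)
      have "\<bar>real (Suc k) * L q\<bar> \<le> real (Suc k) * C" using C[OF q] by (simp add: abs_mult)
      hence "\<lfloor>real (Suc k) * L q\<rfloor> \<in> I" unfolding I_def by (rule rnd)
      moreover have "T q = (\<Sum>i\<in>I. if i = \<lfloor>real (Suc k) * L q\<rfloor> then real_of_int i / real (Suc k) else 0)"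
        unfolding T_def using q by (intro sum.cong refl) (auto simp: lev_def)
      ultimately show ?thesis by (simp add: I_def)
    qed
    have "(\<integral>q. (L q - T q)^2 \<partial>UU) \<le> (\<integral>q. \<epsilon> \<partial>UU)"
    proof (rule UU.P.bmeas_integral_mono)
      show "bmeas UU (\<lambda>q. (L q - T q)^2)" unfolding T_def using lev
        by (intro bmeas_power bmeas_diff bL bmeas_sum bmeas_mult bmeas_const bi)
      fix q assume q: "q \<in> space UU"
      have "real (Suc k) * (L q - T q) = real (Suc k) * L q - \<lfloor>real (Suc k) * L q\<rfloor>" unfolding T[OF q] by (simp add: field_simps)
      hence "0 \<le> real (Suc k) * (L q - T q)" "real (Suc k) * (L q - T q) \<le> 1" by linarith+
      hence "0 \<le> L q - T q" "L q - T q \<le> 1 / real (Suc k)"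
        by (simp_all only: zero_le_mult_iff pos_le_divide_eq[OF of_nat_0_less_iff[THEN iffD2, OF zero_less_Suc]] mult.commute) auto
      hence "(L q - T q)^2 \<le> (sqrt \<epsilon>)^2" using k by (intro power_mono) auto
      thus "(L q - T q)^2 \<le> \<epsilon>" using e by simp
    qed simp
    moreover have "null T" unfolding T_def[abs_def] using lev ind unfolding setsE by (intro null_sum) auto
    ultimately show "\<exists>L'. null L' \<and> (\<integral>q. (L q - L' q)^2 \<partial>UU) \<le> \<epsilon>" using UU.P.prob_space by auto
  qed
  thus ?thesis unfolding null_def hs_pair[OF R K] by (simp add: r_def L_def)
qed

lemma kernel_zero_AE: "bm2 B \<Longrightarrow> hs B B = 0 \<longleftrightarrow> (AE q in UU. B (fst q) (snd q) = 0)"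
  using bm2_integrable[OF bm2_power, of B 2] unfolding hs_pair power2_eq_square[symmetric]
  by (subst integral_nonneg_eq_0_iff_AE) (auto simp: case_prod_unfold)

lemma kernel_zero_of_opr:
  assumes B: "bm2 B" and z: "\<And>\<phi>. bm1 \<phi> \<Longrightarrow> ip (opr B \<phi>) (opr B \<phi>) = 0"
  shows "hs B B = 0"
  using hs_tendsto_0[of "\<lambda>_. B" "hs B B" B] B z by (simp add: LIMSEQ_const_iff)

section \<open>The top eigenvector of a bounded symmetric kernel\<close>

text \<open>The kernel of the operator power \<open>k + 1\<close>.\<close>
primrec kpow :: "kernel \<Rightarrow> nat \<Rightarrow> real \<Rightarrow> real \<Rightarrow> real" where
  "kpow B 0 = B"
| "kpow B (Suc k) = kcomp B (kpow B k)"

context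
  fixes B :: kernel
  assumes B: "bm2 B" and symB: "sym2 B"
begin

lemma bm2_kpow [intro!]: "bm2 (kpow B k)"
  by (induction k) (auto intro: B)

lemma kpow_add: "x \<in> {0..1} \<Longrightarrow> y \<in> {0..1} \<Longrightarrow> kcomp (kpow B j) (kpow B k) x y = kpow B (j + k + 1) x y"
proof (induction j arbitrary: x)
  case (Suc j)
  have "kcomp (kpow B (Suc j)) (kpow B k) x y = kcomp B (kcomp (kpow B j) (kpow B k)) x y"
    using Suc.prems B by (simp add: kcomp_assoc bm2_kpow)
  also have "\<dots> = kcomp B (kpow B (j + k + 1)) x y"
    unfolding kcomp_def[of B] using Suc by (intro opr_cong refl) auto
  finally show ?case by simp
qed simp

lemma kpow_sym: "x \<in> {0..1} \<Longrightarrow> y \<in> {0..1} \<Longrightarrow> kpow B k x y = kpow B k y x"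
proof (induction k arbitrary: x y)
  case 0 thus ?case using symB by (simp add: sym2_def)
next
  case (Suc k)
  have "kpow B (Suc k) x y = kcomp (kpow B k) (kpow B 0) x y"
    using kpow_add[OF Suc.prems, of k 0] by simp
  also have "\<dots> = (\<I> z. kpow B k x z * B z y)" by (simp add: kcomp_def opr_def)
  also have "\<dots> = (\<I> z. B y z * kpow B k z x)"
    using Suc symB by (intro lint_cong refl) (auto simp: sym2_def)
  finally show ?case by (simp add: kcomp_def opr_def)
qed

text \<open>The trace of the operator power \<open>n + 2\<close>; for even \<open>n\<close> it is the squared Hilbert--Schmidt norm of a power.\<close>
definition trc :: "nat \<Rightarrow> real" where "trc n = (\<I> x. kpow B (n + 1) x x)"

lemma hs_kpow: "hs (kpow B j) (kpow B k) = trc (j + k)"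
proof -
  have "hs (kpow B j) (kpow B k) = (\<I> x. kcomp (kpow B j) (kpow B k) x x)"
    unfolding hs_def kcomp_def opr_def
    by (intro lint_cong refl) (auto simp: kpow_sym)
  also have "\<dots> = trc (j + k)" unfolding trc_def
    by (intro lint_cong refl) (simp add: kpow_add)
  finally show ?thesis .
qed

text \<open>The squared operator norm.\<close>
definition onorm2 :: real where "onorm2 = (SUP \<phi>\<in>{\<phi>. bm1 \<phi> \<and> ip \<phi> \<phi> = 1}. ip (opr B \<phi>) (opr B \<phi>))"

lemma onorm2_bdd: "bdd_above ((\<lambda>\<phi>. ip (opr B \<phi>) (opr B \<phi>)) ` {\<phi>. bm1 \<phi> \<and> ip \<phi> \<phi> = 1})"
proof (rule bdd_aboveI[of _ "hs B B"])
  fix r assume "r \<in> (\<lambda>\<phi>. ip (opr B \<phi>) (opr B \<phi>)) ` {\<phi>. bm1 \<phi> \<and> ip \<phi> \<phi> = 1}"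
  then obtain \<phi> where "r = ip (opr B \<phi>) (opr B \<phi>)" "bm1 \<phi>" "ip \<phi> \<phi> = 1" by auto
  thus "r \<le> hs B B" using opr_norm_le[OF B, of \<phi>] by simp
qed

lemma onorm2_bound:
  assumes "bm1 \<phi>" shows "ip (opr B \<phi>) (opr B \<phi>) \<le> onorm2 * ip \<phi> \<phi>"
proof (cases "ip \<phi> \<phi> = 0")
  case True
  thus ?thesis using opr_norm_le[OF B assms] by simp
next
  case False
  hence p: "ip \<phi> \<phi> > 0" using ip_self(2)[of \<phi>] by simp
  have "ip (opr B \<phi>) (opr B \<phi>) / ip \<phi> \<phi> \<le> onorm2"
    unfolding onorm2_def ip_normalize(3)[OF assms p, symmetric]
    using ip_normalize(1,2)[OF assms p] by (intro cSUP_upper onorm2_bdd) auto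
  thus ?thesis using p by (simp add: field_simps)
qed

text \<open>
  The Hilbert--Schmidt norms of the powers dominate the powers of the operator norm: the norms
  along an orbit are log-convex, so a large first step forces geometric growth.
\<close>
lemma onorm2_pow_le: "onorm2 \<ge> 0" "onorm2 ^ (k + 1) \<le> trc (2 * k)"
proof -
  have tr0: "trc (2 * k) \<ge> 0" for k using hs_kpow[of k k] hs_self(2)[of "kpow B k"] by (simp add: mult_2)
  have one: "bm1 (\<lambda>_. 1)" "ip (\<lambda>_. 1) (\<lambda>_. 1) = 1" by (auto simp: ip_def)
  show "onorm2 \<ge> 0"
    using onorm2_bound[OF one(1)] one(2) ip_self(2)[of "opr B (\<lambda>_. 1)"] by simp
  have key: "ip (opr B \<phi>) (opr B \<phi>) ^ (k + 1) \<le> trc (2 * k)" if f: "bm1 \<phi>" "ip \<phi> \<phi> = 1" for \<phi>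
  proof -
    define F where "F i = (opr B ^^ i) \<phi>" for i
    have F: "bm1 (F i)" "F (Suc i) = opr B (F i)" "F 0 = \<phi>" for i
      by (auto simp: F_def) (induction i, auto intro: f B)
    define s where "s i = ip (F i) (F i)" for i
    define \<rho> where "\<rho> = s 1"
    have s: "s i \<ge> 0" "s 0 = 1" for i by (auto simp: s_def ip_self(2) F f)
    have lc: "(s (Suc i))^2 \<le> s i * s (Suc (Suc i))" for i
    proof -
      have "s (Suc i) = ip (F i) (F (Suc (Suc i)))"
        unfolding s_def F(2) by (rule opr_selfadjoint[OF B symB F(1)]) (auto intro: B F)
      thus ?thesis unfolding s_def using ip_cs[OF F(1)[of i] F(1)[of "Suc (Suc i)"]] by simp
    qed
    have step: "\<rho> * s i \<le> s (Suc i)" for i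
    proof (induction i)
      case 0 show ?case by (simp add: \<rho>_def s)
    next
      case (Suc i)
      show ?case
      proof (cases "s (Suc i) = 0")
        case True thus ?thesis using s by simp
      next
        case False
        hence p: "s (Suc i) > 0" using s(1)[of "Suc i"] by simp
        have "\<rho> * s (Suc i) * s i \<le> s (Suc i) * s (Suc i)"
          using mult_right_mono[OF Suc, of "s (Suc i)"] p by (simp add: mult_ac)
        also have "\<dots> \<le> s (Suc (Suc i)) * s i" using lc[of i] by (simp add: power2_eq_square mult_ac)
        finally have *: "\<rho> * s (Suc i) * s i \<le> s (Suc (Suc i)) * s i" .
        have "s i > 0"
        proof (rule ccontr)
          assume "\<not> s i > 0"
          hence "s i = 0" using s(1)[of i] by simp
          thus False using lc[of i] p by simp
        qed
        thus ?thesis using * by simp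
      qed
    qed
    have grow: "\<rho> ^ i \<le> s i" for i
    proof (induction i)
      case (Suc i)
      have "\<rho> * \<rho> ^ i \<le> \<rho> * s i" using Suc s(1)[of 1] by (intro mult_left_mono) (auto simp: \<rho>_def)
      thus ?case using step[of i] by simp
    qed (simp add: s)
    have op: "x \<in> {0..1} \<Longrightarrow> opr (kpow B i) \<phi> x = F (Suc i) x" for i x
    proof (induction i arbitrary: x)
      case (Suc i)
      have "opr (kpow B (Suc i)) \<phi> x = opr B (opr (kpow B i) \<phi>) x"
        using Suc.prems by (simp add: opr_kcomp B bm2_kpow f)
      also have "\<dots> = opr B (F (Suc i)) x" using Suc by (intro opr_cong) auto
      finally show ?case by (simp add: F(2))
    qed (simp add: F)
    have "\<rho> ^ (k + 1) \<le> s (Suc k)" using grow[of "Suc k"] by simp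
    also have "s (Suc k) = ip (opr (kpow B k) \<phi>) (opr (kpow B k) \<phi>)"
      unfolding s_def by (intro ip_cong) (simp_all add: op)
    also have "\<dots> \<le> trc (2 * k)" using opr_norm_le[OF bm2_kpow f(1), of k] f(2) hs_kpow[of k k] by (simp add: mult_2)
    finally show ?thesis by (simp add: \<rho>_def s_def F)
  qed
  have "onorm2 \<le> root (k + 1) (trc (2 * k))"
    unfolding onorm2_def
  proof (rule cSUP_least)
    show "{\<phi>. bm1 \<phi> \<and> ip \<phi> \<phi> = 1} \<noteq> {}" using one by blast
    fix \<phi> assume "\<phi> \<in> {\<phi>. bm1 \<phi> \<and> ip \<phi> \<phi> = 1}"
    hence f: "bm1 \<phi>" "ip \<phi> \<phi> = 1" by auto
    have "ip (opr B \<phi>) (opr B \<phi>) = root (k + 1) (ip (opr B \<phi>) (opr B \<phi>) ^ (k + 1))"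
      by (rule real_root_power_cancel[symmetric]) (simp_all add: ip_self(2))
    also have "\<dots> \<le> root (k + 1) (trc (2 * k))" by (rule real_root_le_mono[OF _ key[OF f]]) simp
    finally show "ip (opr B \<phi>) (opr B \<phi>) \<le> root (k + 1) (trc (2 * k))" .
  qed
  hence "onorm2 ^ (k + 1) \<le> root (k + 1) (trc (2 * k)) ^ (k + 1)" using \<open>onorm2 \<ge> 0\<close> by (intro power_mono)
  also have "\<dots> = trc (2 * k)" by (rule real_root_pow_pos2) (simp_all add: tr0)
  finally show "onorm2 ^ (k + 1) \<le> trc (2 * k)" .
qed

text \<open>The operator norm bounds the effect of \<open>B\<close> on each column of a power.\<close>
lemma tr_Suc_le: "trc (2 * Suc k) \<le> onorm2 * trc (2 * k)"
proof -
  have c: "ip (opr B (\<lambda>z. kpow B k z y)) (opr B (\<lambda>z. kpow B k z y)) \<le> onorm2 * ip (\<lambda>z. kpow B k z y) (\<lambda>z. kpow B k z y)"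
    if "y \<in> {0..1}" for y
    by (rule onorm2_bound[OF bm2_col[OF bm2_kpow that]])
  have colsum: "trc (2 * i) = (\<I> y. (\<I> x. (kpow B i x y)^2))" for i
    using hs_kpow[of i i] bm2_fubini[OF bm2_power[OF bm2_kpow[of i], of 2]] by (simp add: hs_self mult_2)
  have "trc (2 * Suc k) = (\<I> y. ip (opr B (\<lambda>z. kpow B k z y)) (opr B (\<lambda>z. kpow B k z y)))"
    unfolding colsum by (simp add: ip_self kcomp_def)
  also have "\<dots> \<le> (\<I> y. onorm2 * ip (\<lambda>z. kpow B k z y) (\<lambda>z. kpow B k z y))"
  proof (rule U.bmeas_integral_mono)
    have bc: "bm1 (\<lambda>y. \<I> x. (kpow B i x y)^2)" for i
      by (rule bm1_integral[OF bm2_swap[OF bm2_power[OF bm2_kpow]]])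
    show "bm1 (\<lambda>y. ip (opr B (\<lambda>z. kpow B k z y)) (opr B (\<lambda>z. kpow B k z y)))"
      using bc[of "Suc k"] by (simp add: ip_self kcomp_def)
    show "bm1 (\<lambda>y. onorm2 * ip (\<lambda>z. kpow B k z y) (\<lambda>z. kpow B k z y))"
      unfolding ip_self(1) by (intro bmeas_mult bmeas_const bc)
    fix y assume "y \<in> space unit_leb"
    thus "ip (opr B (\<lambda>z. kpow B k z y)) (opr B (\<lambda>z. kpow B k z y)) \<le> onorm2 * ip (\<lambda>z. kpow B k z y) (\<lambda>z. kpow B k z y)"
      by (intro c) simp
  qed
  also have "\<dots> = onorm2 * trc (2 * k)" unfolding colsum by (simp add: ip_self)
  finally show ?thesis .
qed

text \<open>  Power iteration. With \<open>m\<close> the squared operator norm, the kernels \<open>P k = B^(2 k + 2) / m^(k + 1)\<close> have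
  inner products \<open>b (j + k + 1)\<close>, where \<open>b\<close> is decreasing and at least 1. Hence \<open>P\<close> is Cauchy in the
  Hilbert--Schmidt norm, and since a further factor \<open>B\<close> on both sides turns this norm into a uniform bound, it
  converges pointwise and boundedly to a kernel \<open>Q\<close> with \<open>B^2 Q = m Q\<close> and norm at least 1. A non-zero column \<open>g\<close>
  of \<open>Q\<close> gives the eigenfunction \<open>B g + sqrt m * g\<close> for \<open>sqrt m\<close>, unless this vanishes and \<open>g\<close> is an eigenfunction
  for \<open>- sqrt m\<close>.\<close>
lemma top_eigenvector:
  assumes nz: "hs B B \<noteq> 0"
  obtains e \<mu> where "\<mu> \<noteq> 0" "bm1 e" "ip e e = 1" "\<And>x. x \<in> {0..1} \<Longrightarrow> opr B e x = \<mu> * e x"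
    "\<And>\<phi>. bm1 \<phi> \<Longrightarrow> ip (opr B \<phi>) (opr B \<phi>) \<le> \<mu>\<^sup>2 * ip \<phi> \<phi>"
proof -
  define m where "m = onorm2"
  have m: "m > 0"
  proof (rule ccontr)
    assume "\<not> m > 0"
    hence "m = 0" using onorm2_pow_le(1) by (simp add: m_def)
    hence "ip (opr B \<phi>) (opr B \<phi>) = 0" if "bm1 \<phi>" for \<phi>
      using onorm2_bound[OF that] ip_self(2)[of "opr B \<phi>"] by (simp add: m_def)
    thus False using kernel_zero_of_opr[OF B] nz by blast
  qed
  define b where "b k = trc (2 * k) / m ^ (k + 1)" for k
  have b1: "b k \<ge> 1" for k using onorm2_pow_le(2)[of k] m by (simp add: b_def m_def)
  have bdec: "decseq b"
  proof (rule decseq_SucI)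
    fix k
    have "b (Suc k) \<le> (m * trc (2 * k)) / m ^ (Suc k + 1)"
      unfolding b_def using tr_Suc_le[of k] m by (intro divide_right_mono) (auto simp: m_def)
    also have "\<dots> = b k" using m by (simp add: b_def)
    finally show "b (Suc k) \<le> b k" .
  qed
  obtain L where L: "b \<longlonglongrightarrow> L" using decseq_convergent[OF bdec, of 1] b1 by blast
  have L1: "L \<ge> 1" by (rule LIMSEQ_le_const[OF L]) (use b1 in auto)
  define P where "P k x y = kpow B (2 * k + 1) x y / m ^ (k + 1)" for k x y
  have bP: "bm2 (P k)" for k unfolding P_def[abs_def] by (intro bm2_divide bm2_kpow)
  have hP: "hs (P j) (P k) = b (j + k + 1)" for j k
  proof -
    have "hs (P j) (P k) = hs (kpow B (2 * j + 1)) (kpow B (2 * k + 1)) / (m ^ (j + 1) * m ^ (k + 1))"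
      by (simp add: hs_def P_def)
    also have "\<dots> = trc (2 * (j + k + 1)) / m ^ (j + k + 1 + 1)"
      unfolding hs_kpow by (simp add: power_add[symmetric] algebra_simps)
    finally show ?thesis by (simp only: b_def)
  qed
  obtain C where C: "C > 0" "\<And>x y. x \<in> {0..1} \<Longrightarrow> y \<in> {0..1} \<Longrightarrow> \<bar>B x y\<bar> \<le> C" using bm2_bound[OF B] by blast
  have sq: "(\<I> y. (B x y)^2) \<le> C^2" "(\<I> y. (B y x)^2) \<le> C^2" if x: "x \<in> {0..1}" for x
  proof -
    have "(\<I> y. (B x y)^2) \<le> (\<I> y. C^2)"
    proof (rule U.bmeas_integral_mono)
      show "bm1 (\<lambda>y. (B x y)^2)" using bm2_row[OF B x] by auto
      fix y :: real assume "y \<in> space unit_leb"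
      thus "(B x y)^2 \<le> C^2" using power_mono[OF C(2)[OF x] abs_ge_zero, of y 2] by simp
    qed simp
    thus "(\<I> y. (B x y)^2) \<le> C^2" by simp
    moreover have "(\<I> y. (B y x)^2) = (\<I> y. (B x y)^2)"
      using symB x by (intro lint_cong refl) (auto simp: sym2_def)
    ultimately show "(\<I> y. (B y x)^2) \<le> C^2" by simp
  qed
  have smooth: "(kcomp B (kcomp D B) x y)^2 \<le> C ^ 4 * hs D D" if D: "bm2 D" and xy: "x \<in> {0..1}" "y \<in> {0..1}" for D x y
  proof -
    define g where "g z = opr D (\<lambda>w. B w y) z" for z
    have bg: "bm1 g" unfolding g_def[abs_def] using D B bm2_col[OF B xy(2)] by auto
    have "(kcomp B (kcomp D B) x y)^2 = (opr B g x)^2" by (simp add: kcomp_def g_def[abs_def])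
    also have "\<dots> \<le> (\<I> y. (B x y)^2) * ip g g" by (rule opr_cs[OF B bg xy(1)])
    also have "\<dots> \<le> C^2 * (hs D D * C^2)"
    proof (rule mult_mono)
      have "ip g g \<le> hs D D * ip (\<lambda>w. B w y) (\<lambda>w. B w y)"
        unfolding g_def[abs_def] by (rule opr_norm_le[OF D bm2_col[OF B xy(2)]])
      also have "\<dots> \<le> hs D D * C^2" using sq(2)[OF xy(2)] hs_self(2)[of D] by (intro mult_left_mono) (simp_all add: ip_self)
      finally show "ip g g \<le> hs D D * C^2" .
    qed (use sq(1)[OF xy(1)] ip_self(2) in auto)
    finally show ?thesis by (simp add: power2_eq_square power4_eq_xxxx mult_ac)
  qed
  have PS: "P (Suc k) x y = kcomp B (kcomp (P k) B) x y / m" if "x \<in> {0..1}" "y \<in> {0..1}" for k x y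
  proof -
    have "kcomp (P k) B z y = kpow B (2 * k + 2) z y / m ^ (k + 1)" if z: "z \<in> {0..1}" for z
      using kpow_add[OF z \<open>y \<in> {0..1}\<close>, of "2 * k + 1" 0] by (simp add: kcomp_def opr_def P_def)
    hence "kcomp B (kcomp (P k) B) x y = opr B (\<lambda>z. kpow B (2 * k + 2) z y / m ^ (k + 1)) x"
      unfolding kcomp_def[of B] by (intro opr_cong refl)
    also have "\<dots> = kpow B (2 * k + 3) x y / m ^ (k + 1)"
      by (simp add: opr_def kcomp_def numeral_3_eq_3)
    finally show ?thesis using m by (simp add: P_def numeral_3_eq_3)
  qed
  have hdiff: "hs (\<lambda>x y. P j x y - P k x y) (\<lambda>x y. P j x y - P k x y) = b (2 * j + 1) - 2 * b (j + k + 1) + b (2 * k + 1)" for j k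
    unfolding hs_diff[OF bP bP] hP by (simp only: mult_2[of j] mult_2[of k])
  have PSd: "(P (Suc j) x y - P (Suc k) x y)^2 \<le> C ^ 4 / m^2 * (b (2 * j + 1) - 2 * b (j + k + 1) + b (2 * k + 1))"
    if xy: "x \<in> {0..1}" "y \<in> {0..1}" for j k x y
  proof -
    let ?D = "\<lambda>x y. P j x y - P k x y"
    have "kcomp ?D B z y = kcomp (P j) B z y - kcomp (P k) B z y" if z: "z \<in> {0..1}" for z
      using bm2_row[OF bP z] bm2_col[OF B xy(2)]
      unfolding kcomp_def opr_def left_diff_distrib
      by (intro lint_diff bm1_integrable bmeas_mult)
    hence "kcomp B (kcomp ?D B) x y = opr B (\<lambda>z. kcomp (P j) B z y - kcomp (P k) B z y) x"
      unfolding kcomp_def[of B] by (intro opr_cong refl)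
    also have "\<dots> = kcomp B (kcomp (P j) B) x y - kcomp B (kcomp (P k) B) x y"
      using bm2_row[OF B xy(1)] bm2_col[OF bm2_kcomp[OF bP B] xy(2)]
      unfolding kcomp_def[of B] unfolding opr_def right_diff_distrib
      by (intro lint_diff bm1_integrable bmeas_mult)
    finally have "P (Suc j) x y - P (Suc k) x y = kcomp B (kcomp ?D B) x y / m"
      using PS[OF xy] by (simp add: diff_divide_distrib)
    hence "(P (Suc j) x y - P (Suc k) x y)^2 = (kcomp B (kcomp ?D B) x y)^2 / m^2" by (simp add: power_divide)
    also have "\<dots> \<le> C ^ 4 * hs ?D ?D / m^2" by (intro divide_right_mono smooth xy bm2_diff bP) simp
    finally show ?thesis unfolding hdiff by simp
  qed
  have conv: "convergent (\<lambda>k. P k x y)" if xy: "x \<in> {0..1}" "y \<in> {0..1}" for x y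
  proof -
    have "Cauchy (\<lambda>k. P (Suc k) x y)"
    proof (rule metric_CauchyI)
      fix e :: real assume e: "e > 0"
      define \<delta> where "\<delta> = e^2 * m^2 / (2 * C ^ 4)"
      have d: "\<delta> > 0" using e m C by (simp add: \<delta>_def)
      obtain N where N: "\<And>n. n \<ge> N \<Longrightarrow> \<bar>b n - L\<bar> < \<delta> / 4" using LIMSEQ_D[OF L, of "\<delta> / 4"] d by auto
      show "\<exists>M. \<forall>j\<ge>M. \<forall>k\<ge>M. dist (P (Suc j) x y) (P (Suc k) x y) < e"
      proof (intro exI[of _ N] allI impI)
        fix j k assume jk: "j \<ge> N" "k \<ge> N"
        have "b (2 * j + 1) - 2 * b (j + k + 1) + b (2 * k + 1) \<le> \<delta>"
          using N[of "2 * j + 1"] N[of "j + k + 1"] N[of "2 * k + 1"] jk by linarith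
        hence "C ^ 4 / m^2 * (b (2 * j + 1) - 2 * b (j + k + 1) + b (2 * k + 1)) \<le> C ^ 4 / m^2 * \<delta>"
          by (intro mult_left_mono) auto
        also have "C ^ 4 / m^2 * \<delta> = e^2 / 2" using C(1) m by (simp add: \<delta>_def)
        finally have "(P (Suc j) x y - P (Suc k) x y)^2 < e\<^sup>2" using PSd[OF xy, of j k] e by (smt (verit) zero_less_power field_sum_of_halves)
        hence "\<bar>P (Suc j) x y - P (Suc k) x y\<bar> < e" using e by (intro power2_less_imp_less[of _ e]) auto
        thus "dist (P (Suc j) x y) (P (Suc k) x y) < e" by (simp add: dist_real_def)
      qed
    qed
    hence "convergent (\<lambda>k. P (Suc k) x y)" by (simp add: Cauchy_convergent_iff)
    thus ?thesis using convergent_Suc_iff[of "\<lambda>k. P k x y"] by simp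
  qed
  define Q where "Q x y = lim (\<lambda>k. P (Suc k) x y)" for x y
  have PQ: "(\<lambda>k. P (Suc k) x y) \<longlonglongrightarrow> Q x y" if xy: "x \<in> {0..1}" "y \<in> {0..1}" for x y
    using conv[OF xy] convergent_Suc_iff[of "\<lambda>k. P k x y"] unfolding Q_def by (simp add: convergent_LIMSEQ_iff)
  define M where "M = sqrt (C ^ 4 / m^2 * b 0)"
  have PM: "\<bar>P (Suc k) x y\<bar> \<le> M" if xy: "x \<in> {0..1}" "y \<in> {0..1}" for k x y
  proof -
    have "(P (Suc k) x y)^2 = (kcomp B (kcomp (P k) B) x y)^2 / m^2" by (simp add: PS[OF xy] power_divide)
    also have "\<dots> \<le> C ^ 4 * hs (P k) (P k) / m^2" by (intro divide_right_mono smooth xy bP) simp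
    also have "\<dots> \<le> C ^ 4 * b 0 / m^2" unfolding hP using C(1) decseqD[OF bdec, of 0 "k + k + 1"]
      by (intro divide_right_mono mult_left_mono) auto
    finally show ?thesis unfolding M_def by (intro real_le_rsqrt) simp
  qed
  have QM: "\<bar>Q x y\<bar> \<le> M" if xy: "x \<in> {0..1}" "y \<in> {0..1}" for x y
    by (rule LIMSEQ_le_const2[OF tendsto_rabs[OF PQ[OF xy]]]) (use PM[OF xy] in auto)
  have bQ: "bm2 Q" unfolding bm2_def
  proof (rule bmeasI[where C=M])
    show "(\<lambda>(x, y). Q x y) \<in> borel_measurable UU"
    proof (rule borel_measurable_LIMSEQ_real)
      show "(\<lambda>k. (\<lambda>(x, y). P (Suc k) x y) q) \<longlonglongrightarrow> (\<lambda>(x, y). Q x y) q" if "q \<in> space UU" for q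
        using that PQ by (auto simp: space_pair_measure)
      show "(\<lambda>(x, y). P (Suc k) x y) \<in> borel_measurable UU" for k using bP[of "Suc k"] unfolding bm2_def by (rule bmeas_measurable)
    qed
  qed (use QM in \<open>auto simp: space_pair_measure\<close>)
  have opr_lim: "(\<lambda>k. opr B (F k) x) \<longlonglongrightarrow> opr B f x"
    if x: "x \<in> {0..1}" and F: "\<And>k. bm1 (F k)" "bm1 f" "\<And>z. z \<in> {0..1} \<Longrightarrow> (\<lambda>k. F k z) \<longlonglongrightarrow> f z"
      "\<And>k z. z \<in> {0..1} \<Longrightarrow> \<bar>F k z\<bar> \<le> M'" for x F f M'
    unfolding opr_def
  proof (rule integral_dominated_convergence[where w="\<lambda>_. C * M'"])
    show "(\<lambda>y. B x y * f y) \<in> borel_measurable unit_leb" "\<And>i. (\<lambda>y. B x y * F i y) \<in> borel_measurable unit_leb"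
      using bm2_row[OF B x] F(1,2) by (auto intro!: bmeas_measurable)
    show "AE y in unit_leb. (\<lambda>i. B x y * F i y) \<longlonglongrightarrow> B x y * f y" by (rule AE_I2) (auto intro!: tendsto_intros F)
    show "AE y in unit_leb. norm (B x y * F i y) \<le> C * M'" for i
    proof (rule AE_I2)
      fix y assume "y \<in> space unit_leb"
      hence y: "y \<in> {0..1}" by simp
      show "norm (B x y * F i y) \<le> C * M'" using C(2)[OF x y] F(4)[OF y, of i] C(1)
        by (auto simp: abs_mult intro!: mult_mono)
    qed
  qed simp
  have Qeig: "opr B (opr B (\<lambda>z. Q z y)) x = m * Q x y" if xy: "x \<in> {0..1}" "y \<in> {0..1}" for x y
  proof -
    have l1: "(\<lambda>k. opr B (\<lambda>w. P (Suc k) w y) z) \<longlonglongrightarrow> opr B (\<lambda>w. Q w y) z" if z: "z \<in> {0..1}" for z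
      by (rule opr_lim[where M'=M]) (use z xy PQ PM bm2_col[OF bP] bm2_col[OF bQ] in auto)
    have bd: "\<bar>opr B (\<lambda>w. P (Suc k) w y) z\<bar> \<le> C * M" if z: "z \<in> {0..1}" for k z
    proof -
      have "\<bar>opr B (\<lambda>w. P (Suc k) w y) z\<bar> \<le> (\<I> w. \<bar>B z w * P (Suc k) w y\<bar>)"
        unfolding opr_def by (rule integral_abs_bound)
      also have "\<dots> \<le> (\<I> w. C * M)"
      proof (rule U.bmeas_integral_mono)
        show "bm1 (\<lambda>w. \<bar>B z w * P (Suc k) w y\<bar>)" using bm2_row[OF B z] bm2_col[OF bP xy(2)] by auto
        fix w assume "w \<in> space unit_leb"
        hence w: "w \<in> {0..1}" by simp
        show "\<bar>B z w * P (Suc k) w y\<bar> \<le> C * M" using C(2)[OF z w] PM[OF w xy(2), of k] C(1)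
          by (auto simp: abs_mult intro!: mult_mono)
      qed simp
      finally show ?thesis by simp
    qed
    have "(\<lambda>k. opr B (opr B (\<lambda>w. P (Suc k) w y)) x) \<longlonglongrightarrow> opr B (opr B (\<lambda>w. Q w y)) x"
      by (rule opr_lim[where M'="C * M"]) (use xy l1 bd bm2_col[OF bP] bm2_col[OF bQ] B in auto)
    moreover have "opr B (opr B (\<lambda>w. P (Suc k) w y)) x = m * P (Suc (Suc k)) x y" for k
    proof -
      have "opr B (opr B (\<lambda>w. P (Suc k) w y)) x = kpow B (2 * Suc k + 3) x y / m ^ (Suc k + 1)"
        by (simp add: P_def opr_def kcomp_def numeral_3_eq_3)
      thus ?thesis using m by (simp add: P_def numeral_3_eq_3)
    qed
    moreover have "(\<lambda>k. m * P (Suc (Suc k)) x y) \<longlonglongrightarrow> m * Q x y"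
      by (intro tendsto_mult tendsto_const LIMSEQ_Suc[OF PQ[OF xy]])
    ultimately show ?thesis using LIMSEQ_unique by simp
  qed
  have "hs Q Q \<ge> 1"
  proof -
    have e: "hs A A = (\<integral>q. (A (fst q) (snd q))^2 \<partial>UU)" if "bm2 A" for A
      unfolding hs_self using that by (subst bm2_pair[of "\<lambda>x y. (A x y)^2"]) auto
    have "(\<lambda>k. hs (P (Suc k)) (P (Suc k))) \<longlonglongrightarrow> hs Q Q"
      unfolding e[OF bP] e[OF bQ]
    proof (rule integral_dominated_convergence[where w="\<lambda>_. M^2"])
      show "(\<lambda>q. (Q (fst q) (snd q))^2) \<in> borel_measurable UU" "\<And>k. (\<lambda>q. (P (Suc k) (fst q) (snd q))^2) \<in> borel_measurable UU"
        using bQ bP unfolding bm2_def case_prod_unfold by (auto intro!: bmeas_measurable)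
      show "AE q in UU. (\<lambda>k. (P (Suc k) (fst q) (snd q))^2) \<longlonglongrightarrow> (Q (fst q) (snd q))\<^sup>2"
        by (rule AE_I2) (auto simp: space_pair_measure intro!: tendsto_power PQ)
      show "AE q in UU. norm ((P (Suc k) (fst q) (snd q))^2) \<le> M^2" for k
      proof (rule AE_I2)
        fix q assume "q \<in> space UU"
        hence "\<bar>P (Suc k) (fst q) (snd q)\<bar> \<le> M" by (intro PM) (auto simp: space_pair_measure)
        from power_mono[OF this abs_ge_zero, of 2] show "norm ((P (Suc k) (fst q) (snd q))^2) \<le> M^2" by simp
      qed
    qed simp
    thus ?thesis unfolding hP by (rule LIMSEQ_le_const) (use b1 in auto)
  qed
  moreover have "hs Q Q = (\<I> y. ip (\<lambda>x. Q x y) (\<lambda>x. Q x y))"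
    unfolding hs_self ip_self using bm2_fubini[OF bm2_power[OF bQ, of 2]] by simp
  ultimately have "\<exists>y\<in>{0..1}. ip (\<lambda>x. Q x y) (\<lambda>x. Q x y) \<noteq> 0"
    using lint_cong[of unit_leb unit_leb "\<lambda>y. ip (\<lambda>x. Q x y) (\<lambda>x. Q x y)" "\<lambda>_. 0"] by fastforce
  then obtain y where y: "y \<in> {0..1}" "ip (\<lambda>x. Q x y) (\<lambda>x. Q x y) \<noteq> 0" by blast
  define g where "g x = Q x y" for x
  have bg: "bm1 g" unfolding g_def by (rule bm2_col[OF bQ y(1)])
  have gg: "ip g g \<noteq> 0" using y(2) by (simp add: g_def[abs_def])
  have geig: "opr B (opr B g) x = m * g x" if "x \<in> {0..1}" for x using Qeig[OF that y(1)] by (simp add: g_def[abs_def])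
  define s where "s = sqrt m"
  have s: "s > 0" "s * s = m" using m by (auto simp: s_def)
  have "\<exists>f \<mu>. \<mu>\<^sup>2 = m \<and> bm1 f \<and> ip f f \<noteq> 0 \<and> (\<forall>x\<in>{0..1}. opr B f x = \<mu> * f x)"
  proof -
    define f where "f x = opr B g x + s * g x" for x
    have bf: "bm1 f" unfolding f_def[abs_def] using B bg by auto
    have bBg: "bm1 (opr B g)" using B bg by auto
    show ?thesis
    proof (cases "ip f f = 0")
      case False
      have "opr B f x = s * f x" if x: "x \<in> {0..1}" for x
      proof -
        have "opr B f x = opr B (opr B g) x + s * opr B g x"
          unfolding opr_def[of B f] f_def distrib_left
          using bm2_row[OF B x] bBg bg
          by (subst lint_add) (auto intro!: bm1_integrable simp: opr_def[of B g x] opr_def[of B "opr B g" x] mult.left_commute)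
        also have "\<dots> = s * f x" using geig[OF x] s(2) by (simp add: f_def algebra_simps)
        finally show ?thesis .
      qed
      thus ?thesis using bf False s by (intro exI[of _ f] exI[of _ s]) (auto simp: power2_eq_square)
    next
      case True
      hence "AE x in unit_leb. (f x)^2 = 0"
        using bf unfolding ip_self by (subst (asm) integral_nonneg_eq_0_iff_AE) (auto intro!: bm1_integrable)
      hence ae: "AE x in unit_leb. opr B g x = - s * g x" by (rule AE_mp) (auto simp: f_def)
      have "opr B g x = - s * g x" if x: "x \<in> {0..1}" for x
      proof -
        have "m * g x = opr B (\<lambda>x. - s * g x) x"
          unfolding geig[OF x, symmetric]
          by (rule opr_cong_AE[OF B x _ _ ae]) (use bBg bg in \<open>auto intro!: bmeas_measurable\<close>)
        also have "\<dots> = - s * opr B g x" by (simp add: opr_def mult.left_commute)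
        finally have "s * (s * g x) = s * (- opr B g x)" unfolding s(2)[symmetric] by simp
        hence "s * (s * g x + opr B g x) = 0" by (simp add: distrib_left)
        hence "s * g x + opr B g x = 0" using s(1) by (simp only: mult_eq_0_iff) simp
        thus ?thesis by simp
      qed
      thus ?thesis using bg gg s by (intro exI[of _ g] exI[of _ "- s"]) (auto simp: power2_eq_square)
    qed
  qed
  then obtain f \<mu> where f: "\<mu>\<^sup>2 = m" "bm1 f" "ip f f \<noteq> 0" "\<And>x. x \<in> {0..1} \<Longrightarrow> opr B f x = \<mu> * f x" by blast
  have fp: "ip f f > 0" using f(3) ip_self(2)[of f] by simp
  show thesis
  proof (rule that[of \<mu> "\<lambda>x. f x / sqrt (ip f f)"])
    show "\<mu> \<noteq> 0" using f(1) m by auto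
    show "bm1 (\<lambda>x. f x / sqrt (ip f f))" "ip (\<lambda>x. f x / sqrt (ip f f)) (\<lambda>x. f x / sqrt (ip f f)) = 1"
      by (rule ip_normalize[OF f(2) fp])+
    show "opr B (\<lambda>x. f x / sqrt (ip f f)) x = \<mu> * (f x / sqrt (ip f f))" if "x \<in> {0..1}" for x
      using f(4)[OF that] by (simp add: opr_def)
    show "ip (opr B \<phi>) (opr B \<phi>) \<le> \<mu>\<^sup>2 * ip \<phi> \<phi>" if "bm1 \<phi>" for \<phi>
      using onorm2_bound[OF that] f(1) by (simp add: m_def)
  qed
qed

end


section \<open>Completeness in mean square\<close>

text \<open>The increments are summable in mean, so their series converges absolutely almost everywhere.\<close>
lemma (in prob_space) AE_convergent_of_fast_L2:
  fixes X :: "nat \<Rightarrow> 'a \<Rightarrow> real"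
  assumes m: "\<And>k. X k \<in> borel_measurable M"
    and fast: "\<And>k. (\<integral>\<^sup>+x. ennreal ((X (Suc k) x - X k x)^2) \<partial>M) \<le> ennreal ((1/4) ^ k)"
  obtains Y where "Y \<in> borel_measurable M" "AE x in M. (\<lambda>k. X k x) \<longlonglongrightarrow> Y x"
proof -
  define D where "D k x = \<bar>X (Suc k) x - X k x\<bar>" for k x
  have mD: "D k \<in> borel_measurable M" for k unfolding D_def[abs_def] using m by measurable
  have D1: "(\<integral>\<^sup>+x. ennreal (D k x) \<partial>M) \<le> ennreal ((1/2) ^ k)" for k
  proof -
    have "(\<integral>\<^sup>+x. ennreal (D k x) \<partial>M) \<le> (\<integral>\<^sup>+x. ennreal ((1/2) ^ k / 2) + ennreal (2 ^ k / 2) * ennreal ((X (Suc k) x - X k x)^2) \<partial>M)"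
    proof (rule nn_integral_mono)
      fix x
      define y where "y = D k x"
      have p: "(1/2 :: real) ^ k * 2 ^ k = 1" by (simp add: power_mult_distrib[symmetric])
      \<comment> \<open>The arithmetic-geometric inequality, weighted so that both terms have mean of order \<open>2^(-k)\<close>.\<close>
      have "0 \<le> ((1/2) ^ k - y)^2 * 2 ^ k" by simp
      also have "\<dots> = ((1/2) ^ k * 2 ^ k) * (1/2) ^ k - 2 * ((1/2) ^ k * 2 ^ k) * y + 2 ^ k * y^2"
        by (simp add: power2_eq_square algebra_simps)
      finally have "y \<le> (1/2) ^ k / 2 + 2 ^ k / 2 * y^2" unfolding p by simp
      hence "ennreal y \<le> ennreal ((1/2) ^ k / 2 + 2 ^ k / 2 * y^2)" by (rule ennreal_leI)
      thus "ennreal (D k x) \<le> ennreal ((1/2) ^ k / 2) + ennreal (2 ^ k / 2) * ennreal ((X (Suc k) x - X k x)^2)"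
        by (simp add: y_def D_def ennreal_plus[symmetric] ennreal_mult[symmetric] del: ennreal_plus)
    qed
    also have "\<dots> = ennreal ((1/2) ^ k / 2) + ennreal (2 ^ k / 2) * (\<integral>\<^sup>+x. ennreal ((X (Suc k) x - X k x)^2) \<partial>M)"
      using m by (subst nn_integral_add) (auto simp: nn_integral_cmult emeasure_space_1)
    also have "\<dots> \<le> ennreal ((1/2) ^ k / 2) + ennreal (2 ^ k / 2) * ennreal ((1/4) ^ k)"
      by (intro add_left_mono mult_left_mono fast) simp
    also have "\<dots> = ennreal ((1/2) ^ k / 2 + 2 ^ k / 2 * (1/4) ^ k)"
      by (simp add: ennreal_plus[symmetric] ennreal_mult[symmetric] del: ennreal_plus)
    also have "(2::real) ^ k / 2 * (1/4) ^ k = (1/2) ^ k / 2"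
      by (simp add: power_mult_distrib[symmetric])
    finally show ?thesis by simp
  qed
  have "(\<integral>\<^sup>+x. (\<Sum>k. ennreal (D k x)) \<partial>M) = (\<Sum>k. \<integral>\<^sup>+x. ennreal (D k x) \<partial>M)"
    using mD by (intro nn_integral_suminf) auto
  also have "\<dots> \<le> (\<Sum>k. ennreal ((1/2) ^ k))" by (intro suminf_le D1) auto
  also have "\<dots> = ennreal (\<Sum>k. (1/2) ^ k)" by (rule suminf_ennreal2) (auto intro: summable_geometric)
  finally have "(\<integral>\<^sup>+x. (\<Sum>k. ennreal (D k x)) \<partial>M) < \<infinity>" by (simp add: order_le_less_trans)
  hence "AE x in M. (\<Sum>k. ennreal (D k x)) \<noteq> \<infinity>"
    using mD by (intro nn_integral_PInf_AE) auto
  hence conv: "AE x in M. convergent (\<lambda>k. X k x)"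
  proof eventually_elim
    case (elim x)
    have "summable (\<lambda>k. D k x)"
      by (rule summable_suminf_not_top) (use elim in \<open>auto simp: D_def\<close>)
    hence "summable (\<lambda>k. X (Suc k) x - X k x)" unfolding D_def by (rule summable_rabs_cancel)
    hence "convergent (\<lambda>n. \<Sum>k<n. X (Suc k) x - X k x)" by (simp add: summable_iff_convergent)
    moreover have "(\<Sum>k<n. X (Suc k) x - X k x) = X n x - X 0 x" for n by (induction n) auto
    ultimately have "convergent (\<lambda>n. X n x - X 0 x)" by simp
    thus ?case using convergent_add_const_iff[of "- X 0 x" "\<lambda>n. X n x"] by simp
  qed
  show thesis
  proof (rule that[of "\<lambda>x. lim (\<lambda>k. X k x)"])
    show "(\<lambda>x. lim (\<lambda>k. X k x)) \<in> borel_measurable M" using m by (rule borel_measurable_lim_metric)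
    show "AE x in M. (\<lambda>k. X k x) \<longlonglongrightarrow> lim (\<lambda>k. X k x)" using conv by eventually_elim (simp add: convergent_LIMSEQ_iff)
  qed
qed

text \<open>Fatou's lemma turns pointwise convergence into mean-square bounds for the limit.\<close>
lemma L2_fatou:
  fixes X :: "nat \<Rightarrow> 'a \<Rightarrow> real"
  assumes m: "\<And>k. X k \<in> borel_measurable M" "Z \<in> borel_measurable M" "Y \<in> borel_measurable M"
    and conv: "AE x in M. (\<lambda>k. X k x) \<longlonglongrightarrow> Y x"
    and bound: "\<And>k. k \<ge> N \<Longrightarrow> (\<integral>\<^sup>+x. ennreal ((X k x - Z x)^2) \<partial>M) \<le> c"
  shows "(\<integral>\<^sup>+x. ennreal ((Y x - Z x)^2) \<partial>M) \<le> c"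
proof -
  have "(\<integral>\<^sup>+x. ennreal ((Y x - Z x)^2) \<partial>M) = (\<integral>\<^sup>+x. liminf (\<lambda>k. ennreal ((X k x - Z x)^2)) \<partial>M)"
  proof (rule nn_integral_cong_AE)
    show "AE x in M. ennreal ((Y x - Z x)^2) = liminf (\<lambda>k. ennreal ((X k x - Z x)^2))"
      using conv
    proof eventually_elim
      case (elim x)
      have "(\<lambda>k. ennreal ((X k x - Z x)^2)) \<longlonglongrightarrow> ennreal ((Y x - Z x)^2)"
        by (intro tendsto_ennrealI tendsto_intros elim)
      from lim_imp_Liminf[OF _ this] show ?case by simp
    qed
  qed
  also have "\<dots> \<le> liminf (\<lambda>k. \<integral>\<^sup>+x. ennreal ((X k x - Z x)^2) \<partial>M)"
    using m by (intro nn_integral_liminf) measurable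
  also have "\<dots> \<le> liminf (\<lambda>k. c)"
    by (rule Liminf_mono) (rule eventually_mono[OF eventually_ge_at_top[of N] bound])
  finally show ?thesis by (simp add: Liminf_const)
qed

section \<open>Spectral decomposition of a bounded symmetric kernel\<close>

text \<open>Gaussian elimination of the last equation with pivot \<open>p\<close>.\<close>
lemma linear_dependence:
  fixes a :: "'i \<Rightarrow> nat \<Rightarrow> real"
  assumes "finite I" "m < card I"
  shows "\<exists>c. (\<exists>i\<in>I. c i \<noteq> 0) \<and> (\<forall>l<m. (\<Sum>i\<in>I. c i * a i l) = 0)"
  using assms
proof (induction m arbitrary: I a)
  case 0
  then obtain i where "i \<in> I" by (metis card_gt_0_iff ex_in_conv)
  thus ?case by (intro exI[of _ "\<lambda>_. 1"]) auto
next
  case (Suc m)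
  show ?case
  proof (cases "\<forall>i\<in>I. a i m = 0")
    case True
    obtain c where "\<exists>i\<in>I. c i \<noteq> 0" "\<forall>l<m. (\<Sum>i\<in>I. c i * a i l) = 0"
      using Suc.IH[OF Suc.prems(1), of a] Suc.prems(2) by auto
    thus ?thesis using True by (intro exI[of _ c]) (auto simp: less_Suc_eq)
  next
    case False
    then obtain p where p: "p \<in> I" "a p m \<noteq> 0" by blast
    define b where "b i l = a i l - a i m / a p m * a p l" for i l
    have "m < card (I - {p})" using Suc.prems p by simp
    then obtain c where c: "\<exists>i\<in>I - {p}. c i \<noteq> 0" "\<forall>l<m. (\<Sum>i\<in>I - {p}. c i * b i l) = 0"
      using Suc.IH[of "I - {p}" b] Suc.prems(1) by auto
    define d where "d = c(p := - (\<Sum>i\<in>I - {p}. c i * a i m) / a p m)"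
    have split: "(\<Sum>i\<in>I. d i * a i l) = d p * a p l + (\<Sum>i\<in>I - {p}. c i * a i l)" for l
    proof -
      have "(\<Sum>i\<in>I. d i * a i l) = d p * a p l + (\<Sum>i\<in>I - {p}. d i * a i l)" using Suc.prems(1) p(1) by (rule sum.remove)
      also have "(\<Sum>i\<in>I - {p}. d i * a i l) = (\<Sum>i\<in>I - {p}. c i * a i l)" by (intro sum.cong) (auto simp: d_def)
      finally show ?thesis .
    qed
    have "(\<Sum>i\<in>I. d i * a i l) = 0" if "l < Suc m" for l
    proof (cases "l = m")
      case True thus ?thesis unfolding split using p(2) by (simp add: d_def)
    next
      case False
      hence "(\<Sum>i\<in>I - {p}. c i * b i l) = 0" using that c(2) by auto
      moreover have "(\<Sum>i\<in>I - {p}. c i * b i l) = (\<Sum>i\<in>I - {p}. c i * a i l) - (\<Sum>i\<in>I - {p}. c i * a i m) / a p m * a p l"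
        by (simp add: b_def right_diff_distrib sum_subtractf sum_divide_distrib sum_distrib_right mult.assoc)
      ultimately show ?thesis unfolding split by (simp add: d_def)
    qed
    thus ?thesis using c(1) by (intro exI[of _ d]) (auto simp: d_def)
  qed
qed

text \<open>  Unlike \<open>eigenspace_L2\<close>, this asks for a bounded function and for the equation at every point. By \<open>eig_version\<close>
  nothing is lost for a non-zero eigenvalue.\<close>
definition eig :: "kernel \<Rightarrow> real \<Rightarrow> (real \<Rightarrow> real) set" where
  "eig K l = {f. bm1 f \<and> (\<forall>x\<in>{0..1}. opr K f x = l * f x)}"

definition orthonormal :: "'i set \<Rightarrow> ('i \<Rightarrow> real \<Rightarrow> real) \<Rightarrow> bool" where
  "orthonormal I f \<longleftrightarrow> (\<forall>i\<in>I. \<forall>j\<in>I. ip (f i) (f j) = of_bool (i = j))"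

definition ksum :: "'i set \<Rightarrow> ('i \<Rightarrow> real) \<Rightarrow> ('i \<Rightarrow> real \<Rightarrow> real) \<Rightarrow> real \<Rightarrow> real \<Rightarrow> real" where
  "ksum F lam f x y = (\<Sum>i\<in>F. lam i * f i x * f i y)"

lemma bm2_ksum [intro!]: "(\<And>i. i \<in> F \<Longrightarrow> bm1 (f i)) \<Longrightarrow> bm2 (ksum F lam f)"
  unfolding ksum_def[abs_def] by (intro bm2_sum bm2_mult bm2_const bm2_fst bm2_snd)

lemma sym2_ksum: "sym2 (ksum F lam f)"
  by (simp add: sym2_def ksum_def mult.assoc mult.left_commute mult.commute)

lemma opr_ksum:
  assumes "\<And>i. i \<in> F \<Longrightarrow> bm1 (f i)" "bm1 g"
  shows "opr (ksum F lam f) g x = (\<Sum>i\<in>F. lam i * f i x * ip (f i) g)"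
proof -
  have "opr (ksum F lam f) g x = (\<I> y. (\<Sum>i\<in>F. lam i * f i x * (f i y * g y)))"
    by (simp add: opr_def ksum_def sum_distrib_right mult.assoc)
  also have "\<dots> = (\<Sum>i\<in>F. \<I> y. lam i * f i x * (f i y * g y))"
    using assms by (intro lint_sum bm1_integrable) auto
  finally show ?thesis by (simp add: ip_def)
qed

lemma hs_ksum:
  assumes "bm2 K" "\<And>i. i \<in> F \<Longrightarrow> bm1 (f i)"
  shows "hs K (ksum F lam f) = (\<Sum>i\<in>F. lam i * ip (f i) (opr K (f i)))"
proof -
  have b: "bm2 (\<lambda>x y. K x y * f i y)" if "i \<in> F" for i using assms that by auto
  have "hs K (ksum F lam f) = (\<I> x. (\<Sum>i\<in>F. lam i * (f i x * opr K (f i) x)))"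
    unfolding hs_def
  proof (intro lint_cong refl)
    fix x assume "x \<in> space unit_leb"
    hence x: "x \<in> {0..1}" by simp
    have "(\<I> y. K x y * ksum F lam f x y) = (\<I> y. (\<Sum>i\<in>F. lam i * f i x * (K x y * f i y)))"
      by (simp add: ksum_def sum_distrib_left mult_ac)
    also have "\<dots> = (\<Sum>i\<in>F. \<I> y. lam i * f i x * (K x y * f i y))"
      using assms bm2_row[OF assms(1) x] by (intro lint_sum bm1_integrable) auto
    finally show "(\<I> y. K x y * ksum F lam f x y) = (\<Sum>i\<in>F. lam i * (f i x * opr K (f i) x))"
      by (simp add: opr_def mult.assoc)
  qed
  also have "\<dots> = (\<Sum>i\<in>F. \<I> x. lam i * (f i x * opr K (f i) x))"
    using assms by (intro lint_sum bm1_integrable) auto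
  finally show ?thesis by (simp add: ip_def)
qed

lemma eigD: "f \<in> eig K l \<Longrightarrow> bm1 f" "f \<in> eig K l \<Longrightarrow> x \<in> {0..1} \<Longrightarrow> opr K f x = l * f x"
  by (auto simp: eig_def)

lemma ip_opr_eig: "f \<in> eig K l \<Longrightarrow> ip g (opr K f) = l * ip g f"
proof -
  assume f: "f \<in> eig K l"
  have "ip g (opr K f) = ip g (\<lambda>x. l * f x)" using f by (intro ip_cong) (auto simp: eig_def)
  thus ?thesis by (simp add: ip_sym[of g] ip_scale)
qed

text \<open>By orthonormality both \<open>hs K (ksum F lam f)\<close> and the squared norm of \<open>ksum F lam f\<close> are the sum of the squared
  eigenvalues.\<close>
lemma hs_minus_ksum:
  assumes K: "bm2 K" and F: "finite F" and f: "\<And>i. i \<in> F \<Longrightarrow> f i \<in> eig K (lam i)" and on: "orthonormal F f"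
  shows "hs_dist K (ksum F lam f) = hs K K - (\<Sum>i\<in>F. (lam i)^2)"
    and "(\<Sum>i\<in>F. (lam i)^2) \<le> hs K K" and "hs (ksum F lam f) (ksum F lam f) = (\<Sum>i\<in>F. (lam i)^2)"
proof -
  have b: "bm1 (f i)" if "i \<in> F" for i using f[OF that] by (rule eigD)
  have o1: "ip (f i) (f i) = 1" if "i \<in> F" for i using on that by (auto simp: orthonormal_def)
  have "hs K (ksum F lam f) = (\<Sum>i\<in>F. lam i * ip (f i) (opr K (f i)))" by (rule hs_ksum[OF K]) (rule b)
  also have "\<dots> = (\<Sum>i\<in>F. (lam i)^2)"
    by (intro sum.cong refl) (simp add: ip_opr_eig[OF f] o1 power2_eq_square)
  finally have 1: "hs K (ksum F lam f) = (\<Sum>i\<in>F. (lam i)^2)" .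
  have "hs (ksum F lam f) (ksum F lam f) = (\<Sum>i\<in>F. lam i * ip (f i) (opr (ksum F lam f) (f i)))"
    by (rule hs_ksum) (use b in auto)
  also have "\<dots> = (\<Sum>i\<in>F. (lam i)^2)"
  proof (intro sum.cong refl)
    fix i assume i: "i \<in> F"
    have "ip (f i) (opr (ksum F lam f) (f i)) = ip (f i) (\<lambda>x. lam i * f i x)"
    proof (intro ip_cong refl)
      fix x
      have "opr (ksum F lam f) (f i) x = (\<Sum>j\<in>F. lam j * f j x * ip (f j) (f i))" by (rule opr_ksum[OF b b[OF i]])
      also have "\<dots> = (\<Sum>j\<in>F. if j = i then lam j * f j x else 0)"
        using on i by (intro sum.cong) (auto simp: orthonormal_def)
      finally show "opr (ksum F lam f) (f i) x = lam i * f i x" using F i by simp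
    qed
    thus "lam i * ip (f i) (opr (ksum F lam f) (f i)) = (lam i)^2"
      using o1[OF i] ip_scale[of "lam i" "f i" "f i"] by (simp add: ip_sym[of "f i" "\<lambda>x. lam i * f i x"] power2_eq_square)
  qed
  finally show 2: "hs (ksum F lam f) (ksum F lam f) = (\<Sum>i\<in>F. (lam i)^2)" .
  show 3: "hs_dist K (ksum F lam f) = hs K K - (\<Sum>i\<in>F. (lam i)^2)"
    using hs_diff[OF K bm2_ksum[of F f lam]] b 1 2 by simp
  show "(\<Sum>i\<in>F. (lam i)^2) \<le> hs K K"
    using 3 hs_self(2)[of "\<lambda>x y. K x y - ksum F lam f x y"] by simp
qed

lemma ip_zero_AE: "bm1 f \<Longrightarrow> ip f f = 0 \<longleftrightarrow> (AE x in unit_leb. f x = 0)"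
  unfolding ip_self by (subst integral_nonneg_eq_0_iff_AE) (auto intro!: bm1_integrable)

context
  fixes K :: kernel
  assumes K: "bm2 K" and symK: "sym2 K"
begin

lemma eig_orthogonal:
  assumes "f \<in> eig K l" "g \<in> eig K l'" "l \<noteq> l'" shows "ip f g = 0"
proof -
  have "l' * ip f g = ip f (opr K g)" using ip_opr_eig[OF assms(2)] by simp
  also have "\<dots> = ip (opr K f) g" using opr_selfadjoint[OF K symK eigD(1)[OF assms(1)] eigD(1)[OF assms(2)]] by simp
  also have "\<dots> = l * ip f g" using ip_opr_eig[OF assms(1), of g] by (simp add: ip_sym)
  finally show ?thesis using assms(3) by simp
qed

lemma eig_subset: "eig K l \<subseteq> eigenspace_L2 K l"
proof
  fix f assume f: "f \<in> eig K l"
  have "f \<in> borel_measurable unit_leb" using eigD(1)[OF f] by (rule bmeas_measurable)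
  moreover have "integrable unit_leb (\<lambda>x. (f x)^2)" using eigD(1)[OF f] by (intro bm1_integrable bmeas_power)
  ultimately show "f \<in> eigenspace_L2 K l" using eigD(2)[OF f] unfolding eigenspace_L2_def opr_def by auto
qed

text \<open>The version is \<open>opr K f / l\<close>: it is bounded because \<open>K\<close> is, and applying the operator does not see
  null sets.\<close>
lemma eig_version:
  assumes l: "l \<noteq> 0" and f: "f \<in> eigenspace_L2 K l"
  obtains g where "g \<in> eig K l" "AE x in unit_leb. f x = g x"
proof -
  have fm: "f \<in> borel_measurable unit_leb" and f2: "integrable unit_leb (\<lambda>x. (f x)^2)"
    and fe: "AE x in unit_leb. opr K f x = l * f x"
    using f by (auto simp: eigenspace_L2_def opr_def)
  have fi: "integrable unit_leb f" using U.cauchy_schwarz(1)[of "\<lambda>_. 1" f] fm f2 by simp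
  define g where "g x = opr K f x / l" for x
  obtain C where C: "C > 0" "\<And>x y. x \<in> {0..1} \<Longrightarrow> y \<in> {0..1} \<Longrightarrow> \<bar>K x y\<bar> \<le> C" using bm2_bound[OF K] by blast
  have bg: "bm1 g"
  proof (rule bmeasI[where C="C * (\<I> y. \<bar>f y\<bar>) / \<bar>l\<bar>"])
    have "(\<lambda>(x, y). K x y * f y) \<in> borel_measurable UU"
      using bmeas_measurable[of UU "\<lambda>(x, y). K x y"] K fm unfolding bm2_def case_prod_unfold by simp
    from U.borel_measurable_lebesgue_integral[OF this] show "g \<in> borel_measurable unit_leb"
      unfolding g_def[abs_def] opr_def[abs_def] by simp
    fix x assume "x \<in> space unit_leb"
    hence x: "x \<in> {0..1}" by simp
    have Kx: "K x \<in> borel_measurable unit_leb" using bm2_row[OF K x] by (rule bmeas_measurable)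
    have iK: "integrable unit_leb (\<lambda>y. K x y * f y)"
      by (rule Bochner_Integration.integrable_bound[of _ "\<lambda>y. C * f y"])
         (use fi Kx fm C(2)[OF x] C(1) in \<open>auto simp: abs_mult intro!: AE_I2 mult_right_mono\<close>)
    have "\<bar>opr K f x\<bar> \<le> (\<I> y. \<bar>K x y * f y\<bar>)" unfolding opr_def by (rule integral_abs_bound)
    also have "\<dots> \<le> (\<I> y. C * \<bar>f y\<bar>)"
    proof (rule integral_mono[OF integrable_abs[OF iK]])
      show "integrable unit_leb (\<lambda>y. C * \<bar>f y\<bar>)" using fi by simp
      fix y assume "y \<in> space unit_leb"
      thus "\<bar>K x y * f y\<bar> \<le> C * \<bar>f y\<bar>" using C(2)[OF x, of y] by (simp add: abs_mult mult_right_mono)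
    qed
    finally have "\<bar>opr K f x\<bar> \<le> C * (\<I> y. \<bar>f y\<bar>)" by simp
    thus "norm (g x) \<le> C * (\<I> y. \<bar>f y\<bar>) / \<bar>l\<bar>" by (simp add: g_def divide_right_mono)
  qed
  have fg: "AE x in unit_leb. f x = g x" using fe by eventually_elim (use l in \<open>simp add: g_def\<close>)
  have "opr K g x = l * g x" if x: "x \<in> {0..1}" for x
  proof -
    have "opr K g x = opr K f x"
      by (rule opr_cong_AE[OF K x bmeas_measurable[OF bg] fm]) (use fg in \<open>auto elim: eventually_mono\<close>)
    thus ?thesis using l by (simp add: g_def)
  qed
  thus thesis using that[of g] bg fg by (auto simp: eig_def)
qed

lemma orthonormal_indep:
  assumes "\<And>i. i < m \<Longrightarrow> bm1 (f i)" "orthonormal {..<m} f" shows "indep_L2 m f"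
  unfolding indep_L2_def
proof (intro allI impI)
  fix c i assume ae: "AE x in unit_leb. (\<Sum>i<m. c i * f i x) = 0" and i: "i < m"
  have "ip (\<lambda>x. \<Sum>j<m. c j * f j x) (f i) = (\<I> x. 0)"
    unfolding ip_def using ae assms(1) i
    by (intro integral_cong_AE) (auto intro!: bmeas_measurable elim: eventually_mono)
  moreover have "ip (\<lambda>x. \<Sum>j<m. c j * f j x) (f i) = (\<Sum>j<m. ip (\<lambda>x. c j * f j x) (f i))"
    using assms(1) i by (intro ip_sum) auto
  moreover have "\<dots> = (\<Sum>j<m. if j = i then c j else 0)"
    using assms(2) i by (intro sum.cong) (auto simp: ip_scale orthonormal_def)
  ultimately show "c i = 0" using i by simp
qed

text \<open>  A larger independent system would have a non-trivial combination orthogonal to the family, by counting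
  equations; maximality makes this combination vanish almost everywhere.\<close>
lemma maximal_family_mult:
  assumes l: "l \<noteq> 0" and f: "\<And>i. i < m \<Longrightarrow> f i \<in> eig K l" "orthonormal {..<m} f"
    and max: "\<And>g. g \<in> eig K l \<Longrightarrow> (\<And>i. i < m \<Longrightarrow> ip g (f i) = 0) \<Longrightarrow> ip g g = 0"
  shows "eigen_mult K l = enat m"
  unfolding eigen_mult_def
proof (rule antisym)
  show "enat m \<le> (SUP k\<in>{k. \<exists>f. (\<forall>i<k. f i \<in> eigenspace_L2 K l) \<and> indep_L2 k f}. enat k)"
  proof (rule SUP_upper)
    show "m \<in> {k. \<exists>f. (\<forall>i<k. f i \<in> eigenspace_L2 K l) \<and> indep_L2 k f}"
      using f eig_subset orthonormal_indep[OF _ f(2)] eigD(1) by blast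
  qed
  show "(SUP k\<in>{k. \<exists>f. (\<forall>i<k. f i \<in> eigenspace_L2 K l) \<and> indep_L2 k f}. enat k) \<le> enat m"
  proof (rule SUP_least, clarify)
    fix k g assume g: "\<forall>i<k. g i \<in> eigenspace_L2 K l" and ind: "indep_L2 k g"
    show "enat k \<le> enat m"
    proof (rule ccontr)
      assume "\<not> enat k \<le> enat m"
      hence km: "m < card {..<k}" by simp
      have "\<forall>i. \<exists>h. i < k \<longrightarrow> h \<in> eig K l \<and> (AE x in unit_leb. g i x = h x)"
        using g eig_version[OF l] by metis
      then obtain h where h: "\<And>i. i < k \<Longrightarrow> h i \<in> eig K l" "\<And>i. i < k \<Longrightarrow> AE x in unit_leb. g i x = h i x" by metis
      obtain c where c: "\<exists>i\<in>{..<k}. c i \<noteq> 0" "\<forall>j<m. (\<Sum>i<k. c i * ip (h i) (f j)) = 0"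
        using linear_dependence[OF finite_lessThan km, of "\<lambda>i j. ip (h i) (f j)"] by blast
      define v where "v x = (\<Sum>i<k. c i * h i x)" for x
      have bh: "bm1 (h i)" if "i < k" for i using h(1)[OF that] by (rule eigD)
      have bv: "bm1 v" unfolding v_def[abs_def] using bh by auto
      have ve: "v \<in> eig K l"
      proof -
        have "opr K v x = l * v x" if x: "x \<in> {0..1}" for x
        proof -
          have "opr K v x = (\<I> y. (\<Sum>i<k. c i * (K x y * h i y)))"
            by (simp add: opr_def v_def sum_distrib_left mult.left_commute)
          also have "\<dots> = (\<Sum>i<k. \<I> y. c i * (K x y * h i y))"
            using bm2_row[OF K x] bh by (intro lint_sum bm1_integrable) auto
          also have "\<dots> = (\<Sum>i<k. c i * (l * h i x))"
            using eigD(2)[OF h(1) x] by (intro sum.cong) (auto simp: opr_def)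
          finally show ?thesis by (simp add: v_def sum_distrib_left mult.left_commute)
        qed
        thus ?thesis using bv by (auto simp: eig_def)
      qed
      have "ip v (f j) = 0" if j: "j < m" for j
      proof -
        have "ip v (f j) = (\<Sum>i<k. ip (\<lambda>x. c i * h i x) (f j))"
          unfolding v_def[abs_def] using bh eigD(1)[OF f(1)[OF j]] by (intro ip_sum) auto
        thus ?thesis using c(2) j by (simp add: ip_scale)
      qed
      hence "ip v v = 0" by (rule max[OF ve])
      hence v0: "AE x in unit_leb. v x = 0" using ip_zero_AE[OF bv] by simp
      have "AE x in unit_leb. \<forall>i\<in>{..<k}. g i x = h i x" by (rule AE_finite_allI) (use h(2) in auto)
      hence "AE x in unit_leb. (\<Sum>i<k. c i * g i x) = 0" using v0
      proof eventually_elim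
        case (elim x)
        have "(\<Sum>i<k. c i * g i x) = v x" unfolding v_def by (intro sum.cong refl) (use elim in auto)
        thus ?case using elim by simp
      qed
      hence "\<forall>i<k. c i = 0" using ind by (auto simp: indep_L2_def)
      thus False using c(1) by auto
    qed
  qed
qed

text \<open>By Bessel's inequality for the kernel, \<open>m * l^2 \<le> hs K K\<close> bounds the size of the families.\<close>
lemma maximal_family_exists:
  fixes n :: nat
  assumes l: "l \<noteq> 0" and g: "\<And>i. i < n \<Longrightarrow> g i \<in> eig K l" "orthonormal {..<n} g"
  obtains m f where "n \<le> m" "\<And>i. i < m \<Longrightarrow> f i \<in> eig K l" "orthonormal {..<m} f" "\<And>i. i < n \<Longrightarrow> f i = g i"
    "\<And>h. h \<in> eig K l \<Longrightarrow> (\<And>i. i < m \<Longrightarrow> ip h (f i) = 0) \<Longrightarrow> ip h h = 0"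
proof -
  define P where "P m = (n \<le> m \<and> (\<exists>f. (\<forall>i<m. f i \<in> eig K l) \<and> orthonormal {..<m} f \<and> (\<forall>i<n. f i = g i)))" for m
  have P0: "P n" using g by (auto simp: P_def)
  have bound: "m \<le> nat \<lfloor>hs K K / l^2\<rfloor>" if "P m" for m
  proof -
    obtain f where f: "\<forall>i<m. f i \<in> eig K l" "orthonormal {..<m} f" using \<open>P m\<close> by (auto simp: P_def)
    have "(\<Sum>i<m. l^2) \<le> hs K K"
      by (rule hs_minus_ksum(2)[OF K _ _ f(2)]) (use f(1) in auto)
    hence "real m \<le> hs K K / l^2" using l by (simp add: field_simps)
    thus ?thesis by linarith
  qed
  obtain m where m: "P m" "\<And>k. P k \<Longrightarrow> k \<le> m"
    using Greatest_le_nat[of P _ "nat \<lfloor>hs K K / l^2\<rfloor>"] GreatestI_nat[of P n "nat \<lfloor>hs K K / l^2\<rfloor>"] P0 bound by blast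
  obtain f where f: "\<forall>i<m. f i \<in> eig K l" "orthonormal {..<m} f" "\<forall>i<n. f i = g i" and nm: "n \<le> m"
    using m(1) by (auto simp: P_def)
  have max: "ip h h = 0" if h: "h \<in> eig K l" "\<And>i. i < m \<Longrightarrow> ip h (f i) = 0" for h
  proof (rule ccontr)
    assume "ip h h \<noteq> 0"
    hence hp: "ip h h > 0" using ip_self(2)[of h] by simp
    define u where "u x = h x / sqrt (ip h h)" for x
    have u: "bm1 u" "ip u u = 1" using ip_normalize[OF eigD(1)[OF h(1)] hp] by (simp_all add: u_def[abs_def])
    have uf: "ip u (f i) = 0" if "i < m" for i
      using h(2)[OF that] ip_scale[of "1 / sqrt (ip h h)" h "f i"] by (simp add: u_def[abs_def])
    have ue: "u \<in> eig K l" using u(1) eigD(2)[OF h(1)] by (auto simp: eig_def u_def[abs_def] opr_def)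
    have "P (Suc m)"
      unfolding P_def
    proof (intro conjI exI[of _ "f(m := u)"])
      show "orthonormal {..<Suc m} (f(m := u))"
        unfolding orthonormal_def
      proof (intro ballI)
        fix i j assume ij: "i \<in> {..<Suc m}" "j \<in> {..<Suc m}"
        have uf': "ip (f i) u = 0" if "i < m" for i using uf[OF that] by (simp add: ip_sym)
        have "ip (f i) (f j) = of_bool (i = j)" if "i < m" "j < m" using f(2) that by (simp add: orthonormal_def)
        thus "ip ((f(m := u)) i) ((f(m := u)) j) = of_bool (i = j)"
          using ij u(2) uf uf' by (cases "i = m"; cases "j = m") auto
      qed
      show "\<forall>i<Suc m. (f(m := u)) i \<in> eig K l" using f(1) ue by (auto simp: less_Suc_eq)
    qed (use nm f(3) in auto)
    thus False using m(2)[of "Suc m"] by simp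
  qed
  show thesis
  proof (rule that[of m f])
    show "n \<le> m" by (rule nm)
    show "orthonormal {..<m} f" by (rule f(2))
    show "\<And>i. i < m \<Longrightarrow> f i \<in> eig K l" "\<And>i. i < n \<Longrightarrow> f i = g i" using f by simp_all
    show "\<And>h. h \<in> eig K l \<Longrightarrow> (\<And>i. i < m \<Longrightarrow> ip h (f i) = 0) \<Longrightarrow> ip h h = 0" by (rule max)
  qed
qed

end


text \<open>
  An orthonormal family of eigenfunctions, indexed by eigenvalue and position, whose finite partial sums
  approximate the kernel in the Hilbert--Schmidt norm.
\<close>
definition diagonalizes :: "kernel \<Rightarrow> (real \<times> nat) set \<Rightarrow> (real \<times> nat \<Rightarrow> real \<Rightarrow> real) \<Rightarrow> bool" where
  "diagonalizes K J f \<longleftrightarrow> (\<forall>j\<in>J. f j \<in> eig K (fst j)) \<and> orthonormal J f \<and>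
     (\<forall>\<epsilon>>0. \<exists>G. finite G \<and> G \<subseteq> J \<and> (\<forall>F. finite F \<and> G \<subseteq> F \<and> F \<subseteq> J \<longrightarrow>
        hs_dist K (ksum F fst f) \<le> \<epsilon>))"

lemma diagonalizesD:
  assumes "diagonalizes K J f"
  shows "j \<in> J \<Longrightarrow> f j \<in> eig K (fst j)" "orthonormal J f" "F \<subseteq> J \<Longrightarrow> orthonormal F f"
  using assms unfolding diagonalizes_def orthonormal_def by blast+

lemma diagonalizes_approx:
  assumes "diagonalizes K J f" "\<epsilon> > 0"
  obtains G where "finite G" "G \<subseteq> J" "\<And>F. finite F \<Longrightarrow> G \<subseteq> F \<Longrightarrow> F \<subseteq> J \<Longrightarrow>
    hs_dist K (ksum F fst f) \<le> \<epsilon>"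
  using assms unfolding diagonalizes_def by (elim conjE allE[of _ \<epsilon>] impE exE) auto

text \<open>  A maximal orthonormal family is chosen for every eigenvalue, with \<open>u\<close> in first place for \<open>l0\<close>. Only finitely many
  members, \<open>big k\<close>, belong to eigenvalues of modulus at least \<open>1 / Suc k\<close>. A top eigenfunction of the kernel
  that remains after removing them is orthogonal to them, hence an eigenfunction of \<open>K\<close>, and maximality
  excludes an eigenvalue larger than \<open>1 / Suc k\<close>. So the residual operators tend to 0 in norm, and
  \<open>hs_tendsto_0\<close> gives convergence in the Hilbert--Schmidt norm.\<close>
theorem spectral_decomposition:
  assumes K: "bm2 K" and symK: "sym2 K" and l0: "l0 \<noteq> 0" and u: "u \<in> eig K l0" "ip u u = 1"
  defines "J \<equiv> mset_index (Spec K)"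
  obtains f where "diagonalizes K J f" "(l0, 0) \<in> J" "f (l0, 0) = u" "\<And>l. l \<noteq> 0 \<Longrightarrow> Spec K l \<noteq> \<infinity>"
proof -
  define P where "P l m h \<longleftrightarrow> (\<forall>i<m. h i \<in> eig K l) \<and> orthonormal {..<m} h \<and> (l = l0 \<longrightarrow> 1 \<le> m \<and> h 0 = u) \<and>
      (\<forall>g. g \<in> eig K l \<longrightarrow> (\<forall>i<m. ip g (h i) = 0) \<longrightarrow> ip g g = 0)" for l and m :: nat and h
  have "\<exists>m h. P l m h" if l: "l \<noteq> 0" for l
  proof -
    define n where "n = (if l = l0 then 1 else 0 :: nat)"
    have g: "\<And>i. i < n \<Longrightarrow> (\<lambda>_. u) i \<in> eig K l" "orthonormal {..<n} (\<lambda>_. u)"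
      using u by (auto simp: n_def orthonormal_def split: if_splits)
    show "\<exists>m h. P l m h"
    proof (rule maximal_family_exists[OF K symK l g])
      fix m h assume mh: "n \<le> m" "\<And>i. i < m \<Longrightarrow> h i \<in> eig K l" "orthonormal {..<m} h" "\<And>i. i < n \<Longrightarrow> h i = u"
      "\<And>g. g \<in> eig K l \<Longrightarrow> (\<And>i. i < m \<Longrightarrow> ip g (h i) = 0) \<Longrightarrow> ip g g = 0"
      have "P l m h" unfolding P_def
      proof (intro conjI allI impI)
        show "ip g g = 0" if "g \<in> eig K l" "\<forall>i<m. ip g (h i) = 0" for g using mh(5) that by simp
      qed (use mh(1-4) in \<open>auto simp: n_def\<close>)
      thus "\<exists>m h. P l m h" by blast
    qed
  qed
  then obtain mm hh where mh: "\<And>l. l \<noteq> 0 \<Longrightarrow> P l (mm l) (hh l)" by metis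
  have mult: "Spec K l = (if l = 0 then 0 else enat (mm l))" for l
  proof (cases "l = 0")
    case False
    have "eigen_mult K l = enat (mm l)"
      by (rule maximal_family_mult[OF K symK False]) (use mh[OF False] in \<open>auto simp: P_def\<close>)
    thus ?thesis using False by (simp add: Spec_def)
  qed (simp add: Spec_def)
  have J: "(l, i) \<in> J \<longleftrightarrow> l \<noteq> 0 \<and> i < mm l" for l i
    unfolding J_def mset_index_def by (auto simp: mult zero_enat_def)
  define f where "f j = hh (fst j) (snd j)" for j
  have fe: "f j \<in> eig K (fst j)" if "j \<in> J" for j
    using that mh[of "fst j"] J[of "fst j" "snd j"] by (auto simp: P_def f_def)
  have fb: "bm1 (f j)" if "j \<in> J" for j by (rule eigD(1)[OF fe[OF that]])
  have on: "orthonormal J f" unfolding orthonormal_def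
  proof (intro ballI)
    fix i j assume ij: "i \<in> J" "j \<in> J"
    show "ip (f i) (f j) = of_bool (i = j)"
    proof (cases "fst i = fst j")
      case False
      thus ?thesis using eig_orthogonal[OF K symK fe[OF ij(1)] fe[OF ij(2)] False] by auto
    next
      case True
      have "fst i \<noteq> 0 \<and> snd i < mm (fst i)" "fst j \<noteq> 0 \<and> snd j < mm (fst j)"
        using J[of "fst i" "snd i"] J[of "fst j" "snd j"] ij by simp_all
      hence "fst i \<noteq> 0" "snd i < mm (fst i)" "snd j < mm (fst i)" using True by simp_all
      hence "ip (f i) (f j) = of_bool (snd i = snd j)"
        using mh[of "fst i"] True unfolding P_def f_def orthonormal_def by auto
      thus ?thesis using True by (auto simp: prod_eq_iff)
    qed
  qed
  have on': "orthonormal F f" if "F \<subseteq> J" for F using on that unfolding orthonormal_def by blast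
  have Pars: "hs_dist K (ksum F fst f) = hs K K - (\<Sum>i\<in>F. (fst i)^2)"
    "(\<Sum>i\<in>F. (fst i)^2) \<le> hs K K" "hs (ksum F fst f) (ksum F fst f) = (\<Sum>i\<in>F. (fst i)^2)"
    if "finite F" "F \<subseteq> J" for F
    using hs_minus_ksum[OF K that(1) _ on'[OF that(2)], of fst] fe that(2) by blast+
  have bks: "bm2 (ksum F fst f)" if "F \<subseteq> J" for F using fb that by (intro bm2_ksum) blast
  define big where "big k = {j \<in> J. 1 / real (Suc k) \<le> \<bar>fst j\<bar>}" for k
  have big_fin: "finite (big k)" for k
  proof (rule ccontr)
    assume inf: "infinite (big k)"
    obtain N :: nat where N: "hs K K * (real (Suc k))^2 < N" using reals_Archimedean2 by blast
    obtain F where F: "finite F" "card F = N" "F \<subseteq> big k" using infinite_arbitrarily_large[OF inf] by blast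
    have "real N * (1 / real (Suc k))^2 = (\<Sum>j\<in>F. (1 / real (Suc k))^2)" using F by simp
    also have "\<dots> \<le> (\<Sum>j\<in>F. (fst j)^2)"
    proof (rule sum_mono)
      fix j assume "j \<in> F"
      hence "1 / real (Suc k) \<le> \<bar>fst j\<bar>" using F by (auto simp: big_def)
      from power_mono[OF this, of 2] show "(1 / real (Suc k))^2 \<le> (fst j)^2" by simp
    qed
    also have "\<dots> \<le> hs K K" by (rule Pars(2)) (use F in \<open>auto simp: big_def\<close>)
    finally have "real N \<le> hs K K * (real (Suc k))^2" by (simp add: field_simps)
    thus False using N by simp
  qed
  have small: "ip (opr R \<phi>) (opr R \<phi>) \<le> (1 / real (Suc k))^2 * ip \<phi> \<phi>"
    if F: "finite F" "big k \<subseteq> F" "F \<subseteq> J" and \<phi>: "bm1 \<phi>" and R: "R = (\<lambda>x y. K x y - ksum F fst f x y)" for F k \<phi> R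
  proof -
    have bR: "bm2 R" unfolding R using K bks[OF F(3)] by (rule bm2_diff)
    have sR: "sym2 R" using symK sym2_ksum[of F fst f] unfolding R sym2_def by simp
    have bfF: "bm1 (f i)" if "i \<in> F" for i using fb F(3) that by blast
    have opR: "opr R g x = opr K g x - (\<Sum>i\<in>F. fst i * f i x * ip (f i) g)" if "bm1 g" "x \<in> {0..1}" for g x
    proof -
      have "opr R g x = (\<I> y. K x y * g y - ksum F fst f x y * g y)" by (simp add: opr_def R left_diff_distrib)
      also have "\<dots> = opr K g x - opr (ksum F fst f) g x"
        unfolding opr_def using bm2_row[OF K that(2)] bm2_row[OF bks[OF F(3)] that(2)] that(1)
        by (intro lint_diff bm1_integrable bmeas_mult)
      also have "opr (ksum F fst f) g x = (\<Sum>i\<in>F. fst i * f i x * ip (f i) g)"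
        by (rule opr_ksum) (use bfF that in auto)
      finally show ?thesis .
    qed
    show ?thesis
    proof (cases "hs R R = 0")
      case True
      hence "ip (opr R \<phi>) (opr R \<phi>) \<le> 0" using opr_norm_le[OF bR \<phi>] by simp
      also have "0 \<le> (1 / real (Suc k))^2 * ip \<phi> \<phi>" using ip_self(2) by simp
      finally show ?thesis .
    next
      case False
      show ?thesis
      proof (rule top_eigenvector[OF bR sR False])
      fix e \<mu> assume e: "\<mu> \<noteq> 0" "bm1 e" "ip e e = 1" "\<And>x. x \<in> {0..1} \<Longrightarrow> opr R e x = \<mu> * e x"
        "\<And>\<phi>. bm1 \<phi> \<Longrightarrow> ip (opr R \<phi>) (opr R \<phi>) \<le> \<mu>\<^sup>2 * ip \<phi> \<phi>"
      have ef: "ip (f j) e = 0" if j: "j \<in> F" for j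
      proof -
        have "opr R (f j) x = 0" if x: "x \<in> {0..1}" for x
        proof -
          have "(\<Sum>i\<in>F. fst i * f i x * ip (f i) (f j)) = (\<Sum>i\<in>F. if i = j then fst i * f i x else 0)"
            using on'[OF F(3)] j by (intro sum.cong) (auto simp: orthonormal_def)
          also have "\<dots> = fst j * f j x" using F(1) j by simp
          finally show ?thesis using opR[OF bfF[OF j] x] eigD(2)[OF fe x, of j] j F(3) by auto
        qed
        hence "ip e (opr R (f j)) = ip e (\<lambda>_. 0)" by (intro ip_cong) auto
        hence "0 = ip (opr R e) (f j)" using opr_selfadjoint[OF bR sR e(2) bfF[OF j]] by (simp add: ip_def)
        also have "\<dots> = ip (\<lambda>x. \<mu> * e x) (f j)" by (intro ip_cong) (auto simp: e(4))
        finally show ?thesis using e(1) by (simp add: ip_scale ip_sym)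
      qed
      have eK: "e \<in> eig K \<mu>"
        using e(2,4) opR[OF e(2)] ef by (auto simp: eig_def)
      have "\<bar>\<mu>\<bar> \<le> 1 / real (Suc k)"
      proof (rule ccontr)
        assume *: "\<not> \<bar>\<mu>\<bar> \<le> 1 / real (Suc k)"
        have "ip e (hh \<mu> i) = 0" if i: "i < mm \<mu>" for i
        proof -
          have "(\<mu>, i) \<in> big k" using * i e(1) J by (auto simp: big_def)
          hence "ip (f (\<mu>, i)) e = 0" using F(2) ef by blast
          thus ?thesis by (simp add: f_def ip_sym)
        qed
        hence "ip e e = 0" using mh[OF e(1)] eK by (auto simp: P_def)
        thus False using e(3) by simp
      qed
      hence "\<mu>\<^sup>2 \<le> (1 / real (Suc k))^2" using power_mono[of "\<bar>\<mu>\<bar>" "1 / real (Suc k)" 2] by simp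
      thus "ip (opr R \<phi>) (opr R \<phi>) \<le> (1 / real (Suc k))^2 * ip \<phi> \<phi>" using e(5)[OF \<phi>] ip_self(2)[of \<phi>] mult_right_mono[of "\<mu>\<^sup>2" "(1 / real (Suc k))^2" "ip \<phi> \<phi>"] by linarith
      qed
    qed
  qed
  define R where "R k x y = K x y - ksum (big k) fst f x y" for k x y
  have big_sub: "big k \<subseteq> J" for k by (auto simp: big_def)
  have bR: "bm2 (R k)" for k unfolding R_def[abs_def] using K bks[OF big_sub] by (rule bm2_diff)
  have hR: "hs (R k) (R k) = hs K K - (\<Sum>i\<in>big k. (fst i)^2)" for k
    unfolding R_def[abs_def] by (rule Pars(1)[OF big_fin big_sub])
  \<comment> \<open>The residual is orthogonal to the part of the kernel already split off, so its norm is a pairing with \<open>K\<close>.\<close>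
  have hRK: "hs (R k) K = hs (R k) (R k)" for k
  proof -
    have i: "integrable UU (\<lambda>q. L (fst q) (snd q) * K (fst q) (snd q))" if "bm2 L" for L
      using bm2_integrable[OF bm2_mult[OF that K]] by (simp add: case_prod_unfold)
    have "hs (R k) K = hs K K - hs (ksum (big k) fst f) K"
      unfolding hs_pair[OF bR K] hs_pair[OF K K] hs_pair[OF bks[OF big_sub] K] R_def left_diff_distrib
      using i[OF K] i[OF bks[OF big_sub]] by simp
    also have "hs (ksum (big k) fst f) K = hs K (ksum (big k) fst f)" by (simp add: hs_def mult.commute)
    finally show ?thesis
      using hs_diff[OF K bks[OF big_sub[of k]]] Pars(1,3)[OF big_fin big_sub, of k] hR[of k] by simp
  qed
  have lim: "(\<lambda>k. hs (R k) K) \<longlonglongrightarrow> 0"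
  proof (rule hs_tendsto_0[OF bR _ _ K])
    show "hs (R k) (R k) \<le> hs K K" for k unfolding hR by (simp add: sum_nonneg)
    fix \<phi> assume \<phi>: "bm1 \<phi>"
    show "(\<lambda>k. ip (opr (R k) \<phi>) (opr (R k) \<phi>)) \<longlonglongrightarrow> 0"
    proof (rule tendsto_sandwich[OF _ _ tendsto_const])
      show "\<forall>\<^sub>F k in sequentially. ip (opr (R k) \<phi>) (opr (R k) \<phi>) \<le> (1 / real (Suc k))^2 * ip \<phi> \<phi>"
        by (intro always_eventually allI small[OF big_fin order_refl big_sub \<phi>]) (simp add: R_def[abs_def])
      have "(\<lambda>k. (1 / real (Suc k))^2) \<longlonglongrightarrow> 0" by real_asymp
      thus "(\<lambda>k. (1 / real (Suc k))^2 * ip \<phi> \<phi>) \<longlonglongrightarrow> 0" by (rule tendsto_mult_left_zero)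
    qed (simp add: ip_self(2))
  qed
  show thesis
  proof (rule that[of f])
    show "(l0, 0) \<in> J" using mh[OF l0] l0 by (auto simp: J P_def)
    show "f (l0, 0) = u" using mh[OF l0] by (simp add: f_def P_def)
    show "Spec K l \<noteq> \<infinity>" if "l \<noteq> 0" for l using that by (simp add: mult)
    show "diagonalizes K J f" unfolding diagonalizes_def
    proof (intro conjI ballI allI impI fe on)
      fix \<epsilon> :: real assume "\<epsilon> > 0"
      from LIMSEQ_D[OF lim this] obtain k where "\<forall>n\<ge>k. norm (hs (R n) (R n) - 0) < \<epsilon>" unfolding hRK by blast
      hence k: "hs (R k) (R k) \<le> \<epsilon>" by (auto dest: spec[of _ k])
      show "\<exists>G. finite G \<and> G \<subseteq> J \<and> (\<forall>F. finite F \<and> G \<subseteq> F \<and> F \<subseteq> J \<longrightarrow>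
          hs_dist K (ksum F fst f) \<le> \<epsilon>)"
      proof (intro exI[of _ "big k"] conjI allI impI big_fin big_sub)
        fix F assume F: "finite F \<and> big k \<subseteq> F \<and> F \<subseteq> J"
        have "(\<Sum>i\<in>big k. (fst i)^2) \<le> (\<Sum>i\<in>F. (fst i)^2)" by (rule sum_mono2) (use F in auto)
        thus "hs_dist K (ksum F fst f) \<le> \<epsilon>"
          using Pars(1)[of F] F hR[of k] k by auto
      qed
    qed
  qed
qed

text \<open>
  When the constants are eigenfunctions for \<open>l0\<close>, the rest of the spectrum diagonalizes \<open>K - l0\<close>: the
  constant is put first among the eigenfunctions of \<open>l0\<close> and the remaining ones are shifted by one position.
\<close>
theorem spectral_decomposition_minus:
  assumes K: "bm2 K" and symK: "sym2 K" and l0: "l0 \<noteq> 0" and one: "AE x in unit_leb. opr K (\<lambda>_. 1) x = l0"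
  defines "J \<equiv> mset_index ((Spec K)(l0 := Spec K l0 - 1))"
  obtains f where "diagonalizes (\<lambda>x y. K x y - l0) J f" "\<And>j. j \<in> J \<Longrightarrow> ip (f j) (\<lambda>_. 1) = 0"
    "\<And>j. j \<in> J \<Longrightarrow> fst j \<noteq> 0"
proof -
  have "(\<lambda>_. 1) \<in> eigenspace_L2 K l0"
    using one by (simp add: eigenspace_L2_def opr_def)
  then obtain u where u: "u \<in> eig K l0" and u1: "AE x in unit_leb. 1 = u x" by (rule eig_version[OF K symK l0])
  have bu: "bm1 u" by (rule eigD(1)[OF u])
  have "ip u u = (\<I> x. 1)" unfolding ip_self
    by (rule integral_cong_AE) (use bu u1 in \<open>auto intro!: bmeas_measurable elim: eventually_mono\<close>)
  hence uu: "ip u u = 1" by simp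
  let ?J = "mset_index (Spec K)"
  show thesis
  proof (rule spectral_decomposition[OF K symK l0 u uu])
  fix f assume dg: "diagonalizes K ?J f" and f: "(l0, 0) \<in> ?J" "f (l0, 0) = u" "\<And>l. l \<noteq> 0 \<Longrightarrow> Spec K l \<noteq> \<infinity>"
  note D = diagonalizesD[OF dg]
  define \<sigma> where "\<sigma> j = (fst j, if fst j = l0 then Suc (snd j) else snd j)" for j :: "real \<times> nat"
  have inj: "inj \<sigma>" by (auto simp: inj_def \<sigma>_def prod_eq_iff split: if_splits)
  obtain m where m: "Spec K l0 = enat m" using f(3)[OF l0] by auto
  have mem: "j \<in> J \<longleftrightarrow> \<sigma> j \<in> ?J" for j
  proof (cases "fst j = l0")
    case True
    have "enat m - 1 = enat (m - 1)" by (simp add: one_enat_def)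
    thus ?thesis using True m by (auto simp: J_def mset_index_def \<sigma>_def split_beta)
  next
    case False thus ?thesis by (simp add: J_def mset_index_def \<sigma>_def split_beta)
  qed
  have ne: "\<sigma> j \<noteq> (l0, 0)" for j by (auto simp: \<sigma>_def)
  have cover: "?J \<subseteq> insert (l0, 0) (\<sigma> ` J)"
  proof
    fix i assume i: "i \<in> ?J"
    show "i \<in> insert (l0, 0) (\<sigma> ` J)"
    proof (cases "i = (l0, 0)")
      case False
      define j where "j = (fst i, if fst i = l0 then snd i - 1 else snd i)"
      have "\<sigma> j = i" using False by (cases i) (auto simp: \<sigma>_def j_def)
      thus ?thesis using i mem[of j] by force
    qed simp
  qed
  have fst\<sigma>: "fst (\<sigma> j) = fst j" for j by (simp add: \<sigma>_def)
  define g where "g j = f (\<sigma> j)" for j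
  have ge: "g j \<in> eig K (fst j)" if "j \<in> J" for j using D(1)[of "\<sigma> j"] mem[of j] that by (simp add: g_def fst\<sigma>)
  have bg: "bm1 (g j)" if "j \<in> J" for j by (rule eigD(1)[OF ge[OF that]])
  have g1: "ip (g j) (\<lambda>_. 1) = 0" if j: "j \<in> J" for j
  proof -
    have "ip (g j) (\<lambda>_. 1) = ip (g j) u" unfolding ip_def
      by (rule integral_cong_AE) (use bg[OF j] bu u1 in \<open>auto intro!: bmeas_measurable elim: eventually_mono\<close>)
    also have "\<dots> = of_bool (\<sigma> j = (l0, 0))"
      using D(2) mem[of j] j unfolding g_def f(2)[symmetric] orthonormal_def using f(1) by blast
    finally show ?thesis using ne by simp
  qed
  show thesis
  proof (rule that[of g])
    show "fst j \<noteq> 0" if "j \<in> J" for j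
    proof -
      have "\<sigma> j \<in> ?J" using that mem by simp
      thus ?thesis by (auto simp: mset_index_def Spec_def \<sigma>_def zero_enat_def split: if_splits)
    qed
    show "ip (g j) (\<lambda>_. 1) = 0" if "j \<in> J" for j by (rule g1[OF that])
    show "diagonalizes (\<lambda>x y. K x y - l0) J g" unfolding diagonalizes_def
    proof (intro conjI ballI allI impI)
    show "g j \<in> eig (\<lambda>x y. K x y - l0) (fst j)" if j: "j \<in> J" for j
      unfolding eig_def
    proof (intro CollectI conjI ballI bg[OF j])
      fix x :: real assume x: "x \<in> {0..1}"
      have "opr (\<lambda>x y. K x y - l0) (g j) x = opr K (g j) x - l0 * ip (g j) (\<lambda>_. 1)"
        using bm1_integrable[OF bmeas_mult[OF bm2_row[OF K x] bg[OF j]]] bm1_integrable[OF bg[OF j]]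
        by (simp add: opr_def ip_def left_diff_distrib)
      thus "opr (\<lambda>x y. K x y - l0) (g j) x = fst j * g j x" using eigD(2)[OF ge[OF j] x] g1[OF j] by simp
    qed
    show "orthonormal J g" unfolding orthonormal_def
    proof (intro ballI)
      fix i j assume "i \<in> J" "j \<in> J"
      hence "ip (g i) (g j) = of_bool (\<sigma> i = \<sigma> j)" using D(2) mem by (auto simp: g_def orthonormal_def)
      thus "ip (g i) (g j) = of_bool (i = j)" using inj by (simp add: inj_eq)
    qed
    fix \<epsilon> :: real assume "\<epsilon> > 0"
    obtain G where G: "finite G" "G \<subseteq> ?J" "\<And>F. finite F \<Longrightarrow> G \<subseteq> F \<Longrightarrow> F \<subseteq> ?J \<Longrightarrow>
        hs_dist K (ksum F fst f) \<le> \<epsilon>"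
      using diagonalizes_approx[OF dg \<open>\<epsilon> > 0\<close>] by blast
    show "\<exists>G. finite G \<and> G \<subseteq> J \<and> (\<forall>F. finite F \<and> G \<subseteq> F \<and> F \<subseteq> J \<longrightarrow>
        hs (\<lambda>x y. K x y - l0 - ksum F fst g x y) (\<lambda>x y. K x y - l0 - ksum F fst g x y) \<le> \<epsilon>)"
    proof (intro exI[of _ "\<sigma> -` G \<inter> J"] conjI allI impI)
      show "finite (\<sigma> -` G \<inter> J)" using finite_vimageI[OF G(1) inj] by simp
      fix F assume F: "finite F \<and> \<sigma> -` G \<inter> J \<subseteq> F \<and> F \<subseteq> J"
      define F' where "F' = insert (l0, 0) (\<sigma> ` F)"
      have "G \<subseteq> F'"
      proof
        fix i assume i: "i \<in> G"
        hence "i \<in> insert (l0, 0) (\<sigma> ` J)" using G(2) cover by auto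
        thus "i \<in> F'" using F i by (auto simp: F'_def)
      qed
      moreover have "F' \<subseteq> ?J" using F mem f(1) by (auto simp: F'_def)
      moreover have "finite F'" using F by (simp add: F'_def)
      ultimately have le: "hs_dist K (ksum F' fst f) \<le> \<epsilon>" using G(3) by blast
      have ks: "ksum F' fst f x y = l0 * u x * u y + ksum F fst g x y" for x y
      proof -
        have "(l0, 0) \<notin> \<sigma> ` F" using ne by force
        hence "ksum F' fst f x y = l0 * u x * u y + (\<Sum>i\<in>\<sigma> ` F. fst i * f i x * f i y)"
          using F by (simp add: ksum_def F'_def f(2))
        also have "(\<Sum>i\<in>\<sigma> ` F. fst i * f i x * f i y) = ksum F fst g x y"
          unfolding ksum_def g_def by (subst sum.reindex) (use inj in \<open>auto simp: inj_on_def inj_def fst\<sigma>\<close>)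
        finally show ?thesis .
      qed
      have bk: "bm2 (ksum F fst g)" using bg F by (intro bm2_ksum) blast
      have b1: "bm2 (\<lambda>x y. K x y - l0 - ksum F fst g x y)" by (intro bm2_diff K bk bm2_const)
      have b2: "bm2 (\<lambda>x y. K x y - ksum F' fst f x y)" unfolding ks
        by (intro bm2_diff bm2_add bm2_mult K bk bm2_const bm2_fst bm2_snd bu)
      have "hs (\<lambda>x y. K x y - l0 - ksum F fst g x y) (\<lambda>x y. K x y - l0 - ksum F fst g x y)
          = hs_dist K (ksum F' fst f)"
        unfolding hs_self(1)
      proof (rule integral_cong_AE)
        show "(\<lambda>x. \<I> y. (K x y - l0 - ksum F fst g x y)^2) \<in> borel_measurable unit_leb"
          "(\<lambda>x. \<I> y. (K x y - ksum F' fst f x y)^2) \<in> borel_measurable unit_leb"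
          by (intro bmeas_measurable bm1_integral bm2_power b1 b2)+
        show "AE x in unit_leb. (\<I> y. (K x y - l0 - ksum F fst g x y)^2) = (\<I> y. (K x y - ksum F' fst f x y)^2)"
          using u1 AE_space[of unit_leb]
        proof eventually_elim
          case (elim x)
          hence x: "x \<in> {0..1}" by simp
          show ?case
          proof (rule integral_cong_AE)
            show "(\<lambda>y. (K x y - l0 - ksum F fst g x y)^2) \<in> borel_measurable unit_leb"
              "(\<lambda>y. (K x y - ksum F' fst f x y)^2) \<in> borel_measurable unit_leb"
              by (intro bmeas_measurable bmeas_power bm2_row[OF b1 x] bm2_row[OF b2 x])+
            show "AE y in unit_leb. (K x y - l0 - ksum F fst g x y)^2 = (K x y - ksum F' fst f x y)^2"
              using u1 by eventually_elim (use elim in \<open>simp add: ks diff_diff_eq\<close>)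
          qed
        qed
      qed
      thus "hs (\<lambda>x y. K x y - l0 - ksum F fst g x y) (\<lambda>x y. K x y - l0 - ksum F fst g x y) \<le> \<epsilon>" using le by simp
    qed auto
    qed
  qed
  qed
qed


section \<open>Degenerate quadratic forms\<close>

text \<open>The coordinates that belong to a vertex in the forms below; \<open>touch\<close> also contains the edges from smaller vertices.\<close>
definition blk :: "nat \<Rightarrow> (nat \<times> nat) set" where "blk u = {i. fst i = u}"

text \<open>  Vectors indexed by \<open>J\<close>, one for each vertex, independent between vertices, centred and with identity covariance.
  Both eigenfunctions evaluated at the types and random signs are of this kind.\<close>
definition vertex_noise :: "'j set \<Rightarrow> real \<Rightarrow> (nat \<Rightarrow> 'j \<Rightarrow> outcome \<Rightarrow> real) \<Rightarrow> bool" where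
  "vertex_noise J c V \<longleftrightarrow> (\<forall>u. \<forall>j\<in>J. bmeas Om (V u j) \<and> depends_on (blk u) (V u j) \<and>
     (\<forall>w\<in>space Om. \<bar>V u j w\<bar> \<le> c) \<and> (\<E> w. V u j w) = 0 \<and>
     (\<forall>i\<in>J. (\<E> w. V u i w * V u j w) = of_bool (i = j)))"

text \<open>The subtracted diagonal leaves the sum over ordered pairs of distinct vertices.\<close>
definition qform :: "'j set \<Rightarrow> ('j \<Rightarrow> real) \<Rightarrow> nat \<Rightarrow> (nat \<Rightarrow> 'j \<Rightarrow> outcome \<Rightarrow> real) \<Rightarrow> outcome \<Rightarrow> real" where
  "qform J lam n V w = (\<Sum>j\<in>J. lam j * ((\<Sum>u\<in>{1..n}. V u j w)^2 - (\<Sum>u\<in>{1..n}. (V u j w)^2))) / real n"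

lemma vertex_noiseD:
  assumes "vertex_noise J c V" "j \<in> J"
  shows "bmeas Om (V u j)" "depends_on (blk u) (V u j)" "w \<in> space Om \<Longrightarrow> \<bar>V u j w\<bar> \<le> c"
    "(\<E> w. V u j w) = 0" "i \<in> J \<Longrightarrow> (\<E> w. V u i w * V u j w) = of_bool (i = j)"
  using assms unfolding vertex_noise_def by blast+

text \<open>The dependence of the form on a single vertex is linear because it has no diagonal.\<close>
lemma qform_split:
  assumes "k \<in> {1..n}"
  shows "qform J lam n V w = qform J lam n (V(k := \<lambda>_ _. 0)) w
    + (\<Sum>j\<in>J. 2 * lam j / real n * (\<Sum>u\<in>{1..n} - {k}. V u j w) * V k j w)"
proof -
  have s: "(\<Sum>u\<in>{1..n}. f u) = f k + (\<Sum>u\<in>{1..n} - {k}. f u)" for f :: "nat \<Rightarrow> real"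
    using assms by (intro sum.remove) auto
  have z: "(\<Sum>u\<in>{1..n} - {k}. g ((V(k := \<lambda>_ _. 0)) u j w)) = (\<Sum>u\<in>{1..n} - {k}. g (V u j w))" for g :: "real \<Rightarrow> real" and j
    by (intro sum.cong refl) auto
  have "lam j * ((\<Sum>u\<in>{1..n}. V u j w)^2 - (\<Sum>u\<in>{1..n}. (V u j w)^2))
     = lam j * ((\<Sum>u\<in>{1..n}. (V(k := \<lambda>_ _. 0)) u j w)^2 - (\<Sum>u\<in>{1..n}. ((V(k := \<lambda>_ _. 0)) u j w)^2))
      + 2 * lam j * (\<Sum>u\<in>{1..n} - {k}. V u j w) * V k j w" for j
    unfolding s z[of "\<lambda>x. x"] z[of "\<lambda>x. x^2"] by (simp add: power2_eq_square algebra_simps)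
  thus ?thesis unfolding qform_def by (simp add: sum.distrib add_divide_distrib sum_divide_distrib)
qed

text \<open>  Lindeberg's step at the vertex \<open>k\<close>. The approximating quantity does not contain \<open>V k\<close>: the form is linear in it,
  and only its first two moments enter.\<close>
lemma qform_step:
  fixes lam :: "'j \<Rightarrow> real" and t :: real
  assumes J: "finite J" and V: "vertex_noise J c V" and k: "k \<in> {1..n}"
  defines "G \<equiv> \<lambda>w. iexp (t * qform J lam n (V(k := \<lambda>_ _. 0)) w)"
    and "B \<equiv> \<lambda>j w. t * (2 * lam j / real n * (\<Sum>u\<in>{1..n} - {k}. V u j w))"
  shows "cmod ((\<E> w. iexp (t * qform J lam n V w)) -
      ((\<E> w. G w) - (\<Sum>j\<in>J. \<E> w. G w * of_real ((B j w)^2)) / 2))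
    \<le> (1 + 11 * (2 * t * (\<Sum>j\<in>J. \<bar>lam j\<bar> * c^2)) ^ 4) * (1 / sqrt (real n)) ^ 3"
proof -
  note VD = vertex_noiseD[OF V]
  have n0: "real n > 0" using k by auto
  have dis: "blk k \<inter> - blk k = {}" by simp
  have bG: "bmeas Om G" unfolding G_def qform_def
    using VD(1) by (intro bmeas_iexp bmeas_mult bmeas_const bmeas_divide bmeas_sum bmeas_diff bmeas_power) auto
  have G1: "cmod (G w) \<le> 1" for w by (simp add: G_def)
  have dV: "depends_on (- blk k) (V u j)" if "u \<noteq> k" "j \<in> J" for u j
    by (rule depends_on_mono[OF VD(2)[OF that(2)]]) (use that in \<open>auto simp: blk_def\<close>)
  have dG: "depends_on (- blk k) G" unfolding G_def qform_def
    by (intro depends_on_arith depends_on_sum depends_on_const) (auto intro: dV)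
  have bB: "bmeas Om (B j)" if "j \<in> J" for j unfolding B_def
    using VD(1) that by (intro bmeas_mult bmeas_sum bmeas_const) auto
  have dB: "depends_on (- blk k) (B j)" if "j \<in> J" for j unfolding B_def
    using that by (intro depends_on_arith depends_on_sum depends_on_const) (auto intro: dV)
  define X where "X w = (\<Sum>j\<in>J. B j w * V k j w)" for w
  have bX: "bmeas Om X" unfolding X_def using bB VD(1) by auto
  have e: "(\<E> w. iexp (t * qform J lam n V w)) = (\<E> w. G w * iexp (X w))"
    unfolding G_def qform_split[OF k, of J lam V]
    by (simp add: X_def B_def distrib_left exp_add sum_distrib_left mult_ac)
  have bc: "bmeas Om (\<lambda>w. complex_of_real (V k j w))" "bmeas Om (\<lambda>w. complex_of_real (B j w))" if "j \<in> J" for j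
    using VD(1) bB that by auto
  have ofr: "(\<E> w. complex_of_real (g w)) = complex_of_real (\<E> w. g w)" for g by simp
  have GX: "(\<E> w. G w * of_real (X w)) = 0"
  proof -
    have z: "(\<E> w. G w * of_real (B j w) * of_real (V k j w)) = 0" if j: "j \<in> J" for j
    proof -
      have "(\<E> w. G w * of_real (B j w) * of_real (V k j w))
        = (\<E> w. G w * of_real (B j w)) * (\<E> w. complex_of_real (V k j w))"
        by (rule expectation_disjoint_mult[where A="- blk k" and B="blk k"])
           (use bG bc[OF j] VD(2)[OF j] dG dB[OF j] in auto)
      thus ?thesis using VD(4)[OF j] ofr by simp
    qed
    have "(\<E> w. G w * of_real (X w)) = (\<E> w. (\<Sum>j\<in>J. G w * of_real (B j w) * of_real (V k j w)))"
      by (simp add: X_def sum_distrib_left mult_ac)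
    also have "\<dots> = (\<Sum>j\<in>J. \<E> w. G w * of_real (B j w) * of_real (V k j w))"
      by (intro lint_sum Om.bmeas_integrable bmeas_mult bG bc)
    finally show ?thesis using z by simp
  qed
  have GX2: "(\<E> w. G w * of_real ((X w)^2)) = (\<Sum>j\<in>J. \<E> w. G w * of_real ((B j w)^2))"
  proof -
    let ?T = "\<lambda>i j w. G w * of_real (B i w) * of_real (B j w) * (complex_of_real (V k i w) * of_real (V k j w))"
    have z: "(\<E> w. ?T i j w) = (if j = i then \<integral>w. G w * of_real ((B i w)^2) \<partial>Om else 0)" if "i \<in> J" "j \<in> J" for i j
    proof -
      have "(\<E> w. ?T i j w) = (\<E> w. G w * of_real (B i w) * of_real (B j w)) *
           (\<E> w. complex_of_real (V k i w) * of_real (V k j w))"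
        by (rule expectation_disjoint_mult[where A="- blk k" and B="blk k"])
           (use that bG bB VD(1,2) dG dB in auto)
      also have "(\<E> w. complex_of_real (V k i w) * of_real (V k j w)) = complex_of_real (of_bool (i = j))"
        using VD(5)[OF that(2,1)] ofr[of "\<lambda>w. V k i w * V k j w"] by simp
      finally show ?thesis by (simp add: power2_eq_square mult.assoc)
    qed
    have "(\<E> w. G w * of_real ((X w)^2)) = (\<E> w. (\<Sum>i\<in>J. \<Sum>j\<in>J. ?T i j w))"
      by (simp add: X_def power2_eq_square sum_product sum_distrib_left mult_ac)
    also have "\<dots> = (\<Sum>i\<in>J. \<Sum>j\<in>J. \<E> w. ?T i j w)"
    proof -
      have b: "bmeas Om (?T i j)" if "i \<in> J" "j \<in> J" for i j using that by (intro bmeas_mult bG bc)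
      show ?thesis
        by (subst lint_sum)
           (auto intro!: sum.cong lint_sum Om.bmeas_integrable bmeas_sum b)
    qed
    also have "\<dots> = (\<Sum>i\<in>J. \<Sum>j\<in>J. if j = i then \<integral>w. G w * of_real ((B i w)^2) \<partial>Om else 0)"
      by (intro sum.cong refl z)
    finally show ?thesis using J by simp
  qed
  have X4: "(\<E> w. (X w) ^ 4) \<le> (11 * (2 * t * (\<Sum>j\<in>J. \<bar>lam j\<bar> * c^2)) ^ 4) * (1 / sqrt (real n)) ^ 4"
  proof -
    define D where "D = (\<Sum>j\<in>J. \<bar>lam j\<bar> * c^2)"
    define Y where "Y u w = (\<Sum>j\<in>J. lam j * V u j w * V k j w)" for u w
    have bY: "bmeas Om (Y u)" for u unfolding Y_def using VD(1) by auto
    have YD: "\<bar>Y u w\<bar> \<le> D" if w: "w \<in> space Om" for u w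
    proof -
      have "\<bar>Y u w\<bar> \<le> (\<Sum>j\<in>J. \<bar>lam j * V u j w * V k j w\<bar>)" unfolding Y_def by (rule sum_abs)
      also have "\<dots> \<le> D" unfolding D_def
      proof (rule sum_mono)
        fix j assume j: "j \<in> J"
        have "\<bar>V u j w\<bar> * \<bar>V k j w\<bar> \<le> c * c" using VD(3)[OF j w] by (intro mult_mono) (auto intro: order_trans[OF abs_ge_zero])
        thus "\<bar>lam j * V u j w * V k j w\<bar> \<le> \<bar>lam j\<bar> * c^2"
          by (simp add: abs_mult mult.assoc power2_eq_square mult_left_mono)
      qed
      finally show ?thesis .
    qed
    have orth: "(\<E> w. (\<Sum>i\<in>I. Y i w) ^ p * Y u w) = 0" if I: "I \<subseteq> {1..n} - {k}" "u \<in> {1..n} - {k} - I" for I u p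
    proof -
      define H where "H w = (\<Sum>i\<in>I. Y i w) ^ p" for w
      have bH: "bmeas Om H" unfolding H_def using bY by auto
      have dH: "depends_on (- blk u) H" unfolding H_def Y_def
        by (intro depends_on_arith depends_on_sum depends_on_const)
           (use I in \<open>auto intro!: depends_on_mono[OF VD(2)] simp: blk_def\<close>)
      have z: "(\<E> w. (H w * (lam j * V k j w)) * V u j w) = 0" if j: "j \<in> J" for j
      proof -
        have dk: "depends_on (- blk u) (V k j)"
          by (rule depends_on_mono[OF VD(2)[OF j]]) (use I in \<open>auto simp: blk_def\<close>)
        have "(\<E> w. (H w * (lam j * V k j w)) * V u j w) = (\<E> w. H w * (lam j * V k j w)) * (\<E> w. V u j w)"
          by (rule expectation_disjoint_mult[where A="- blk u" and B="blk u"])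
             (use bH dH dk VD(1,2)[OF j] in auto)
        thus ?thesis using VD(4)[OF j] by simp
      qed
      have "(\<E> w. H w * Y u w) = (\<E> w. (\<Sum>j\<in>J. (H w * (lam j * V k j w)) * V u j w))"
        by (simp add: Y_def sum_distrib_left mult_ac)
      also have "\<dots> = (\<Sum>j\<in>J. \<E> w. (H w * (lam j * V k j w)) * V u j w)"
        by (intro lint_sum Om.bmeas_integrable bmeas_mult bH bmeas_const VD(1))
      finally show ?thesis using z by (simp add: H_def)
    qed
    have "(\<E> w. (\<Sum>u\<in>{1..n} - {k}. Y u w) ^ 4) \<le> 11 * D ^ 4 * (real (card ({1..n} - {k})))^2"
      by (rule Om.fourth_moment_sum(1)) (use bY YD orth in auto)
    also have "\<dots> \<le> 11 * D ^ 4 * (real n)^2" using k by (intro mult_left_mono power_mono) auto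
    finally have Y4: "(\<E> w. (\<Sum>u\<in>{1..n} - {k}. Y u w) ^ 4) \<le> 11 * D ^ 4 * (real n)^2" .
    have XY: "X w = 2 * t / real n * (\<Sum>u\<in>{1..n} - {k}. Y u w)" for w
    proof -
      have "(\<Sum>u\<in>{1..n} - {k}. Y u w) = (\<Sum>j\<in>J. \<Sum>u\<in>{1..n} - {k}. lam j * V u j w * V k j w)"
        unfolding Y_def by (rule sum.swap)
      thus ?thesis by (simp add: X_def B_def sum_distrib_left sum_distrib_right mult_ac)
    qed
    have "(\<E> w. (X w) ^ 4) = (2 * t / real n) ^ 4 * (\<E> w. (\<Sum>u\<in>{1..n} - {k}. Y u w) ^ 4)"
      unfolding XY power_mult_distrib by simp
    also have "\<dots> \<le> (2 * t / real n) ^ 4 * (11 * D ^ 4 * (real n)^2)" using Y4 by (intro mult_left_mono) auto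
    also have "\<dots> = (11 * (2 * t * D) ^ 4) * (1 / sqrt (real n)) ^ 4"
    proof -
      have "sqrt (real n) ^ 4 = (sqrt (real n) ^ 2) ^ 2" by (simp add: power_mult[symmetric] del: real_sqrt_pow2 real_sqrt_power)
      hence "sqrt (real n) ^ 4 = (real n)^2" by (simp only: real_sqrt_pow2[OF of_nat_0_le_iff])
      thus ?thesis using n0 by (simp add: power_divide power_mult_distrib field_simps eval_nat_numeral)
    qed
    finally show ?thesis by (simp add: D_def)
  qed
  have "cmod ((\<E> w. G w * iexp (X w)) - ((\<E> w. G w) - (\<E> w. G w * (X w)^2) / 2)) \<le> (\<E> w. \<bar>X w\<bar> ^ 3)"
    by (rule Om.iexp_taylor2[OF bG G1 bX GX])
  also have "\<dots> \<le> (1 + 11 * (2 * t * (\<Sum>j\<in>J. \<bar>lam j\<bar> * c^2)) ^ 4) * (1 / sqrt (real n)) ^ 3"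
    using n0 by (intro Om.third_moment_le bX X4) simp
  finally show ?thesis unfolding e using GX2 by simp
qed

text \<open>
  Invariance principle: the law of the form depends on the noise only through its first two moments,
  up to an error that vanishes. The noise is exchanged one vertex at a time.
\<close>
lemma qform_universal:
  fixes lam :: "'j \<Rightarrow> real" and t :: real
  assumes J: "finite J" and V: "vertex_noise J c V" and V': "vertex_noise J c V'"
  shows "(\<lambda>n. (\<E> w. iexp (t * qform J lam n V w)) - (\<E> w. iexp (t * qform J lam n V' w))) \<longlonglongrightarrow> 0"
proof -
  define C where "C = 1 + 11 * (2 * t * (\<Sum>j\<in>J. \<bar>lam j\<bar> * c^2)) ^ 4"
  define H where "H k u = (if u \<le> k then V u else V' u)" for k u
  have HN: "vertex_noise J c (H k)" for k
    using V V' unfolding vertex_noise_def H_def by auto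
  define \<phi> where "\<phi> n k = (\<E> w. iexp (t * qform J lam n (H k) w))" for n k
  have step: "cmod (\<phi> n (Suc k) - \<phi> n k) \<le> 2 * (C * (1 / sqrt (real n)) ^ 3)" if "k < n" for n k
  proof -
    let ?k = "Suc k"
    have k: "?k \<in> {1..n}" using that by auto
    have e1: "(H ?k)(?k := \<lambda>_ _. 0) = (H k)(?k := \<lambda>_ _. 0)" by (auto simp: H_def fun_eq_iff)
    have e2: "(\<Sum>u\<in>{1..n} - {?k}. H ?k u j w) = (\<Sum>u\<in>{1..n} - {?k}. H k u j w)" for j w
      by (intro sum.cong refl) (auto simp: H_def)
    have near: "cmod (a - b) \<le> 2 * r" if "cmod (a - m) \<le> r" "cmod (b - m) \<le> r" for a b m :: complex and r
      using norm_triangle_ineq4[of "a - m" "b - m"] that by simp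
    show ?thesis unfolding \<phi>_def C_def
      by (rule near[OF qform_step[OF J HN[of ?k] k, unfolded e1 e2] qform_step[OF J HN[of k] k]])
  qed
  have tot: "cmod (\<phi> n k - \<phi> n 0) \<le> real k * (2 * (C * (1 / sqrt (real n)) ^ 3))" if "k \<le> n" for n k
    using that
  proof (induction k)
    case (Suc k)
    have "cmod (\<phi> n (Suc k) - \<phi> n 0) \<le> cmod (\<phi> n (Suc k) - \<phi> n k) + cmod (\<phi> n k - \<phi> n 0)"
      using norm_triangle_ineq[of "\<phi> n (Suc k) - \<phi> n k" "\<phi> n k - \<phi> n 0"] by simp
    also have "\<dots> \<le> 2 * (C * (1 / sqrt (real n)) ^ 3) + real k * (2 * (C * (1 / sqrt (real n)) ^ 3))"
      using Suc by (intro add_mono step) auto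
    finally show ?case by (simp add: algebra_simps)
  qed simp
  have q: "qform J lam n (H n) w = qform J lam n V w" "qform J lam n (H 0) w = qform J lam n V' w" for n w
  proof -
    have h: "(\<Sum>u\<in>{1..n}. g (H n u j w)) = (\<Sum>u\<in>{1..n}. g (V u j w))"
      "(\<Sum>u\<in>{1..n}. g (H 0 u j w)) = (\<Sum>u\<in>{1..n}. g (V' u j w))" for j and g :: "real \<Rightarrow> real"
      by (intro sum.cong refl; simp add: H_def)+
    show "qform J lam n (H n) w = qform J lam n V w" "qform J lam n (H 0) w = qform J lam n V' w"
      unfolding qform_def h[of "\<lambda>x. x"] h[of "\<lambda>x. x^2"] by simp_all
  qed
  show ?thesis
  proof (rule Lim_null_comparison)
    show "\<forall>\<^sub>F n in sequentially. cmod ((\<E> w. iexp (t * qform J lam n V w)) - (\<E> w. iexp (t * qform J lam n V' w)))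
       \<le> 2 * C * (real n * (1 / sqrt (real n)) ^ 3)"
      using tot[OF order_refl] unfolding \<phi>_def q by (intro always_eventually allI) (simp add: mult_ac)
    have "(\<lambda>n::nat. real n * (1 / sqrt (real n)) ^ 3) \<longlonglongrightarrow> 0" by real_asymp
    from tendsto_mult_right_zero[OF this, of "2 * C"] show "(\<lambda>n. 2 * C * (real n * (1 / sqrt (real n)) ^ 3)) \<longlonglongrightarrow> 0" .
  qed
qed

text \<open>The characteristic function of a centred squared standard normal variable.\<close>
definition chi_char :: "real \<Rightarrow> complex" where
  "chi_char s = (\<integral>x. iexp (s * (x^2 - 1)) \<partial>NN)"

lemma rad_square_limit:
  "(\<lambda>n. \<E> w. iexp (s * (((\<Sum>u\<in>{1..n}. rad (w (u, Suc m))) / sqrt n)^2 - 1))) \<longlonglongrightarrow> chi_char s"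
proof -
  define X where "X n w = (\<Sum>u\<in>{1..n}. rad (w (u, Suc m))) / sqrt (real n)" for n :: nat and w :: outcome
  have mX: "X n \<in> borel_measurable Om" for n unfolding X_def by (rule bmeas_measurable) auto
  have wc: "weak_conv_m (\<lambda>n. distr Om borel (X n)) (distr NN borel (\<lambda>x. x))"
  proof (rule weak_conv_by_char[OF Om.prob_space_axioms prob_space_std_normal mX])
    fix t
    have "(\<lambda>n. \<E> w. iexp (t * ((\<Sum>i<n. rad (w (Suc i, Suc m))) / sqrt n))) \<longlonglongrightarrow> exp (- (t^2 * (\<I> x. (rad x)^2)) / 2)"
      by (rule clt_coords[OF bmeas_rad rad_mean0]) (auto simp: inj_def)
    moreover have "(\<Sum>i<n. rad (w (Suc i, Suc m))) = (\<Sum>u\<in>{1..n}. rad (w (u, Suc m)))" for n :: nat and w :: outcome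
      by (rule sum.reindex_bij_witness[of _ "\<lambda>u. u - 1" Suc]) auto
    ultimately show "(\<lambda>n. \<E> w. iexp (t * X n w)) \<longlonglongrightarrow> (\<integral>x. iexp (t * x) \<partial>NN)"
      unfolding iexp_std_normal by (simp add: X_def)
  qed simp
  have did: "distr NN borel (\<lambda>x. x) = NN" by (rule distr_id2) simp
  have rd: "real_distribution (distr Om borel (X n))" for n
    using mX by (auto simp: real_distribution_def real_distribution_axioms_def intro!: Om.prob_space_distr)
  have "(\<lambda>n. \<integral>x. iexp (s * (x^2 - 1)) \<partial>(distr Om borel (X n))) \<longlonglongrightarrow> (\<integral>x. iexp (s * (x^2 - 1)) \<partial>NN)"
    by (rule weak_conv_imp_integral_bdd_continuous_conv[OF rd real_dist_normal_dist wc[unfolded did], where B=1])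
       (auto intro!: continuous_intros)
  moreover have "(\<integral>x. iexp (s * (x^2 - 1)) \<partial>(distr Om borel (X n))) = (\<E> w. iexp (s * ((X n w)^2 - 1)))" for n
    by (rule integral_distr) (use mX in auto)
  ultimately show ?thesis by (simp add: X_def chi_char_def)
qed

text \<open>  For random signs on disjoint coordinates the components are independent, and since the squares of signs are 1, each
  is a centred square of a normalized sum.\<close>
theorem qform_limit:
  fixes lam :: "'j \<Rightarrow> real" and t :: real
  assumes J: "finite J" and V: "vertex_noise J c V"
  shows "(\<lambda>n. \<E> w. iexp (t * qform J lam n V w)) \<longlonglongrightarrow> (\<Prod>j\<in>J. chi_char (t * lam j))"
proof -
  obtain e :: "'j \<Rightarrow> nat" where e: "inj_on e J" using finite_imp_inj_to_nat_seg[OF J] by blast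
  define R where "R u j w = rad (w (u, Suc (e j)))" for u :: nat and j and w :: outcome
  have mono: "vertex_noise J (max c 1) V"
    using V unfolding vertex_noise_def by (auto simp: le_max_iff_disj)
  have R: "vertex_noise J (max c 1) R"
    unfolding vertex_noise_def
  proof (intro allI ballI conjI)
    fix u i j assume ij: "i \<in> J" "j \<in> J"
    show "bmeas Om (R u j)" unfolding R_def by auto
    show d: "depends_on (blk u) (R u j)" unfolding R_def
      by (intro depends_on_comp[where h=rad] depends_on_coord) (simp add: blk_def)
    show "\<bar>R u j w\<bar> \<le> max c 1" for w by (simp add: R_def)
    show "(\<E> w. R u j w) = 0" unfolding R_def by (simp add: expectation_coord[OF bmeas_rad] rad_mean0)
    show "(\<E> w. R u i w * R u j w) = of_bool (i = j)"
    proof (cases "i = j")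
      case True thus ?thesis by (simp add: R_def Om.prob_space)
    next
      case False
      hence "(u, Suc (e i)) \<noteq> (u, Suc (e j))" using e ij by (auto simp: inj_on_def)
      hence "(\<E> w. R u i w * of_real (rad (w (u, Suc (e j))))) = 0"
        by (intro rad_orthogonal) (auto simp: R_def intro!: depends_on_comp[where h=rad] depends_on_coord)
      thus ?thesis using False by (simp add: R_def)
    qed
  qed
  let ?S = "\<lambda>n j w. (\<Sum>u\<in>{1..n}. R u j w) / sqrt (real n)"
  have qR: "qform J lam n R w = (\<Sum>j\<in>J. lam j * ((?S n j w)^2 - 1))" if "n > 0" for n w
  proof -
    have "lam j * ((\<Sum>u\<in>{1..n}. R u j w)^2 - (\<Sum>u\<in>{1..n}. (R u j w)^2)) / real n = lam j * ((?S n j w)^2 - 1)" for j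
      using that by (simp only: power_divide real_sqrt_pow2[OF of_nat_0_le_iff]) (simp add: R_def field_simps)
    thus ?thesis unfolding qform_def sum_divide_distrib by simp
  qed
  have lim: "(\<lambda>n. \<E> w. iexp (t * qform J lam n R w)) \<longlonglongrightarrow> (\<Prod>j\<in>J. chi_char (t * lam j))"
  proof (rule Lim_transform_eventually)
    show "(\<lambda>n. \<Prod>j\<in>J. \<E> w. iexp (t * lam j * ((?S n j w)^2 - 1))) \<longlonglongrightarrow> (\<Prod>j\<in>J. chi_char (t * lam j))"
      unfolding R_def by (intro tendsto_prod rad_square_limit)
    show "\<forall>\<^sub>F n in sequentially. (\<Prod>j\<in>J. \<E> w. iexp (t * lam j * ((?S n j w)^2 - 1))) = (\<E> w. iexp (t * qform J lam n R w))"
      using eventually_gt_at_top[of 0]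
    proof eventually_elim
      case (elim n)
      have "(\<E> w. iexp (t * qform J lam n R w)) = (\<E> w. (\<Prod>j\<in>J. iexp (t * lam j * ((?S n j w)^2 - 1))))"
        unfolding qR[OF elim] by (simp add: sum_distrib_left exp_sum[OF J] mult.assoc)
      also have "\<dots> = (\<Prod>j\<in>J. \<E> w. iexp (t * lam j * ((?S n j w)^2 - 1)))"
      proof (rule expectation_disjoint_prod[OF J])
        show "bmeas Om (\<lambda>w. iexp (t * lam j * ((?S n j w)^2 - 1)))" for j
          unfolding R_def by (intro bmeas_iexp bmeas_mult bmeas_const bmeas_diff bmeas_power bmeas_divide bmeas_sum bmeas_rad_comp coord_measurable)
        show "depends_on {i. snd i = Suc (e j)} (\<lambda>w. iexp (t * lam j * ((?S n j w)^2 - 1)))" for j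
          unfolding R_def by (intro depends_on_arith depends_on_const depends_on_sum depends_on_comp[where h=rad] depends_on_coord) simp
        show "disjoint_family_on (\<lambda>j. {i :: nat \<times> nat. snd i = Suc (e j)}) J"
          using e by (auto simp: disjoint_family_on_def inj_on_def)
      qed
      finally show ?case by simp
    qed
  qed
  from tendsto_add[OF qform_universal[OF J mono R, of t lam] lim] show ?thesis by simp
qed


section \<open>Averages over pairs of types\<close>

lemma expectation_coord_pair:
  assumes "bm2 K" "i \<noteq> j"
  shows "(\<E> w. K (w i) (w j)) = (\<I> x. (\<I> y. K x y))"
proof -
  have "(\<E> w. (\<lambda>q. K (fst q) (snd q)) (w i, w j)) = (\<integral>q. K (fst q) (snd q) \<partial>distr Om UU (\<lambda>w. (w i, w j)))"
    by (rule integral_distr[symmetric]) (use assms in \<open>auto simp: bm2_def case_prod_unfold intro: bmeas_measurable\<close>)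
  thus ?thesis unfolding distr_coord_pair[OF assms(2)] bm2_pair[OF assms(1)] by simp
qed

lemma bmeas_types: "bm2 K \<Longrightarrow> bmeas Om (\<lambda>w. K (w i) (w j))"
  using bm2_comp[where K=K and M=Om and g="\<lambda>w. w i" and h="\<lambda>w. w j"] by simp

lemma depends_types: "i \<in> A \<Longrightarrow> j \<in> A \<Longrightarrow> depends_on A (\<lambda>w. K (w i) (w j))"
  unfolding depends_on_def by simp

text \<open>
  A law of large numbers: terms with disjoint pairs are uncorrelated, and only a fraction of order
  \<open>1/n\<close> of all pairs of pairs share a vertex.
\<close>
lemma pair_average:
  assumes K: "bm2 K"
  defines "m \<equiv> (\<I> x. (\<I> y. K x y))"
  shows "(\<lambda>n. \<E> w. ((\<Sum>(u, v)\<in>pairs n. K (w (u, 0)) (w (v, 0))) / (real n)^2 - m / 2)^2) \<longlonglongrightarrow> 0"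
proof -
  define Y where "Y i w = K (w (fst i, 0)) (w (snd i, 0)) - m" for i :: "nat \<times> nat" and w :: outcome
  have bY: "bmeas Om (Y i)" for i unfolding Y_def by (intro bmeas_diff bmeas_types K bmeas_const)
  obtain C where C: "C > 0" "\<And>x y. x \<in> {0..1} \<Longrightarrow> y \<in> {0..1} \<Longrightarrow> \<bar>K x y - m\<bar> \<le> C"
    using bm2_bound[OF bm2_diff[OF K bm2_const[of m]]] by blast
  have YC: "\<bar>Y i w\<bar> \<le> C" if "w \<in> space Om" for i w unfolding Y_def by (intro C coord_in that)
  have Y0: "(\<E> w. Y i w) = 0" if "i \<in> pairs n" for i n
  proof -
    have "(fst i, 0::nat) \<noteq> (snd i, 0)" using that by (auto simp: pairs_def)
    thus ?thesis unfolding Y_def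
      using expectation_coord_pair[OF K] Om.bmeas_integrable[OF bmeas_types[OF K]] by (simp add: m_def Om.prob_space)
  qed
  have cov: "(\<E> w. Y i w * Y j w) \<le> (if fst j \<in> {fst i, snd i} \<or> snd j \<in> {fst i, snd i} then C\<^sup>2 else 0)"
    if ij: "i \<in> pairs n" "j \<in> pairs n" for i j n
  proof (cases "fst j \<in> {fst i, snd i} \<or> snd j \<in> {fst i, snd i}")
    case True
    have "(\<E> w. Y i w * Y j w) \<le> (\<E> w. C^2)"
    proof (rule Om.bmeas_integral_mono)
      fix w assume w: "w \<in> space Om"
      have "\<bar>Y i w * Y j w\<bar> \<le> C * C" unfolding abs_mult by (intro mult_mono YC w) (use C in auto)
      thus "Y i w * Y j w \<le> C^2" by (simp add: power2_eq_square)
    qed (intro bmeas_mult bY bmeas_const)+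
    thus ?thesis using True by (simp add: Om.prob_space)
  next
    case False
    have "(\<E> w. Y i w * Y j w) = (\<E> w. Y i w) * (\<E> w. Y j w)"
    proof (rule expectation_disjoint_mult[OF bY _ bY])
      show "depends_on {(fst i, 0), (snd i, 0)} (Y i)" "depends_on {(fst j, 0), (snd j, 0)} (Y j)"
        unfolding Y_def by (intro depends_on_arith depends_types depends_on_const; simp)+
    qed (use False in auto)
    thus ?thesis using Y0[OF ij(1)] False by simp
  qed
  have var: "(\<E> w. (\<Sum>i\<in>pairs n. Y i w)^2) \<le> 4 * C^2 * real n ^ 3" for n
  proof -
    have "(\<E> w. (\<Sum>i\<in>pairs n. Y i w)^2) = (\<E> w. (\<Sum>i\<in>pairs n. \<Sum>j\<in>pairs n. Y i w * Y j w))"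
      by (simp add: power2_eq_square sum_product)
    also have "\<dots> = (\<Sum>i\<in>pairs n. \<Sum>j\<in>pairs n. \<E> w. Y i w * Y j w)"
      by (simp add: lint_sum Om.bmeas_integrable bmeas_mult bmeas_sum bY)
    also have "\<dots> \<le> (\<Sum>i\<in>pairs n. 4 * C^2 * real n)"
    proof (rule sum_mono)
      fix i assume i: "i \<in> pairs n"
      define S where "S = {j \<in> pairs n. fst j \<in> {fst i, snd i} \<or> snd j \<in> {fst i, snd i}}"
      have "(\<Sum>j\<in>pairs n. \<E> w. Y i w * Y j w) \<le> (\<Sum>j\<in>pairs n. if fst j \<in> {fst i, snd i} \<or> snd j \<in> {fst i, snd i} then C\<^sup>2 else 0)"
        by (intro sum_mono cov[OF i])
      also have "\<dots> = (\<Sum>j\<in>S. C^2)" unfolding S_def using finite_pairs by (intro sum.inter_filter[symmetric])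
      also have "\<dots> = C^2 * real (card S)" by simp
      also have "real (card S) \<le> 4 * real n"
      proof -
        have "S \<subseteq> {fst i, snd i} \<times> {1..n} \<union> {1..n} \<times> {fst i, snd i}" by (auto simp: S_def pairs_def)
        hence "card S \<le> card ({fst i, snd i} \<times> {1..n} \<union> {1..n} \<times> {fst i, snd i})" by (intro card_mono) auto
        also have "\<dots> \<le> card ({fst i, snd i} \<times> {1..n}) + card ({1..n} \<times> {fst i, snd i})" by (rule card_Un_le)
        also have "\<dots> = 2 * (card {fst i, snd i} * n)" by (simp add: card_cartesian_product)
        also have "\<dots> \<le> 2 * (2 * n)" by (intro mult_left_mono mult_right_mono) (auto simp: card_insert_if)
        finally have "real (card S) \<le> real (2 * (2 * n))" by (rule of_nat_mono)
        thus ?thesis by simp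
      qed
      finally show "(\<Sum>j\<in>pairs n. \<E> w. Y i w * Y j w) \<le> 4 * C^2 * real n" using C by (simp add: mult_left_mono mult_ac)
    qed
    also have "\<dots> = 4 * C^2 * real n * real (card (pairs n))" by simp
    also have "\<dots> \<le> 4 * C^2 * real n * (real n)^2"
      using of_nat_mono[OF card_pairs_le[of n], where 'a=real] by (intro mult_left_mono) auto
    finally show ?thesis by (simp add: power3_eq_cube power2_eq_square mult_ac)
  qed
  show ?thesis
  proof (rule Lim_null_comparison)
    show "(\<lambda>n. 8 * C^2 / real n + m^2 / (2 * real n ^ 2)) \<longlonglongrightarrow> 0" by real_asymp
    show "\<forall>\<^sub>F n in sequentially. norm (\<E> w. ((\<Sum>(u, v)\<in>pairs n. K (w (u, 0)) (w (v, 0))) / (real n)^2 - m / 2)^2)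
        \<le> 8 * C^2 / real n + m^2 / (2 * real n ^ 2)"
      using eventually_gt_at_top[of 0]
    proof eventually_elim
      case (elim n)
      define S where "S w = (\<Sum>i\<in>pairs n. Y i w)" for w
      have bS: "bmeas Om S" unfolding S_def by (intro bmeas_sum bY)
      have e: "(\<Sum>(u, v)\<in>pairs n. K (w (u, 0)) (w (v, 0))) / (real n)^2 - m / 2 = S w / (real n)^2 - m / (2 * real n)" for w
      proof -
        have "(\<Sum>(u, v)\<in>pairs n. K (w (u, 0)) (w (v, 0))) = S w + m * (real n * (real n - 1) / 2)"
          by (simp add: S_def Y_def case_prod_unfold sum_subtractf card_pairs[symmetric])
        thus ?thesis using elim by (simp add: field_simps power2_eq_square)
      qed
      have "(\<E> w. (S w / (real n)^2 - m / (2 * real n))^2) \<le> (\<E> w. 2 * ((S w)^2 / real n ^ 4) + m^2 / (2 * real n ^ 2))"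
      proof (rule Om.bmeas_integral_mono)
        fix w
        show "(S w / (real n)^2 - m / (2 * real n))^2 \<le> 2 * ((S w)^2 / real n ^ 4) + m^2 / (2 * real n ^ 2)"
          using sq_diff_le[of "S w / (real n)^2" "m / (2 * real n)"] by (simp add: power_divide power_mult_distrib power_mult[symmetric])
      qed (use bS in auto)
      also have "\<dots> = 2 * ((\<E> w. (S w)^2) / real n ^ 4) + m^2 / (2 * real n ^ 2)"
        using Om.bmeas_integrable[OF bmeas_power[OF bS, of 2]] by (simp add: Om.prob_space)
      also have "\<dots> \<le> 2 * (4 * C^2 * real n ^ 3 / real n ^ 4) + m^2 / (2 * real n ^ 2)"
        using var[of n] by (intro add_mono mult_left_mono divide_right_mono) (auto simp: S_def)
      also have "\<dots> = 8 * C^2 / real n + m^2 / (2 * real n ^ 2)" using elim by (simp add: field_simps eval_nat_numeral)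
      finally show ?case unfolding e by simp
    qed
  qed
qed

section \<open>The noise of the edges given the types\<close>

text \<open>Comparison with a centred Gaussian variable of the same variance.\<close>
lemma centred_bernoulli_char:
  fixes a p :: real
  assumes p: "p \<in> {0..1}"
  defines "\<psi> \<equiv> (\<I> y. iexp (a * (of_bool (y \<le> p) - p)))"
  shows "cmod \<psi> \<le> 1" and "cmod (\<psi> - complex_of_real (exp (- (a^2 * (p * (1 - p)) / 2)))) \<le> \<bar>a\<bar> ^ 3 + a ^ 4"
proof -
  define X where "X y = a * (of_bool (y \<le> p) - p)" for y :: real
  have bo: "bm1 (\<lambda>y. of_bool (y \<le> p) :: real)"
    by (rule bmeas_of_bool) (simp add: unit_leb_def measurable_restrict_space1)
  have bX: "bm1 X" unfolding X_def by (intro bmeas_mult bmeas_diff bo bmeas_const)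
  have X1: "(\<I> y. X y) = 0"
    using integral_unit_threshold[OF p] U.bmeas_integrable[OF bo] by (simp add: X_def)
  have X2: "(\<I> y. (X y)^2) = a^2 * (p * (1 - p))"
  proof -
    have "(\<I> y. (X y)^2) = (\<I> y. a^2 * ((1 - 2 * p) * of_bool (y \<le> p) + p^2))"
      by (intro lint_cong refl) (auto simp: X_def power2_eq_square algebra_simps)
    also have "\<dots> = a^2 * ((1 - 2 * p) * p + p^2)"
      using integral_unit_threshold[OF p] U.bmeas_integrable[OF bo] by simp
    finally show ?thesis by (simp add: power2_eq_square algebra_simps)
  qed
  have Xa: "\<bar>X y\<bar> \<le> \<bar>a\<bar>" for y
  proof -
    have "\<bar>of_bool (y \<le> p) - p\<bar> \<le> 1" using p by auto
    thus ?thesis unfolding X_def abs_mult by (rule mult_left_le) simp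
  qed
  have psi: "\<psi> = (\<I> y. 1 * iexp (X y))" by (simp add: \<psi>_def X_def)
  have "cmod \<psi> \<le> (\<I> y. cmod (1 * iexp (X y)))" unfolding psi by (rule integral_norm_bound)
  thus "cmod \<psi> \<le> 1" by simp
  define x where "x = a^2 * (p * (1 - p)) / 2"
  have "p * (1 - p) \<le> 1 * 1" using p by (intro mult_mono) auto
  hence "a^2 * (p * (1 - p)) \<le> a^2" using mult_left_mono[of "p * (1 - p)" 1 "a^2"] by simp
  moreover have "0 \<le> a^2 * (p * (1 - p))" using p by auto
  ultimately have x: "0 \<le> x" "x \<le> a^2" by (auto simp: x_def simp del: zero_le_mult_iff)
  have "cmod ((\<I> y. 1 * iexp (X y)) - ((\<I> y. (1 :: complex)) - (\<I> y. 1 * of_real ((X y)^2)) / 2)) \<le> (\<I> y. \<bar>X y\<bar> ^ 3)"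
  proof (rule U.iexp_taylor2[OF _ _ bX])
    show "(CLINT y|unit_leb. 1 * of_real (X y)) = 0" using X1 by simp
  qed auto
  also have "(\<I> y. 1 * of_real ((X y)^2)) = complex_of_real (\<I> y. (X y)^2)"
    unfolding integral_complex_of_real[symmetric] by simp
  also have "(\<I> y. (1 :: complex)) - complex_of_real (\<I> y. (X y)^2) / 2 = complex_of_real (1 - x)"
    by (simp add: X2 x_def)
  finally have 1: "cmod (\<psi> - complex_of_real (1 - x)) \<le> (\<I> y. \<bar>X y\<bar> ^ 3)" unfolding psi .
  have 2: "(\<I> y. \<bar>X y\<bar> ^ 3) \<le> (\<I> y. \<bar>a\<bar> ^ 3)"
    by (rule U.bmeas_integral_mono) (use bX Xa in \<open>auto intro: power_mono\<close>)
  have 3: "cmod (complex_of_real (1 - x) - complex_of_real (exp (- x))) \<le> a ^ 4"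
  proof -
    have "cmod (complex_of_real (1 - x) - complex_of_real (exp (- x))) = \<bar>1 - x - exp (- x)\<bar>"
      by (simp only: of_real_diff[symmetric] norm_of_real)
    also have "\<dots> \<le> x^2 / 2" by (rule exp_minus_taylor[OF x(1)])
    also have "\<dots> \<le> x^2" by simp
    also have "\<dots> \<le> (a^2)^2" by (rule power_mono[OF x(2,1)])
    finally show ?thesis by (simp add: power_mult[symmetric])
  qed
  have "cmod (\<psi> - complex_of_real (exp (- x))) \<le> \<bar>a\<bar> ^ 3 + a ^ 4"
    using norm_triangle_ineq[of "\<psi> - complex_of_real (1 - x)" "complex_of_real (1 - x) - complex_of_real (exp (- x))"] 1 2 3 by (simp del: of_real_diff of_real_exp)
  thus "cmod (\<psi> - complex_of_real (exp (- (a^2 * (p * (1 - p)) / 2)))) \<le> \<bar>a\<bar> ^ 3 + a ^ 4" by (simp add: x_def)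
qed

lemma exp_minus_lipschitz:
  fixes a b :: real
  assumes "0 \<le> a" "0 \<le> b" shows "\<bar>exp (- a) - exp (- b)\<bar> \<le> \<bar>a - b\<bar>"
  using assms
proof (induction a b rule: linorder_wlog)
  case (le a b)
  have "exp (- a) - exp (- b) = exp (- a) * (1 - exp (a - b))" by (simp add: right_diff_distrib mult_exp_exp)
  also have "\<dots> \<le> 1 * (b - a)"
    using le exp_ge_add_one_self[of "a - b"] by (intro mult_mono) (simp_all add: algebra_simps)
  finally show ?case using le by simp
qed (simp add: abs_minus_commute)

context tourn
begin

definition edge_noise :: "kernel \<Rightarrow> nat \<Rightarrow> outcome \<Rightarrow> real" where
  "edge_noise c n w = (\<Sum>(u, v)\<in>pairs n. (adj w u v - W (w (u, 0)) (w (v, 0))) * c (w (u, 0)) (w (v, 0))) / real n"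

lemma bm2_W: "bm2 W" using bmeas_W by (simp add: bm2_def)

lemma bm2_p: "bm2 (p_fun W)" using bmeas_p by (simp add: bm2_def)

lemma bmeas_edge_noise: "bm2 c \<Longrightarrow> bmeas Om (edge_noise c n)"
  unfolding edge_noise_def case_prod_unfold
  by (intro bmeas_divide bmeas_sum bmeas_mult bmeas_diff bmeas_adj bmeas_W_comp bmeas_types) simp_all

text \<open>The contribution of an edge to the variance of \<open>edge_noise\<close> given the types.\<close>
definition edge_var :: "kernel \<Rightarrow> real \<Rightarrow> real \<Rightarrow> real" where
  "edge_var c x y = W x y * W y x * (c x y)^2"

lemma bm2_edge_var: "bm2 c \<Longrightarrow> bm2 (edge_var c)" unfolding edge_var_def[abs_def]
  by (intro bm2_mult bm2_W bm2_swap[OF bm2_W] bm2_power)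

lemma edge_var_in: "x \<in> {0..1} \<Longrightarrow> y \<in> {0..1} \<Longrightarrow> 0 \<le> edge_var c x y"
  using W_in[of x y] W_in[of y x] by (auto simp: edge_var_def)

definition cond_var :: "kernel \<Rightarrow> nat \<Rightarrow> outcome \<Rightarrow> real" where
  "cond_var c n w = (\<Sum>(u, v)\<in>pairs n. edge_var c (w (u, 0)) (w (v, 0))) / (real n)^2"

lemma bmeas_cond_var: "bm2 c \<Longrightarrow> bmeas Om (cond_var c n)"
  unfolding cond_var_def case_prod_unfold by (intro bmeas_divide bmeas_sum bmeas_types bm2_edge_var)

context
  fixes c :: kernel
  assumes c: "bm2 c" and c1: "\<And>x y. x \<in> {0..1} \<Longrightarrow> y \<in> {0..1} \<Longrightarrow> \<bar>c x y\<bar> \<le> 1"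
begin

text \<open>  Given the types the characteristic function is a product over the edges. Replacing one factor by its Gaussian
  counterpart costs \<open>O(n^(-3))\<close>, and there are at most \<open>n^2\<close> factors.\<close>
lemma edge_noise_conditional:
  assumes A: "bmeas Om A" "depends_on {i. snd i = 0} A" and n: "n > 0"
  shows "cmod ((\<E> w. iexp (A w + t * edge_noise c n w)) - (\<E> w. iexp (A w) * of_real (exp (- (t^2 * cond_var c n w / 2)))))
    \<le> (real n)^2 * (\<bar>t / real n\<bar> ^ 3 + (t / real n) ^ 4)"
proof -
  define a where "a e w = t / real n * c (w (fst e, 0)) (w (snd e, 0))" for e :: "nat \<times> nat" and w :: outcome
  define P where "P e w = W (w (fst e, 0)) (w (snd e, 0))" for e :: "nat \<times> nat" and w :: outcome
  define g where "g e y w = iexp (a e w * (of_bool (y \<le> P e w) - P e w))" for e y w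
  define \<psi> where "\<psi> e w = (\<I> y. g e y w)" for e w
  define E where "E e w = exp (- ((a e w)^2 * (P e w * (1 - P e w)) / 2))" for e w
  have Pin: "P e w \<in> {0..1}" if "w \<in> space Om" for e w unfolding P_def by (intro W_in coord_in that)
  have ale: "\<bar>a e w\<bar> \<le> \<bar>t / real n\<bar>" if "w \<in> space Om" for e w
    unfolding a_def abs_mult by (rule mult_left_le[OF c1]) (use coord_in that in auto)
  have ba: "bmeas Om (a e)" and bP: "bmeas Om (P e)" for e
    unfolding a_def P_def by (intro bmeas_mult bmeas_const bmeas_types c bm2_W)+
  have da: "depends_on {i. snd i = 0} (a e)" and dP: "depends_on {i. snd i = 0} (P e)" for e
    unfolding a_def P_def by (intro depends_on_arith depends_on_const depends_types; simp)+
  have fstm: "bmeas (Om \<Otimes>\<^sub>M unit_leb) (\<lambda>z. f (fst z))" if "bmeas Om f" for f :: "_ \<Rightarrow> real" by (rule bmeas_comp[OF that]) simp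
  have bg: "bmeas (Om \<Otimes>\<^sub>M unit_leb) (\<lambda>(w, y). g e y w)" for e
  proof -
    have "Measurable.pred (Om \<Otimes>\<^sub>M unit_leb) (\<lambda>z. snd z \<le> P e (fst z))"
      by (rule borel_measurable_le[unfolded pred_def[symmetric]])
         (auto intro: measurable_compose[OF measurable_snd ident_unit_measurable] bmeas_measurable fstm[OF bP])
    thus ?thesis unfolding g_def case_prod_unfold
      by (intro bmeas_iexp bmeas_mult bmeas_diff bmeas_of_bool fstm ba bP)
  qed
  have dg: "depends_on {i. snd i = 0} (g e y)" for e y unfolding g_def
    by (intro depends_on_arith da dP depends_on_comp[where h="\<lambda>p. of_bool (y \<le> p)"])
  have bpsi: "bmeas Om (\<psi> e)" for e unfolding \<psi>_def using U.bmeas_integral[OF bg] by simp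
  have bE: "bmeas Om (E e)" for e unfolding E_def by (intro bmeas_exp bmeas_uminus bmeas_divide bmeas_mult bmeas_power bmeas_diff bmeas_const ba bP)
  have sum_e: "t * edge_noise c n w = (\<Sum>e\<in>pairs n. a e w * (of_bool (w e \<le> P e w) - P e w))" for w
  proof -
    have "adj w (fst e) (snd e) = of_bool (w e \<le> P e w)" if "e \<in> pairs n" for e
      using that by (cases e) (auto simp: adj_alt ori_def P_def pairs_def)
    thus ?thesis unfolding edge_noise_def sum_divide_distrib sum_distrib_left
      by (intro sum.cong refl) (auto simp: case_prod_unfold a_def P_def)
  qed
  have e1: "iexp (A w + t * edge_noise c n w) = iexp (A w) * (\<Prod>e\<in>pairs n. g e (w e) w)" for w
    unfolding sum_e g_def by (simp add: exp_add distrib_left sum_distrib_left exp_sum[OF finite_pairs])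
  have e2: "exp (- (t^2 * cond_var c n w / 2)) = (\<Prod>e\<in>pairs n. E e w)" if w: "w \<in> space Om" for w
  proof -
    have W': "P e w * (1 - P e w) = W (w (fst e, 0)) (w (snd e, 0)) * W (w (snd e, 0)) (w (fst e, 0))" for e
      unfolding P_def by (subst W_swap[OF coord_in[OF w] coord_in[OF w], of "(snd e, 0)" "(fst e, 0)"])
        (simp add: W_swap[OF coord_in[OF w] coord_in[OF w], of "(fst e, 0)" "(snd e, 0)"])
    have "- (t^2 * cond_var c n w / 2) = (\<Sum>e\<in>pairs n. - ((a e w)^2 * (P e w * (1 - P e w)) / 2))"
      unfolding cond_var_def sum_divide_distrib sum_distrib_left sum_negf[symmetric]
      unfolding W' by (intro sum.cong refl) (simp add: case_prod_unfold a_def edge_var_def power_mult_distrib power_divide)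
    thus ?thesis unfolding E_def exp_sum[OF finite_pairs, symmetric] by simp
  qed
  have bA: "bmeas Om (\<lambda>w. iexp (A w))" by (intro bmeas_iexp A)
  have "(\<E> w. iexp (A w + t * edge_noise c n w)) = (\<E> w. iexp (A w) * (\<Prod>e\<in>pairs n. \<psi> e w))"
    unfolding e1 \<psi>_def
    by (rule integrate_edges[OF finite_pairs _ bA _ bg dg]) (auto simp: pairs_def intro!: depends_on_arith A)
  moreover have "(\<E> w. iexp (A w) * of_real (exp (- (t^2 * cond_var c n w / 2)))) = (\<E> w. iexp (A w) * of_real (\<Prod>e\<in>pairs n. E e w))"
    by (rule lint_cong[OF refl]) (simp only: e2)
  ultimately have "(\<E> w. iexp (A w + t * edge_noise c n w)) - (\<E> w. iexp (A w) * of_real (exp (- (t^2 * cond_var c n w / 2))))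
      = (\<E> w. iexp (A w) * (\<Prod>e\<in>pairs n. \<psi> e w) - iexp (A w) * of_real (\<Prod>e\<in>pairs n. E e w))"
    by (simp only:) (intro lint_diff[symmetric] Om.bmeas_integrable bmeas_mult bA bmeas_prod bpsi bmeas_of_real bE)
  also have "cmod \<dots> \<le> (\<E> w. cmod (iexp (A w) * (\<Prod>e\<in>pairs n. \<psi> e w) - iexp (A w) * of_real (\<Prod>e\<in>pairs n. E e w)))"
    by (rule integral_norm_bound)
  also have "\<dots> \<le> (\<E> w. (real n)^2 * (\<bar>t / real n\<bar> ^ 3 + (t / real n) ^ 4))"
  proof (rule Om.bmeas_integral_mono)
    show "bmeas Om (\<lambda>w. cmod (iexp (A w) * (\<Prod>e\<in>pairs n. \<psi> e w) - iexp (A w) * of_real (\<Prod>e\<in>pairs n. E e w)))"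
      by (intro bmeas_norm bmeas_diff bmeas_mult bA bmeas_prod bpsi bmeas_of_real bE)
    fix w assume w: "w \<in> space Om"
    have near: "cmod (\<psi> e w) \<le> 1" "cmod (\<psi> e w - complex_of_real (E e w)) \<le> \<bar>a e w\<bar> ^ 3 + (a e w) ^ 4" for e
      using centred_bernoulli_char[OF Pin[OF w], of "a e w" e] unfolding \<psi>_def g_def E_def by auto
    have a34: "\<bar>a e w\<bar> ^ 3 + (a e w) ^ 4 \<le> \<bar>t / real n\<bar> ^ 3 + (t / real n) ^ 4" for e
    proof -
      have "\<bar>a e w\<bar> ^ 4 \<le> \<bar>t / real n\<bar> ^ 4" by (intro power_mono ale w) simp
      hence "(a e w) ^ 4 \<le> (t / real n) ^ 4" by (simp only: power_even_abs_numeral[OF even_numeral])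
      moreover have "\<bar>a e w\<bar> ^ 3 \<le> \<bar>t / real n\<bar> ^ 3" by (intro power_mono ale w) simp
      ultimately show ?thesis by linarith
    qed
    have E1: "cmod (complex_of_real (E e w)) \<le> 1" for e
    proof -
      have "0 \<le> (a e w)^2 * (P e w * (1 - P e w)) / 2" using Pin[OF w, of e] by auto
      thus ?thesis by (simp add: E_def)
    qed
    have "cmod (iexp (A w) * (\<Prod>e\<in>pairs n. \<psi> e w) - iexp (A w) * of_real (\<Prod>e\<in>pairs n. E e w))
       = cmod ((\<Prod>e\<in>pairs n. \<psi> e w) - (\<Prod>e\<in>pairs n. complex_of_real (E e w)))"
      by (simp add: right_diff_distrib[symmetric] norm_mult)
    also have "\<dots> \<le> (\<Sum>e\<in>pairs n. cmod (\<psi> e w - complex_of_real (E e w)))"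
      by (rule norm_prod_diff) (use near E1 in auto)
    also have "\<dots> \<le> (\<Sum>e\<in>pairs n. \<bar>t / real n\<bar> ^ 3 + (t / real n) ^ 4)"
      by (intro sum_mono order_trans[OF near(2) a34])
    also have "\<dots> = real (card (pairs n)) * (\<bar>t / real n\<bar> ^ 3 + (t / real n) ^ 4)" by simp
    also have "\<dots> \<le> (real n)^2 * (\<bar>t / real n\<bar> ^ 3 + (t / real n) ^ 4)"
      using of_nat_mono[OF card_pairs_le[of n], where 'a=real] by (intro mult_right_mono) auto
    finally show "cmod (iexp (A w) * (\<Prod>e\<in>pairs n. \<psi> e w) - iexp (A w) * of_real (\<Prod>e\<in>pairs n. E e w))
       \<le> (real n)^2 * (\<bar>t / real n\<bar> ^ 3 + (t / real n) ^ 4)" .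
  qed auto
  finally show ?thesis by (simp add: Om.prob_space)
qed

text \<open>The conditional variance concentrates, so the noise contributes an independent Gaussian factor.\<close>
lemma edge_noise_limit:
  assumes A: "\<And>n. bmeas Om (A n)" "\<And>n. depends_on {i. snd i = 0} (A n)"
  defines "v \<equiv> (\<I> x. (\<I> y. edge_var c x y)) / 2"
  shows "(\<lambda>n. (\<E> w. iexp (A n w + t * edge_noise c n w)) - complex_of_real (exp (- (t^2 * v / 2))) * (\<E> w. iexp (A n w))) \<longlonglongrightarrow> 0"
proof (rule Lim_null_comparison)
  define D where "D n = (\<E> w. (cond_var c n w - v)^2)" for n
  have D: "D \<longlonglongrightarrow> 0" unfolding D_def[abs_def] cond_var_def v_def by (rule pair_average[OF bm2_edge_var[OF c]])
  have v0: "0 \<le> v" unfolding v_def by (auto intro!: integral_nonneg_AE AE_I2 edge_var_in)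
  have "(\<lambda>n::nat. (real n)^2 * (\<bar>t / real n\<bar> ^ 3 + (t / real n) ^ 4)) \<longlonglongrightarrow> 0"
  proof -
    have "(\<lambda>n::nat. \<bar>t\<bar> ^ 3 / real n + t ^ 4 / (real n)^2) \<longlonglongrightarrow> 0" by real_asymp
    moreover have "\<forall>\<^sub>F n in sequentially. \<bar>t\<bar> ^ 3 / real n + t ^ 4 / (real n)^2 = (real n)^2 * (\<bar>t / real n\<bar> ^ 3 + (t / real n) ^ 4)"
      using eventually_gt_at_top[of 0] by eventually_elim (simp add: power_divide field_simps eval_nat_numeral)
    ultimately show ?thesis by (rule Lim_transform_eventually)
  qed
  moreover have "(\<lambda>n. t^2 / 2 * sqrt (D n)) \<longlonglongrightarrow> 0"
    using tendsto_mult_right_zero[OF tendsto_real_sqrt[OF D, simplified]] .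
  ultimately show "(\<lambda>n. (real n)^2 * (\<bar>t / real n\<bar> ^ 3 + (t / real n) ^ 4) + t^2 / 2 * sqrt (D n)) \<longlonglongrightarrow> 0"
    using tendsto_add_zero by blast
  show "\<forall>\<^sub>F n in sequentially. cmod ((\<E> w. iexp (A n w + t * edge_noise c n w)) - complex_of_real (exp (- (t^2 * v / 2))) * (\<E> w. iexp (A n w)))
      \<le> (real n)^2 * (\<bar>t / real n\<bar> ^ 3 + (t / real n) ^ 4) + t^2 / 2 * sqrt (D n)"
    using eventually_gt_at_top[of 0]
  proof eventually_elim
    case (elim n)
    define V where "V = cond_var c n"
    have bV: "bmeas Om V" unfolding V_def by (rule bmeas_cond_var[OF c])
    have V0: "0 \<le> V w" if "w \<in> space Om" for w
      unfolding V_def cond_var_def by (intro divide_nonneg_nonneg sum_nonneg) (auto intro!: edge_var_in coord_in that)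
    have bA: "bmeas Om (\<lambda>w. iexp (A n w))" by (intro bmeas_iexp A)
    have bX: "bmeas Om (\<lambda>w. complex_of_real (exp (- (t^2 * V w / 2))))"
      by (intro bmeas_of_real bmeas_exp bmeas_uminus bmeas_divide bmeas_mult bmeas_const bV)
    let ?L = "(\<E> w. iexp (A n w) * of_real (exp (- (t^2 * V w / 2)))) - complex_of_real (exp (- (t^2 * v / 2))) * (\<E> w. iexp (A n w))"
    let ?h = "\<lambda>w. iexp (A n w) * of_real (exp (- (t^2 * V w / 2))) - complex_of_real (exp (- (t^2 * v / 2))) * iexp (A n w)"
    have L: "?L = (\<E> w. ?h w)"
      using Om.bmeas_integrable[OF bA] Om.bmeas_integrable[OF bmeas_mult[OF bA bX]]
      by (subst lint_diff) (auto simp del: of_real_exp)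
    have "cmod ?L \<le> (\<E> w. cmod (?h w))" unfolding L by (rule integral_norm_bound)
    also have "\<dots> \<le> (\<E> w. t^2 / 2 * \<bar>V w - v\<bar>)"
    proof (rule Om.bmeas_integral_mono)
      show "bmeas Om (\<lambda>w. cmod (iexp (A n w) * of_real (exp (- (t^2 * V w / 2))) - complex_of_real (exp (- (t^2 * v / 2))) * iexp (A n w)))"
        by (rule bmeas_norm[OF bmeas_diff[OF bmeas_mult[OF bA bX] bmeas_mult[OF bmeas_const bA]]])
      show "bmeas Om (\<lambda>w. t^2 / 2 * \<bar>V w - v\<bar>)" by (rule bmeas_mult[OF bmeas_const bmeas_abs[OF bmeas_diff[OF bV bmeas_const]]])
      fix w assume w: "w \<in> space Om"
      have "cmod (iexp (A n w) * of_real (exp (- (t^2 * V w / 2))) - complex_of_real (exp (- (t^2 * v / 2))) * iexp (A n w))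
         = cmod (iexp (A n w) * of_real (exp (- (t^2 * V w / 2)) - exp (- (t^2 * v / 2))))"
        by (simp add: algebra_simps)
      also have "\<dots> = \<bar>exp (- (t^2 * V w / 2)) - exp (- (t^2 * v / 2))\<bar>" unfolding norm_mult norm_of_real by simp
      also have "\<dots> \<le> \<bar>t^2 * V w / 2 - t^2 * v / 2\<bar>" by (rule exp_minus_lipschitz) (use V0[OF w] v0 in auto)
      also have "\<dots> = t^2 / 2 * \<bar>V w - v\<bar>" by (simp add: abs_mult right_diff_distrib[symmetric] diff_divide_distrib[symmetric])
      finally show "cmod (iexp (A n w) * of_real (exp (- (t^2 * V w / 2))) - complex_of_real (exp (- (t^2 * v / 2))) * iexp (A n w)) \<le> t^2 / 2 * \<bar>V w - v\<bar>" .
    qed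
    also have "\<dots> = t^2 / 2 * (\<E> w. \<bar>V w - v\<bar>)" by simp
    also have "\<dots> \<le> t^2 / 2 * sqrt (D n)" unfolding D_def V_def
      by (intro mult_left_mono Om.L1_le_L2 bmeas_measurable Om.bmeas_integrable bmeas_power bmeas_diff bmeas_cond_var c bmeas_const) simp
    finally have 2: "cmod ((\<E> w. iexp (A n w) * of_real (exp (- (t^2 * V w / 2)))) - complex_of_real (exp (- (t^2 * v / 2))) * (\<E> w. iexp (A n w)))
        \<le> t^2 / 2 * sqrt (D n)" .
    have tri: "cmod (x - z) \<le> a + b" if "cmod (x - y) \<le> a" "cmod (y - z) \<le> b" for x y z :: complex and a b
      using norm_triangle_ineq[of "x - y" "y - z"] that by simp
    show ?case
      by (rule tri[OF edge_noise_conditional[OF A(1)[of n] A(2)[of n] elim, of t] 2[unfolded V_def]])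
  qed
qed

end

end


section \<open>The Gaussian limit variable\<close>

text \<open>Finite sets whose complements carry geometrically small sums: the speed that \<open>AE_convergent_of_fast_L2\<close> needs.\<close>
lemma square_summable_exhaustion:
  fixes a :: "'i \<Rightarrow> real"
  assumes nonneg: "\<And>j. 0 \<le> a j" and bound: "\<And>F. finite F \<Longrightarrow> F \<subseteq> J \<Longrightarrow> (\<Sum>j\<in>F. a j) \<le> B"
  obtains H :: "nat \<Rightarrow> 'i set" where "\<And>k. finite (H k)" "\<And>k. H k \<subseteq> J" "\<And>i k. i \<le> k \<Longrightarrow> H i \<subseteq> H k"
    "\<And>F k. finite F \<Longrightarrow> H k \<subseteq> F \<Longrightarrow> F \<subseteq> J \<Longrightarrow> (\<Sum>j\<in>F - H k. a j) \<le> (1/4) ^ k"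
proof -
  define s where "s = (SUP F\<in>{F. finite F \<and> F \<subseteq> J}. \<Sum>i\<in>F. a i)"
  have bdd: "bdd_above ((\<lambda>F. \<Sum>i\<in>F. a i) ` {F. finite F \<and> F \<subseteq> J})"
    by (rule bdd_aboveI[of _ B]) (use bound in auto)
  have s_up: "(\<Sum>i\<in>F. a i) \<le> s" if "finite F" "F \<subseteq> J" for F
    unfolding s_def by (rule cSUP_upper[OF _ bdd]) (use that in simp)
  have "\<exists>G. finite G \<and> G \<subseteq> J \<and> s - (1/4) ^ k < (\<Sum>i\<in>G. a i)" for k :: nat
  proof -
    have ne: "{F. finite F \<and> F \<subseteq> J} \<noteq> {}" by auto
    have "s - (1/4) ^ k < (SUP F\<in>{F. finite F \<and> F \<subseteq> J}. \<Sum>i\<in>F. a i)" unfolding s_def[symmetric] by simp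
    from less_cSUP_iff[OF ne bdd, THEN iffD1, OF this]
    obtain G where "G \<in> {F. finite F \<and> F \<subseteq> J}" "s - (1/4) ^ k < (\<Sum>i\<in>G. a i)" by auto
    thus ?thesis by auto
  qed
  then obtain G where G: "\<And>k. finite (G k)" "\<And>k. G k \<subseteq> J" "\<And>k. s - (1/4) ^ k < (\<Sum>i\<in>G k. a i)" by metis
  define H where "H k = (\<Union>i\<le>k. G i)" for k
  have H: "finite (H k)" "H k \<subseteq> J" "G k \<subseteq> H k" for k using G(1,2) by (auto simp: H_def)
  show thesis
  proof (rule that[of H])
    show "finite (H k)" "H k \<subseteq> J" for k by (rule H)+
    show "H i \<subseteq> H k" if "i \<le> k" for i k using that by (auto simp: H_def intro: order_trans)
    show "(\<Sum>i\<in>F - H k. a i) \<le> (1/4) ^ k" if F: "finite F" "H k \<subseteq> F" "F \<subseteq> J" for F k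
    proof -
      have "(\<Sum>i\<in>F - H k. a i) = (\<Sum>i\<in>F. a i) - (\<Sum>i\<in>H k. a i)" by (rule sum_diff[OF F(1,2)])
      moreover have "(\<Sum>i\<in>G k. a i) \<le> (\<Sum>i\<in>H k. a i)" by (rule sum_mono2) (use H nonneg in auto)
      ultimately show ?thesis using s_up[OF F(1,3)] G(3)[of k] by linarith
    qed
  qed
qed

interpretation NN: prob_space NN by (rule prob_space_std_normal)

lemma normal_moments:
  "integrable NN (\<lambda>x. x)" "integrable NN (\<lambda>x. x^2)" "integrable NN (\<lambda>x. (x^2 - 1)^2)"
  "(\<integral>x. x \<partial>NN) = 0" "(\<integral>x. x^2 \<partial>NN) = 1" "(\<integral>x. x^2 - 1 \<partial>NN) = 0" "(\<integral>x. (x^2 - 1)^2 \<partial>NN) = 2"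
proof -
  have i: "integrable NN (\<lambda>x. x ^ 2)" "integrable NN (\<lambda>x. x ^ 4)"
    using std_normal_distribution_even_moments(2)[of 1] std_normal_distribution_even_moments(2)[of 2] by simp_all
  have e: "(\<integral>x. x ^ 2 \<partial>NN) = 1" "(\<integral>x. x ^ 4 \<partial>NN) = 3"
    using std_normal_distribution_even_moments(1)[of 1] std_normal_distribution_even_moments(1)[of 2]
    by (simp_all add: fact_numeral)
  show "integrable NN (\<lambda>x. x^2)" "(\<integral>x. x^2 \<partial>NN) = 1" by (fact i e)+
  show "integrable NN (\<lambda>x. x)"
    using NN.cauchy_schwarz(1)[of "\<lambda>_. 1" "\<lambda>x. x"] i by simp
  show "(\<integral>x. x \<partial>NN) = 0" using integral_std_normal_distribution_moment_odd[of 1] by simp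
  show "(\<integral>x. x^2 - 1 \<partial>NN) = 0" using i e NN.prob_space by simp
  have q: "(x^2 - 1)^2 = x ^ 4 - 2 * x ^ 2 + 1" for x :: real by (simp add: power2_eq_square power4_eq_xxxx algebra_simps)
  show "integrable NN (\<lambda>x. (x^2 - 1)^2)" "(\<integral>x. (x^2 - 1)^2 \<partial>NN) = 2"
    unfolding q using i e NN.prob_space by simp_all
qed

context
  fixes K :: "'k set" and \<Gamma> :: "('k \<Rightarrow> real) measure"
  assumes K: "K \<noteq> {}"
  defines "\<Gamma> \<equiv> \<Pi>\<^sub>M k\<in>K. NN"
begin

lemma gauss_prob: "prob_space \<Gamma>"
  unfolding \<Gamma>_def by (intro prob_space_PiM prob_space_std_normal)

lemma gauss_coord_measurable: "k \<in> K \<Longrightarrow> (\<lambda>w. w k) \<in> measurable \<Gamma> NN"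
  unfolding \<Gamma>_def by (rule measurable_component_singleton)

lemma gauss_coord_borel: "k \<in> K \<Longrightarrow> (\<lambda>w. w k) \<in> borel_measurable \<Gamma>"
  using gauss_coord_measurable by simp

lemma gauss_coord_distr: "k \<in> K \<Longrightarrow> distr \<Gamma> NN (\<lambda>w. w k) = NN"
  unfolding \<Gamma>_def by (rule distr_PiM_component) (auto intro: prob_space_std_normal)

lemma gauss_coord_integral:
  fixes h :: "real \<Rightarrow> 'b::{banach, second_countable_topology}"
  assumes "k \<in> K" "h \<in> borel_measurable borel"
  shows "(\<integral>w. h (w k) \<partial>\<Gamma>) = (\<integral>x. h x \<partial>NN)" "integrable \<Gamma> (\<lambda>w. h (w k)) \<longleftrightarrow> integrable NN h"
proof -
  have h: "h \<in> borel_measurable NN" using assms(2) by simp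
  show "(\<integral>w. h (w k) \<partial>\<Gamma>) = (\<integral>x. h x \<partial>NN)"
    using integral_distr[OF gauss_coord_measurable[OF assms(1)] h] unfolding gauss_coord_distr[OF assms(1)] by simp
  show "integrable \<Gamma> (\<lambda>w. h (w k)) \<longleftrightarrow> integrable NN h"
    using integrable_distr_eq[OF gauss_coord_measurable[OF assms(1)] h] unfolding gauss_coord_distr[OF assms(1)] by simp
qed

lemma gauss_expectation_prod:
  fixes h :: "'k \<Rightarrow> real \<Rightarrow> 'b::{real_normed_field, banach, second_countable_topology}"
  assumes I: "finite I" "I \<subseteq> K" and h: "\<And>i. i \<in> I \<Longrightarrow> h i \<in> borel_measurable borel" "\<And>i. i \<in> I \<Longrightarrow> integrable NN (h i)"
  shows "(\<integral>w. (\<Prod>i\<in>I. h i (w i)) \<partial>\<Gamma>) = (\<Prod>i\<in>I. \<integral>x. h i x \<partial>NN)" "integrable \<Gamma> (\<lambda>w. \<Prod>i\<in>I. h i (w i))"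
proof -
  interpret G: prob_space \<Gamma> by (rule gauss_prob)
  have "G.indep_vars (\<lambda>_. NN) (\<lambda>i w. w i) K"
    unfolding \<Gamma>_def by (rule indep_vars_PiM_coords) (use K in \<open>auto intro: prob_space_std_normal\<close>)
  hence iv: "G.indep_vars (\<lambda>_. NN) (\<lambda>i w. w i) I" using I(2) by (rule G.indep_vars_subset)
  have iv: "G.indep_vars (\<lambda>_. borel) (\<lambda>i w. h i (w i)) I"
    by (rule G.indep_vars_compose2[OF iv]) (use h in simp)
  have int: "integrable \<Gamma> (\<lambda>w. h i (w i))" if "i \<in> I" for i
    using gauss_coord_integral(2)[of i "h i"] h that I(2) by auto
  have "(\<integral>w. (\<Prod>i\<in>I. h i (w i)) \<partial>\<Gamma>) = (\<Prod>i\<in>I. \<integral>w. h i (w i) \<partial>\<Gamma>)"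
    by (rule G.indep_vars_lebesgue_integral[OF I(1) iv int])
  also have "\<dots> = (\<Prod>i\<in>I. \<integral>x. h i x \<partial>NN)"
    by (intro prod.cong refl gauss_coord_integral(1)) (use I(2) h in auto)
  finally show "(\<integral>w. (\<Prod>i\<in>I. h i (w i)) \<partial>\<Gamma>) = (\<Prod>i\<in>I. \<integral>x. h i x \<partial>NN)" .
  show "integrable \<Gamma> (\<lambda>w. \<Prod>i\<in>I. h i (w i))" by (rule G.indep_vars_integrable[OF I(1) iv int])
qed

lemma gauss_second_moment:
  fixes h :: "'k \<Rightarrow> real \<Rightarrow> real"
  assumes I: "finite I" "I \<subseteq> K" and h: "\<And>i. i \<in> I \<Longrightarrow> h i \<in> borel_measurable borel"
    "\<And>i. i \<in> I \<Longrightarrow> integrable NN (\<lambda>x. (h i x)^2)" "\<And>i. i \<in> I \<Longrightarrow> (\<integral>x. h i x \<partial>NN) = 0"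
  shows "integrable \<Gamma> (\<lambda>w. (c + (\<Sum>i\<in>I. h i (w i)))^2)"
    "(\<integral>w. (c + (\<Sum>i\<in>I. h i (w i)))^2 \<partial>\<Gamma>) = c^2 + (\<Sum>i\<in>I. \<integral>x. (h i x)^2 \<partial>NN)"
proof -
  interpret G: prob_space \<Gamma> by (rule gauss_prob)
  have h1: "integrable NN (h i)" if "i \<in> I" for i
    using NN.cauchy_schwarz(1)[of "\<lambda>_. 1" "h i"] h(1,2)[OF that] by simp
  have i1: "integrable \<Gamma> (\<lambda>w. h i (w i))" "(\<integral>w. h i (w i) \<partial>\<Gamma>) = 0" if "i \<in> I" for i
    using gauss_coord_integral[of i "h i"] h h1 that I(2) by auto
  have i2: "integrable \<Gamma> (\<lambda>w. h i (w i) * h j (w j))"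
    "(\<integral>w. h i (w i) * h j (w j) \<partial>\<Gamma>) = (if j = i then \<integral>x. (h i x)^2 \<partial>NN else 0)" if ij: "i \<in> I" "j \<in> I" for i j
  proof -
    have "integrable \<Gamma> (\<lambda>w. h i (w i) * h j (w j)) \<and>
      (\<integral>w. h i (w i) * h j (w j) \<partial>\<Gamma>) = (if j = i then \<integral>x. (h i x)^2 \<partial>NN else 0)"
    proof (cases "j = i")
      case True
      thus ?thesis using gauss_coord_integral[of i "\<lambda>x. (h i x)^2"] h ij I(2) by (auto simp: power2_eq_square)
    next
      case False
      have "{i, j} \<subseteq> K" "finite {i, j}" using ij I(2) by auto
      from gauss_expectation_prod[OF this(2,1), of h] False h h1 ij show ?thesis by auto
    qed
    thus "integrable \<Gamma> (\<lambda>w. h i (w i) * h j (w j))"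
      "(\<integral>w. h i (w i) * h j (w j) \<partial>\<Gamma>) = (if j = i then \<integral>x. (h i x)^2 \<partial>NN else 0)" by auto
  qed
  have e: "(c + (\<Sum>i\<in>I. h i (w i)))^2 = c^2 + 2 * c * (\<Sum>i\<in>I. h i (w i)) + (\<Sum>i\<in>I. \<Sum>j\<in>I. h i (w i) * h j (w j))" for w
    by (simp add: power2_eq_square sum_product algebra_simps)
  have I1: "integrable \<Gamma> (\<lambda>w. \<Sum>i\<in>I. h i (w i))" by (intro Bochner_Integration.integrable_sum i1)
  have I2: "integrable \<Gamma> (\<lambda>w. \<Sum>i\<in>I. \<Sum>j\<in>I. h i (w i) * h j (w j))" by (intro Bochner_Integration.integrable_sum i2)
  show "integrable \<Gamma> (\<lambda>w. (c + (\<Sum>i\<in>I. h i (w i)))^2)" unfolding e using I1 I2 by simp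
  have "(\<integral>w. (\<Sum>i\<in>I. h i (w i)) \<partial>\<Gamma>) = 0" using i1 by simp
  moreover have "(\<integral>w. (\<Sum>i\<in>I. \<Sum>j\<in>I. h i (w i) * h j (w j)) \<partial>\<Gamma>) = (\<Sum>i\<in>I. \<integral>x. (h i x)^2 \<partial>NN)"
  proof -
    have "(\<integral>w. (\<Sum>i\<in>I. \<Sum>j\<in>I. h i (w i) * h j (w j)) \<partial>\<Gamma>) = (\<Sum>i\<in>I. \<Sum>j\<in>I. \<integral>w. h i (w i) * h j (w j) \<partial>\<Gamma>)"
      by (subst lint_sum) (auto intro!: Bochner_Integration.integrable_sum sum.cong lint_sum i2)
    also have "\<dots> = (\<Sum>i\<in>I. \<Sum>j\<in>I. if j = i then \<integral>x. (h i x)^2 \<partial>NN else 0)" by (intro sum.cong refl i2)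
    finally show ?thesis using I(1) by simp
  qed
  ultimately show "(\<integral>w. (c + (\<Sum>i\<in>I. h i (w i)))^2 \<partial>\<Gamma>) = c^2 + (\<Sum>i\<in>I. \<integral>x. (h i x)^2 \<partial>NN)"
    unfolding e using I1 I2 by (simp add: G.prob_space)
qed

end

definition chaos :: "real \<times> nat \<Rightarrow> ((real \<times> nat) option \<Rightarrow> real) \<Rightarrow> real" where
  "chaos = (\<lambda>(l, i) w. l * ((w (Some (l, i)))^2 - 1))"

abbreviation chaos_sum :: "(real \<times> nat) set \<Rightarrow> ((real \<times> nat) option \<Rightarrow> real) \<Rightarrow> real" where
  "chaos_sum F w \<equiv> \<Sum>j\<in>F. chaos j w"

context
  fixes m :: "real \<Rightarrow> enat" and J :: "(real \<times> nat) set" and \<Gamma> :: "((real \<times> nat) option \<Rightarrow> real) measure"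
  defines "J \<equiv> mset_index m" and "\<Gamma> \<equiv> gauss_space m"
begin

interpretation G: prob_space \<Gamma>
  unfolding \<Gamma>_def gauss_space_def by (intro prob_space_PiM prob_space_std_normal)

lemma chaos_measurable: "j \<in> J \<Longrightarrow> chaos j \<in> borel_measurable \<Gamma>"
proof -
  assume "j \<in> J"
  hence "(\<lambda>w. w (Some j)) \<in> borel_measurable \<Gamma>"
    unfolding \<Gamma>_def gauss_space_def J_def by (intro gauss_coord_borel) auto
  thus ?thesis unfolding chaos_def case_prod_unfold by simp
qed

lemma chaos_second_moment:
  assumes F: "finite F" "F \<subseteq> J"
  shows "integrable \<Gamma> (\<lambda>w. (c + (\<tau> * w None + chaos_sum F w))^2)"
    "(\<integral>w. (c + (\<tau> * w None + chaos_sum F w))^2 \<partial>\<Gamma>) = c^2 + (\<tau>\<^sup>2 + (\<Sum>j\<in>F. 2 * (fst j)^2))"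
proof -
  define h where "h i x = (case i of None \<Rightarrow> \<tau> * x | Some j \<Rightarrow> fst j * (x^2 - 1))" for i :: "(real \<times> nat) option" and x :: real
  let ?I = "insert None (Some ` F)"
  have I: "finite ?I" "?I \<subseteq> insert None (Some ` mset_index m)" using F by (auto simp: J_def)
  have ne: "insert None (Some ` mset_index m) \<noteq> {}" by simp
  have hm: "h i \<in> borel_measurable borel" for i unfolding h_def by (cases i) simp_all
  have hi: "integrable NN (\<lambda>x. (h i x)^2)" "(\<integral>x. h i x \<partial>NN) = 0" for i
    unfolding h_def using normal_moments by (cases i; simp add: power_mult_distrib)+
  have sq: "(\<integral>x. (h i x)^2 \<partial>NN) = (case i of None \<Rightarrow> \<tau>\<^sup>2 | Some j \<Rightarrow> 2 * (fst j)^2)" for i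
    unfolding h_def using normal_moments by (cases i) (simp_all add: power_mult_distrib)
  have s: "(\<Sum>i\<in>?I. g i) = g None + (\<Sum>j\<in>F. g (Some j))" for g :: "_ \<Rightarrow> real"
    using F(1) by (simp add: sum.reindex)
  have e: "(\<Sum>i\<in>?I. h i (w i)) = \<tau> * w None + chaos_sum F w" for w
    unfolding s by (simp add: h_def chaos_def case_prod_unfold)
  show "integrable \<Gamma> (\<lambda>w. (c + (\<tau> * w None + chaos_sum F w))^2)"
    using gauss_second_moment(1)[OF ne I, where h=h and c=c, OF hm hi] unfolding e \<Gamma>_def gauss_space_def .
  show "(\<integral>w. (c + (\<tau> * w None + chaos_sum F w))^2 \<partial>\<Gamma>) = c^2 + (\<tau>\<^sup>2 + (\<Sum>j\<in>F. 2 * (fst j)^2))"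
    using gauss_second_moment(2)[OF ne I, where h=h and c=c, OF hm hi] unfolding e sq s \<Gamma>_def gauss_space_def by simp
qed

lemma chaos_char:
  assumes F: "finite F" "F \<subseteq> J"
  shows "(\<integral>w. iexp (t * (\<tau> * w None + chaos_sum F w)) \<partial>\<Gamma>)
    = complex_of_real (exp (- (t^2 * \<tau>\<^sup>2 / 2))) * (\<Prod>j\<in>F. chi_char (t * fst j))"
proof -
  define h where "h i x = (case i of None \<Rightarrow> iexp (t * \<tau> * x) | Some j \<Rightarrow> iexp (t * fst j * (x^2 - 1)))" for i :: "(real \<times> nat) option" and x :: real
  let ?I = "insert None (Some ` F)"
  have I: "finite ?I" "?I \<subseteq> insert None (Some ` mset_index m)" using F by (auto simp: J_def)
  have ne: "insert None (Some ` mset_index m) \<noteq> {}" by simp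
  have hm: "h i \<in> borel_measurable borel" for i unfolding h_def by (cases i) simp_all
  have hi: "integrable NN (h i)" for i
    by (rule NN.integrable_const_bound[where B=1]) (use hm[of i] in \<open>auto simp: h_def split: option.split\<close>)
  have s: "(\<Prod>i\<in>?I. g i) = g None * (\<Prod>j\<in>F. g (Some j))" for g :: "_ \<Rightarrow> complex"
    using F(1) by (simp add: prod.reindex)
  have e: "iexp (t * (\<tau> * w None + chaos_sum F w)) = (\<Prod>i\<in>?I. h i (w i))" for w
    unfolding s h_def
    by (simp add: chaos_def case_prod_unfold distrib_left exp_add sum_distrib_left exp_sum[OF F(1)] mult_ac)
  have n: "(\<integral>x. h None x \<partial>NN) = complex_of_real (exp (- (t^2 * \<tau>\<^sup>2 / 2)))"
    using iexp_std_normal[of "t * \<tau>"] by (simp add: h_def power_mult_distrib)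
  have c: "(\<integral>x. h (Some j) x \<partial>NN) = chi_char (t * fst j)" for j by (simp add: h_def chi_char_def)
  show ?thesis
    using gauss_expectation_prod(1)[OF ne I, where h=h, OF hm hi] unfolding e s n c \<Gamma>_def gauss_space_def .
qed

context
  fixes B :: real
  assumes bound: "\<And>F. finite F \<Longrightarrow> F \<subseteq> J \<Longrightarrow> (\<Sum>j\<in>F. (fst j)^2) \<le> B"
begin

text \<open>  Along a fast exhaustion the partial sums converge almost everywhere. Fatou's lemma turns this into
  mean-square convergence, and the tail bounds extend it from the exhaustion to all finite index sets.\<close>
lemma chaos_sum_exists: "\<exists>S. has_L2_sum \<Gamma> chaos J S"
proof -
  obtain H where H: "\<And>k. finite (H k)" "\<And>k. H k \<subseteq> J" "\<And>i k. i \<le> k \<Longrightarrow> H i \<subseteq> H k"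
    "\<And>F k. finite F \<Longrightarrow> H k \<subseteq> F \<Longrightarrow> F \<subseteq> J \<Longrightarrow> (\<Sum>j\<in>F - H k. 2 * (fst j)^2) \<le> (1/4) ^ k"
  proof (rule square_summable_exhaustion[of "\<lambda>j. 2 * (fst j)^2" J "2 * B"])
    show "(\<Sum>j\<in>F. 2 * (fst j)^2) \<le> 2 * B" if "finite F" "F \<subseteq> J" for F
      using bound[OF that] by (simp add: sum_distrib_left[symmetric])
  qed auto
  define P where "P F w = chaos_sum F w" for F w
  have mP: "P F \<in> borel_measurable \<Gamma>" if "F \<subseteq> J" for F
    unfolding P_def using chaos_measurable that by (intro borel_measurable_sum) auto
  have dist: "(\<integral>\<^sup>+w. ennreal ((P F w - P (H k) w)^2) \<partial>\<Gamma>) \<le> ennreal ((1/4) ^ k)" if F: "finite F" "H k \<subseteq> F" "F \<subseteq> J" for F k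
  proof -
    have e: "P F w - P (H k) w = 0 + (0 * w None + (\<Sum>j\<in>F - H k. chaos j w))" for w
      unfolding P_def by (simp add: sum_diff[OF F(1,2)])
    have D: "finite (F - H k)" "F - H k \<subseteq> J" using F by auto
    have "(\<integral>\<^sup>+w. ennreal ((P F w - P (H k) w)^2) \<partial>\<Gamma>) = ennreal (0^2 + (0^2 + (\<Sum>j\<in>F - H k. 2 * (fst j)^2)))"
      unfolding e chaos_second_moment(2)[OF D, symmetric]
      by (rule nn_integral_eq_integral[OF chaos_second_moment(1)[OF D]]) simp
    also have "\<dots> \<le> ennreal ((1/4) ^ k)" using H(4)[OF F] by (intro ennreal_leI) simp
    finally show ?thesis .
  qed
  have step: "(\<integral>\<^sup>+w. ennreal ((P (H i) w - P (H k) w)^2) \<partial>\<Gamma>) \<le> ennreal ((1/4) ^ k)" if "k \<le> i" for i k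
    by (rule dist[OF H(1) H(3)[OF that] H(2)])
  obtain S where S: "S \<in> borel_measurable \<Gamma>" "AE w in \<Gamma>. (\<lambda>k. P (H k) w) \<longlonglongrightarrow> S w"
    by (rule G.AE_convergent_of_fast_L2[OF mP[OF H(2)] step[OF le_SucI[OF order_refl]]])
  have SH: "(\<integral>\<^sup>+w. ennreal ((S w - P (H k) w)^2) \<partial>\<Gamma>) \<le> ennreal ((1/4) ^ k)" for k
    by (rule L2_fatou[OF mP[OF H(2)] mP[OF H(2)] S, of k]) (rule step)
  have SF: "(\<integral>\<^sup>+w. ennreal ((S w - P F w)^2) \<partial>\<Gamma>) \<le> ennreal (4 * (1/4) ^ k)" if F: "finite F" "H k \<subseteq> F" "F \<subseteq> J" for F k
  proof -
    have m: "(\<lambda>w. ennreal ((S w - P (H k) w)^2)) \<in> borel_measurable \<Gamma>" "(\<lambda>w. ennreal ((P F w - P (H k) w)^2)) \<in> borel_measurable \<Gamma>"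
      using S(1) mP[OF H(2)[of k]] mP[OF F(3)] by measurable
    have "(\<integral>\<^sup>+w. ennreal ((S w - P F w)^2) \<partial>\<Gamma>)
       \<le> (\<integral>\<^sup>+w. 2 * ennreal ((S w - P (H k) w)^2) + 2 * ennreal ((P F w - P (H k) w)^2) \<partial>\<Gamma>)"
    proof (rule nn_integral_mono)
      fix w
      have "ennreal ((S w - P F w)^2) \<le> ennreal (2 * (S w - P (H k) w)^2 + 2 * (P F w - P (H k) w)^2)"
        using sq_diff_le[of "S w - P (H k) w" "P F w - P (H k) w"] by (intro ennreal_leI) simp
      also have "\<dots> = 2 * ennreal ((S w - P (H k) w)^2) + 2 * ennreal ((P F w - P (H k) w)^2)"
        by (simp add: ennreal_plus ennreal_mult'')
      finally show "ennreal ((S w - P F w)^2) \<le> \<dots>" .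
    qed
    also have "\<dots> = 2 * (\<integral>\<^sup>+w. ennreal ((S w - P (H k) w)^2) \<partial>\<Gamma>) + 2 * (\<integral>\<^sup>+w. ennreal ((P F w - P (H k) w)^2) \<partial>\<Gamma>)"
      using m by (simp add: nn_integral_add nn_integral_cmult)
    also have "\<dots> \<le> 2 * ennreal ((1/4) ^ k) + 2 * ennreal ((1/4) ^ k)"
      by (intro add_mono mult_left_mono SH dist F) simp_all
    also have "\<dots> = ennreal (4 * (1/4) ^ k)"
    proof -
      have "2 * ennreal ((1/4) ^ k) = ennreal (2 * (1/4) ^ k)" by (simp add: ennreal_mult'')
      thus ?thesis by (simp add: ennreal_plus[symmetric] del: ennreal_plus)
    qed
    finally show ?thesis .
  qed
  have "((\<lambda>F. \<integral>\<^sup>+w. ennreal ((S w - P F w)^2) \<partial>\<Gamma>) \<longlongrightarrow> 0) (finite_subsets_at_top J)"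
  proof (rule order_tendstoI)
    fix a :: ennreal assume "a > 0"
    have "(\<lambda>k. ennreal (4 * (1/4) ^ k)) \<longlonglongrightarrow> ennreal (4 * 0)"
      by (intro tendsto_ennrealI tendsto_intros LIMSEQ_power_zero) simp
    hence "(\<lambda>k. ennreal (4 * (1/4) ^ k)) \<longlonglongrightarrow> 0" by simp
    from order_tendstoD(2)[OF this \<open>a > 0\<close>] obtain k where k: "ennreal (4 * (1/4) ^ k) < a"
      by (auto simp: eventually_sequentially)
    show "\<forall>\<^sub>F F in finite_subsets_at_top J. (\<integral>\<^sup>+w. ennreal ((S w - P F w)^2) \<partial>\<Gamma>) < a"
      unfolding eventually_finite_subsets_at_top
    proof (intro exI[of _ "H k"] conjI allI impI)
      fix F assume F: "finite F \<and> H k \<subseteq> F \<and> F \<subseteq> J"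
      show "(\<integral>\<^sup>+w. ennreal ((S w - P F w)^2) \<partial>\<Gamma>) < a"
        by (rule order_le_less_trans[OF SF k]) (use F in auto)
    qed (rule H)+
  qed simp
  hence "has_L2_sum \<Gamma> chaos J S" using S(1) unfolding has_L2_sum_def P_def by simp
  thus ?thesis by (rule exI[where x=S])
qed

end

context
  fixes S :: "((real \<times> nat) option \<Rightarrow> real) \<Rightarrow> real"
  assumes S: "has_L2_sum \<Gamma> chaos J S"
begin

lemma chaos_sum_measurable: "S \<in> borel_measurable \<Gamma>" "(\<lambda>w. \<tau> * w None + S w) \<in> borel_measurable \<Gamma>"
proof -
  show S': "S \<in> borel_measurable \<Gamma>" using S by (simp add: has_L2_sum_def)
  have "(\<lambda>w. w None) \<in> borel_measurable \<Gamma>" unfolding \<Gamma>_def gauss_space_def by (intro gauss_coord_borel) auto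
  thus "(\<lambda>w. \<tau> * w None + S w) \<in> borel_measurable \<Gamma>" using S' by simp
qed

lemma chaos_sum_approx:
  assumes "\<epsilon> > 0"
  obtains G where "finite G" "G \<subseteq> J" "\<And>F. finite F \<Longrightarrow> G \<subseteq> F \<Longrightarrow> F \<subseteq> J \<Longrightarrow> integrable \<Gamma> (\<lambda>w. (S w - chaos_sum F w)^2)"
    "\<And>F. finite F \<Longrightarrow> G \<subseteq> F \<Longrightarrow> F \<subseteq> J \<Longrightarrow> (\<integral>w. (S w - chaos_sum F w)^2 \<partial>\<Gamma>) \<le> \<epsilon>"
proof -
  have "((\<lambda>F. \<integral>\<^sup>+w. ennreal ((S w - chaos_sum F w)^2) \<partial>\<Gamma>) \<longlongrightarrow> 0) (finite_subsets_at_top J)"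
    using S by (simp add: has_L2_sum_def)
  hence "\<exists>G. finite G \<and> G \<subseteq> J \<and> (\<forall>F. finite F \<and> G \<subseteq> F \<and> F \<subseteq> J \<longrightarrow>
      (\<integral>\<^sup>+w. ennreal ((S w - chaos_sum F w)^2) \<partial>\<Gamma>) < ennreal \<epsilon>)"
    using assms unfolding eventually_finite_subsets_at_top[symmetric] by (intro order_tendstoD(2)) auto
  then obtain G where G: "finite G" "G \<subseteq> J"
    "\<And>F. finite F \<Longrightarrow> G \<subseteq> F \<Longrightarrow> F \<subseteq> J \<Longrightarrow> (\<integral>\<^sup>+w. ennreal ((S w - chaos_sum F w)^2) \<partial>\<Gamma>) < ennreal \<epsilon>"
    by auto
  show thesis
  proof (rule that[OF G(1,2)])
    fix F assume F: "finite F" "G \<subseteq> F" "F \<subseteq> J"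
    have "chaos_sum F \<in> borel_measurable \<Gamma>" using chaos_measurable F(3) by (intro borel_measurable_sum) auto
    hence m: "(\<lambda>w. (S w - chaos_sum F w)^2) \<in> borel_measurable \<Gamma>" using chaos_sum_measurable(1) by measurable
    show i: "integrable \<Gamma> (\<lambda>w. (S w - chaos_sum F w)^2)"
      by (rule integrableI_bounded[OF m]) (use G(3)[OF F] in \<open>simp add: order_less_trans[OF _ ennreal_less_top]\<close>)
    have "ennreal (\<integral>w. (S w - chaos_sum F w)^2 \<partial>\<Gamma>) < ennreal \<epsilon>"
      using G(3)[OF F] by (subst nn_integral_eq_integral[OF i, symmetric]) auto
    thus "(\<integral>w. (S w - chaos_sum F w)^2 \<partial>\<Gamma>) \<le> \<epsilon>" using ennreal_less_iff assms by (simp add: ennreal_less_iff)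
  qed
qed

lemma chaos_sum_char:
  assumes "\<epsilon> > 0"
  obtains G where "finite G" "G \<subseteq> J" "\<And>F. finite F \<Longrightarrow> G \<subseteq> F \<Longrightarrow> F \<subseteq> J \<Longrightarrow>
     cmod ((\<integral>w. iexp (t * (\<tau> * w None + S w)) \<partial>\<Gamma>) - complex_of_real (exp (- (t^2 * \<tau>\<^sup>2 / 2))) * (\<Prod>j\<in>F. chi_char (t * fst j))) \<le> \<bar>t\<bar> * \<epsilon>"
proof -
  have e2: "\<epsilon>\<^sup>2 > 0" using assms by simp
  show thesis
  proof (rule chaos_sum_approx[OF e2])
    fix G assume G: "finite G" "G \<subseteq> J" "\<And>F. finite F \<Longrightarrow> G \<subseteq> F \<Longrightarrow> F \<subseteq> J \<Longrightarrow> integrable \<Gamma> (\<lambda>w. (S w - chaos_sum F w)^2)"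
    "\<And>F. finite F \<Longrightarrow> G \<subseteq> F \<Longrightarrow> F \<subseteq> J \<Longrightarrow> (\<integral>w. (S w - chaos_sum F w)^2 \<partial>\<Gamma>) \<le> \<epsilon>\<^sup>2"
    show thesis
    proof (rule that[OF G(1,2)])
      fix F assume F: "finite F" "G \<subseteq> F" "F \<subseteq> J"
      have mF: "(\<lambda>w. \<tau> * w None + chaos_sum F w) \<in> borel_measurable \<Gamma>"
      proof -
        have "(\<lambda>w. w None) \<in> borel_measurable \<Gamma>" unfolding \<Gamma>_def gauss_space_def by (intro gauss_coord_borel) auto
        moreover have "chaos_sum F \<in> borel_measurable \<Gamma>" using chaos_measurable F(3) by (intro borel_measurable_sum) auto
        ultimately show ?thesis by simp
      qed
      have d: "(\<tau> * w None + S w) - (\<tau> * w None + chaos_sum F w) = S w - chaos_sum F w" for w by simp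
      have "cmod ((\<integral>w. iexp (t * (\<tau> * w None + S w)) \<partial>\<Gamma>) - (\<integral>w. iexp (t * (\<tau> * w None + chaos_sum F w)) \<partial>\<Gamma>))
         \<le> \<bar>t\<bar> * sqrt (\<integral>w. (S w - chaos_sum F w)^2 \<partial>\<Gamma>)"
        using G.iexp_expectation_diff_le[OF chaos_sum_measurable(2)[of \<tau>] mF, of t] G(3)[OF F] unfolding d by blast
      also have "\<dots> \<le> \<bar>t\<bar> * \<epsilon>"
        using G(4)[OF F] assms by (intro mult_left_mono real_le_lsqrt) auto
      finally show "cmod ((\<integral>w. iexp (t * (\<tau> * w None + S w)) \<partial>\<Gamma>) - complex_of_real (exp (- (t^2 * \<tau>\<^sup>2 / 2))) * (\<Prod>j\<in>F. chi_char (t * fst j))) \<le> \<bar>t\<bar> * \<epsilon>"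
        unfolding chaos_char[OF F(1,3)] .
    qed
  qed
qed

text \<open>If the limit is constant, the partial sums come close to a constant in mean square, while their variance is at
  least that of any single term.\<close>
lemma chaos_nondegenerate:
  assumes J: "\<And>j. j \<in> J \<Longrightarrow> fst j \<noteq> 0"
  shows "nondegenerate (distr \<Gamma> borel (\<lambda>w. \<tau> * w None + S w)) \<longleftrightarrow> \<not> (\<tau> = 0 \<and> J = {})"
proof
  assume nd: "nondegenerate (distr \<Gamma> borel (\<lambda>w. \<tau> * w None + S w))"
  show "\<not> (\<tau> = 0 \<and> J = {})"
  proof
    assume z: "\<tau> = 0 \<and> J = {}"
    have small: "(\<integral>w. (S w)^2 \<partial>\<Gamma>) \<le> \<epsilon> \<and> integrable \<Gamma> (\<lambda>w. (S w)^2)" if "\<epsilon> > 0" for \<epsilon>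
    proof (rule chaos_sum_approx[OF that])
      fix G assume G: "G \<subseteq> J" "\<And>F. finite F \<Longrightarrow> G \<subseteq> F \<Longrightarrow> F \<subseteq> J \<Longrightarrow> integrable \<Gamma> (\<lambda>w. (S w - chaos_sum F w)^2)"
        "\<And>F. finite F \<Longrightarrow> G \<subseteq> F \<Longrightarrow> F \<subseteq> J \<Longrightarrow> (\<integral>w. (S w - chaos_sum F w)^2 \<partial>\<Gamma>) \<le> \<epsilon>"
      have "G \<subseteq> {}" using G(1) z by simp
      from G(2)[OF finite.emptyI this] G(3)[OF finite.emptyI this] show ?thesis by simp
    qed
    have i: "integrable \<Gamma> (\<lambda>w. (S w)^2)" using small[OF zero_less_one] by simp
    have "(\<integral>w. (S w)^2 \<partial>\<Gamma>) \<le> 0" by (rule field_le_epsilon) (use small in simp)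
    hence "(\<integral>w. (S w)^2 \<partial>\<Gamma>) = 0" by (intro antisym) auto
    hence "AE w in \<Gamma>. (S w)^2 = 0" using integral_nonneg_eq_0_iff_AE[OF i] by simp
    hence "AE w in \<Gamma>. \<tau> * w None + S w = 0" by eventually_elim (use z in simp)
    hence "distr \<Gamma> borel (\<lambda>w. \<tau> * w None + S w) = distr \<Gamma> borel (\<lambda>w. 0)"
      using chaos_sum_measurable(2)[of \<tau>] by (intro distr_cong_AE) auto
    also have "\<dots> = return borel 0" by (rule G.distr_const) simp
    finally show False using nd by (auto simp: nondegenerate_def)
  qed
next
  assume nz: "\<not> (\<tau> = 0 \<and> J = {})"
  show "nondegenerate (distr \<Gamma> borel (\<lambda>w. \<tau> * w None + S w))" unfolding nondegenerate_def
  proof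
    assume "\<exists>c. distr \<Gamma> borel (\<lambda>w. \<tau> * w None + S w) = return borel c"
    then obtain c where c: "distr \<Gamma> borel (\<lambda>w. \<tau> * w None + S w) = return borel c" ..
    have "AE x in distr \<Gamma> borel (\<lambda>w. \<tau> * w None + S w). x = c" unfolding c by (subst AE_return) auto
    hence AEc: "AE w in \<Gamma>. \<tau> * w None + S w = c"
      by (subst (asm) AE_distr_iff[OF chaos_sum_measurable(2)]) auto
    have le: "\<tau>\<^sup>2 + 2 * (\<Sum>j\<in>F0. (fst j)^2) \<le> \<epsilon>" if "\<epsilon> > 0" and F0: "finite F0" "F0 \<subseteq> J" for \<epsilon> F0
    proof (rule chaos_sum_approx[OF that(1)])
      fix G assume G: "finite G" "G \<subseteq> J" "\<And>F. finite F \<Longrightarrow> G \<subseteq> F \<Longrightarrow> F \<subseteq> J \<Longrightarrow> integrable \<Gamma> (\<lambda>w. (S w - chaos_sum F w)^2)"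
        "\<And>F. finite F \<Longrightarrow> G \<subseteq> F \<Longrightarrow> F \<subseteq> J \<Longrightarrow> (\<integral>w. (S w - chaos_sum F w)^2 \<partial>\<Gamma>) \<le> \<epsilon>"
      define F where "F = G \<union> F0"
      have F: "finite F" "G \<subseteq> F" "F \<subseteq> J" "F0 \<subseteq> F" using G(1,2) F0 by (auto simp: F_def)
      have "(\<Sum>j\<in>F0. (fst j)^2) \<le> (\<Sum>j\<in>F. (fst j)^2)" by (rule sum_mono2) (use F in auto)
      hence "\<tau>\<^sup>2 + 2 * (\<Sum>j\<in>F0. (fst j)^2) \<le> (- c)^2 + (\<tau>\<^sup>2 + (\<Sum>j\<in>F. 2 * (fst j)^2))"
        using zero_le_power2[of "- c"] by (simp only: sum_distrib_left[symmetric])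
      also have "\<dots> = (\<integral>w. (- c + (\<tau> * w None + chaos_sum F w))^2 \<partial>\<Gamma>)"
        by (rule chaos_second_moment(2)[OF F(1,3), symmetric])
      also have "\<dots> = (\<integral>w. (S w - chaos_sum F w)^2 \<partial>\<Gamma>)"
      proof (rule integral_cong_AE)
        show "AE w in \<Gamma>. (- c + (\<tau> * w None + chaos_sum F w))^2 = (S w - chaos_sum F w)^2"
          using AEc
        proof eventually_elim
          case (elim w)
          have "- c + (\<tau> * w None + chaos_sum F w) = - (S w - chaos_sum F w)" using elim by simp
          thus ?case by (simp only: power2_minus)
        qed
      qed (rule borel_measurable_integrable, rule chaos_second_moment(1)[OF F(1,3)] G(3)[OF F(1-3)])+
      also have "\<dots> \<le> \<epsilon>" by (rule G(4)[OF F(1-3)])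
      finally show ?thesis .
    qed
    have "\<tau>\<^sup>2 \<le> 0"
    proof (rule field_le_epsilon)
      fix e :: real assume "e > 0"
      from le[OF this finite.emptyI empty_subsetI] show "\<tau>\<^sup>2 \<le> 0 + e" by simp
    qed
    moreover have "J = {}"
    proof (rule ccontr)
      assume "J \<noteq> {}"
      then obtain j where j: "j \<in> J" by auto
      have "2 * (fst j)^2 \<le> 0"
      proof (rule field_le_epsilon)
        fix e :: real assume "e > 0"
        have "\<tau>\<^sup>2 + 2 * (\<Sum>j\<in>{j}. (fst j)^2) \<le> e" by (rule le[OF \<open>e > 0\<close>]) (use j in auto)
        hence "\<tau>\<^sup>2 + 2 * (fst j)^2 \<le> e" by simp
        moreover have "0 \<le> \<tau>\<^sup>2" by simp
        ultimately show "2 * (fst j)^2 \<le> 0 + e" by linarith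
      qed
      thus False using J[OF j] by simp
    qed
    ultimately show False using nz by simp
  qed
qed

end

end


section \<open>The degenerate regime\<close>

lemma AE_coord: "(AE x in unit_leb. P x) \<Longrightarrow> AE w in Om. P (w i)"
  using AE_distrD[OF coord_measurable[of i], unfolded distr_coord] .

text \<open>The factor 2 accounts for the ordered pairs, so that this is \<open>qform\<close> for kernels of finite rank (\<open>kernel_quad_ksum\<close>).\<close>
definition kernel_quad :: "kernel \<Rightarrow> nat \<Rightarrow> outcome \<Rightarrow> real" where
  "kernel_quad K n w = (\<Sum>(u, v)\<in>pairs n. 2 * K (w (u, 0)) (w (v, 0))) / real n"

lemma bmeas_kernel_quad: "bm2 K \<Longrightarrow> bmeas Om (kernel_quad K n)"
  unfolding kernel_quad_def case_prod_unfold by (intro bmeas_divide bmeas_sum bmeas_mult bmeas_const bmeas_types)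

lemma depends_kernel_quad: "depends_on {i. snd i = 0} (kernel_quad K n)"
  unfolding kernel_quad_def case_prod_unfold by (intro depends_on_arith depends_on_sum depends_on_const depends_types; simp)

lemma kernel_quad_ksum:
  "kernel_quad (ksum F lam f) n w = qform F lam n (\<lambda>u j w. f j (w (u, 0))) w"
proof -
  let ?K = "\<lambda>u v. ksum F lam f (w (u, 0)) (w (v, 0))"
  have sym: "?K u v = ?K v u" for u v by (simp add: ksum_def mult_ac)
  have "(\<Sum>(u, v)\<in>pairs n. 2 * ?K u v) = (\<Sum>(u, v)\<in>pairs n. ?K u v + ?K v u)"
    using sym by (intro sum.cong refl) auto
  also have "\<dots> = (\<Sum>u\<in>{1..n}. \<Sum>v\<in>{1..n}. ?K u v) - (\<Sum>u\<in>{1..n}. ?K u u)" by (rule sum_pairs_ordered)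
  also have "(\<Sum>u\<in>{1..n}. \<Sum>v\<in>{1..n}. ?K u v) = (\<Sum>j\<in>F. lam j * (\<Sum>u\<in>{1..n}. f j (w (u, 0)))^2)"
  proof -
    have "(\<Sum>u\<in>{1..n}. \<Sum>v\<in>{1..n}. ?K u v) = (\<Sum>u\<in>{1..n}. \<Sum>j\<in>F. \<Sum>v\<in>{1..n}. lam j * f j (w (u, 0)) * f j (w (v, 0)))"
      unfolding ksum_def by (intro sum.cong refl sum.swap)
    also have "\<dots> = (\<Sum>j\<in>F. \<Sum>u\<in>{1..n}. \<Sum>v\<in>{1..n}. lam j * f j (w (u, 0)) * f j (w (v, 0)))" by (rule sum.swap)
    also have "\<dots> = (\<Sum>j\<in>F. lam j * (\<Sum>u\<in>{1..n}. f j (w (u, 0)))^2)"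
      unfolding power2_eq_square sum_product by (simp add: sum_distrib_left mult.assoc)
    finally show ?thesis .
  qed
  also have "(\<Sum>u\<in>{1..n}. ?K u u) = (\<Sum>j\<in>F. lam j * (\<Sum>u\<in>{1..n}. (f j (w (u, 0)))^2))"
    unfolding ksum_def by (subst sum.swap) (simp add: power2_eq_square sum_distrib_left mult.assoc)
  finally show ?thesis
    unfolding kernel_quad_def qform_def by (simp add: right_diff_distrib sum_subtractf)
qed

lemma vertex_noise_eigenfunctions:
  assumes F: "finite F" and b: "\<And>j. j \<in> F \<Longrightarrow> bm1 (f j)" and on: "orthonormal F f"
    and one: "\<And>j. j \<in> F \<Longrightarrow> ip (f j) (\<lambda>_. 1) = 0"
  shows "\<exists>c. vertex_noise F c (\<lambda>u j w. f j (w (u, 0)))"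
proof -
  have "\<forall>j\<in>F. \<exists>C. \<forall>x\<in>{0..1}. \<bar>f j x\<bar> \<le> C"
  proof
    fix j assume "j \<in> F"
    from bmeas_bound[OF b[OF this]] obtain C where "\<And>x. x \<in> space unit_leb \<Longrightarrow> norm (f j x) \<le> C" by blast
    thus "\<exists>C. \<forall>x\<in>{0..1}. \<bar>f j x\<bar> \<le> C" by (intro exI[of _ C]) simp
  qed
  then obtain C where C: "\<And>j x. j \<in> F \<Longrightarrow> x \<in> {0..1} \<Longrightarrow> \<bar>f j x\<bar> \<le> C j" by metis
  have C0: "0 \<le> C j" if "j \<in> F" for j using C[OF that, of 0] by simp
  have "vertex_noise F (\<Sum>j\<in>F. C j) (\<lambda>u j w. f j (w (u, 0)))"
    unfolding vertex_noise_def
  proof (intro allI ballI conjI)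
    fix u i j assume j: "j \<in> F"
    show "bmeas Om (\<lambda>w. f j (w (u, 0)))" by (rule bmeas_comp[OF b[OF j]]) simp
    show "depends_on (blk u) (\<lambda>w. f j (w (u, 0)))" by (intro depends_on_comp[where h="f j"] depends_on_coord) (simp add: blk_def)
    show "\<bar>f j (w (u, 0))\<bar> \<le> (\<Sum>j\<in>F. C j)" if w: "w \<in> space Om" for w
      using C[OF j coord_in[OF w, of "(u, 0)"]] member_le_sum[of j F C] j F C0 by (meson DiffD1 order_trans)
    show "(\<E> w. f j (w (u, 0))) = 0" using one[OF j] by (simp add: expectation_coord[OF b[OF j]] ip_def)
    assume i: "i \<in> F"
    have "(\<E> w. f i (w (u, 0)) * f j (w (u, 0))) = ip (f i) (f j)"
      unfolding ip_def by (rule expectation_coord[OF bmeas_mult[OF b[OF i] b[OF j]]])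
    thus "(\<E> w. f i (w (u, 0)) * f j (w (u, 0))) = of_bool (i = j)" using on i j by (simp add: orthonormal_def)
  qed
  thus ?thesis ..
qed

context tourn
begin

text \<open>Degeneracy makes the terms of distinct pairs orthogonal, and each has second moment \<open>hs K K\<close>.\<close>
lemma kernel_quad_bound:
  assumes K: "bm2 K" and sym: "\<And>x y. K x y = K y x" and deg: "AE x in unit_leb. opr K (\<lambda>_. 1) x = 0"
  shows "(\<E> w. (kernel_quad K n w)^2) \<le> 2 * hs K K"
proof (cases "n = 0")
  case True
  thus ?thesis using hs_self(2)[of K] by (simp add: kernel_quad_def)
next
  case False
  define Y where "Y w u v = K (w (u, 0)) (w (v, 0))" for w :: outcome and u v :: nat
  have bY: "bmeas Om (\<lambda>w. Y w u v)" for u v unfolding Y_def by (rule bmeas_types[OF K])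
  have dY: "depends_on (coords {u, v}) (\<lambda>w. Y w u v)" for u v
    unfolding Y_def by (rule depends_types) (auto simp: coords_def)
  have degY: "(\<E> w. f w * Y w u x) = 0"
    if f: "bmeas Om f" "depends_on (- touch x) f" and ux: "u \<noteq> x" "u \<noteq> 0" "x \<noteq> 0" for f u x
  proof -
    have "(\<E> w. f w * (\<lambda>y w. K (w (u, 0)) y) (w (x, 0)) w) = (\<E> w. f w * (\<I> y. K (w (u, 0)) y))"
    proof (rule integrate_coordinate[OF f(1)])
      show "bmeas Om (\<lambda>w. K (w (u, 0)) (w (x, 0)))" by (rule bmeas_types[OF K])
      show "depends_on (- {(x, 0)}) f" by (rule depends_on_mono[OF f(2)]) (auto simp: touch_def)
      show "depends_on (- {(x, 0)}) (\<lambda>w. K (w (u, 0)) y)" for y using ux by (auto simp: depends_on_def)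
    qed
    also have "\<dots> = (\<E> w. f w * opr K (\<lambda>_. 1) (w (u, 0)))" by (simp add: opr_def)
    also have "\<dots> = (\<E> w. 0)"
    proof (rule integral_cong_AE)
      show "(\<lambda>w. f w * opr K (\<lambda>_. 1) (w (u, 0))) \<in> borel_measurable Om"
        using bmeas_comp[OF bm1_opr[OF K bmeas_const[of unit_leb "1::real"]] coord_measurable[of "(u, 0)"]] f(1)
        by (intro bmeas_measurable bmeas_mult)
      show "AE w in Om. f w * opr K (\<lambda>_. 1) (w (u, 0)) = 0" using AE_coord[OF deg, of "(u, 0)"] by eventually_elim simp
    qed simp
    finally show ?thesis by (simp add: Y_def)
  qed
  obtain C where C: "\<And>x y. x \<in> {0..1} \<Longrightarrow> y \<in> {0..1} \<Longrightarrow> \<bar>K x y\<bar> \<le> C" using bm2_bound[OF K] by blast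
  have YC: "\<bar>Y w u v\<bar> \<le> C" if "w \<in> space Om" for w u v unfolding Y_def by (intro C coord_in that)
  have "(\<E> w. (\<Sum>i\<in>pairs n. Y w (fst i) (snd i))^2) = (\<Sum>i\<in>pairs n. \<E> w. (Y w (fst i) (snd i))^2)"
  proof (rule Om.orthogonal_sum_bound(1)[OF finite_pairs bY YC])
    show "(\<E> w. Y w (fst i) (snd i) * Y w (fst j) (snd j)) = 0" if "i \<in> pairs n" "j \<in> pairs n" "i \<noteq> j" for i j
      by (rule pair_orthogonal[OF bY _ dY degY that]) (simp_all add: Y_def sym)
  qed
  also have "\<dots> = (\<Sum>i\<in>pairs n. hs K K)"
  proof (rule sum.cong[OF refl])
    fix i assume i: "i \<in> pairs n"
    hence "(fst i, 0::nat) \<noteq> (snd i, 0)" by (auto simp: pairs_def)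
    from expectation_coord_pair[OF bm2_power[OF K, of 2] this] show "(\<E> w. (Y w (fst i) (snd i))^2) = hs K K"
      by (simp add: Y_def hs_self(1))
  qed
  also have "\<dots> = real n * (real n - 1) / 2 * hs K K" by (simp add: card_pairs)
  also have "\<dots> \<le> (real n)^2 / 2 * hs K K"
    using hs_self(2)[of K] by (intro mult_right_mono divide_right_mono) (auto simp: power2_eq_square algebra_simps)
  finally have le: "(\<E> w. (\<Sum>i\<in>pairs n. Y w (fst i) (snd i))^2) \<le> (real n)^2 / 2 * hs K K" .
  have "kernel_quad K n w = 2 / real n * (\<Sum>i\<in>pairs n. Y w (fst i) (snd i))" for w
    by (simp add: kernel_quad_def Y_def case_prod_unfold sum_distrib_left[symmetric])
  hence "(\<E> w. (kernel_quad K n w)^2) = (\<E> w. (2 / real n)^2 * (\<Sum>i\<in>pairs n. Y w (fst i) (snd i))^2)"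
    by (simp only: power_mult_distrib)
  also have "\<dots> = (2 / real n)^2 * (\<E> w. (\<Sum>i\<in>pairs n. Y w (fst i) (snd i))^2)" by simp
  also have "\<dots> \<le> (2 / real n)^2 * ((real n)^2 / 2 * hs K K)" using le by (intro mult_left_mono) auto
  also have "\<dots> = 2 * hs K K" using False by (simp add: power_divide)
  finally show ?thesis .
qed

lemma bm2_tri: "bm2 (tri_kernel W)"
  unfolding tri_kernel_def[abs_def]
  by (intro bm2_mult bm2_const bm2_add bm2_W bm2_p bm2_swap[OF bm2_W] bm2_swap[OF bm2_p])

lemma tri_sym: "tri_kernel W x y = tri_kernel W y x"
  by (simp add: tri_kernel_def)

lemma opr_tri:
  assumes x: "x \<in> {0..1}" shows "opr (tri_kernel W) (\<lambda>_. 1) x = t_tri W x"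
proof -
  have b: "bm1 (\<lambda>y. W x y * p_fun W x y)" "bm1 (\<lambda>y. W y x * p_fun W y x)"
    using bmeas_mult[OF bm2_row[OF bm2_W x] bm2_row[OF bm2_p x]] bmeas_mult[OF bm2_col[OF bm2_W x] bm2_col[OF bm2_p x]]
    by simp_all
  have "opr (tri_kernel W) (\<lambda>_. 1) x = (\<I> y. 1/2 * (W x y * p_fun W x y) + 1/2 * (W y x * p_fun W y x))"
    by (simp add: opr_def tri_kernel_def algebra_simps)
  also have "\<dots> = 1/2 * (\<I> y. W x y * p_fun W x y) + 1/2 * (\<I> y. W y x * p_fun W y x)"
    using b[THEN bm1_integrable] by simp
  also have "\<dots> = t_tri W x" unfolding t_tri_eq1[OF x, symmetric] t_tri_eq2[OF x, symmetric] by simp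
  finally show ?thesis .
qed

text \<open>The coefficient of the edge noise in \<open>h2\<close>, and the difference that occurs in \<open>tau\<close>.\<close>
definition skew :: kernel where "skew x y = p_fun W x y - p_fun W y x"

lemma bm2_skew: "bm2 skew" unfolding skew_def[abs_def] by (intro bm2_diff bm2_p bm2_swap[OF bm2_p])

lemma skew_bound: "x \<in> {0..1} \<Longrightarrow> y \<in> {0..1} \<Longrightarrow> \<bar>skew x y\<bar> \<le> 1"
  using p_in[of x y] p_in[of y x] by (auto simp: skew_def)

lemma tau_sq: "(tau W)^2 = (\<I> x. (\<I> y. edge_var skew x y)) / 2"
proof -
  have e: "(\<integral>(x, y). W x y * W y x * (p_fun W x y - p_fun W y x)^2 \<partial>UU) = (\<I> x. (\<I> y. edge_var skew x y))"
    using bm2_pair[OF bm2_edge_var[OF bm2_skew]] unfolding case_prod_unfold edge_var_def skew_def .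
  have "0 \<le> (\<I> x. (\<I> y. edge_var skew x y))"
    by (auto intro!: integral_nonneg_AE AE_I2 edge_var_in)
  thus ?thesis unfolding tau_def e by simp
qed

text \<open>Conditioning on the types replaces \<open>adj\<close> by \<open>W\<close> and leaves the triangle kernel; the rest is edge noise.\<close>
lemma pair_proj_split:
  assumes w: "w \<in> space Om" and uv: "u \<noteq> v"
  shows "pair_proj w u v = 2 * tri_kernel W (w (u, 0)) (w (v, 0))
     + (adj w u v - W (w (u, 0)) (w (v, 0))) * skew (w (u, 0)) (w (v, 0))"
  unfolding pair_proj_def tri_kernel_def skew_def adj_swap[OF uv]
    W_swap[OF coord_in[OF w] coord_in[OF w], of "(u, 0)" "(v, 0)"]
  by (simp add: algebra_simps)

end

locale regular_tourn = tourn +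
  assumes reg: "tri_regular W" and pos: "t_C3 W > 0"
begin

abbreviation \<theta> :: real where "\<theta> \<equiv> t_C3 W"
abbreviation spec_index :: "(real \<times> nat) set" where "spec_index \<equiv> mset_index (Spec_minus W)"
definition centred_tri :: kernel where "centred_tri x y = tri_kernel W x y - \<theta>"

lemma t_tri_const: "AE x in unit_leb. t_tri W x = \<theta>"
  using reg by (simp add: tri_regular_iff)

lemma opr_tri_const: "AE x in unit_leb. opr (tri_kernel W) (\<lambda>_. 1) x = \<theta>"
  using t_tri_const AE_space[of unit_leb] by eventually_elim (simp add: opr_tri)

lemma bm2_centred: "bm2 centred_tri"
  unfolding centred_tri_def[abs_def] by (intro bm2_diff bm2_tri bm2_const)

lemma eigenfunctions:
  obtains f where "diagonalizes centred_tri spec_index f" "\<And>j. j \<in> spec_index \<Longrightarrow> ip (f j) (\<lambda>_. 1) = 0"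
    "\<And>j. j \<in> spec_index \<Longrightarrow> fst j \<noteq> 0"
proof -
  have sym: "sym2 (tri_kernel W)" by (simp add: sym2_def tri_sym)
  have nz: "\<theta> \<noteq> 0" using pos by simp
  show thesis
    by (rule spectral_decomposition_minus[OF bm2_tri sym nz opr_tri_const, folded Spec_minus_def centred_tri_def[abs_def]])
       (rule that)
qed

text \<open>  The linear part vanishes by regularity and the cubic part is of order \<open>n^(3/2)\<close>. The term \<open>2 * B w / r^2\<close> is the
  difference between the weights \<open>(n - 2) / n^2\<close> and \<open>1 / n\<close> of the quadratic part.\<close>
lemma triads_L2_approx:
  "(\<lambda>n. \<E> w. (centred_count n w / real n ^ 2
      - (kernel_quad centred_tri n w + edge_noise skew n w))^2) \<longlonglongrightarrow> 0"
proof (rule Lim_null_comparison)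
  show "(\<lambda>n. 1400 / real n) \<longlonglongrightarrow> 0" by real_asymp
  show "\<forall>\<^sub>F n in sequentially. norm (\<E> w. (centred_count n w / real n ^ 2
      - (kernel_quad centred_tri n w + edge_noise skew n w))^2) \<le> 1400 / real n"
    using eventually_gt_at_top[of 0]
  proof eventually_elim
    case (elim n)
    define r where "r = real n"
    have r: "r \<ge> 1" using elim by (simp add: r_def)
    define A where "A w = (\<Sum>(u, v, x)\<in>triples n. h3 w u v x)" for w
    define B where "B w = (\<Sum>(u, v)\<in>pairs n. h2 w u v)" for w
    have bA: "bmeas Om A" and bB: "bmeas Om B" unfolding A_def B_def case_prod_unfold by auto
    have t: "AE w in Om. \<forall>u. t_tri W (w (u, 0)) = \<theta>"
      unfolding AE_all_countable by (intro allI AE_coord t_tri_const)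
    have "AE w in Om. (centred_count n w / real n ^ 2
      - (kernel_quad centred_tri n w + edge_noise skew n w))^2 = (A w / r^2 - 2 * B w / r^2)^2"
      using t AE_space[of Om]
    proof eventually_elim
      case (elim w)
      have "B w = (\<Sum>(u, v)\<in>pairs n. 2 * centred_tri (w (u, 0)) (w (v, 0))
          + (adj w u v - W (w (u, 0)) (w (v, 0))) * skew (w (u, 0)) (w (v, 0)))"
        unfolding B_def by (intro sum.cong refl) (use elim in \<open>auto simp: pairs_def h2_def pair_proj_split centred_tri_def\<close>)
      hence Bq: "kernel_quad centred_tri n w + edge_noise skew n w = B w / r"
        by (simp add: kernel_quad_def edge_noise_def case_prod_unfold sum.distrib add_divide_distrib r_def)
      have N: "centred_count n w = A w + (r - 2) * B w"
        unfolding hoeffding_decomposition A_def B_def r_def using elim by simp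
      have "(A w + (r - 2) * B w) / r^2 - B w / r = A w / r^2 - 2 * B w / r^2"
        using r by (simp add: field_simps power2_eq_square)
      thus ?case unfolding N Bq r_def[symmetric] by simp
    qed
    hence "(\<E> w. (centred_count n w / real n ^ 2
      - (kernel_quad centred_tri n w + edge_noise skew n w))^2) = (\<E> w. (A w / r^2 - 2 * B w / r^2)^2)"
      by (intro integral_cong_AE bmeas_measurable bmeas_power bmeas_diff bmeas_add bmeas_divide bmeas_mult bmeas_const
          bA bB bmeas_num_triads bmeas_kernel_quad bm2_centred bmeas_edge_noise bm2_skew)
    also have "\<dots> \<le> (\<E> w. 2 * (A w)^2 / r ^ 4 + 8 * (B w)^2 / r ^ 4)"
    proof (rule Om.bmeas_integral_mono)
      fix w
      show "(A w / r^2 - 2 * B w / r^2)^2 \<le> 2 * (A w)^2 / r ^ 4 + 8 * (B w)^2 / r ^ 4"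
        using sq_diff_le[of "A w / r^2" "2 * B w / r^2"] by (simp add: power_divide power_mult_distrib power_mult[symmetric])
    qed (use bA bB in auto)
    also have "\<dots> = 2 * (\<E> w. (A w)^2) / r ^ 4 + 8 * (\<E> w. (B w)^2) / r ^ 4"
      using Om.bmeas_integrable[OF bmeas_power[OF bA, of 2]] Om.bmeas_integrable[OF bmeas_power[OF bB, of 2]] by simp
    also have "\<dots> \<le> 2 * (400 * r ^ 3) / r ^ 4 + 8 * (64 * r ^ 2) / r ^ 4"
      using h3_sum_bound[of n] h2_sum_bound[of n] r
      by (intro add_mono divide_right_mono mult_left_mono) (auto simp: A_def B_def r_def)
    also have "\<dots> = 800 / r + 512 / r^2" using r by (simp add: field_simps eval_nat_numeral)
    also have "\<dots> \<le> 800 / r + 512 / r" using r by (intro add_left_mono divide_left_mono) (auto simp: power2_eq_square)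
    also have "\<dots> \<le> 1400 / r" using r by (simp add: field_simps)
    finally show ?case by (simp add: r_def)
  qed
qed

lemma spec_square_summable:
  assumes "finite F" "F \<subseteq> spec_index"
  shows "(\<Sum>j\<in>F. (fst j)^2) \<le> hs centred_tri centred_tri"
proof (rule eigenfunctions)
  fix f assume f: "diagonalizes centred_tri spec_index f"
  show ?thesis
  proof (rule hs_minus_ksum(2)[OF bm2_centred assms(1) _ diagonalizesD(3)[OF f assms(2)]])
    show "f j \<in> eig centred_tri (fst j)" if "j \<in> F" for j using diagonalizesD(1)[OF f] assms(2) that by blast
  qed
qed

text \<open>  The edge noise splits off its Gaussian factor. For the quadratic form one finite set \<open>F\<close> of eigenfunctions serves
  twice: it approximates the kernel, uniformly in \<open>n\<close>, and the series of the limit variable. In between,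
  \<open>qform_limit\<close> applies.\<close>
lemma char_limit:
  assumes S: "has_L2_sum (gauss_space (Spec_minus W)) chaos spec_index S"
  shows "(\<lambda>n. \<E> w. iexp (t * (centred_count n w / real n ^ 2)))
    \<longlonglongrightarrow> (\<integral>w. iexp (t * (tau W * w None + S w)) \<partial>gauss_space (Spec_minus W))" (is "_ \<longlonglongrightarrow> ?L")
proof (rule Om.char_limit_perturb[OF _ _ _ triads_L2_approx])
  have bY: "bmeas Om (\<lambda>w. kernel_quad centred_tri n w + edge_noise skew n w)" for n
    by (intro bmeas_add bmeas_kernel_quad bm2_centred bmeas_edge_noise bm2_skew)
  have bX: "bmeas Om (\<lambda>w. centred_count n w / real n ^ 2)" for n
    by (intro bmeas_divide bmeas_diff bmeas_num_triads bmeas_const)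
  show "(\<lambda>w. centred_count n w / real n ^ 2) \<in> borel_measurable Om"
    "(\<lambda>w. kernel_quad centred_tri n w + edge_noise skew n w) \<in> borel_measurable Om"
    "integrable Om (\<lambda>w. (centred_count n w / real n ^ 2
      - (kernel_quad centred_tri n w + edge_noise skew n w))^2)" for n
    by (intro bmeas_measurable bX bY Om.bmeas_integrable bmeas_power bmeas_diff)+
  define q where "q n = (\<E> w. iexp (t * kernel_quad centred_tri n w))" for n
  define e where "e = complex_of_real (exp (- (t^2 * (tau W)^2 / 2)))"
  have e1: "cmod e \<le> 1" by (simp add: e_def)
  have "(\<lambda>n. (\<E> w. iexp (t * kernel_quad centred_tri n w + t * edge_noise skew n w)) - e * q n) \<longlonglongrightarrow> 0"
    unfolding e_def q_def tau_sq
    by (rule edge_noise_limit[OF bm2_skew skew_bound])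
       (intro bmeas_mult bmeas_const bmeas_kernel_quad bm2_centred depends_on_arith depends_on_const depends_kernel_quad | assumption)+
  moreover have "(\<lambda>n. e * q n) \<longlonglongrightarrow> ?L"
  proof (rule eigenfunctions)
    fix f assume dg: "diagonalizes centred_tri spec_index f" and one: "\<And>j. j \<in> spec_index \<Longrightarrow> ip (f j) (\<lambda>_. 1) = 0"
    have bf: "bm1 (f j)" if "j \<in> spec_index" for j by (rule eigD(1)[OF diagonalizesD(1)[OF dg that]])
    have trunc: "cmod (q n - (\<E> w. iexp (t * kernel_quad (ksum F fst f) n w))) \<le> \<bar>t\<bar> * sqrt (2 * hs R R)"
      if F: "finite F" "F \<subseteq> spec_index" and R: "R = (\<lambda>x y. centred_tri x y - ksum F fst f x y)" for F R n
    proof -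
      have bk: "bm2 (ksum F fst f)" using bf F(2) by (intro bm2_ksum) auto
      have bR: "bm2 R" unfolding R by (intro bm2_diff bm2_centred bk)
      have symR: "R x y = R y x" for x y unfolding R ksum_def using tri_sym[of x y] by (simp add: centred_tri_def mult_ac)
      have degR: "AE x in unit_leb. opr R (\<lambda>_. 1) x = 0"
        using opr_tri_const AE_space[of unit_leb]
      proof eventually_elim
        case (elim x)
        hence x: "x \<in> {0..1}" by simp
        have "opr R (\<lambda>_. 1) x = (\<I> y. tri_kernel W x y - \<theta> - ksum F fst f x y)" by (simp add: opr_def R centred_tri_def)
        also have "\<dots> = (\<I> y. tri_kernel W x y) - \<theta> - (\<I> y. ksum F fst f x y)"
          using bm1_integrable[OF bm2_row[OF bm2_tri x]] bm1_integrable[OF bm2_row[OF bk x]] by simp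
        also have "(\<I> y. tri_kernel W x y) = \<theta>" using elim by (simp add: opr_def)
        also have "(\<I> y. ksum F fst f x y) = opr (ksum F fst f) (\<lambda>_. 1) x" by (simp add: opr_def)
        also have "\<dots> = (\<Sum>j\<in>F. fst j * f j x * ip (f j) (\<lambda>_. 1))" by (rule opr_ksum) (use bf F(2) in auto)
        also have "\<dots> = 0" using one F(2) by (intro sum.neutral) auto
        finally show ?case by simp
      qed
      have d: "kernel_quad centred_tri n w - kernel_quad (ksum F fst f) n w = kernel_quad R n w" for w
        by (simp add: kernel_quad_def R case_prod_unfold sum_subtractf right_diff_distrib diff_divide_distrib)
      have "cmod (q n - (\<E> w. iexp (t * kernel_quad (ksum F fst f) n w))) \<le> \<bar>t\<bar> * sqrt (\<E> w. (kernel_quad R n w)^2)"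
        using Om.iexp_expectation_diff_le[OF bmeas_measurable[OF bmeas_kernel_quad[OF bm2_centred, of n]]
            bmeas_measurable[OF bmeas_kernel_quad[OF bk, of n]], of t]
          Om.bmeas_integrable[OF bmeas_power[OF bmeas_kernel_quad[OF bR, of n], of 2]] unfolding d q_def by simp
      also have "\<dots> \<le> \<bar>t\<bar> * sqrt (2 * hs R R)"
        by (intro mult_left_mono real_sqrt_le_mono kernel_quad_bound bR symR degR) simp
      finally show ?thesis .
    qed
    show ?thesis
    proof (rule LIMSEQ_I)
      fix \<epsilon> :: real assume "\<epsilon> > 0"
      define d where "d = \<epsilon> / (2 * (2 * \<bar>t\<bar> + 1))"
      have t1: "2 * \<bar>t\<bar> + 1 > 0" by simp
      have d0: "d > 0" using \<open>\<epsilon> > 0\<close> t1 by (simp add: d_def)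
      have "(2 * \<bar>t\<bar> + 1) * d = \<epsilon> / 2" using t1 unfolding d_def by (simp add: divide_simps)
      hence dt: "(2 * \<bar>t\<bar> + 1) * d < \<epsilon>" using \<open>\<epsilon> > 0\<close> by simp
      have d2: "d^2 / 2 > 0" using d0 by simp
      obtain G1 where G1: "finite G1" "G1 \<subseteq> spec_index" "\<And>F. finite F \<Longrightarrow> G1 \<subseteq> F \<Longrightarrow> F \<subseteq> spec_index \<Longrightarrow>
        hs_dist centred_tri (ksum F fst f) \<le> d^2 / 2"
        using diagonalizes_approx[OF dg d2] by blast
      show "\<exists>N. \<forall>n\<ge>N. cmod (e * q n - ?L) < \<epsilon>"
      proof (rule chaos_sum_char[OF S d0, of t "tau W"])
        fix G2 assume G2: "finite G2" "G2 \<subseteq> spec_index" "\<And>F. finite F \<Longrightarrow> G2 \<subseteq> F \<Longrightarrow> F \<subseteq> spec_index \<Longrightarrow>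
          cmod (?L - complex_of_real (exp (- (t^2 * (tau W)^2 / 2))) * (\<Prod>j\<in>F. chi_char (t * fst j))) \<le> \<bar>t\<bar> * d"
        define F where "F = G1 \<union> G2"
        have F: "finite F" "G1 \<subseteq> F" "G2 \<subseteq> F" "F \<subseteq> spec_index" using G1 G2 by (auto simp: F_def)
        define R where "R = (\<lambda>x y. centred_tri x y - ksum F fst f x y)"
        have hR: "2 * hs R R \<le> d^2" using G1(3)[OF F(1,2,4)] unfolding R_def by simp
        have a: "cmod (q n - (\<E> w. iexp (t * kernel_quad (ksum F fst f) n w))) \<le> \<bar>t\<bar> * d" for n
        proof -
          have "sqrt (2 * hs R R) \<le> d" using hR d0 by (intro real_le_lsqrt) auto
          thus ?thesis using trunc[OF F(1,4) R_def, of n] mult_left_mono[of "sqrt (2 * hs R R)" d "\<bar>t\<bar>"] by linarith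
        qed
        have b: "cmod (?L - e * (\<Prod>j\<in>F. chi_char (t * fst j))) \<le> \<bar>t\<bar> * d" unfolding e_def by (rule G2(3)[OF F(1,3,4)])
        obtain c where vn: "vertex_noise F c (\<lambda>u j w. f j (w (u, 0)))"
          using vertex_noise_eigenfunctions[OF F(1) _ diagonalizesD(3)[OF dg F(4)]] bf one F(4) by blast
        have "(\<lambda>n. \<E> w. iexp (t * kernel_quad (ksum F fst f) n w)) \<longlonglongrightarrow> (\<Prod>j\<in>F. chi_char (t * fst j))"
          unfolding kernel_quad_ksum by (rule qform_limit[OF F(1) vn])
        from LIMSEQ_D[OF this d0] obtain N where
          N: "\<And>n. n \<ge> N \<Longrightarrow> cmod ((\<E> w. iexp (t * kernel_quad (ksum F fst f) n w)) - (\<Prod>j\<in>F. chi_char (t * fst j))) < d" by auto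
        have comb: "cmod (e * x - l) < \<epsilon>" if "cmod (x - y) \<le> \<bar>t\<bar> * d" "cmod (y - z) < d" "cmod (l - e * z) \<le> \<bar>t\<bar> * d" for x y z l
        proof -
          have "e * x - l = e * ((x - y) + (y - z)) - (l - e * z)" by (simp add: algebra_simps)
          hence "cmod (e * x - l) \<le> cmod (e * ((x - y) + (y - z))) + cmod (l - e * z)" by (simp only: norm_triangle_ineq4)
          also have "cmod (e * ((x - y) + (y - z))) \<le> 1 * cmod ((x - y) + (y - z))"
            unfolding norm_mult by (intro mult_right_mono e1) simp
          also have "cmod ((x - y) + (y - z)) \<le> cmod (x - y) + cmod (y - z)" by (rule norm_triangle_ineq)
          finally show ?thesis using that dt by (simp add: algebra_simps)
        qed
        show "\<exists>N. \<forall>n\<ge>N. cmod (e * q n - ?L) < \<epsilon>"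
        proof (intro exI[of _ N] allI impI)
          fix n assume "n \<ge> N"
          show "cmod (e * q n - ?L) < \<epsilon>" by (rule comb[OF a N[OF \<open>n \<ge> N\<close>] b])
        qed
      qed
    qed
  qed
  ultimately have "(\<lambda>n. ((\<E> w. iexp (t * kernel_quad centred_tri n w + t * edge_noise skew n w)) - e * q n) + e * q n) \<longlonglongrightarrow> 0 + ?L"
    by (rule tendsto_add)
  thus "(\<lambda>n. \<E> w. iexp (t * (kernel_quad centred_tri n w + edge_noise skew n w))) \<longlonglongrightarrow> ?L"
    by (simp add: distrib_left)
qed

end


context regular_tourn
begin

text \<open>  Here \<open>p_fun W\<close> is \<open>1/4\<close> and the triangle kernel is \<open>1/8\<close> almost everywhere, so its operator vanishes on functions
  orthogonal to the constants.\<close>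
lemma balanced_degenerate:
  assumes half: "AE q in UU. W (fst q) (snd q) = 1/2"
  shows "tau W = 0 \<and> spec_index = {}"
proof -
  define good where "good x \<longleftrightarrow> (AE y in unit_leb. W x y = 1/2)" for x
  have good: "AE x in unit_leb. good x" unfolding good_def using UU.AE_pair[OF half] by simp
  have good': "AE y in unit_leb. W y x = 1/2" if "good x" "x \<in> {0..1}" for x
    using that(1)[unfolded good_def] AE_space[of unit_leb]
  proof eventually_elim
    case (elim y)
    thus ?case using W_swap[OF that(2), of y] by simp
  qed
  have p: "p_fun W x y = 1/4" if x: "good x" "x \<in> {0..1}" and y: "good y" "y \<in> {0..1}" for x y
  proof -
    have "p_fun W x y = (\<I> z. 1/4)" unfolding p_fun_def
    proof (rule integral_cong_AE)
      show "(\<lambda>z. W y z * W z x) \<in> borel_measurable unit_leb"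
        by (rule bmeas_measurable[OF bmeas_mult[OF bm2_row[OF bm2_W y(2)] bm2_col[OF bm2_W x(2)]]])
      show "AE z in unit_leb. W y z * W z x = 1/4"
        using y(1)[unfolded good_def] good'[OF x]
      proof eventually_elim
        case (elim z)
        have "W y z * W z x = 1/2 * (1/2)" by (simp only: elim)
        thus ?case by simp
      qed
    qed simp
    thus ?thesis by simp
  qed
  have "AE x in unit_leb. (\<I> y. edge_var skew x y) = 0"
    using good AE_space[of unit_leb]
  proof eventually_elim
    case (elim x)
    have "AE y in unit_leb. edge_var skew x y = 0"
      using good AE_space[of unit_leb] by eventually_elim (use elim in \<open>simp add: edge_var_def skew_def p\<close>)
    thus ?case by (rule integral_eq_zero_AE)
  qed
  hence "(tau W)^2 = 0" unfolding tau_sq by (simp add: integral_eq_zero_AE)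
  moreover have "spec_index = {}"
  proof (rule eigenfunctions)
    fix f assume dg: "diagonalizes centred_tri spec_index f"
      and f: "\<And>j. j \<in> spec_index \<Longrightarrow> ip (f j) (\<lambda>_. 1) = 0" "\<And>j. j \<in> spec_index \<Longrightarrow> fst j \<noteq> 0"
    note D = diagonalizesD[OF dg]
    show ?thesis
    proof (rule ccontr)
      assume "spec_index \<noteq> {}"
      then obtain j where j: "j \<in> spec_index" by auto
      have bf: "bm1 (f j)" by (rule eigD(1)[OF D(1)[OF j]])
      have "AE x in unit_leb. f j x = 0"
        using good AE_space[of unit_leb]
      proof eventually_elim
        case (elim x)
        hence x: "x \<in> {0..1}" by simp
        have "opr centred_tri (f j) x = (\<I> y. (1/8 - \<theta>) * (f j y * 1))" unfolding opr_def
        proof (rule integral_cong_AE)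
          show "(\<lambda>y. centred_tri x y * f j y) \<in> borel_measurable unit_leb"
            by (rule bmeas_measurable[OF bmeas_mult[OF bm2_row[OF bm2_centred x] bf]])
          show "(\<lambda>y. (1/8 - \<theta>) * (f j y * 1)) \<in> borel_measurable unit_leb" using bmeas_measurable[OF bf] by simp
          show "AE y in unit_leb. centred_tri x y * f j y = (1/8 - \<theta>) * (f j y * 1)"
            using elim(1)[unfolded good_def] good'[OF elim(1) x] good AE_space[of unit_leb]
            by eventually_elim (use elim x in \<open>simp add: centred_tri_def tri_kernel_def p\<close>)
        qed
        also have "\<dots> = (1/8 - \<theta>) * ip (f j) (\<lambda>_. 1)" by (simp add: ip_def)
        finally have "fst j * f j x = 0" using eigD(2)[OF D(1)[OF j] x] f(1)[OF j] by simp
        thus ?case using f(2)[OF j] by simp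
      qed
      hence "ip (f j) (f j) = 0" using ip_zero_AE[OF bf] by simp
      thus False using D(2) j by (simp add: orthonormal_def)
    qed
  qed
  ultimately show ?thesis by simp
qed

text \<open>
  If no fluctuation survives, the triangle kernel is constant and \<open>p_fun W x y\<close> is symmetric wherever both
  orientations are possible. Both together force every vertex to have mean out-degree \<open>1/2\<close>; then the
  centred tournamenton composed with itself is constant, hence zero, and an antisymmetric operator with
  vanishing square vanishes.
\<close>
lemma degenerate_balanced:
  assumes tau0: "tau W = 0" and empty: "spec_index = {}"
  shows "AE q in UU. W (fst q) (snd q) = 1/2"
proof -
  have bWW: "bm2 (\<lambda>x y. W y x)" by (rule bm2_swap[OF bm2_W])
  have const: "AE x in unit_leb. AE y in unit_leb. tri_kernel W x y = \<theta>"
  proof (rule eigenfunctions)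
    fix f assume f: "diagonalizes centred_tri spec_index f"
    have "hs centred_tri centred_tri \<le> 0 + \<epsilon>" if "\<epsilon> > 0" for \<epsilon>
      using diagonalizes_approx[OF f that] unfolding empty by (auto simp: ksum_def)
    hence "hs centred_tri centred_tri \<le> 0" by (rule field_le_epsilon)
    hence "hs centred_tri centred_tri = 0" using hs_self(2)[of centred_tri] by simp
    hence "AE q in UU. centred_tri (fst q) (snd q) = 0" using kernel_zero_AE[OF bm2_centred] by simp
    hence "AE q in UU. tri_kernel W (fst q) (snd q) = \<theta>" by eventually_elim (simp add: centred_tri_def)
    from UU.AE_pair[OF this] show ?thesis by simp
  qed
  have ev: "AE x in unit_leb. AE y in unit_leb. edge_var skew x y = 0"
  proof -
    have i: "integrable UU (\<lambda>q. edge_var skew (fst q) (snd q))"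
      using bm2_integrable[OF bm2_edge_var[OF bm2_skew]] by (simp add: case_prod_unfold)
    have z: "(\<integral>q. edge_var skew (fst q) (snd q) \<partial>UU) = 0"
      using tau0 tau_sq unfolding bm2_pair[OF bm2_edge_var[OF bm2_skew]] by simp
    have nn: "AE q in UU. 0 \<le> edge_var skew (fst q) (snd q)"
      using AE_space[of UU] by eventually_elim (auto simp: space_pair_measure intro!: edge_var_in)
    have "AE q in UU. edge_var skew (fst q) (snd q) = 0"
      using integral_nonneg_eq_0_iff_AE[OF i nn] z by simp
    from UU.AE_pair[OF this] show ?thesis by simp
  qed
  \<comment> \<open>Where both orientations are possible, \<open>tau W = 0\<close> makes \<open>p_fun W\<close> symmetric; elsewhere one summand of the triangle kernel is 0.\<close>
  have Wp: "W x y * p_fun W x y = 2 * \<theta> * W x y"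
    if xy: "x \<in> {0..1}" "y \<in> {0..1}" and k: "tri_kernel W x y = \<theta>" and e: "edge_var skew x y = 0" for x y
  proof -
    have s: "W y x = 1 - W x y" by (rule W_swap[OF xy])
    have k': "W x y * p_fun W x y + (1 - W x y) * p_fun W y x = 2 * \<theta>" using k unfolding tri_kernel_def s by simp
    consider "W x y = 0" | "W x y = 1" | "p_fun W x y = p_fun W y x"
      using e unfolding edge_var_def skew_def s by auto
    thus ?thesis using k' by cases (auto simp: algebra_simps)
  qed
  define A where "A x y = W x y - 1/2" for x y
  have bA: "bm2 A" unfolding A_def[abs_def] by (intro bm2_diff bm2_W bm2_const)
  have anti: "A y x = - A x y" if "x \<in> {0..1}" "y \<in> {0..1}" for x y using W_swap[OF that] by (simp add: A_def)
  \<comment> \<open>Mean out-degree \<open>1/2\<close>, by integrating \<open>Wp\<close> over \<open>y\<close> and comparing with \<open>t_tri W x = \<theta>\<close>.\<close>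
  define good where "good x \<longleftrightarrow> (\<I> y. A x y) = 0" for x
  have good: "AE x in unit_leb. good x"
    using const ev t_tri_const AE_space[of unit_leb]
  proof eventually_elim
    case (elim x)
    hence x: "x \<in> {0..1}" by simp
    have "t_tri W x = (\<I> y. 2 * \<theta> * W x y)" unfolding t_tri_eq1[OF x]
    proof (rule integral_cong_AE)
      show "(\<lambda>y. W x y * p_fun W x y) \<in> borel_measurable unit_leb" "(\<lambda>y. 2 * \<theta> * W x y) \<in> borel_measurable unit_leb"
        by (rule bmeas_measurable[OF bmeas_mult[OF bm2_row[OF bm2_W x] bm2_row[OF bm2_p x]]]
                 bmeas_measurable[OF bmeas_mult[OF bmeas_const bm2_row[OF bm2_W x]]])+
      show "AE y in unit_leb. W x y * p_fun W x y = 2 * \<theta> * W x y"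
        using elim(1,2) AE_space[of unit_leb] by eventually_elim (use Wp x in auto)
    qed
    hence "\<theta> * (2 * (\<I> y. W x y) - 1) = 0" using elim(3) by (simp add: algebra_simps)
    hence "(\<I> y. W x y) = 1/2" using pos by simp
    moreover have "(\<I> y. A x y) = (\<I> y. W x y) - 1/2"
      unfolding A_def using bm1_integrable[OF bm2_row[OF bm2_W x]] by simp
    ultimately show ?case by (simp add: good_def)
  qed
  define C where "C = kcomp A A"
  have bC: "bm2 C" unfolding C_def by (intro bm2_kcomp bA)
  have symC: "C x y = C y x" if xy: "x \<in> {0..1}" "y \<in> {0..1}" for x y
    unfolding C_def kcomp_def opr_def
  proof (intro lint_cong refl)
    fix z assume "z \<in> space unit_leb"
    hence z: "z \<in> {0..1}" by simp
    show "A x z * A z y = A y z * A z x" unfolding anti[OF xy(2) z] anti[OF xy(1) z] by simp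
  qed
  have pC: "p_fun W x y = 1/4 + C y x" if xy: "x \<in> {0..1}" "y \<in> {0..1}" and g: "good x" "good y" for x y
  proof -
    have b: "bm1 (A y)" "bm1 (\<lambda>z. A z x)" by (rule bm2_row[OF bA xy(2)] bm2_col[OF bA xy(1)])+
    have gx: "(\<I> z. A z x) = 0"
    proof -
      have "(\<I> z. A z x) = (\<I> z. - A x z)"
      proof (intro lint_cong refl)
        fix z assume "z \<in> space unit_leb"
        thus "A z x = - A x z" by (intro anti[OF xy(1)]) simp
      qed
      thus ?thesis using g(1) by (simp add: good_def)
    qed
    have "p_fun W x y = (\<I> z. 1/4 + (1/2) * A y z + (1/2) * A z x + A y z * A z x)"
      unfolding p_fun_def by (intro lint_cong refl) (simp add: A_def algebra_simps)
    also have "\<dots> = 1/4 + C y x"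
      using bm1_integrable[OF b(1)] bm1_integrable[OF b(2)] bm1_integrable[OF bmeas_mult[OF b]] g(2) gx
      by (simp add: good_def C_def kcomp_def opr_def)
    finally show ?thesis .
  qed
  \<comment> \<open>By \<open>pC\<close> and the symmetry of \<open>C\<close>, the triangle kernel is \<open>(1/4 + C x y) / 2\<close>.\<close>
  define \<kappa> where "\<kappa> = 2 * \<theta> - 1/4"
  have Ck: "AE x in unit_leb. AE y in unit_leb. C x y = \<kappa>"
    using const good AE_space[of unit_leb]
  proof eventually_elim
    case (elim x)
    hence x: "x \<in> {0..1}" by simp
    show ?case
      using elim(1) good AE_space[of unit_leb]
    proof eventually_elim
      case (elim y)
      hence y: "y \<in> {0..1}" by simp
      have "p_fun W x y = 1/4 + C x y" "p_fun W y x = 1/4 + C x y"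
        using pC[OF x y] pC[OF y x] symC[OF x y] \<open>good x\<close> elim by simp_all
      hence "\<theta> = 1/2 * ((W x y + W y x) * (1/4 + C x y))"
        using elim(1) unfolding tri_kernel_def by (simp add: algebra_simps)
      thus "C x y = \<kappa>" using W_swap[OF x y] by (simp add: \<kappa>_def)
    qed
  qed
  have AA: "AE x in unit_leb. opr A (opr A \<phi>) x = \<kappa> * ip \<phi> (\<lambda>_. 1)" if \<phi>: "bm1 \<phi>" for \<phi>
    using Ck AE_space[of unit_leb]
  proof eventually_elim
    case (elim x)
    hence x: "x \<in> {0..1}" by simp
    have "opr C \<phi> x = (\<I> y. \<kappa> * (\<phi> y * 1))" unfolding opr_def
    proof (rule integral_cong_AE)
      show "(\<lambda>y. C x y * \<phi> y) \<in> borel_measurable unit_leb"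
        by (rule bmeas_measurable[OF bmeas_mult[OF bm2_row[OF bC x] \<phi>]])
      show "(\<lambda>y. \<kappa> * (\<phi> y * 1)) \<in> borel_measurable unit_leb" using bmeas_measurable[OF \<phi>] by simp
      show "AE y in unit_leb. C x y * \<phi> y = \<kappa> * (\<phi> y * 1)" using elim(1) by eventually_elim simp
    qed
    thus ?case unfolding C_def opr_kcomp[OF bA bA \<phi> x] by (simp add: ip_def)
  qed
  have b1: "bm1 (\<lambda>_. 1 :: real)" by simp
  have "AE x in unit_leb. \<kappa> = 0"
    using AA[OF b1] AE_space[of unit_leb]
  proof eventually_elim
    case (elim x)
    hence x: "x \<in> {0..1}" by simp
    have "opr A (opr A (\<lambda>_. 1)) x = opr A (\<lambda>_. 0) x"
    proof (rule opr_cong_AE[OF bA x])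
      show "opr A (\<lambda>_. 1) \<in> borel_measurable unit_leb" by (rule bmeas_measurable[OF bm1_opr[OF bA b1]])
      show "AE y in unit_leb. opr A (\<lambda>_. 1) y = 0" using good by eventually_elim (simp add: good_def opr_def)
    qed simp
    moreover have "opr A (\<lambda>_. 0) x = 0" "ip (\<lambda>_. 1) (\<lambda>_. 1) = 1" by (simp_all add: opr_def ip_def)
    ultimately show ?case using elim(1) by simp
  qed
  hence k0: "\<kappa> = 0" using U.AE_const by simp
  have "hs A A = 0"
  proof (rule kernel_zero_of_opr[OF bA])
    fix \<phi> assume \<phi>: "bm1 \<phi>"
    let ?\<psi> = "opr A \<phi>"
    have b\<psi>: "bm1 ?\<psi>" by (rule bm1_opr[OF bA \<phi>])
    have b: "bm2 (\<lambda>x y. A x y * \<phi> y * ?\<psi> x)" using bA \<phi> b\<psi> by (intro bm2_mult bm2_fst bm2_snd)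
    have "ip ?\<psi> ?\<psi> = (\<I> x. (\<I> y. A x y * \<phi> y * ?\<psi> x))"
      unfolding ip_def by (simp add: opr_def)
    also have "\<dots> = (\<I> y. (\<I> x. A x y * \<phi> y * ?\<psi> x))" by (rule bm2_fubini[OF b, symmetric])
    also have "\<dots> = (\<I> y. (\<I> x. - \<phi> y * (A y x * ?\<psi> x)))"
    proof (intro lint_cong refl)
      fix y x assume "y \<in> space unit_leb" "x \<in> space unit_leb"
      hence "A y x = - A x y" by (intro anti) simp_all
      thus "A x y * \<phi> y * ?\<psi> x = - \<phi> y * (A y x * ?\<psi> x)" by simp
    qed
    also have "\<dots> = (\<I> y. - \<phi> y * opr A ?\<psi> y)" unfolding opr_def[of A ?\<psi>] integral_mult_right_zero ..
    also have "\<dots> = 0"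
      by (rule integral_eq_zero_AE) (use AA[OF \<phi>] in \<open>eventually_elim, simp add: k0\<close>)
    finally show "ip ?\<psi> ?\<psi> = 0" .
  qed
  hence "AE q in UU. A (fst q) (snd q) = 0" using kernel_zero_AE[OF bA] by simp
  thus ?thesis by eventually_elim (simp add: A_def)
qed

theorem degenerate_limit:
  shows "\<exists>S. has_L2_sum (gauss_space (Spec_minus W)) (\<lambda>(l, i) w. l * ((w (Some (l, i)))^2 - 1)) spec_index S \<and>
    (let L = distr (gauss_space (Spec_minus W)) borel (\<lambda>w. tau W * w None + S w)
     in weak_conv_m (\<lambda>n. distr (random_tournament n W) borel
              (\<lambda>a. (num_triads n a - 2 * real (n choose 3) * \<theta>) / real n ^ 2)) L \<and>
        (nondegenerate L \<longleftrightarrow> emeasure UU {(x, y). x \<in> {0..1} \<and> y \<in> {0..1} \<and> W x y \<noteq> 1/2} > 0))"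
proof -
  let ?\<Gamma> = "gauss_space (Spec_minus W)"
  obtain S where S: "has_L2_sum ?\<Gamma> chaos spec_index S"
    using chaos_sum_exists[OF spec_square_summable] by blast
  let ?L = "distr ?\<Gamma> borel (\<lambda>w. tau W * w None + S w)"
  have wc: "weak_conv_m (\<lambda>n. distr (random_tournament n W) borel
              (\<lambda>a. (num_triads n a - 2 * real (n choose 3) * \<theta>) / real n ^ 2)) ?L"
    unfolding distr_num_triads
  proof (rule weak_conv_by_char[OF Om.prob_space_axioms])
    show "prob_space ?\<Gamma>" unfolding gauss_space_def by (intro prob_space_PiM prob_space_std_normal)
    show "(\<lambda>w. centred_count n w / real n ^ 2) \<in> borel_measurable Om" for n
      by (intro bmeas_measurable bmeas_divide bmeas_diff bmeas_num_triads bmeas_const)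
    show "(\<lambda>w. tau W * w None + S w) \<in> borel_measurable ?\<Gamma>" by (rule chaos_sum_measurable(2)[OF S])
  qed (rule char_limit[OF S])
  have nz: "fst j \<noteq> 0" if "j \<in> spec_index" for j by (rule eigenfunctions) (use that in blast)
  have "nondegenerate ?L \<longleftrightarrow> \<not> (tau W = 0 \<and> spec_index = {})" by (rule chaos_nondegenerate[OF S nz])
  also have "\<dots> \<longleftrightarrow> \<not> (AE q in UU. W (fst q) (snd q) = 1/2)"
    using balanced_degenerate degenerate_balanced by blast
  also have "(AE q in UU. W (fst q) (snd q) = 1/2) \<longleftrightarrow> emeasure UU {q \<in> space UU. \<not> W (fst q) (snd q) = 1/2} = 0"
  proof (rule AE_iff_measurable[OF _ refl])
    have "(\<lambda>q. W (fst q) (snd q)) \<in> borel_measurable UU"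
      using bmeas_measurable[OF bmeas_W] by (simp add: case_prod_unfold)
    thus "{q \<in> space UU. \<not> W (fst q) (snd q) = 1/2} \<in> sets UU" by measurable
  qed
  also have "{q \<in> space UU. \<not> W (fst q) (snd q) = 1/2} = {(x, y). x \<in> {0..1} \<and> y \<in> {0..1} \<and> W x y \<noteq> 1/2}"
    by (auto simp: space_pair_measure)
  finally have nd: "nondegenerate ?L \<longleftrightarrow> emeasure UU {(x, y). x \<in> {0..1} \<and> y \<in> {0..1} \<and> W x y \<noteq> 1/2} > 0"
    by (simp add: zero_less_iff_neq_zero)
  show ?thesis
    by (rule exI[where x=S], unfold Let_def, intro conjI S[unfolded chaos_def] wc nd)
qed

end

theorem theorem2p6:
  fixes W :: "real \<Rightarrow> real \<Rightarrow> real"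
  assumes "tournamenton W" and "zeta W \<in> {0..<1}"
  shows
    "(weak_conv_m
        (\<lambda>n. distr (random_tournament n W) borel
           (\<lambda>a. (num_triads n a - 2 * real (n choose 3) * t_C3 W) / real n powr (5/2)))
        (normal_law 0 (sigma_sq W)) \<and>
      (nondegenerate (normal_law 0 (sigma_sq W)) \<longleftrightarrow> \<not> tri_regular W) \<and>
      (sigma_sq W > 0 \<longleftrightarrow> \<not> tri_regular W))
     \<and>
     (tri_regular W \<longrightarrow>
       (\<exists>S. has_L2_sum (gauss_space (Spec_minus W))
              (\<lambda>(l, i) \<omega>. l * ((\<omega> (Some (l, i)))\<^sup>2 - 1)) (mset_index (Spec_minus W)) S \<and>
            (let L = distr (gauss_space (Spec_minus W)) borel (\<lambda>\<omega>. tau W * \<omega> None + S \<omega>)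
             in weak_conv_m
                  (\<lambda>n. distr (random_tournament n W) borel
                     (\<lambda>a. (num_triads n a - 2 * real (n choose 3) * t_C3 W) / real n ^ 2)) L \<and>
                (nondegenerate L \<longleftrightarrow>
                   emeasure (unit_leb \<Otimes>\<^sub>M unit_leb)
                     {(x, y). x \<in> {0..1} \<and> y \<in> {0..1} \<and> W x y \<noteq> 1/2} > 0))))
     \<and>
     ((AE (x, y) in unit_leb \<Otimes>\<^sub>M unit_leb. W x y = 1/2) \<longrightarrow>
       weak_conv_m
         (\<lambda>n. distr (random_tournament n W) borel
            (\<lambda>a. (num_triads n a - 1/4 * real (n choose 3)) / real n powr (3/2)))
         (normal_law 0 (1/32)))"
proof -
  interpret tourn W by unfold_locales (rule assms(1))
  have pos: "t_C3 W > 0" using assms(2) by (simp add: zeta_def)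
  have s0: "sigma_sq W \<ge> 0" unfolding sigma_sq_eq by simp
  have nd: "nondegenerate (normal_law 0 (sigma_sq W)) \<longleftrightarrow> \<not> tri_regular W"
    using nondegenerate_normal_law[OF s0] sigma_sq_pos_iff by simp
  have deg: "regular_tourn W" if "tri_regular W"
    by unfold_locales (use that pos in auto)
  show ?thesis
    by (intro conjI impI gaussian_limit nd sigma_sq_pos_iff balanced_limit regular_tourn.degenerate_limit[OF deg])
qed


end
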